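(* Let $T>0$, $\alpha\in(0,2)$ and $0<\varepsilon_0<1$. There exists a constant $C>0$, depending only on $\varepsilon_0$, $\alpha$ and $T$, such that for all $(u_0,u_1)\in H^1_\alpha\times L^2(0,1)$ and all $f\in L^1(0,T;L^2(0,1))$, if $u$ is the weak solution of problem (P) with data $(f,u_0,u_1)$, then $$\frac{1}{\varepsilon^3}\int_0^T\int_{1-\varepsilon}^1 |u(t,x)|^2\,dx\,dt\le C\Big(\|f\|_{L^1(0,T;L^2(0,1))}^2+\|u_0\|_{H^1_\alpha}^2+\|u_1\|_{L^2(0,1)}^2\Big)\quad\text{for all }\varepsilon\in(0,\varepsilon_0].$$
   Context: Let $T>0$, $\alpha\in(0,2)$, $Q=(0,T)\times(0,1)$. The case $\alpha\in(0,1)$ is the weakly degenerate case (WDC), $\alpha\in[1,2)$ the strongly degenerate case (SDC). In the WDC, $H^1_\alpha$ is the set of $u\in L^2(0,1)$ that are absolutely continuous on $[0,1]$, with $x^{\alpha/2}u_x\in L^2(0,1)$ and $u(0)=u(1)=0$. In the SDC, $H^1_\alpha$ is the set of $u\in L^2(0,1)$ that are locally absolutely continuous on $(0,1]$, with $x^{\alpha/2}u_x\in L^2(0,1)$ and $u(1)=0$. In both cases $\|u\|_{H^1_\alpha}=(\|u\|_{L^2(0,1)}^2+\|x^{\alpha/2}u_x\|_{L^2(0,1)}^2)^{1/2}$. Problem (P): $u_{tt}-(x^\alpha u_x)_x=f$ in $Q$; $u(t,1)=0$ for $t\in(0,T)$; $u(t,0)=0$ if $\alpha\in(0,1)$, or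 $(x^\alpha u_x)(t,0)=0$ if $\alpha\in[1,2)$; $u(0,\cdot)=u_0$, $u_t(0,\cdot)=u_1$. Weak solution: given $f\in L^1(0,T;L^2(0,1))$ and $(u_0,u_1)\in H^1_\alpha\times L^2(0,1)$, a function $u\in C([0,T];H^1_\alpha)\cap C^1([0,T];L^2(0,1))$ is a weak solution of (P) if $u(0,\cdot)=u_0$ and $$\int_Q(-u_t\varphi_t+x^\alpha u_x\varphi_x)\,dx\,dt-\int_0^1u_1\varphi(0,x)\,dx=\int_Q f\varphi\,dx\,dt$$ for all $\varphi\in L^2(0,T;H^1_\alpha)$ with $\varphi_t\in L^2(Q)$ and $\varphi(T,\cdot)=0$. (For such data a weak solution exists and is unique.) *)

theory Defs
  imports "HOL-Analysis.Analysis"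
begin

definition abs_cont_on :: "real \<Rightarrow> real \<Rightarrow> (real \<Rightarrow> real) \<Rightarrow> bool" where
  "abs_cont_on a b g \<longleftrightarrow>
     (\<forall>e>0. \<exists>d>0. \<forall>(n::nat) (l::nat \<Rightarrow> real) (r::nat \<Rightarrow> real).
        (\<forall>i<n. a \<le> l i \<and> l i \<le> r i \<and> r i \<le> b) \<and>
        (\<forall>i<n. \<forall>j<n. i \<noteq> j \<longrightarrow> r i \<le> l j \<or> r j \<le> l i) \<and>
        (\<Sum>i<n. r i - l i) < d
        \<longrightarrow> (\<Sum>i<n. \<bar>g (r i) - g (l i)\<bar>) < e)"

definition loc_abs_cont_0_1 :: "(real \<Rightarrow> real) \<Rightarrow> bool" where
  "loc_abs_cont_0_1 g \<longleftrightarrow> (\<forall>a. 0 < a \<and> a \<le> 1 \<longrightarrow> abs_cont_on a 1 g)"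

definition in_L2 :: "(real \<Rightarrow> real) \<Rightarrow> bool" where
  "in_L2 v \<longleftrightarrow> set_borel_measurable lebesgue {0<..<1} v \<and>
     (\<integral>\<^sup>+x\<in>{0<..<1}. ennreal ((v x)\<^sup>2) \<partial>lebesgue) < \<infinity>"

definition L2norm :: "(real \<Rightarrow> real) \<Rightarrow> real" where
  "L2norm v = sqrt (enn2real (\<integral>\<^sup>+x\<in>{0<..<1}. ennreal ((v x)\<^sup>2) \<partial>lebesgue))"

text \<open>The weighted space H^1_alpha; u_x is the (a.e. defined) classical derivative.\<close>
definition H1a :: "real \<Rightarrow> (real \<Rightarrow> real) \<Rightarrow> bool" where
  "H1a \<alpha> v \<longleftrightarrow> in_L2 v \<and>
     (if \<alpha> < 1 then abs_cont_on 0 1 v \<and> v 0 = 0 else loc_abs_cont_0_1 v) \<and> v 1 = 0 \<and>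
     (\<integral>\<^sup>+x\<in>{0<..<1}. ennreal (x powr \<alpha> * (deriv v x)\<^sup>2) \<partial>lebesgue) < \<infinity>"

definition H1norm :: "real \<Rightarrow> (real \<Rightarrow> real) \<Rightarrow> real" where
  "H1norm \<alpha> v = sqrt ((L2norm v)\<^sup>2 +
     enn2real (\<integral>\<^sup>+x\<in>{0<..<1}. ennreal (x powr \<alpha> * (deriv v x)\<^sup>2) \<partial>lebesgue))"

definition Qset :: "real \<Rightarrow> (real \<times> real) set" where
  "Qset T = {0<..<T} \<times> {0<..<1}"

definition in_L1L2 :: "real \<Rightarrow> (real \<Rightarrow> real \<Rightarrow> real) \<Rightarrow> bool" where
  "in_L1L2 T f \<longleftrightarrow> set_borel_measurable lebesgue (Qset T) (\<lambda>p. f (fst p) (snd p)) \<and>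
     (AE t in lebesgue. t \<in> {0<..<T} \<longrightarrow> in_L2 (f t)) \<and>
     (\<integral>\<^sup>+t\<in>{0<..<T}. ennreal (L2norm (f t)) \<partial>lebesgue) < \<infinity>"

definition L1L2norm :: "real \<Rightarrow> (real \<Rightarrow> real \<Rightarrow> real) \<Rightarrow> real" where
  "L1L2norm T f = enn2real (\<integral>\<^sup>+t\<in>{0<..<T}. ennreal (L2norm (f t)) \<partial>lebesgue)"

definition test_fun :: "real \<Rightarrow> real \<Rightarrow> (real \<Rightarrow> real \<Rightarrow> real) \<Rightarrow> (real \<Rightarrow> real \<Rightarrow> real) \<Rightarrow> bool" where
  "test_fun \<alpha> T \<phi> \<psi> \<longleftrightarrow>
     set_borel_measurable lebesgue (Qset T) (\<lambda>p. \<phi> (fst p) (snd p)) \<and>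
     (AE t in lebesgue. t \<in> {0<..<T} \<longrightarrow> H1a \<alpha> (\<phi> t)) \<and>
     (\<integral>\<^sup>+t\<in>{0<..<T}. ennreal ((H1norm \<alpha> (\<phi> t))\<^sup>2) \<partial>lebesgue) < \<infinity> \<and>
     set_borel_measurable lebesgue (Qset T) (\<lambda>p. \<psi> (fst p) (snd p)) \<and>
     (\<integral>\<^sup>+p\<in>Qset T. ennreal ((\<psi> (fst p) (snd p))\<^sup>2) \<partial>lebesgue) < \<infinity> \<and>
     (AE x in lebesgue. x \<in> {0<..<1} \<longrightarrow>
        set_integrable lebesgue {0..T} (\<lambda>s. \<psi> s x) \<and>
        (\<forall>t\<in>{0..T}. \<phi> t x = \<phi> 0 x + (LINT s:{0..t}|lebesgue. \<psi> s x)) \<and>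
        \<phi> T x = 0)"

text \<open>Weak solution of (P); v plays the role of u_t (a jointly measurable representative
  of the L^2-valued time derivative).\<close>
definition weak_sol :: "real \<Rightarrow> real \<Rightarrow> (real \<Rightarrow> real \<Rightarrow> real) \<Rightarrow> (real \<Rightarrow> real) \<Rightarrow> (real \<Rightarrow> real)
    \<Rightarrow> (real \<Rightarrow> real \<Rightarrow> real) \<Rightarrow> bool" where
  "weak_sol \<alpha> T f u0 u1 u \<longleftrightarrow>
     (\<forall>t\<in>{0..T}. H1a \<alpha> (u t)) \<and>
     (\<forall>t0\<in>{0..T}. ((\<lambda>t. H1norm \<alpha> (\<lambda>x. u t x - u t0 x)) \<longlongrightarrow> 0) (at t0 within {0..T})) \<and>
     (\<forall>x\<in>{0<..1}. u 0 x = u0 x) \<and>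
     (\<exists>v. set_borel_measurable lebesgue (Qset T) (\<lambda>p. v (fst p) (snd p)) \<and>
        (\<forall>t\<in>{0..T}. in_L2 (v t)) \<and>
        (\<forall>t0\<in>{0..T}. ((\<lambda>t. L2norm (\<lambda>x. (u t x - u t0 x) / (t - t0) - v t0 x)) \<longlongrightarrow> 0)
                          (at t0 within {0..T})) \<and>
        (\<forall>t0\<in>{0..T}. ((\<lambda>t. L2norm (\<lambda>x. v t x - v t0 x)) \<longlongrightarrow> 0) (at t0 within {0..T})) \<and>
        (\<forall>\<phi> \<psi>. test_fun \<alpha> T \<phi> \<psi> \<longrightarrow>
           (LINT p:Qset T|lebesgue. - v (fst p) (snd p) * \<psi> (fst p) (snd p)
               + (snd p) powr \<alpha> * deriv (u (fst p)) (snd p) * deriv (\<phi> (fst p)) (snd p))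
           - (LINT x:{0<..<1}|lebesgue. u1 x * \<phi> 0 x)
           = (LINT p:Qset T|lebesgue. f (fst p) (snd p) * \<phi> (fst p) (snd p))))"

end

theory Submission
  imports Defs
begin

text \<open>
  It suffices that the energy of the layer, the integral of x^alpha u_x^2 over (0,T) x (1-eps,1), is
  at most C eps D with D the squared norm of the data. Indeed u vanishes at x = 1, so by
  Cauchy-Schwarz u(t,x)^2 is at most C (1-x) times the integral of x^alpha u_x^2 over (1-eps,1), and
  integrating over the layer contributes the two remaining powers of eps.

  The layer energy is bounded with the multiplier p u_x, where p is supported away from the
  degeneracy, satisfies 0 \<le> p \<le> eps, and has slope -1 on the layer. Because u_x is not an
  admissible test function, u_x is replaced by the central difference (u(x+k) - u(x-k))/(2k), which is
  one, and k tends to 0 after the commutators have been bounded uniformly in k.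

  The a priori energy bound also needs an admissible substitute, for u_t: testing with u(t+h) - u(t)
  turns the elastic term into a difference of averages of the autocorrelations
  <W(t), W(t+r)> with 0 \<le> r \<le> h, where W = x^(alpha/2) u_x, and the limit h -> 0 gives the energy inequality.
\<close>

section \<open>Absolutely continuous functions\<close>

text \<open>The force is only integrable in time and u_t only square integrable in space, so neither
  multiplier can be inserted directly. All information in time is compressed into one inequality for
  a fixed space function, \<open>weak_increment\<close>, where the force enters through a primitive
  of its norm; moving test functions are recovered by freezing them on short time steps.

  The power of eps comes from the height of p: the endpoint and force terms are controlled by the
  norm of the test function, hence by eps times the energy, and the rise of p between a and 2 a has
  slope eps / a, whereas the layer contributes with slope -1. Taking a = (1 - eps0) / 2 keeps all
  constants uniform in eps.

  Functions on (0,1) are extended by zero and live in L2 of the whole line, where translations are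
  isometries. Absolute continuity becomes an integral formula by splitting a function into monotone
  parts and applying Radon-Nikodym to each, which also gives u_x a measurable
  representative.\<close>

definition ivl_family :: "'i set \<Rightarrow> ('i \<Rightarrow> real) \<Rightarrow> ('i \<Rightarrow> real) \<Rightarrow> real \<Rightarrow> real \<Rightarrow> bool" where
  "ivl_family I l r a b \<longleftrightarrow> finite I \<and> (\<forall>i\<in>I. a \<le> l i \<and> l i \<le> r i \<and> r i \<le> b) \<and>
     (\<forall>i\<in>I. \<forall>j\<in>I. i \<noteq> j \<longrightarrow> r i \<le> l j \<or> r j \<le> l i)"

text \<open>Index sets other than initial segments of the naturals arise once families are clipped,
  united or refined; a bijection with \<open>{..<card I}\<close> transfers the definition to
  them.\<close>

lemma abs_cont_on_familyD:
  assumes "abs_cont_on a b g" "e > 0"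
  obtains d where "d > 0"
    "\<forall>(I::nat set) l r. ivl_family I l r a b \<longrightarrow> (\<Sum>i\<in>I. r i - l i) < d \<longrightarrow> (\<Sum>i\<in>I. \<bar>g (r i) - g (l i)\<bar>) < e"
proof -
  obtain d where d: "d > 0" and D0: "\<forall>(n::nat) l r. (\<forall>i<n. a \<le> l i \<and> l i \<le> r i \<and> r i \<le> b) \<and>
        (\<forall>i<n. \<forall>j<n. i \<noteq> j \<longrightarrow> r i \<le> l j \<or> r j \<le> l i) \<and>
        (\<Sum>i<n. r i - l i) < d \<longrightarrow> (\<Sum>i<n. \<bar>g (r i) - g (l i)\<bar>) < e"
    using assms(1)[unfolded abs_cont_on_def, THEN spec, THEN mp, OF assms(2)]
    by (elim exE conjE) (rule that)
  note D = D0[THEN spec, THEN spec, THEN spec, THEN mp, OF conjI, OF _ conjI]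
  show ?thesis
  proof (rule that[OF d], intro allI impI)
    fix I :: "nat set" and l r assume F: "ivl_family I l r a b" and s: "(\<Sum>i\<in>I. r i - l i) < d"
    then have "finite I" by (simp add: ivl_family_def)
    then obtain h where h: "bij_betw h {0..<card I} I" using ex_bij_betw_nat_finite by blast
    have h': "bij_betw h {..<card I} I" using h by (simp add: lessThan_atLeast0)
    have "(\<Sum>i<card I. \<bar>g ((r \<circ> h) i) - g ((l \<circ> h) i)\<bar>) < e"
    proof (rule D)
      show "\<forall>i<card I. a \<le> (l \<circ> h) i \<and> (l \<circ> h) i \<le> (r \<circ> h) i \<and> (r \<circ> h) i \<le> b"
        using F h' unfolding ivl_family_def by (auto simp: bij_betw_def)
      show "\<forall>i<card I. \<forall>j<card I. i \<noteq> j \<longrightarrow> (r \<circ> h) i \<le> (l \<circ> h) j \<or> (r \<circ> h) j \<le> (l \<circ> h) i"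
      proof (intro allI impI)
        fix i j assume ij: "i < card I" "j < card I" "i \<noteq> j"
        then have "h i \<in> I" "h j \<in> I" "h i \<noteq> h j"
          using bij_betwE[OF h'] inj_on_eq_iff[OF bij_betw_imp_inj_on[OF h']] by auto
        then show "(r \<circ> h) i \<le> (l \<circ> h) j \<or> (r \<circ> h) j \<le> (l \<circ> h) i"
          using F unfolding ivl_family_def by auto
      qed
      show "(\<Sum>i<card I. (r \<circ> h) i - (l \<circ> h) i) < d"
        using s sum.reindex_bij_betw[OF h', of "\<lambda>i. r i - l i"] by simp
    qed
    then show "(\<Sum>i\<in>I. \<bar>g (r i) - g (l i)\<bar>) < e"
      using sum.reindex_bij_betw[OF h', of "\<lambda>i. \<bar>g (r i) - g (l i)\<bar>"] by simp
  qed
qed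

text \<open>Families indexed by a sum type or by pairs are brought back to the naturals this way.
  Quantifying over \<phi> lets one reindexing serve both the sum of lengths and the sum of
  increments.\<close>

lemma ivl_family_reindex_nat:
  assumes "ivl_family I l r a b"
  obtains J :: "nat set" and l' r' where "ivl_family J l' r' a b"
    "\<forall>\<phi>. (\<Sum>j\<in>J. \<phi> (l' j) (r' j)) = (\<Sum>i\<in>I. \<phi> (l i) (r i) :: real)"
proof -
  have "finite I" using assms by (simp add: ivl_family_def)
  then obtain h where h: "bij_betw h {0..<card I} I" using ex_bij_betw_nat_finite by blast
  show ?thesis
  proof (rule that[of "{0..<card I}" "l \<circ> h" "r \<circ> h"])
    show "ivl_family {0..<card I} (l \<circ> h) (r \<circ> h) a b"
      unfolding ivl_family_def
    proof (intro conjI)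
      show "\<forall>i\<in>{0..<card I}. a \<le> (l \<circ> h) i \<and> (l \<circ> h) i \<le> (r \<circ> h) i \<and> (r \<circ> h) i \<le> b"
        using assms bij_betwE[OF h] unfolding ivl_family_def by auto
      show "\<forall>i\<in>{0..<card I}. \<forall>j\<in>{0..<card I}. i \<noteq> j \<longrightarrow> (r \<circ> h) i \<le> (l \<circ> h) j \<or> (r \<circ> h) j \<le> (l \<circ> h) i"
      proof (intro ballI impI)
        fix i j assume ij: "i \<in> {0..<card I}" "j \<in> {0..<card I}" "i \<noteq> j"
        then have "h i \<in> I" "h j \<in> I" "h i \<noteq> h j"
          using bij_betwE[OF h] inj_on_eq_iff[OF bij_betw_imp_inj_on[OF h]] by auto
        then show "(r \<circ> h) i \<le> (l \<circ> h) j \<or> (r \<circ> h) j \<le> (l \<circ> h) i"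
          using assms unfolding ivl_family_def by auto
      qed
    qed simp
    show "\<forall>\<phi>. (\<Sum>j\<in>{0..<card I}. \<phi> ((l \<circ> h) j) ((r \<circ> h) j)) = (\<Sum>i\<in>I. \<phi> (l i) (r i) :: real)"
      by (auto intro!: sum.reindex_bij_betw[OF h])
  qed
qed

section \<open>Total variation\<close>

text \<open>The total variation on [x,y]. Families may leave gaps, which does not change the
  supremum, and values in \<open>ennreal\<close> make it exist before finiteness is known.\<close>

definition gvar :: "(real \<Rightarrow> real) \<Rightarrow> real \<Rightarrow> real \<Rightarrow> ennreal" where
  "gvar g x y = Sup {ennreal (\<Sum>i\<in>I. \<bar>g (r i) - g (l i)\<bar>) | (I::nat set) l r. ivl_family I l r x y}"

lemma gvar_upper:
  assumes "ivl_family I l r x y"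
  shows "ennreal (\<Sum>i\<in>I. \<bar>g (r i) - g (l i)\<bar>) \<le> gvar g x y"
proof -
  obtain J :: "nat set" and l' r' where J: "ivl_family J l' r' x y"
    "\<forall>\<phi>. (\<Sum>j\<in>J. \<phi> (l' j) (r' j)) = (\<Sum>i\<in>I. \<phi> (l i) (r i) :: real)"
    by (rule ivl_family_reindex_nat[OF assms])
  show ?thesis
    unfolding gvar_def J(2)[THEN spec, of "\<lambda>a b. \<bar>g b - g a\<bar>", symmetric]
    using J(1) by (intro Sup_upper) auto
qed

lemma gvar_single: "x \<le> y \<Longrightarrow> ennreal \<bar>g y - g x\<bar> \<le> gvar g x y"
  using gvar_upper[of "{0::nat}" "\<lambda>_. x" "\<lambda>_. y" x y g] by (simp add: ivl_family_def)

text \<open>In one direction every interval is clipped to both sides of y: an interval lying on one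
  side becomes degenerate on the other and contributes zero there, and a straddling one is handled
  by the triangle inequality through g y. In the other direction two families are combined over
  \<open>I <+> J\<close>, and the two suprema are pulled out one at a time.\<close>

lemma gvar_additive:
  assumes "x \<le> y" "y \<le> z"
  shows "gvar g x z = gvar g x y + gvar g y z"
proof (rule antisym)
  show "gvar g x z \<le> gvar g x y + gvar g y z"
    unfolding gvar_def[of g x z]
  proof (rule Sup_least, safe)
    fix I :: "nat set" and l r assume F: "ivl_family I l r x z"
    have F1: "ivl_family I (\<lambda>i. min (l i) y) (\<lambda>i. min (r i) y) x y"
      and F2: "ivl_family I (\<lambda>i. max (l i) y) (\<lambda>i. max (r i) y) y z"
    proof -
      have fin: "finite I" and A: "\<And>i. i \<in> I \<Longrightarrow> x \<le> l i \<and> l i \<le> r i \<and> r i \<le> z"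
        and B: "\<And>i j. i \<in> I \<Longrightarrow> j \<in> I \<Longrightarrow> i \<noteq> j \<Longrightarrow> r i \<le> l j \<or> r j \<le> l i"
        using F unfolding ivl_family_def by auto
      show "ivl_family I (\<lambda>i. min (l i) y) (\<lambda>i. min (r i) y) x y"
        unfolding ivl_family_def using fin
      proof (intro conjI ballI impI)
        fix i j assume "i \<in> I" "j \<in> I" "i \<noteq> j"
        from B[OF this] show "min (r i) y \<le> min (l j) y \<or> min (r j) y \<le> min (l i) y" by linarith
      qed (use A assms in \<open>auto simp: min_le_iff_disj intro: min.mono\<close>)
      show "ivl_family I (\<lambda>i. max (l i) y) (\<lambda>i. max (r i) y) y z"
        unfolding ivl_family_def using fin
      proof (intro conjI ballI impI)
        fix i j assume "i \<in> I" "j \<in> I" "i \<noteq> j"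
        from B[OF this] show "max (r i) y \<le> max (l j) y \<or> max (r j) y \<le> max (l i) y" by linarith
      qed (use A assms in \<open>auto simp: le_max_iff_disj dest!: A\<close>)
    qed
    have "(\<Sum>i\<in>I. \<bar>g (r i) - g (l i)\<bar>) \<le> (\<Sum>i\<in>I. \<bar>g (min (r i) y) - g (min (l i) y)\<bar> + \<bar>g (max (r i) y) - g (max (l i) y)\<bar>)"
      by (rule sum_mono) (auto simp: min_def max_def)
    then have "ennreal (\<Sum>i\<in>I. \<bar>g (r i) - g (l i)\<bar>) \<le> ennreal (\<Sum>i\<in>I. \<bar>g (min (r i) y) - g (min (l i) y)\<bar>)
       + ennreal (\<Sum>i\<in>I. \<bar>g (max (r i) y) - g (max (l i) y)\<bar>)"
      by (simp add: sum.distrib sum_nonneg ennreal_leI flip: ennreal_plus)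
    also have "\<dots> \<le> gvar g x y + gvar g y z"
      by (intro add_mono gvar_upper F1 F2)
    finally show "ennreal (\<Sum>i\<in>I. \<bar>g (r i) - g (l i)\<bar>) \<le> gvar g x y + gvar g y z" .
  qed
  let ?S = "\<lambda>x y. {ennreal (\<Sum>i\<in>I. \<bar>g (r i) - g (l i)\<bar>) | (I::nat set) l r. ivl_family I l r x y}"
  have ne: "?S a b \<noteq> {}" for a b
  proof -
    have "ivl_family ({}::nat set) (\<lambda>_. 0) (\<lambda>_. 0) a b" by (simp add: ivl_family_def)
    then show ?thesis by blast
  qed
  have *: "A + B \<le> gvar g x z" if AB: "A \<in> ?S x y" "B \<in> ?S y z" for A B
  proof -
    obtain I l r where A: "ivl_family (I::nat set) l r x y" "A = ennreal (\<Sum>i\<in>I. \<bar>g (r i) - g (l i)\<bar>)"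
      using AB(1) by auto
    obtain J m s where B: "ivl_family (J::nat set) m s y z" "B = ennreal (\<Sum>i\<in>J. \<bar>g (s i) - g (m i)\<bar>)"
      using AB(2) by auto
    have f: "finite I" "finite J" using A B by (auto simp: ivl_family_def)
    have IA: "\<And>i. i \<in> I \<Longrightarrow> x \<le> l i \<and> l i \<le> r i \<and> r i \<le> y"
        "\<And>i j. i \<in> I \<Longrightarrow> j \<in> I \<Longrightarrow> i \<noteq> j \<Longrightarrow> r i \<le> l j \<or> r j \<le> l i"
      using A unfolding ivl_family_def by auto
    have JB: "\<And>i. i \<in> J \<Longrightarrow> y \<le> m i \<and> m i \<le> s i \<and> s i \<le> z"
        "\<And>i j. i \<in> J \<Longrightarrow> j \<in> J \<Longrightarrow> i \<noteq> j \<Longrightarrow> s i \<le> m j \<or> s j \<le> m i"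
      using B unfolding ivl_family_def by auto
    have "ivl_family (I <+> J) (case_sum l m) (case_sum r s) x z"
      unfolding ivl_family_def using f
    proof (intro conjI ballI impI)
      fix i j assume "i \<in> I <+> J" "j \<in> I <+> J" "i \<noteq> j"
      then show "case_sum r s i \<le> case_sum l m j \<or> case_sum r s j \<le> case_sum l m i"
        using IA JB by (elim PlusE) (auto, (meson order_trans)+)
    next
      fix i assume "i \<in> I <+> J"
      then show "x \<le> case_sum l m i" "case_sum l m i \<le> case_sum r s i" "case_sum r s i \<le> z"
        using IA(1) JB(1) assms by (auto elim!: PlusE) (meson order_trans)+
    qed auto
    from gvar_upper[OF this, of g] show ?thesis
      using A B f by (simp add: sum.Plus sum_nonneg)
  qed
  have "gvar g x y + gvar g y z = (SUP A\<in>?S x y. A + gvar g y z)"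
    unfolding gvar_def[of g x y]
    using ennreal_SUP_add_left[OF ne, of "\<lambda>x. x"] by simp
  also have "\<dots> \<le> gvar g x z"
  proof (rule SUP_least)
    fix A assume A: "A \<in> ?S x y"
    have "A + gvar g y z = (SUP B\<in>?S y z. A + B)"
      unfolding gvar_def[of g y z]
      using ennreal_SUP_add_right[OF ne, of _ "\<lambda>x. x"] by simp
    also have "\<dots> \<le> gvar g x z" using *[OF A] by (intro SUP_least)
    finally show "A + gvar g y z \<le> gvar g x z" .
  qed
  finally show "gvar g x y + gvar g y z \<le> gvar g x z" .
qed

text \<open>Suprema are taken one index at a time in the induction; the accumulator K holds the
  elements chosen so far.\<close>

lemma sum_Sup_le_ennreal:
  fixes F :: "'i \<Rightarrow> ennreal set"
  assumes "finite I" "\<And>i. i \<in> I \<Longrightarrow> F i \<noteq> {}"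
    and "\<And>c. (\<And>i. i \<in> I \<Longrightarrow> c i \<in> F i) \<Longrightarrow> K + (\<Sum>i\<in>I. c i) \<le> e"
  shows "K + (\<Sum>i\<in>I. Sup (F i)) \<le> e"
  using assms
proof (induction I arbitrary: K rule: finite_induct)
  case empty
  show ?case using empty(2)[of "\<lambda>_. 0"] by simp
next
  case (insert j I)
  have "K + x + (\<Sum>i\<in>I. Sup (F i)) \<le> e" if x: "x \<in> F j" for x
  proof (rule insert.IH)
    fix c assume c: "\<And>i. i \<in> I \<Longrightarrow> c i \<in> F i"
    have "K + (\<Sum>i\<in>insert j I. (c(j := x)) i) \<le> e"
      by (rule insert.prems(2)) (use c x in auto)
    moreover have "(\<Sum>i\<in>I. (c(j := x)) i) = (\<Sum>i\<in>I. c i)"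
      using insert by (intro sum.cong) auto
    ultimately show "K + x + (\<Sum>i\<in>I. c i) \<le> e"
      using insert by (simp add: add.assoc)
  qed (use insert in auto)
  then have "(SUP x\<in>F j. x + (K + (\<Sum>i\<in>I. Sup (F i)))) \<le> e"
    by (intro SUP_least) (simp add: ac_simps)
  moreover have "(SUP x\<in>F j. x + (K + (\<Sum>i\<in>I. Sup (F i)))) = Sup (F j) + (K + (\<Sum>i\<in>I. Sup (F i)))"
    using ennreal_SUP_add_left[of "F j" "\<lambda>x. x"] insert.prems by simp
  ultimately show ?case
    using insert by (simp add: ac_simps)
qed

text \<open>Absolute continuity controls the variation of g over the intervals and not only its
  increments: subfamilies chosen inside each interval combine over \<open>Sigma I J\<close> into one
  admissible family of no larger total length. The strict bound becomes a weak one in the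
  supremum.\<close>

lemma sum_gvar_le:
  assumes F: "ivl_family (I::'i set) l r a b" and d: "(\<Sum>i\<in>I. r i - l i) < d"
    and AC: "\<And>(I::nat set) l r. ivl_family I l r a b \<Longrightarrow> (\<Sum>i\<in>I. r i - l i) < d \<Longrightarrow> (\<Sum>i\<in>I. \<bar>g (r i) - g (l i)\<bar>) < e"
  shows "(\<Sum>i\<in>I. gvar g (l i) (r i)) \<le> ennreal e"
proof -
  have fin: "finite I" using F by (simp add: ivl_family_def)
  let ?S = "\<lambda>x y. {ennreal (\<Sum>i\<in>I. \<bar>g (r i) - g (l i)\<bar>) | (I::nat set) l r. ivl_family I l r x y}"
  have "0 + (\<Sum>i\<in>I. Sup (?S (l i) (r i))) \<le> ennreal e"
  proof (rule sum_Sup_le_ennreal[OF fin])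
    fix i
    have "ivl_family ({}::nat set) (\<lambda>_. 0) (\<lambda>_. 0) (l i) (r i)" by (simp add: ivl_family_def)
    then show "?S (l i) (r i) \<noteq> {}" by blast
  next
    fix c assume "\<And>i. i \<in> I \<Longrightarrow> c i \<in> ?S (l i) (r i)"
    then have "\<forall>i. \<exists>J m s. i \<in> I \<longrightarrow> ivl_family (J::nat set) m s (l i) (r i) \<and> c i = ennreal (\<Sum>j\<in>J. \<bar>g (s j) - g (m j)\<bar>)"
      by (smt (verit) mem_Collect_eq)
    then obtain J m s where J: "\<And>i. i \<in> I \<Longrightarrow> ivl_family (J i::nat set) (m i) (s i) (l i) (r i)"
      "\<And>i. i \<in> I \<Longrightarrow> c i = ennreal (\<Sum>j\<in>J i. \<bar>g (s i j) - g (m i j)\<bar>)" by metis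
    have fJ: "finite (J i)" if "i \<in> I" for i using J(1)[OF that] by (simp add: ivl_family_def)
    have "ivl_family (Sigma I J) (\<lambda>(i,j). m i j) (\<lambda>(i,j). s i j) a b"
      unfolding ivl_family_def
    proof (intro conjI)
      show "finite (Sigma I J)" using fin fJ by auto
      have "a \<le> m i j \<and> m i j \<le> s i j \<and> s i j \<le> b" if "i \<in> I" "j \<in> J i" for i j
        using J(1)[OF that(1)] F that unfolding ivl_family_def by (meson order_trans)
      then show "\<forall>p\<in>Sigma I J. a \<le> (case p of (i,j) \<Rightarrow> m i j) \<and> (case p of (i,j) \<Rightarrow> m i j) \<le> (case p of (i,j) \<Rightarrow> s i j) \<and> (case p of (i,j) \<Rightarrow> s i j) \<le> b"
        by auto
      have "s i j \<le> m i' j' \<or> s i' j' \<le> m i j" if "i \<in> I" "j \<in> J i" "i' \<in> I" "j' \<in> J i'" "(i,j) \<noteq> (i',j')" for i j i' j'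
      proof (cases "i = i'")
        case True then show ?thesis using J(1)[OF that(1)] that unfolding ivl_family_def by auto
      next
        case False
        then have "r i \<le> l i' \<or> r i' \<le> l i" using F that unfolding ivl_family_def by auto
        moreover have "s i j \<le> r i" "l i \<le> m i j" using J(1)[OF that(1)] that(2) unfolding ivl_family_def by auto
        moreover have "s i' j' \<le> r i'" "l i' \<le> m i' j'" using J(1)[OF that(3)] that(4) unfolding ivl_family_def by auto
        ultimately show ?thesis by linarith
      qed
      then show "\<forall>p\<in>Sigma I J. \<forall>q\<in>Sigma I J. p \<noteq> q \<longrightarrow> (case p of (i,j) \<Rightarrow> s i j) \<le> (case q of (i,j) \<Rightarrow> m i j) \<or> (case q of (i,j) \<Rightarrow> s i j) \<le> (case p of (i,j) \<Rightarrow> m i j)"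
        by auto
    qed
    then obtain J' :: "nat set" and l' r' where J': "ivl_family J' l' r' a b"
      "\<forall>\<phi>. (\<Sum>j\<in>J'. \<phi> (l' j) (r' j)) = (\<Sum>p\<in>Sigma I J. \<phi> (case p of (i,j) \<Rightarrow> m i j) (case p of (i,j) \<Rightarrow> s i j) :: real)"
      by (rule ivl_family_reindex_nat)
    \<comment> \<open>The open intervals of a subfamily are disjoint subsets of [l i, r i], so the
      comparison of lengths is monotonicity of Lebesgue measure.\<close>
    have len: "(\<Sum>j\<in>J i. s i j - m i j) \<le> r i - l i" if i: "i \<in> I" for i
    proof -
      have J1: "ivl_family (J i) (m i) (s i) (l i) (r i)" by (rule J(1)[OF i])
      have "(\<Sum>j\<in>J i. s i j - m i j) = (\<Sum>j\<in>J i. measure lborel {m i j<..<s i j})"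
        using J1 unfolding ivl_family_def by (intro sum.cong) auto
      also have "\<dots> = measure lborel (\<Union>j\<in>J i. {m i j<..<s i j})"
      proof (rule measure_finite_Union[symmetric])
        show "disjoint_family_on (\<lambda>j. {m i j<..<s i j}) (J i)"
          unfolding disjoint_family_on_def
        proof (intro ballI impI)
          fix j k assume "j \<in> J i" "k \<in> J i" "j \<noteq> k"
          then have "s i j \<le> m i k \<or> s i k \<le> m i j" using J1 unfolding ivl_family_def by auto
          then show "{m i j<..<s i j} \<inter> {m i k<..<s i k} = {}" by auto
        qed
      qed (use fJ[OF i] J1 in \<open>auto simp: ivl_family_def\<close>)
      also have "\<dots> \<le> measure lborel {l i..r i}"
      proof (rule measure_mono_fmeasurable)
        show "(\<Union>j\<in>J i. {m i j<..<s i j}) \<subseteq> {l i..r i}"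
          using J1 unfolding ivl_family_def by fastforce
      qed (use fJ[OF i] in \<open>auto intro: fmeasurable_cbox[of "l i" "r i", simplified]\<close>)
      also have "\<dots> = r i - l i" using F i unfolding ivl_family_def by simp
      finally show ?thesis .
    qed
    have "(\<Sum>j\<in>J'. r' j - l' j) = (\<Sum>i\<in>I. \<Sum>j\<in>J i. s i j - m i j)"
      using J'(2)[THEN spec, of "\<lambda>a b. b - a"] fin fJ by (simp add: sum.Sigma case_prod_unfold)
    also have "\<dots> \<le> (\<Sum>i\<in>I. r i - l i)" by (rule sum_mono) (rule len)
    finally have "(\<Sum>j\<in>J'. r' j - l' j) < d" using d by simp
    from AC[OF J'(1) this] have "(\<Sum>i\<in>I. \<Sum>j\<in>J i. \<bar>g (s i j) - g (m i j)\<bar>) < e"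
      using J'(2)[THEN spec, of "\<lambda>a b. \<bar>g b - g a\<bar>"] fin fJ by (simp add: sum.Sigma case_prod_unfold)
    moreover have "(\<Sum>i\<in>I. c i) = ennreal (\<Sum>i\<in>I. \<Sum>j\<in>J i. \<bar>g (s i j) - g (m i j)\<bar>)"
      using J(2) by (simp add: sum_nonneg)
    ultimately show "0 + (\<Sum>i\<in>I. c i) \<le> ennreal e" by (simp add: ennreal_leI)
  qed
  then show ?thesis by (simp add: gvar_def)
qed

text \<open>On pieces shorter than the d belonging to e = 1 the variation is at most 1, and finitely
  many such pieces make up [a,b].\<close>

lemma gvar_finite:
  assumes AC: "abs_cont_on a b g" and "a \<le> b"
  shows "gvar g a b < \<infinity>"
proof -
  obtain d where d: "d > 0" and D0:
    "\<forall>(I::nat set) l r. ivl_family I l r a b \<longrightarrow> (\<Sum>i\<in>I. r i - l i) < d \<longrightarrow> (\<Sum>i\<in>I. \<bar>g (r i) - g (l i)\<bar>) < 1"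
    by (rule abs_cont_on_familyD[OF AC zero_less_one])
  note D = D0[rule_format]
  have small: "gvar g x y \<le> 1" if "a \<le> x" "x \<le> y" "y \<le> b" "y - x < d" for x y
    using sum_gvar_le[of "{0::nat}" "\<lambda>_. x" "\<lambda>_. y" a b d g 1] D that by (auto simp: ivl_family_def)
  obtain N :: nat where N: "(b - a) / d < real N" "N > 0"
  proof -
    obtain n :: nat where "(b - a) / d < real n" using reals_Archimedean2 by blast
    then show ?thesis using that[of "Suc n"] by simp
  qed
  define h where "h = (b - a) / N"
  have h: "0 \<le> h" "h < d" "real N * h = b - a" using N d assms by (auto simp: h_def field_simps)
  have "gvar g a (a + real k * h) \<le> of_nat k + 1" if "k \<le> N" for k
    using that
  proof (induction k)
    case 0 show ?case using small[of a a] assms d by simp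
  next
    case (Suc k)
    have le: "real (Suc k) * h \<le> real N * h" using Suc h by (intro mult_right_mono) auto
    have "gvar g a (a + real (Suc k) * h) = gvar g a (a + real k * h) + gvar g (a + real k * h) (a + real (Suc k) * h)"
      using h by (intro gvar_additive) (auto simp: field_simps)
    also have "\<dots> \<le> (of_nat k + 1) + 1"
      using Suc h le by (intro add_mono small) (auto simp: algebra_simps)
    finally show ?case by (simp add: add.commute)
  qed
  from this[of N] h have "gvar g a b \<le> of_nat N + 1" by simp
  also have "\<dots> < \<infinity>" by (simp add: of_nat_less_top)
  finally show ?thesis .
qed

section \<open>Differentiation of integrals and the fundamental theorem\<close>

text \<open>The averages in \<open>integrable_ccontinuous_explicit\<close> extend to the right of x.
  Applied also to the reflected function h(-t), it gives the averages to the left, and both together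
  yield the two-sided derivative.\<close>

lemma AE_has_real_derivative_indefinite_integral:
  fixes h :: "real \<Rightarrow> real"
  assumes h: "integrable lborel h"
  shows "AE x in lborel. a < x \<longrightarrow> ((\<lambda>u. LINT t:{a..u}|lborel. h t) has_real_derivative h x) (at x)"
proof -
  have si: "set_integrable lborel {u..v} h" for u v
    unfolding set_integrable_def using h by (rule integrable_mult_indicator[rotated]) simp
  have hi: "h integrable_on {u..v}" for u v
    by (rule set_borel_integral_eq_integral(1)[OF si])
  have F: "(LINT t:{u..v}|lborel. h t) = integral {u..v} h" for u v
    by (rule set_borel_integral_eq_integral(2)[OF si])
  have hi': "(\<lambda>t. h (- t)) integrable_on {u..v}" for u v
    using hi[of "-v" "-u"] Henstock_Kurzweil_Integration.integrable_reflect_real[of h "-u" "-v"] by simp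
  obtain N1 where N1: "negligible N1" "\<And>x e. \<lbrakk>x \<notin> N1; 0 < e\<rbrakk> \<Longrightarrow>
      \<exists>d>0. \<forall>k. 0 < k \<and> k < d \<longrightarrow> \<bar>integral {x..x + k} h / k - h x\<bar> < e"
    using integrable_ccontinuous_explicit[of h] hi by (auto simp: cbox_interval divide_inverse mult.commute)
  obtain N2 where N2: "negligible N2" "\<And>x e. \<lbrakk>x \<notin> N2; 0 < e\<rbrakk> \<Longrightarrow>
      \<exists>d>0. \<forall>k. 0 < k \<and> k < d \<longrightarrow> \<bar>integral {x..x + k} (\<lambda>t. h (-t)) / k - h (-x)\<bar> < e"
    using integrable_ccontinuous_explicit[of "\<lambda>t. h (-t)"] hi' by (auto simp: cbox_interval divide_inverse mult.commute)
  have "negligible (uminus ` N2)"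
    by (rule negligible_differentiable_image_negligible) (use N2 in \<open>auto intro!: derivative_intros\<close>)
  then have "negligible (N1 \<union> uminus ` N2)" using N1 by auto
  then have "AE x in lebesgue. x \<notin> N1 \<union> uminus ` N2"
    using negligible_iff_null_sets AE_not_in by blast
  then have ae: "AE x in lborel. x \<notin> N1 \<union> uminus ` N2"
    by (simp add: AE_completion_iff)
  show ?thesis
    using ae
  proof eventually_elim
    case (elim x)
    show ?case
    proof
      assume ax: "a < x"
      show "((\<lambda>u. LINT t:{a..u}|lborel. h t) has_real_derivative h x) (at x)"
        unfolding DERIV_def F
      proof (rule LIM_I)
        fix e :: real assume e: "e > 0"
        obtain d1 where d1: "d1 > 0" "\<And>k. 0 < k \<Longrightarrow> k < d1 \<Longrightarrow> \<bar>integral {x..x + k} h / k - h x\<bar> < e"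
          using N1(2)[of x e] elim e by auto
        have "-x \<notin> N2" using elim by (metis UnI2 image_eqI minus_minus)
        then obtain d2 where d2: "d2 > 0" "\<And>k. 0 < k \<Longrightarrow> k < d2 \<Longrightarrow> \<bar>integral {-x..-x + k} (\<lambda>t. h (-t)) / k - h x\<bar> < e"
          using N2(2)[of "-x" e] e by auto
        show "\<exists>s>0. \<forall>k::real. k \<noteq> 0 \<and> norm (k - 0) < s \<longrightarrow> norm ((integral {a..x + k} h - integral {a..x} h) / k - h x) < e"
        proof (intro exI[of _ "min (min d1 d2) (x - a)"] conjI allI impI)
          fix k :: real assume k: "k \<noteq> 0 \<and> norm (k - 0) < min (min d1 d2) (x - a)"
          show "norm ((integral {a..x + k} h - integral {a..x} h) / k - h x) < e"
          proof (cases "k > 0")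
            case True
            have "integral {a..x} h + integral {x..x+k} h = integral {a..x+k} h"
              using ax True hi by (intro Henstock_Kurzweil_Integration.integral_combine) auto
            then have "integral {a..x + k} h - integral {a..x} h = integral {x..x+k} h" by linarith
            then show ?thesis using d1(2)[of k] True k by simp
          next
            case False
            then have k0: "k < 0" using k by auto
            have "integral {a..x+k} h + integral {x+k..x} h = integral {a..x} h"
              using ax k0 k hi by (intro Henstock_Kurzweil_Integration.integral_combine) auto
            moreover have "integral {-x..-x + -k} (\<lambda>t. h (-t)) = integral {x+k..x} h"
              using Henstock_Kurzweil_Integration.integral_reflect_real[of x "x+k" h] by simp
            ultimately have "(integral {a..x + k} h - integral {a..x} h) / k = integral {-x..-x + -k} (\<lambda>t. h (-t)) / (-k)"
              by (simp add: divide_simps)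
            then show ?thesis using d2(2)[of "-k"] k0 k by simp
          qed
        qed (use d1 d2 ax in auto)
      qed
    qed
  qed
qed

text \<open>The cells of the dyadic grid that fit into an open set exhaust it, so absolute continuity
  on finite families of intervals passes to open sets and, by outer regularity, to null sets.\<close>
lemma mono_abs_cont_null_sets:
  fixes F :: "real \<Rightarrow> real"
  assumes mono: "\<And>x y. x \<le> y \<Longrightarrow> F x \<le> F y" and cont: "continuous_on UNIV F"
    and AC: "\<And>e. e > 0 \<Longrightarrow> \<exists>d>0. \<forall>(I::int set) l r. finite I \<longrightarrow> (\<forall>i\<in>I. l i \<le> r i) \<longrightarrow>
       (\<forall>i\<in>I. \<forall>j\<in>I. i \<noteq> j \<longrightarrow> r i \<le> l j \<or> r j \<le> l i) \<longrightarrow> (\<Sum>i\<in>I. r i - l i) < d \<longrightarrow> (\<Sum>i\<in>I. F (r i) - F (l i)) \<le> e"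
  shows "null_sets lborel \<subseteq> null_sets (interval_measure F)"
proof
  let ?\<mu> = "interval_measure F"
  have rc: "continuous (at_right a) F" for a
    using cont by (auto simp: continuous_on_eq_continuous_within intro: continuous_within_subset)
  note Ioc = emeasure_interval_measure_Ioc[of _ _ F, OF _ mono rc]
  fix N :: "real set" assume N: "N \<in> null_sets lborel"
  then have NB: "N \<in> sets ?\<mu>" "N \<in> sets borel" by auto
  have "emeasure ?\<mu> N \<le> ennreal e" if e: "e > 0" for e
  proof -
    obtain d where d: "d > 0" and D0: "\<forall>(I::int set) l r. finite I \<longrightarrow> (\<forall>i\<in>I. l i \<le> r i) \<longrightarrow>
       (\<forall>i\<in>I. \<forall>j\<in>I. i \<noteq> j \<longrightarrow> r i \<le> l j \<or> r j \<le> l i) \<longrightarrow> (\<Sum>i\<in>I. r i - l i) < d \<longrightarrow> (\<Sum>i\<in>I. F (r i) - F (l i)) \<le> e"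
      using AC[OF e] by (elim exE conjE) (rule that)
    note D = D0[rule_format]
    obtain U where U: "open U" "N \<subseteq> U" "emeasure lborel (U - N) < ennreal d"
      by (rule outer_regular_lborel[OF NB(2) d])
    have "emeasure lborel U \<le> emeasure lborel (U - N) + emeasure lborel N"
      using U NB N by (intro order_trans[OF _ emeasure_subadditive] emeasure_mono) auto
    also have "emeasure lborel N = 0" using N by auto
    finally have Ud: "emeasure lborel U < ennreal d" using U(3) by simp
    define c where "c n k = {real_of_int k / 2^n <.. real_of_int (k+1) / 2^n}" for n :: nat and k :: int
    \<comment> \<open>The bound on k keeps \<open>J n\<close> finite, while the range of cells it
      allows grows to the whole line with n.\<close>
    define J where "J n = {k. \<bar>k\<bar> \<le> int n * 2^n \<and> c n k \<subseteq> U}" for n :: nat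
    have fJ: "finite (J n)" for n
      by (rule finite_subset[of _ "{-(int n * 2^n)..int n * 2^n}"]) (auto simp: J_def)
    define A where "A n = (\<Union>k\<in>J n. c n k)" for n
    have disj: "disjoint_family_on (c n) K" for n K
    proof -
      have "x \<notin> c n j" if "x \<in> c n i" "i < j" for x i j
      proof -
        have "real_of_int (i + 1) \<le> real_of_int j" using that by linarith
        then have "real_of_int (i+1) / 2^n \<le> real_of_int j / 2^n" by (intro divide_right_mono) auto
        then show ?thesis using that by (auto simp: c_def)
      qed
      then show ?thesis unfolding disjoint_family_on_def by (metis disjoint_iff linorder_neqE)
    qed
    have cs: "c n ` K \<subseteq> sets borel" for n K by (auto simp: c_def)
    have cle: "real_of_int k / 2^n \<le> real_of_int (k+1) / 2^n" for k :: int and n :: nat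
      by (intro divide_right_mono) auto
    have inc: "A n \<subseteq> A (Suc n)" for n
    proof
      fix x assume "x \<in> A n"
      then obtain k where k: "k \<in> J n" "x \<in> c n k" by (auto simp: A_def)
      \<comment> \<open>\<open>k'\<close> is the half of the old cell that contains x, so refining
        the grid loses no point.\<close>
      define k' where "k' = (if x \<le> (2 * real_of_int k + 1) / 2^Suc n then 2*k else 2*k+1)"
      have e1: "real_of_int k / 2^n = 2 * real_of_int k / 2^Suc n" "real_of_int (k+1) / 2^n = (2 * real_of_int k + 2) / 2^Suc n"
        by (simp_all add: field_simps)
      have sub: "c (Suc n) k' \<subseteq> c n k"
      proof
        fix y assume y: "y \<in> c (Suc n) k'"
        have "2 * real_of_int k / 2^Suc n \<le> real_of_int k' / 2^Suc n" "real_of_int (k'+1) / 2^Suc n \<le> (2 * real_of_int k + 2) / 2^Suc n"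
          by (intro divide_right_mono; simp add: k'_def)+
        then show "y \<in> c n k" using y unfolding c_def e1 by auto
      qed
      have "x \<in> c (Suc n) k'"
        using k(2) unfolding c_def e1 k'_def by (auto simp: add.commute)
      moreover have "\<bar>k'\<bar> \<le> int (Suc n) * 2 ^ Suc n"
      proof -
        have "\<bar>k\<bar> \<le> int n * 2^n" using k by (auto simp: J_def)
        moreover have "\<bar>k'\<bar> \<le> 2 * \<bar>k\<bar> + 1" by (auto simp: k'_def)
        moreover have "int (Suc n) * 2 ^ Suc n = 2 * (int n * 2^n) + 2 * 2^n" by (simp add: algebra_simps)
        moreover have "(1::int) \<le> 2^n" by simp
        ultimately show ?thesis by linarith
      qed
      ultimately show "x \<in> A (Suc n)" using sub k(1) unfolding A_def J_def by blast
    qed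
    have AU: "(\<Union>n. A n) = U"
    proof
      show "(\<Union>n. A n) \<subseteq> U" by (auto simp: A_def J_def)
      show "U \<subseteq> (\<Union>n. A n)"
      proof
        fix x assume x: "x \<in> U"
        then obtain \<eta> where \<eta>: "\<eta> > 0" "\<And>y. \<bar>y - x\<bar> < \<eta> \<Longrightarrow> y \<in> U"
          using U(1) unfolding open_dist dist_real_def by blast
        obtain n1 where n1: "(1/2)^n1 < \<eta>" using real_arch_pow_inv[OF \<eta>(1), of "1/2"] by auto
        obtain n2 :: nat where n2: "\<bar>x\<bar> + 1 < real n2" using reals_Archimedean2 by blast
        define n where "n = max n1 n2"
        have n: "(1/2)^n < \<eta>" "\<bar>x\<bar> + 1 < real n"
          using n1 n2 power_decreasing[of n1 n "1/2::real"] unfolding n_def by linarith+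
        define k where "k = \<lceil>x * 2^n\<rceil> - 1"
        have k: "real_of_int k < x * 2^n" "x * 2^n \<le> real_of_int k + 1" unfolding k_def by linarith+
        have xc: "x \<in> c n k" using k by (auto simp: c_def field_simps)
        have "c n k \<subseteq> U"
        proof
          fix y assume "y \<in> c n k"
          then have "\<bar>y - x\<bar> \<le> real_of_int (k+1) / 2^n - real_of_int k / 2^n" using xc by (auto simp: c_def)
          also have "\<dots> = (1/2)^n" by (simp add: field_simps)
          finally show "y \<in> U" using n \<eta> by auto
        qed
        moreover have "\<bar>k\<bar> \<le> int n * 2^n"
        proof -
          have "\<bar>real_of_int k\<bar> \<le> \<bar>x\<bar> * 2^n + 1"
            using k abs_mult[of x "2^n"] abs_mult[of x "2^n"] by simp
          also have "\<dots> \<le> (\<bar>x\<bar> + 1) * 2^n" by (simp add: algebra_simps)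
          also have "\<dots> \<le> real n * 2^n" using n by (intro mult_right_mono) auto
          finally have "real_of_int \<bar>k\<bar> \<le> real_of_int (int n * 2^n)" by simp
          then show ?thesis by (simp only: of_int_le_iff)
        qed
        ultimately show "x \<in> (\<Union>n. A n)" using xc by (auto simp: A_def J_def)
      qed
    qed
    have "emeasure ?\<mu> (A n) \<le> ennreal e" for n
    proof -
      have len: "(\<Sum>k\<in>J n. real_of_int (k+1) / 2^n - real_of_int k / 2^n) < d"
      proof -
        have "ennreal (\<Sum>k\<in>J n. real_of_int (k+1) / 2^n - real_of_int k / 2^n) = (\<Sum>k\<in>J n. emeasure lborel (c n k))"
          using cle by (subst sum_ennreal[symmetric]) (auto simp: c_def)
        also have "\<dots> = emeasure lborel (A n)"
          unfolding A_def using fJ disj cs by (intro sum_emeasure) auto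
        also have "\<dots> \<le> emeasure lborel U" using U AU by (intro emeasure_mono) auto
        also have "\<dots> < ennreal d" by (rule Ud)
        finally show ?thesis
          by (subst (asm) ennreal_less_iff) (intro sum_nonneg, use cle in \<open>simp add: field_simps\<close>)
      qed
      have "emeasure ?\<mu> (A n) = (\<Sum>k\<in>J n. emeasure ?\<mu> (c n k))"
        unfolding A_def using fJ disj cs by (intro sum_emeasure[symmetric]) auto
      also have "\<dots> = ennreal (\<Sum>k\<in>J n. F (real_of_int (k+1) / 2^n) - F (real_of_int k / 2^n))"
        unfolding c_def using mono[OF cle] by (subst sum_ennreal[symmetric]) (auto simp: Ioc cle simp del: of_int_add)
      also have "\<dots> \<le> ennreal e"
      proof (intro ennreal_leI D fJ cle len)
        fix i j :: int assume "i \<noteq> j"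
        then consider "i + 1 \<le> j" | "j + 1 \<le> i" by linarith
        then show "real_of_int (i + 1) / 2 ^ n \<le> real_of_int j / 2 ^ n \<or> real_of_int (j + 1) / 2 ^ n \<le> real_of_int i / 2 ^ n"
        proof cases
          case 1
          then have "real_of_int (i + 1) / 2 ^ n \<le> real_of_int j / 2 ^ n" by (intro divide_right_mono) auto
          then show ?thesis ..
        next
          case 2
          then have "real_of_int (j + 1) / 2 ^ n \<le> real_of_int i / 2 ^ n" by (intro divide_right_mono) auto
          then show ?thesis ..
        qed
      qed
      finally show ?thesis .
    qed
    moreover have "(SUP n. emeasure ?\<mu> (A n)) = emeasure ?\<mu> U"
      unfolding AU[symmetric]
    proof (rule SUP_emeasure_incseq)
      show "range A \<subseteq> sets ?\<mu>" by (auto simp: A_def c_def fJ)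
      show "incseq A" using inc by (rule incseq_SucI)
    qed
    ultimately have "emeasure ?\<mu> U \<le> ennreal e" by (metis SUP_least)
    moreover have "emeasure ?\<mu> N \<le> emeasure ?\<mu> U" using U NB by (intro emeasure_mono) auto
    ultimately show ?thesis by simp
  qed
  then have "emeasure ?\<mu> N = 0"
    by (metis ennreal_le_epsilon add_0 zero_le order_antisym)
  then show "N \<in> null_sets ?\<mu>" using NB by auto
qed

text \<open>Radon-Nikodym for the Stieltjes measure of F. The density is infinite only on a null
  set, because its integral over each [-n,n] is F n - F (-n); hence \<open>enn2real\<close> does not
  change its integrals.\<close>

lemma mono_abs_cont_density:
  fixes F :: "real \<Rightarrow> real"
  assumes mono: "\<And>x y. x \<le> y \<Longrightarrow> F x \<le> F y" and cont: "continuous_on UNIV F"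
    and AC: "\<And>e. e > 0 \<Longrightarrow> \<exists>d>0. \<forall>(I::int set) l r. finite I \<longrightarrow> (\<forall>i\<in>I. l i \<le> r i) \<longrightarrow>
       (\<forall>i\<in>I. \<forall>j\<in>I. i \<noteq> j \<longrightarrow> r i \<le> l j \<or> r j \<le> l i) \<longrightarrow> (\<Sum>i\<in>I. r i - l i) < d \<longrightarrow> (\<Sum>i\<in>I. F (r i) - F (l i)) \<le> e"
  shows "\<exists>h. h \<in> borel_measurable borel \<and>
    (\<forall>x y. x \<le> y \<longrightarrow> set_integrable lborel {x..y} h \<and> F y - F x = (LINT t:{x..y}|lborel. h t))"
proof -
  let ?\<mu> = "interval_measure F"
  have rc: "continuous (at_right a) F" for a
    using cont by (auto simp: continuous_on_eq_continuous_within intro: continuous_within_subset)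
  note Icc = emeasure_interval_measure_Icc[of _ _ F, OF _ mono cont]
  have "absolutely_continuous lborel ?\<mu>"
    unfolding absolutely_continuous_def by (rule mono_abs_cont_null_sets[OF assms])
  then obtain f where f: "f \<in> borel_measurable lborel" "density lborel f = ?\<mu>"
    using sigma_finite_measure.Radon_Nikodym[OF sigma_finite_lborel] by (metis sets_interval_measure sets_lborel)
  have fI: "(\<integral>\<^sup>+t. f t * indicator {x..y} t \<partial>lborel) = ennreal (F y - F x)" if "x \<le> y" for x y
    using Icc[OF that] emeasure_density[OF f(1), of "{x..y}"] f(2) by simp
  have fin: "AE t in lborel. f t < \<infinity>"
  proof -
    have "AE t in lborel. f t * indicator {- real n..real n} t \<noteq> \<infinity>" for n :: nat
      using fI[of "- real n" "real n"] f by (intro nn_integral_PInf_AE) auto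
    then have "AE t in lborel. \<forall>n::nat. f t * indicator {- real n..real n} t \<noteq> \<infinity>"
      by (simp add: AE_all_countable)
    then show ?thesis
    proof eventually_elim
      case (elim t)
      obtain n :: nat where "\<bar>t\<bar> < real n" using reals_Archimedean2 by blast
      then show ?case using elim[THEN spec, of n] by (auto simp: less_top abs_less_iff)
    qed
  qed
  define h where "h t = enn2real (f t)" for t
  have hm: "h \<in> borel_measurable borel" and [measurable]: "f \<in> borel_measurable borel" unfolding h_def using f(1) by simp_all
  have hI: "has_bochner_integral lborel (\<lambda>t. indicator {x..y} t *\<^sub>R h t) (F y - F x)" if "x \<le> y" for x y
  proof (rule has_bochner_integral_nn_integral)
    have "(\<integral>\<^sup>+t. ennreal (indicator {x..y} t *\<^sub>R h t) \<partial>lborel) = (\<integral>\<^sup>+t. f t * indicator {x..y} t \<partial>lborel)"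
      using fin by (intro nn_integral_cong_AE) (auto simp: h_def indicator_def)
    then show "(\<integral>\<^sup>+t. ennreal (indicator {x..y} t *\<^sub>R h t) \<partial>lborel) = ennreal (F y - F x)"
      using fI[OF that] by simp
  qed (use hm mono[OF that] in \<open>auto simp: h_def\<close>)
  show ?thesis
    using hm hI unfolding set_integrable_def set_lebesgue_integral_def has_bochner_integral_iff
    by (intro exI[of _ h]) auto
qed

lemma abs_cont_on_imp_continuous_on:
  assumes "abs_cont_on a b g"
  shows "continuous_on {a..b} g"
proof (rule continuous_on_iff[THEN iffD2], intro ballI allI impI)
  fix x e assume x: "x \<in> {a..b}" and e: "(e::real) > 0"
  obtain d where d: "d > 0"
    "\<forall>(I::nat set) l r. ivl_family I l r a b \<longrightarrow> (\<Sum>i\<in>I. r i - l i) < d \<longrightarrow> (\<Sum>i\<in>I. \<bar>g (r i) - g (l i)\<bar>) < e"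
    by (rule abs_cont_on_familyD[OF assms e])
  have "dist (g y) (g x) < e" if "y \<in> {a..b}" "dist y x < d" for y
    using d(2)[rule_format, of "{0}" "\<lambda>_. min x y" "\<lambda>_. max x y"] x that
    by (cases "x \<le> y") (auto simp: ivl_family_def dist_real_def min_def max_def abs_minus_commute)
  then show "\<exists>d>0. \<forall>x'\<in>{a..b}. dist x' x < d \<longrightarrow> dist (g x') (g x) < e" using d(1) by blast
qed

text \<open>Jordan decomposition: \<open>F1\<close> is the variation from a, and \<open>F2\<close>
  is that variation minus g. Both are monotone and absolutely continuous, so both have densities,
  and h is the difference of the two on [a,b].\<close>

theorem abs_cont_on_FTC:
  assumes AC: "abs_cont_on a b g" and "a \<le> b"
  obtains h where "integrable lborel h" "\<forall>x\<in>{a..b}. g x = g a + (LINT t:{a..x}|lborel. h t)"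
    "AE x in lborel. a < x \<and> x < b \<longrightarrow> (g has_real_derivative h x) (at x)"
proof -
  \<comment> \<open>Clamping to [a,b] continues \<open>F1\<close> and \<open>F2\<close> as constants
    outside the interval, since \<open>mono_abs_cont_density\<close> speaks of functions on the
    whole line.\<close>
  define c where "c x = max a (min b x)" for x
  have c: "a \<le> c x" "c x \<le> b" for x using \<open>a \<le> b\<close> by (auto simp: c_def)
  have cmono: "c x \<le> c y" if "x \<le> y" for x y using that by (auto simp: c_def)
  have clip: "c y - c x \<le> y - x" if "x \<le> y" for x y using that by (auto simp: c_def)
  have cid: "x \<in> {a..b} \<Longrightarrow> c x = x" for x by (auto simp: c_def)
  have fin: "gvar g x y < \<infinity>" if "a \<le> x" "x \<le> y" "y \<le> b" for x y
    using gvar_additive[of a x y g] gvar_additive[of a y b g] gvar_finite[OF AC \<open>a \<le> b\<close>] that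
    by (simp add: less_top)
  define v where "v x y = enn2real (gvar g x y)" for x y
  have vadd: "v x z = v x y + v y z" if "a \<le> x" "x \<le> y" "y \<le> z" "z \<le> b" for x y z
    unfolding v_def using gvar_additive[of x y z g] fin[of x y] fin[of y z] that
    by (simp add: enn2real_plus)
  have vg: "\<bar>g y - g x\<bar> \<le> v x y" if "a \<le> x" "x \<le> y" "y \<le> b" for x y
    using gvar_single[of x y g] fin[of x y] that enn2real_mono[of "ennreal \<bar>g y - g x\<bar>" "gvar g x y"] by (auto simp: v_def)
  have v0: "0 \<le> v x y" for x y by (simp add: v_def)
  define F1 where "F1 x = v a (c x)" for x
  define F2 where "F2 x = v a (c x) - g (c x)" for x
  have F1d: "F1 y - F1 x = v (c x) (c y)" if "x \<le> y" for x y
    using vadd[of a "c x" "c y"] c cmono[OF that] by (auto simp: F1_def)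
  have F2d: "F2 y - F2 x = v (c x) (c y) - (g (c y) - g (c x))" if "x \<le> y" for x y
    using F1d[OF that] by (auto simp: F1_def F2_def)
  have vgc: "\<bar>g (c y) - g (c x)\<bar> \<le> v (c x) (c y)" if "x \<le> y" for x y
    using vg c cmono[OF that] by auto
  have m1: "F1 x \<le> F1 y" if "x \<le> y" for x y using F1d[OF that] v0[of "c x" "c y"] by linarith
  have m2: "F2 x \<le> F2 y" if "x \<le> y" for x y using F2d[OF that] vgc[OF that] by linarith
  have AC1: "\<exists>d>0. \<forall>(I::int set) l r. finite I \<longrightarrow> (\<forall>i\<in>I. l i \<le> r i) \<longrightarrow>
       (\<forall>i\<in>I. \<forall>j\<in>I. i \<noteq> j \<longrightarrow> r i \<le> l j \<or> r j \<le> l i) \<longrightarrow> (\<Sum>i\<in>I. r i - l i) < d \<longrightarrow> (\<Sum>i\<in>I. v (c (l i)) (c (r i))) \<le> e"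
    if e: "e > 0" for e
  proof -
    obtain d where d: "d > 0" and D0:
      "\<forall>(I::nat set) l r. ivl_family I l r a b \<longrightarrow> (\<Sum>i\<in>I. r i - l i) < d \<longrightarrow> (\<Sum>i\<in>I. \<bar>g (r i) - g (l i)\<bar>) < e"
      by (rule abs_cont_on_familyD[OF AC e])
    note D = D0[rule_format]
    show ?thesis
    proof (intro exI[of _ d] conjI d allI impI)
      fix I :: "int set" and l r
      assume I: "finite I" "\<forall>i\<in>I. l i \<le> r i" "\<forall>i\<in>I. \<forall>j\<in>I. i \<noteq> j \<longrightarrow> r i \<le> l j \<or> r j \<le> l i" "(\<Sum>i\<in>I. r i - l i) < d"
      have fam: "ivl_family I (\<lambda>i. c (l i)) (\<lambda>i. c (r i)) a b"
        unfolding ivl_family_def using I c cmono by (auto; metis)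
      have "(\<Sum>i\<in>I. c (r i) - c (l i)) \<le> (\<Sum>i\<in>I. r i - l i)" by (rule sum_mono) (use I clip in auto)
      then have "(\<Sum>i\<in>I. gvar g (c (l i)) (c (r i))) \<le> ennreal e"
        using I by (intro sum_gvar_le[OF fam _ D]) auto
      moreover have "gvar g (c (l i)) (c (r i)) = ennreal (v (c (l i)) (c (r i)))" if "i \<in> I" for i
        using fin[of "c (l i)" "c (r i)"] c cmono I that by (simp add: v_def)
      ultimately show "(\<Sum>i\<in>I. v (c (l i)) (c (r i))) \<le> e"
        using e by (simp add: v0 ennreal_le_iff)
    qed
  qed
  \<comment> \<open>The factor 2 covers both functions at once: an increment of \<open>F2\<close> is
    a variation minus an increment of g, and each of these is at most v in absolute value.\<close>
  have AC1': "\<exists>d>0. \<forall>(I::int set) l r. finite I \<longrightarrow> (\<forall>i\<in>I. l i \<le> r i) \<longrightarrow>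
       (\<forall>i\<in>I. \<forall>j\<in>I. i \<noteq> j \<longrightarrow> r i \<le> l j \<or> r j \<le> l i) \<longrightarrow> (\<Sum>i\<in>I. r i - l i) < d \<longrightarrow> (\<Sum>i\<in>I. F (r i) - F (l i)) \<le> e"
    if e: "e > 0" and F: "\<And>x y. x \<le> y \<Longrightarrow> F y - F x \<le> 2 * v (c x) (c y)" for e and F :: "real \<Rightarrow> real"
  proof -
    from e have e2: "e/2 > 0" by simp
    obtain d where d: "d > 0" and D0: "\<forall>(I::int set) l r. finite I \<longrightarrow> (\<forall>i\<in>I. l i \<le> r i) \<longrightarrow>
       (\<forall>i\<in>I. \<forall>j\<in>I. i \<noteq> j \<longrightarrow> r i \<le> l j \<or> r j \<le> l i) \<longrightarrow> (\<Sum>i\<in>I. r i - l i) < d \<longrightarrow> (\<Sum>i\<in>I. v (c (l i)) (c (r i))) \<le> e/2"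
      using AC1[OF e2] by (elim exE conjE) (rule that)
    note D = D0[THEN spec, THEN spec, THEN spec, THEN mp, THEN mp, THEN mp, THEN mp]
    show ?thesis
    proof (intro exI[of _ d] conjI d allI impI)
      fix I :: "int set" and l r
      assume I: "finite I" "\<forall>i\<in>I. l i \<le> r i" "\<forall>i\<in>I. \<forall>j\<in>I. i \<noteq> j \<longrightarrow> r i \<le> l j \<or> r j \<le> l i" "(\<Sum>i\<in>I. r i - l i) < d"
      have "(\<Sum>i\<in>I. F (r i) - F (l i)) \<le> (\<Sum>i\<in>I. 2 * v (c (l i)) (c (r i)))"
        using I F by (intro sum_mono) auto
      then show "(\<Sum>i\<in>I. F (r i) - F (l i)) \<le> e" using D[OF I] by (simp flip: sum_distrib_left)
    qed
  qed
  have F1b: "F1 y - F1 x \<le> 2 * v (c x) (c y)" if "x \<le> y" for x y using F1d[OF that] v0[of "c x" "c y"] by linarith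
  have F2b: "F2 y - F2 x \<le> 2 * v (c x) (c y)" if "x \<le> y" for x y using F2d[OF that] vgc[OF that] by linarith
  have cont: "continuous_on UNIV F"
    if F: "\<And>x y. x \<le> y \<Longrightarrow> F y - F x \<le> 2 * v (c x) (c y)" and m: "\<And>x y. x \<le> y \<Longrightarrow> F x \<le> F y" for F :: "real \<Rightarrow> real"
  proof (rule continuous_on_iff[THEN iffD2], intro ballI allI impI)
    fix x e :: real assume e: "e > 0"
    from e have e2: "e/2 > 0" by simp
    have "\<exists>d>0. \<forall>(I::int set) l r. finite I \<longrightarrow> (\<forall>i\<in>I. l i \<le> r i) \<longrightarrow>
       (\<forall>i\<in>I. \<forall>j\<in>I. i \<noteq> j \<longrightarrow> r i \<le> l j \<or> r j \<le> l i) \<longrightarrow> (\<Sum>i\<in>I. r i - l i) < d \<longrightarrow> (\<Sum>i\<in>I. F (r i) - F (l i)) \<le> e/2"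
      by (rule AC1'[OF e2 F])
    then obtain d where d: "d > 0" and D0: "\<forall>(I::int set) l r. finite I \<longrightarrow> (\<forall>i\<in>I. l i \<le> r i) \<longrightarrow>
       (\<forall>i\<in>I. \<forall>j\<in>I. i \<noteq> j \<longrightarrow> r i \<le> l j \<or> r j \<le> l i) \<longrightarrow> (\<Sum>i\<in>I. r i - l i) < d \<longrightarrow> (\<Sum>i\<in>I. F (r i) - F (l i)) \<le> e/2"
      by (elim exE conjE) (rule that)
    note D = D0[THEN spec, THEN spec, THEN spec, THEN mp, THEN mp, THEN mp, THEN mp]
    have "dist (F y) (F x) < e" if "dist y x < d" for y
      using D[of "{0}" "\<lambda>_. min x y" "\<lambda>_. max x y"] that e m[of x y] m[of y x]
      by (cases "x \<le> y") (auto simp: dist_real_def min_def max_def)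
    then show "\<exists>d>0. \<forall>x'\<in>UNIV. dist x' x < d \<longrightarrow> dist (F x') (F x) < e" using d by blast
  qed
  have ex1: "\<exists>h. h \<in> borel_measurable borel \<and>
    (\<forall>x y. x \<le> y \<longrightarrow> set_integrable lborel {x..y} h \<and> F1 y - F1 x = (LINT t:{x..y}|lborel. h t))"
  proof (rule mono_abs_cont_density[OF m1])
    show "continuous_on UNIV F1" by (rule cont[OF F1b m1])
  qed (assumption | rule AC1'[OF _ F1b])+
  then obtain h1 where h1: "set_integrable lborel {x..y} h1"
     "F1 y - F1 x = (LINT t:{x..y}|lborel. h1 t)" if "x \<le> y" for x y
    by (elim exE conjE) (rule that, simp_all)
  have ex2: "\<exists>h. h \<in> borel_measurable borel \<and>
    (\<forall>x y. x \<le> y \<longrightarrow> set_integrable lborel {x..y} h \<and> F2 y - F2 x = (LINT t:{x..y}|lborel. h t))"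
  proof (rule mono_abs_cont_density[OF m2])
    show "continuous_on UNIV F2" by (rule cont[OF F2b m2])
  qed (assumption | rule AC1'[OF _ F2b])+
  then obtain h2 where h2: "set_integrable lborel {x..y} h2"
     "F2 y - F2 x = (LINT t:{x..y}|lborel. h2 t)" if "x \<le> y" for x y
    by (elim exE conjE) (rule that, simp_all)
  define h where "h t = indicator {a..b} t *\<^sub>R (h1 t - h2 t)" for t
  have hI: "integrable lborel h"
    using set_integral_diff(1)[OF h1(1)[OF \<open>a \<le> b\<close>] h2(1)[OF \<open>a \<le> b\<close>]] unfolding h_def set_integrable_def .
  have gh: "g x = g a + (LINT t:{a..x}|lborel. h t)" if x: "x \<in> {a..b}" for x
  proof -
    have "(LINT t:{a..x}|lborel. h t) = (LINT t:{a..x}|lborel. h1 t - h2 t)"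
      using x by (intro set_lebesgue_integral_cong) (auto simp: h_def)
    also have "\<dots> = (F1 x - F1 a) - (F2 x - F2 a)"
      using x h1 h2 by (subst set_integral_diff) auto
    also have "\<dots> = g x - g a" using x cid \<open>a \<le> b\<close> by (simp add: F1_def F2_def)
    finally show ?thesis by simp
  qed
  have "AE x in lborel. a < x \<and> x < b \<longrightarrow> (g has_real_derivative h x) (at x)"
    using AE_has_real_derivative_indefinite_integral[OF hI, of a]
  proof eventually_elim
    case (elim x)
    show ?case
    proof
      assume x: "a < x \<and> x < b"
      then have "((\<lambda>u. g a + (LINT t:{a..u}|lborel. h t)) has_real_derivative 0 + h x) (at x)"
        using elim by (intro DERIV_add DERIV_const) auto
      then have "((\<lambda>u. g a + (LINT t:{a..u}|lborel. h t)) has_real_derivative h x) (at x)" by simp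
      then show "(g has_real_derivative h x) (at x)"
        by (rule has_field_derivative_transform_within_open[of _ _ _ "{a<..<b}"]) (use x in \<open>auto intro!: gh[symmetric]\<close>)
    qed
  qed
  then show ?thesis by (intro that[OF hI] ballI gh)
qed

section \<open>The Hilbert space of square-integrable functions on the line\<close>

definition sq_int :: "(real \<Rightarrow> real) \<Rightarrow> bool" where
  "sq_int f \<longleftrightarrow> f \<in> borel_measurable lebesgue \<and> integrable lebesgue (\<lambda>x. (f x)\<^sup>2)"

lemma sq_intD [measurable_dest]: "sq_int f \<Longrightarrow> f \<in> borel_measurable lebesgue"
  and sq_int_square: "sq_int f \<Longrightarrow> integrable lebesgue (\<lambda>x. (f x)\<^sup>2)"
  by (auto simp: sq_int_def)

lemma sq_int_bound:
  assumes "integrable lebesgue g" "f \<in> borel_measurable lebesgue" "AE x in lebesgue. (f x)\<^sup>2 \<le> g x"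
  shows "sq_int f"
  unfolding sq_int_def
proof
  show "integrable lebesgue (\<lambda>x. (f x)\<^sup>2)"
    by (rule Bochner_Integration.integrable_bound[OF assms(1)]) (use assms(2,3) in \<open>auto elim!: eventually_mono\<close>)
qed fact

lemma sq_int_mult: "sq_int f \<Longrightarrow> sq_int g \<Longrightarrow> integrable lebesgue (\<lambda>x. f x * g x)"
proof -
  assume f: "sq_int f" and g: "sq_int g"
  have "integrable lebesgue (\<lambda>x. (f x)\<^sup>2 + (g x)\<^sup>2)"
    using sq_int_square[OF f] sq_int_square[OF g] by (rule Bochner_Integration.integrable_add)
  then show ?thesis
  proof (rule Bochner_Integration.integrable_bound)
    have "\<bar>f x * g x\<bar> \<le> (f x)\<^sup>2 + (g x)\<^sup>2" for x
    proof -
      have "2 * (\<bar>f x\<bar> * \<bar>g x\<bar>) \<le> \<bar>f x\<bar>\<^sup>2 + \<bar>g x\<bar>\<^sup>2"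
        using sum_squares_bound[of "\<bar>f x\<bar>" "\<bar>g x\<bar>"] by (simp add: ac_simps)
      moreover have "0 \<le> \<bar>f x\<bar> * \<bar>g x\<bar>" by simp
      ultimately show ?thesis unfolding abs_mult power2_abs by linarith
    qed
    then show "AE x in lebesgue. norm (f x * g x) \<le> norm ((f x)\<^sup>2 + (g x)\<^sup>2)"
      by (intro AE_I2) (simp add: abs_mult)
  qed (use f g in measurable)
qed

lemma sq_int_zero [simp]: "sq_int (\<lambda>_. 0)"
  by (simp add: sq_int_def)

lemma sq_int_mult_bounded:
  assumes "sq_int f" "m \<in> borel_measurable lebesgue" "\<And>x. \<bar>m x\<bar> \<le> B"
  shows "sq_int (\<lambda>x. m x * f x)"
proof (rule sq_int_bound)
  show "integrable lebesgue (\<lambda>x. B\<^sup>2 * (f x)\<^sup>2)" using sq_int_square[OF assms(1)] by simp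
  have "(m x)\<^sup>2 \<le> B\<^sup>2" for x using assms(3)[of x] by (simp add: abs_le_square_iff[symmetric] abs_le_iff)
  then show "AE x in lebesgue. (m x * f x)\<^sup>2 \<le> B\<^sup>2 * (f x)\<^sup>2"
    by (intro AE_I2) (simp add: power_mult_distrib mult_right_mono)
qed (use assms in measurable)

lemma sq_int_scale: "sq_int f \<Longrightarrow> sq_int (\<lambda>x. c * f x)"
  by (rule sq_int_mult_bounded[where B="\<bar>c\<bar>"]) auto

lemma sq_int_add: "sq_int f \<Longrightarrow> sq_int g \<Longrightarrow> sq_int (\<lambda>x. f x + g x)"
proof (rule sq_int_bound)
  assume f: "sq_int f" and g: "sq_int g"
  show "integrable lebesgue (\<lambda>x. (f x)\<^sup>2 + (g x)\<^sup>2 + 2 * (f x * g x))"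
    using sq_int_square[OF f] sq_int_square[OF g] sq_int_mult[OF f g]
    by (intro Bochner_Integration.integrable_add integrable_mult_right) auto
  show "(\<lambda>x. f x + g x) \<in> borel_measurable lebesgue" using f g by measurable
qed (auto simp: power2_sum algebra_simps)

lemma sq_int_uminus: "sq_int f \<Longrightarrow> sq_int (\<lambda>x. - f x)"
  using sq_int_scale[of f "-1"] by simp

lemma sq_int_diff: "sq_int f \<Longrightarrow> sq_int g \<Longrightarrow> sq_int (\<lambda>x. f x - g x)"
  using sq_int_add[OF _ sq_int_uminus, of f g] by simp

text \<open>A Lebesgue null set lies in a Borel null set, whose translates are null.\<close>

lemma AE_lebesgue_shift:
  assumes "AE x in lebesgue. P x"
  shows "AE x in lebesgue. P (x + k :: real)"
proof -
  have "AE x in lborel. P x" using assms by (simp add: AE_completion_iff)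
  then obtain N where N: "N \<in> null_sets lborel" "{x. \<not> P x} \<subseteq> N"
    by (auto simp: eventually_ae_filter)
  then have "AE x in lborel. P (x + k)"
    using null_sets_translation[OF N(1), of "-k"] by (intro AE_I'[of "{x. x - - k \<in> N}"]) auto
  then show ?thesis by (simp add: AE_completion_iff)
qed

lemma sq_int_shift: "sq_int f \<Longrightarrow> sq_int (\<lambda>x. f (x + k))"
  using borel_measurable_affine[of f 1 k] lebesgue_integrable_real_affine[of "\<lambda>x. (f x)\<^sup>2" 1 k]
  unfolding sq_int_def by (simp add: add.commute)

lemma lebesgue_integral_shift: "(LINT x|lebesgue. f (x + k)) = (LINT x|lebesgue. f x :: real)" for k :: real
  using lebesgue_integral_real_affine[of 1 f k] by (simp add: add.commute)

lemma borel_measurable_lebesgue_ident [measurable]: "(\<lambda>x::real. x) \<in> borel_measurable lebesgue"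
  using id_borel_measurable_lebesgue by (simp add: id_def)

section \<open>Square-integrable functions modulo null sets\<close>

definition l2_rel :: "(real \<Rightarrow> real) \<Rightarrow> (real \<Rightarrow> real) \<Rightarrow> bool" where
  "l2_rel f g \<longleftrightarrow> sq_int f \<and> sq_int g \<and> (AE x in lebesgue. f x = g x)"

\<comment> \<open>The quotient is partial because functions that are not square integrable belong to
  no class. Having a type makes \<open>real_inner\<close>, vector derivatives and continuity
  available for curves in L2.\<close>
quotient_type l2 = "real \<Rightarrow> real" / partial: l2_rel
  morphisms rep_l2 mk_l2
proof (rule part_equivpI)
  show "\<exists>f. l2_rel f f" by (rule exI[of _ "\<lambda>_. 0"]) (simp add: l2_rel_def)
  show "symp l2_rel" by (auto simp: symp_def l2_rel_def)
  show "transp l2_rel" unfolding transp_def l2_rel_def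
  proof (intro allI impI conjI)
    fix f g h assume "sq_int f \<and> sq_int g \<and> (AE x in lebesgue. f x = g x)" "sq_int g \<and> sq_int h \<and> (AE x in lebesgue. g x = h x)"
    then have "AE x in lebesgue. f x = g x" "AE x in lebesgue. g x = h x" by auto
    then show "AE x in lebesgue. f x = h x" by eventually_elim simp
  qed auto
qed

lemma l2_rel_refl [simp]: "l2_rel f f \<longleftrightarrow> sq_int f"
  by (simp add: l2_rel_def)

instantiation l2 :: real_vector
begin

lift_definition zero_l2 :: l2 is "\<lambda>_. 0" by simp

lift_definition plus_l2 :: "l2 \<Rightarrow> l2 \<Rightarrow> l2" is "\<lambda>f g x. f x + g x"
  unfolding l2_rel_def by (auto intro: sq_int_add elim: eventually_elim2)

lift_definition minus_l2 :: "l2 \<Rightarrow> l2 \<Rightarrow> l2" is "\<lambda>f g x. f x - g x"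
  unfolding l2_rel_def by (auto intro: sq_int_diff elim: eventually_elim2)

lift_definition uminus_l2 :: "l2 \<Rightarrow> l2" is "\<lambda>f x. - f x"
  unfolding l2_rel_def by (auto intro: sq_int_uminus elim: eventually_mono)

lift_definition scaleR_l2 :: "real \<Rightarrow> l2 \<Rightarrow> l2" is "\<lambda>c f x. c * f x"
  unfolding l2_rel_def by (auto intro: sq_int_scale elim: eventually_mono)

instance
proof
  fix x y z :: l2 and a b :: real
  show "x + y + z = x + (y + z)" by transfer (auto simp: l2_rel_def add.assoc intro!: sq_int_add)
  show "x + y = y + x" by transfer (auto simp: l2_rel_def add.commute intro!: sq_int_add)
  show "0 + x = x" by transfer (auto simp: l2_rel_def)
  show "- x + x = 0" by transfer (auto simp: l2_rel_def)
  show "x - y = x + - y" by transfer (auto simp: l2_rel_def intro!: sq_int_add sq_int_uminus sq_int_diff)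
  show "a *\<^sub>R (x + y) = a *\<^sub>R x + a *\<^sub>R y"
    by transfer (auto simp: l2_rel_def algebra_simps intro!: sq_int_add sq_int_scale)
  show "(a + b) *\<^sub>R x = a *\<^sub>R x + b *\<^sub>R x"
    by transfer (auto simp: l2_rel_def algebra_simps intro!: sq_int_add sq_int_scale)
  show "a *\<^sub>R b *\<^sub>R x = (a * b) *\<^sub>R x"
    by transfer (auto simp: l2_rel_def algebra_simps intro!: sq_int_scale)
  show "1 *\<^sub>R x = x" by transfer (auto simp: l2_rel_def)
qed

end

instantiation l2 :: real_inner
begin

lift_definition inner_l2 :: "l2 \<Rightarrow> l2 \<Rightarrow> real" is "\<lambda>f g. LINT x|lebesgue. f x * g x"
  unfolding l2_rel_def by (auto intro!: integral_cong_AE elim: eventually_elim2 dest: sq_intD)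

definition norm_l2 :: "l2 \<Rightarrow> real" where "norm_l2 x = sqrt (inner x x)"
definition dist_l2 :: "l2 \<Rightarrow> l2 \<Rightarrow> real" where "dist_l2 x y = norm (x - y)"
definition sgn_l2 :: "l2 \<Rightarrow> l2" where "sgn_l2 x = x /\<^sub>R norm x"
definition uniformity_l2 :: "(l2 \<times> l2) filter" where
  "uniformity_l2 = (INF e\<in>{0<..}. principal {(x, y). dist x y < e})"
definition open_l2 :: "l2 set \<Rightarrow> bool" where
  "open_l2 U = (\<forall>x\<in>U. eventually (\<lambda>(x', y). x' = x \<longrightarrow> y \<in> U) uniformity)"

instance
proof
  fix x y z :: l2 and a b :: real
  show "dist x y = norm (x - y)" by (rule dist_l2_def)
  show "sgn x = x /\<^sub>R norm x" by (rule sgn_l2_def)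
  show "(uniformity :: (l2 \<times> l2) filter) = (INF e\<in>{0<..}. principal {(x, y). dist x y < e})"
    by (rule uniformity_l2_def)
  show "open U = (\<forall>x\<in>U. eventually (\<lambda>(x', y). x' = x \<longrightarrow> y \<in> U) uniformity)" for U :: "l2 set"
    by (rule open_l2_def)
  show "inner x y = inner y x" by transfer (simp add: mult.commute)
  show "inner (x + y) z = inner x z + inner y z"
    by transfer (simp add: distrib_right sq_int_mult)
  show "inner (a *\<^sub>R x) y = a * inner x y"
    by transfer (simp add: mult.assoc)
  show "0 \<le> inner x x" by transfer simp
  show "(inner x x = 0) = (x = 0)"
  proof transfer
    fix f assume "l2_rel f f"
    then have f: "sq_int f" by simp
    have "(LINT x|lebesgue. f x * f x) = 0 \<longleftrightarrow> (AE x in lebesgue. f x * f x = 0)"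
      using sq_int_mult[OF f f] by (intro integral_nonneg_eq_0_iff_AE) auto
    then show "((LINT x|lebesgue. f x * f x) = 0) = l2_rel f (\<lambda>_. 0)"
      using f by (simp add: l2_rel_def)
  qed
  show "norm x = sqrt (inner x x)" by (rule norm_l2_def)
qed

end

lemma mk_l2_eq_iff: "sq_int f \<Longrightarrow> sq_int g \<Longrightarrow> mk_l2 f = mk_l2 g \<longleftrightarrow> (AE x in lebesgue. f x = g x)"
  using Quotient_rel[OF Quotient_l2, of f g] by (simp add: l2_rel_def)

lemma mk_l2_cases: obtains f where "sq_int f" "X = mk_l2 f"
  using Quotient_rep_reflp[OF Quotient_l2, of X] Quotient_abs_rep[OF Quotient_l2, of X]
  by (intro that[of "rep_l2 X"]) auto

lemma mk_l2_add: "sq_int f \<Longrightarrow> sq_int g \<Longrightarrow> mk_l2 f + mk_l2 g = mk_l2 (\<lambda>x. f x + g x)"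
  by (simp add: plus_l2.abs_eq)

lemma mk_l2_diff: "sq_int f \<Longrightarrow> sq_int g \<Longrightarrow> mk_l2 f - mk_l2 g = mk_l2 (\<lambda>x. f x - g x)"
  by (simp add: minus_l2.abs_eq)

lemma mk_l2_scaleR: "sq_int f \<Longrightarrow> c *\<^sub>R mk_l2 f = mk_l2 (\<lambda>x. c * f x)"
  by (simp add: scaleR_l2.abs_eq)

lemma inner_mk_l2: "sq_int f \<Longrightarrow> sq_int g \<Longrightarrow> inner (mk_l2 f) (mk_l2 g) = (LINT x|lebesgue. f x * g x)"
  by (simp add: inner_l2.abs_eq)

lemma norm_mk_l2: "sq_int f \<Longrightarrow> (norm (mk_l2 f))\<^sup>2 = (LINT x|lebesgue. (f x)\<^sup>2)"
  by (simp add: power2_norm_eq_inner inner_mk_l2, simp add: power2_eq_square)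

section \<open>Multiplication and translation operators\<close>

text \<open>The guard makes the operator total: a multiplier that is not measurable or not bounded
  acts as zero, so that the lift respects classes for every m.\<close>

lift_definition mult_l2 :: "(real \<Rightarrow> real) \<Rightarrow> l2 \<Rightarrow> l2" is
  "\<lambda>m f x. (if m \<in> borel_measurable lebesgue \<and> bounded (range m) then m x else 0) * f x"
proof -
  fix m f g assume fg: "l2_rel f g"
  show "l2_rel (\<lambda>x. (if m \<in> borel_measurable lebesgue \<and> bounded (range m) then m x else 0) * f x)
     (\<lambda>x. (if m \<in> borel_measurable lebesgue \<and> bounded (range m) then m x else 0) * g x)"
  proof (cases "m \<in> borel_measurable lebesgue \<and> bounded (range m)")
    case True
    then obtain B where "\<And>x. \<bar>m x\<bar> \<le> B" unfolding bounded_iff by auto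
    with True fg show ?thesis
      by (auto simp: l2_rel_def intro!: sq_int_mult_bounded[of _ m B] elim: eventually_mono)
  qed auto
qed

lemma mult_l2_mk:
  assumes "sq_int f" "m \<in> borel_measurable lebesgue" "\<And>x. \<bar>m x\<bar> \<le> B"
  shows "mult_l2 m (mk_l2 f) = mk_l2 (\<lambda>x. m x * f x)"
proof -
  have "bounded (range m)" using assms(3) by (auto simp: bounded_iff)
  then show ?thesis using assms by (simp add: mult_l2.abs_eq)
qed

lemma norm_mult_l2_le:
  assumes "m \<in> borel_measurable lebesgue" "\<And>x. \<bar>m x\<bar> \<le> B"
  shows "norm (mult_l2 m X) \<le> B * norm X"
proof -
  obtain f where f: "sq_int f" "X = mk_l2 f" by (rule mk_l2_cases)
  have B: "0 \<le> B" using assms(2)[of 0] by linarith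
  have "(norm (mult_l2 m X))\<^sup>2 = (LINT x|lebesgue. (m x * f x)\<^sup>2)"
    using f(1) sq_int_mult_bounded[OF f(1) assms] unfolding f(2) mult_l2_mk[OF f(1) assms]
    by (simp add: norm_mk_l2)
  also have "\<dots> \<le> (LINT x|lebesgue. B\<^sup>2 * (f x)\<^sup>2)"
  proof (rule integral_mono)
    show "integrable lebesgue (\<lambda>x. (m x * f x)\<^sup>2)"
      using sq_int_square[OF sq_int_mult_bounded[OF f(1) assms]] .
    show "integrable lebesgue (\<lambda>x. B\<^sup>2 * (f x)\<^sup>2)" using sq_int_square[OF f(1)] by simp
    fix x
    have "(m x)\<^sup>2 \<le> B\<^sup>2" using assms(2)[of x] by (simp add: abs_le_square_iff[symmetric] abs_le_iff)
    then show "(m x * f x)\<^sup>2 \<le> B\<^sup>2 * (f x)\<^sup>2" by (simp add: power_mult_distrib mult_right_mono)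
  qed
  also have "\<dots> = (B * norm X)\<^sup>2" using f by (simp add: norm_mk_l2 power_mult_distrib)
  finally show ?thesis by (rule power2_le_imp_le) (use B in simp)
qed

lemma bounded_linear_mult_l2:
  assumes "m \<in> borel_measurable lebesgue" "\<And>x. \<bar>m x\<bar> \<le> B"
  shows "bounded_linear (mult_l2 m)"
proof (rule bounded_linear_intro[where K=B])
  fix X Y :: l2 and r :: real
  obtain f where f: "sq_int f" "X = mk_l2 f" by (rule mk_l2_cases)
  obtain g where g: "sq_int g" "Y = mk_l2 g" by (rule mk_l2_cases)
  note mk = mult_l2_mk[OF _ assms] sq_int_mult_bounded[OF _ assms]
  show "mult_l2 m (X + Y) = mult_l2 m X + mult_l2 m Y"
    using f g by (simp add: mk mk_l2_add sq_int_add distrib_left)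
  show "mult_l2 m (r *\<^sub>R X) = r *\<^sub>R mult_l2 m X"
    using f by (simp add: mk mk_l2_scaleR sq_int_scale mult.left_commute)
  show "norm (mult_l2 m X) \<le> norm X * B"
    using norm_mult_l2_le[OF assms] by (simp add: mult.commute)
qed

lift_definition shift_l2 :: "real \<Rightarrow> l2 \<Rightarrow> l2" is "\<lambda>k f x. f (x + k)"
  unfolding l2_rel_def
proof (elim conjE, intro conjI)
  fix k :: real and f g :: "real \<Rightarrow> real" assume "AE x in lebesgue. f x = g x"
  then show "AE x in lebesgue. f (x + k) = g (x + k)" by (rule AE_lebesgue_shift)
qed (auto intro: sq_int_shift)

lemma shift_l2_mk: "sq_int f \<Longrightarrow> shift_l2 k (mk_l2 f) = mk_l2 (\<lambda>x. f (x + k))"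
  by (simp add: shift_l2.abs_eq)

lemma inner_shift_l2: "inner (shift_l2 k X) (shift_l2 k Y) = inner X Y"
  by transfer (rule lebesgue_integral_shift)

lemma norm_shift_l2 [simp]: "norm (shift_l2 k X) = norm X"
  by (simp add: norm_eq_sqrt_inner inner_shift_l2)

lemma bounded_linear_shift_l2: "bounded_linear (shift_l2 k)"
proof (rule bounded_linear_intro[where K=1])
  fix X Y :: l2 and r :: real
  show "shift_l2 k (X + Y) = shift_l2 k X + shift_l2 k Y"
    by transfer (auto simp: l2_rel_def intro!: sq_int_add sq_int_shift)
  show "shift_l2 k (r *\<^sub>R X) = r *\<^sub>R shift_l2 k X"
    by transfer (auto simp: l2_rel_def intro!: sq_int_scale sq_int_shift)
qed simp

text \<open>The squares of the differences are dominated by 4 G^2, so scalar dominated convergence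
  applies to the squared distance. Square integrability of \<open>f n\<close> and g follows from the
  domination.\<close>

lemma l2_dominated_convergence:
  assumes G: "sq_int G" and fm: "\<And>n. f n \<in> borel_measurable lebesgue" "g \<in> borel_measurable lebesgue"
    and le: "\<And>n. AE x in lebesgue. \<bar>f n x\<bar> \<le> G x"
    and lim: "AE x in lebesgue. (\<lambda>n. f n x) \<longlonglongrightarrow> g x"
  shows "(\<lambda>n. mk_l2 (f n)) \<longlonglongrightarrow> mk_l2 g"
proof -
  have le': "AE x in lebesgue. \<forall>n. \<bar>f n x\<bar> \<le> G x" using le by (simp add: AE_all_countable)
  have gle: "AE x in lebesgue. \<bar>g x\<bar> \<le> G x"
    using le' lim
  proof eventually_elim
    case (elim x)
    then have "(\<lambda>n. \<bar>f n x\<bar>) \<longlonglongrightarrow> \<bar>g x\<bar>" by (intro tendsto_rabs)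
    then show ?case by (rule LIMSEQ_le_const2) (use elim in auto)
  qed
  have sqle: "y\<^sup>2 \<le> z\<^sup>2" if "\<bar>y\<bar> \<le> z" for y z :: real
    using that by (metis abs_ge_zero power2_abs power_mono)
  have fs: "sq_int (f n)" for n
    using sq_int_square[OF G] fm(1)[of n] by (rule sq_int_bound) (use le[of n] sqle in \<open>auto elim!: eventually_mono\<close>)
  have gs: "sq_int g"
    using sq_int_square[OF G] fm(2) by (rule sq_int_bound) (use gle sqle in \<open>auto elim!: eventually_mono\<close>)
  have "(\<lambda>n. LINT x|lebesgue. (f n x - g x)\<^sup>2) \<longlonglongrightarrow> integral\<^sup>L lebesgue (\<lambda>x::real. 0)"
  proof (rule integral_dominated_convergence[where w="\<lambda>x. 4 * (G x)\<^sup>2"])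
    show "integrable lebesgue (\<lambda>x. 4 * (G x)\<^sup>2)" using sq_int_square[OF G] by simp
    show "AE x in lebesgue. (\<lambda>n. (f n x - g x)\<^sup>2) \<longlonglongrightarrow> 0"
      using lim
    proof eventually_elim
      case (elim x)
      have "(\<lambda>n. (f n x - g x)\<^sup>2) \<longlonglongrightarrow> (g x - g x)\<^sup>2" by (intro tendsto_intros elim)
      then show ?case by simp
    qed
    show "AE x in lebesgue. norm ((f n x - g x)\<^sup>2) \<le> 4 * (G x)\<^sup>2" for n
      using le[of n] gle
    proof eventually_elim
      case (elim x)
      then have "\<bar>f n x - g x\<bar> \<le> 2 * G x" by linarith
      from sqle[OF this] show ?case by (simp add: power_mult_distrib)
    qed
  qed (use fs gs in measurable)
  then have "(\<lambda>n. (norm (mk_l2 (f n) - mk_l2 g))\<^sup>2) \<longlonglongrightarrow> 0"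
    using fs gs by (simp add: mk_l2_diff norm_mk_l2 sq_int_diff)
  then have "(\<lambda>n. sqrt ((norm (mk_l2 (f n) - mk_l2 g))\<^sup>2)) \<longlonglongrightarrow> sqrt 0" by (rule tendsto_real_sqrt)
  then have "(\<lambda>n. norm (mk_l2 (f n) - mk_l2 g)) \<longlonglongrightarrow> 0" by simp
  then show ?thesis by (simp add: tendsto_norm_zero_iff LIM_zero_iff)
qed

lemma sq_int_indicator_const: "sq_int (\<lambda>x. c * indicator {a..b} x)"
proof -
  have "integrable lebesgue (\<lambda>x. c\<^sup>2 * indicator {a..b} x :: real)"
    using lmeasurable_cbox[of a b] by (intro integrable_mult_right) (simp add: lmeasurable_iff_integrable cbox_interval)
  then show ?thesis
    by (rule sq_int_bound) (auto simp: indicator_def)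
qed

text \<open>Two approximations: values and support are truncated first, then the truncated function
  is an a.e. limit of continuous functions. Both converge in L2 by dominated convergence.\<close>

lemma l2_dense_continuous:
  assumes e: "e > 0"
  obtains h R where "continuous_on UNIV h" "\<And>x. x \<notin> {-R..R} \<Longrightarrow> h x = 0" "sq_int h" "norm (X - mk_l2 h) < e"
proof -
  obtain f where f: "sq_int f" "X = mk_l2 f" by (rule mk_l2_cases)
  have [measurable]: "f \<in> borel_measurable lebesgue" using f(1) by (rule sq_intD)
  define cl where "cl n y = max (- real n) (min (real n) y)" for n y
  have cl: "\<bar>cl n y\<bar> \<le> real n" "\<bar>cl n y\<bar> \<le> \<bar>y\<bar>" for n y by (auto simp: cl_def)
  define f1 where "f1 n x = cl n (f x) * indicator {- real n..real n} x" for n x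
  have f1m [measurable]: "f1 n \<in> borel_measurable lebesgue" for n unfolding f1_def cl_def by measurable
  have "(\<lambda>n. mk_l2 (f1 n)) \<longlonglongrightarrow> mk_l2 f"
  proof (rule l2_dominated_convergence[where G="\<lambda>x. \<bar>f x\<bar>"])
    show "sq_int (\<lambda>x. \<bar>f x\<bar>)" using f(1) unfolding sq_int_def by auto
    show "AE x in lebesgue. \<bar>f1 n x\<bar> \<le> \<bar>f x\<bar>" for n
      using cl(2) by (intro AE_I2) (auto simp: f1_def indicator_def)
    have "(\<lambda>n. f1 n x) \<longlonglongrightarrow> f x" for x
    proof (rule tendsto_eventually)
      obtain N :: nat where N: "\<bar>x\<bar> + \<bar>f x\<bar> < real N" using reals_Archimedean2 by blast
      show "\<forall>\<^sub>F n in sequentially. f1 n x = f x"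
        using eventually_ge_at_top[of N]
      proof eventually_elim
        case (elim n)
        then have "real N \<le> real n" by simp
        then show ?case using N by (auto simp: f1_def cl_def indicator_def)
      qed
    qed
    then show "AE x in lebesgue. (\<lambda>n. f1 n x) \<longlonglongrightarrow> f x" by simp
  qed measurable
  then obtain n where n: "norm (mk_l2 (f1 n) - mk_l2 f) < e/2"
    using e unfolding LIMSEQ_iff by (metis half_gt_zero order_refl)
  define M where "M = real n"
  have "f1 n measurable_on UNIV"
    by (intro lebesgue_measurable_imp_measurable_on f1m) auto
  then obtain N g where N: "negligible N" and g: "\<And>m. continuous_on UNIV (g m)"
    "\<And>x. x \<notin> N \<Longrightarrow> (\<lambda>m. g m x) \<longlonglongrightarrow> f1 n x"
    unfolding measurable_on_def by auto
  define ct where "ct x = max 0 (min 1 (M + 1 - \<bar>x\<bar>))" for x :: real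
  \<comment> \<open>Clamping and the tent \<open>ct\<close> put the continuous approximants under
    one dominating function without moving their limit, since \<open>f1 n\<close> is already bounded
    by n and supported where \<open>ct\<close> is 1.\<close>
  define h where "h m x = cl n (g m x) * ct x" for m x
  have hc: "continuous_on UNIV (h m)" for m
    unfolding h_def cl_def ct_def using g(1)[of m] by (intro continuous_intros)
  have [measurable]: "h m \<in> borel_measurable lebesgue" for m
    using borel_measurable_continuous_onI[OF hc[of m]] by (simp add: measurable_completion)
  have ct: "0 \<le> ct x" "ct x \<le> 1" "x \<notin> {-(M+1)..M+1} \<Longrightarrow> ct x = 0" "x \<in> {-M..M} \<Longrightarrow> ct x = 1" for x
    by (auto simp: ct_def)
  have hle: "\<bar>h m x\<bar> \<le> M * indicator {-(M+1)..M+1} x" for m x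
  proof -
    have "\<bar>h m x\<bar> \<le> M * ct x" using cl(1)[of n "g m x"] ct(1)[of x] by (simp add: h_def M_def abs_mult mult_right_mono)
    also have "\<dots> \<le> M * indicator {-(M+1)..M+1} x"
      using ct(2,3)[of x] by (intro mult_left_mono) (auto simp: indicator_def M_def)
    finally show ?thesis .
  qed
  have hs: "sq_int (h m)" for m
  proof (rule sq_int_bound[OF sq_int_square[OF sq_int_indicator_const]])
    show "AE x in lebesgue. (h m x)\<^sup>2 \<le> (M * indicator {-(M+1)..M+1} x)\<^sup>2"
      using hle by (intro AE_I2) (metis abs_ge_zero power2_abs power_mono)
  qed measurable
  have "(\<lambda>m. mk_l2 (h m)) \<longlonglongrightarrow> mk_l2 (f1 n)"
  proof (rule l2_dominated_convergence[OF sq_int_indicator_const])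
    show "AE x in lebesgue. \<bar>h m x\<bar> \<le> M * indicator {-(M+1)..M+1} x" for m using hle by simp
    have "AE x in lebesgue. x \<notin> N" using N negligible_iff_null_sets AE_not_in by blast
    then show "AE x in lebesgue. (\<lambda>m. h m x) \<longlonglongrightarrow> f1 n x"
    proof eventually_elim
      case (elim x)
      have "(\<lambda>m. h m x) \<longlonglongrightarrow> cl n (f1 n x) * ct x"
        unfolding h_def cl_def by (intro tendsto_intros g(2) elim)
      moreover have "cl n (f1 n x) * ct x = f1 n x"
        using ct(4)[of x] by (cases "x \<in> {-M..M}") (auto simp: f1_def cl_def M_def)
      ultimately show ?case by simp
    qed
  qed measurable
  then obtain m where m: "norm (mk_l2 (h m) - mk_l2 (f1 n)) < e/2"
    using e unfolding LIMSEQ_iff by (metis half_gt_zero order_refl)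
  show ?thesis
  proof (rule that[of "h m" "M+1"])
    show "norm (X - mk_l2 (h m)) < e"
      using norm_triangle_ineq[of "mk_l2 (h m) - mk_l2 (f1 n)" "mk_l2 (f1 n) - X"] m n f(2)
      by (simp add: norm_minus_commute)
    show "x \<notin> {- (M + 1)..M + 1} \<Longrightarrow> h m x = 0" for x using ct(3)[of x] by (simp add: h_def)
  qed (use hc hs in auto)
qed

text \<open>Strong continuity of the translation group. For continuous functions of compact support
  it is uniform continuity; density extends it to all of L2 because all translations are
  isometries.\<close>

lemma shift_l2_tendsto: "((\<lambda>k. shift_l2 k X) \<longlongrightarrow> X) (at 0)"
proof (rule tendstoI)
  fix e :: real assume e: "e > 0"
  then have e3: "e/3 > 0" by simp
  obtain h R where h: "continuous_on UNIV h" "\<And>x. x \<notin> {-R..R} \<Longrightarrow> h x = 0" "sq_int h" "norm (X - mk_l2 h) < e/3"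
    using l2_dense_continuous[OF e3, of X] by blast
  define Y where "Y = mk_l2 h"
  \<comment> \<open>The margin 1 keeps the support of every translate of h by |k| < 1 inside
    [-S,S].\<close>
  define S where "S = \<bar>R\<bar> + 1"
  \<comment> \<open>Chosen so that \<delta> (2 S + 1) = e/3. The squared norm of a function bounded
    by \<delta> on an interval of length 2 S is at most the square of this.\<close>
  define \<delta> where "\<delta> = e / (3 * (2 * S + 1))"
  have S: "S \<ge> 1" by (simp add: S_def)
  have \<delta>: "\<delta> > 0" using e S by (simp add: \<delta>_def)
  have "uniformly_continuous_on {-(S+1)..S+1} h"
    by (intro compact_uniformly_continuous continuous_on_subset[OF h(1)]) auto
  then obtain d where d: "d > 0" "\<And>x y. x \<in> {-(S+1)..S+1} \<Longrightarrow> y \<in> {-(S+1)..S+1} \<Longrightarrow> dist y x < d \<Longrightarrow> dist (h y) (h x) < \<delta>"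
    unfolding uniformly_continuous_on_def using \<delta> by blast
  have "dist (shift_l2 k X) X < e" if k: "\<bar>k\<bar> < min d 1" for k
  proof -
    have le: "\<bar>h (x + k) - h x\<bar> \<le> \<delta> * indicator {-S..S} x" for x
    proof (cases "x \<in> {-S..S}")
      case True
      then have "dist (h (x+k)) (h x) < \<delta>" using k by (intro d(2)) (auto simp: dist_real_def)
      then show ?thesis using True by (simp add: dist_real_def)
    next
      case False
      then have "h (x + k) = 0" "h x = 0" using k by (auto intro!: h(2) simp: S_def)
      then show ?thesis using \<delta> by simp
    qed
    have "(norm (shift_l2 k Y - Y))\<^sup>2 = (LINT x|lebesgue. (h (x + k) - h x)\<^sup>2)"
      unfolding Y_def using h(3) by (simp add: shift_l2_mk mk_l2_diff sq_int_shift norm_mk_l2 sq_int_diff)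
    also have "\<dots> \<le> (LINT x|lebesgue. (\<delta> * indicator {-S..S} x)\<^sup>2)"
    proof (rule integral_mono)
      show "(h (x + k) - h x)\<^sup>2 \<le> (\<delta> * indicator {-S..S} x)\<^sup>2" for x
        using le[of x] by (metis abs_ge_zero power2_abs power_mono)
    qed (use h(3) sq_int_square sq_int_diff sq_int_shift sq_int_indicator_const in auto)
    also have "\<dots> = \<delta>\<^sup>2 * (2 * S)"
    proof -
      have "(\<lambda>x. (\<delta> * indicator {-S..S} x)\<^sup>2) = (\<lambda>x::real. \<delta>\<^sup>2 * indicator {-S..S} x)"
        by (auto simp: indicator_def fun_eq_iff)
      then show ?thesis using S by simp
    qed
    also have "\<dots> \<le> \<delta>\<^sup>2 * (2 * S + 1)\<^sup>2"
      using S by (intro mult_left_mono) (auto simp: power2_eq_square algebra_simps)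
    also have "\<dots> = (\<delta> * (2 * S + 1))\<^sup>2" by (simp add: power_mult_distrib)
    also have "\<delta> * (2 * S + 1) = e/3"
    proof -
      have "2 * S + 1 \<noteq> 0" using S by linarith
      then show ?thesis unfolding \<delta>_def by (metis divide_divide_eq_left nonzero_eq_divide_eq)
    qed
    finally have "norm (shift_l2 k Y - Y) \<le> e/3" by (rule power2_le_imp_le) (use e in simp)
    moreover have "norm (shift_l2 k X - shift_l2 k Y) < e/3"
      using h(4) by (simp add: Y_def flip: linear_diff[OF bounded_linear.linear[OF bounded_linear_shift_l2]])
    moreover have "norm (Y - X) < e/3" using h(4) by (simp add: Y_def norm_minus_commute)
    moreover have "norm (shift_l2 k X - X) = norm ((shift_l2 k X - shift_l2 k Y) + (shift_l2 k Y - Y) + (Y - X))" by simp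
    ultimately show ?thesis
      unfolding dist_norm using norm_triangle_ineq[of "shift_l2 k X - shift_l2 k Y + (shift_l2 k Y - Y)" "Y - X"]
        norm_triangle_ineq[of "shift_l2 k X - shift_l2 k Y" "shift_l2 k Y - Y"] by linarith
  qed
  then show "\<forall>\<^sub>F k in at 0. dist (shift_l2 k X) X < e"
    unfolding eventually_at using d(1) by (intro exI[of _ "min d 1"]) (auto simp: dist_real_def)
qed

section \<open>Abstract second-order evolutions\<close>

text \<open>Both sides telescope along equal steps shorter than d, so the bound on short intervals
  passes to [0,T] without loss.\<close>

lemma telescope_bound:
  fixes R m :: "real \<Rightarrow> real"
  assumes T: "0 \<le> T" and d: "d > 0"
    and loc: "\<And>s t. 0 \<le> s \<Longrightarrow> s \<le> t \<Longrightarrow> t \<le> T \<Longrightarrow> t - s < d \<Longrightarrow> \<bar>R t - R s\<bar> \<le> m t - m s"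
  shows "\<bar>R T - R 0\<bar> \<le> m T - m 0"
proof -
  obtain N :: nat where N: "T / d < real N" using reals_Archimedean2 by blast
  then have N0: "N > 0" using T d by (cases N) (auto simp: field_simps)
  define h where "h = T / N"
  have h: "0 \<le> h" "h < d" "real N * h = T" using N N0 T d by (auto simp: h_def field_simps)
  have "\<bar>R (k * h) - R 0\<bar> \<le> m (k * h) - m 0" if "k \<le> N" for k :: nat
    using that
  proof (induction k)
    case (Suc k)
    have "real (Suc k) * h \<le> real N * h" using Suc.prems h by (intro mult_right_mono) auto
    then have "\<bar>R (Suc k * h) - R (k * h)\<bar> \<le> m (Suc k * h) - m (k * h)"
      using h by (intro loc) (auto simp: algebra_simps)
    then show ?case using Suc by linarith
  qed simp
  from this[of N] show ?thesis using h by simp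
qed

lemma norm_diff_le_vector_derivative_bound:
  fixes U :: "real \<Rightarrow> 'h::real_normed_vector"
  assumes "\<And>t. t \<in> {a..b} \<Longrightarrow> (U has_vector_derivative V t) (at t within {a..b})"
    and "\<And>t. t \<in> {a..b} \<Longrightarrow> norm (V t) \<le> S" and "s \<in> {a..b}" "t \<in> {a..b}"
  shows "norm (U t - U s) \<le> S * \<bar>t - s\<bar>"
proof -
  have "norm (U t - U s) \<le> S * norm (t - s)"
  proof (rule differentiable_bound[of "{a..b}" U "\<lambda>t h. h *\<^sub>R V t"])
    show "onorm (\<lambda>h. h *\<^sub>R V x) \<le> S" if "x \<in> {a..b}" for x
      using assms(2)[OF that] by (intro onorm_le) (simp add: mult.commute[of S] mult_left_mono)
  qed (use assms in \<open>auto simp: has_vector_derivative_def\<close>)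
  then show ?thesis by simp
qed

lemma abs_integral_le_const:
  fixes f :: "real \<Rightarrow> real"
  assumes "a \<le> b" "continuous_on {a..b} f" "\<And>x. x \<in> {a..b} \<Longrightarrow> \<bar>f x\<bar> \<le> c"
  shows "\<bar>integral {a..b} f\<bar> \<le> c * (b - a)"
proof -
  have "norm (integral {a..b} f) \<le> integral {a..b} (\<lambda>x. c)"
    using assms by (intro Henstock_Kurzweil_Integration.integral_norm_bound_integral integrable_continuous_real) auto
  then show ?thesis using assms(1) by (simp add: mult.commute)
qed

lemma integral_shift_interval:
  fixes f :: "real \<Rightarrow> real"
  assumes "continuous_on {a + c..b + c} f"
  shows "integral {a + c..b + c} f = integral {a..b} (\<lambda>x. f (x + c))"
proof -
  have "(f has_integral integral {a + c..b + c} f) (cbox (a + c) (b + c))"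
    using integrable_integral[OF integrable_continuous_real[OF assms]] by (simp add: cbox_interval)
  from has_integral_affinity'[OF this, of 1 c]
  have "((\<lambda>x. f (x + c)) has_integral integral {a + c..b + c} f) {a..b}" by (simp add: cbox_interval)
  then show ?thesis by (simp add: integral_unique)
qed

lemma integral_reflect_interval:
  fixes f :: "real \<Rightarrow> real"
  assumes "continuous_on {0..h} f"
  shows "integral {0..h} (\<lambda>r. f (h - r)) = integral {0..h} f"
proof -
  have "(f has_integral integral {0..h} f) (cbox 0 h)"
    using integrable_integral[OF integrable_continuous_real[OF assms]] by (simp add: cbox_interval)
  from has_integral_affinity[OF this, of "-1" h]
  have "((\<lambda>r. f (h - r)) has_integral integral {0..h} f) ((\<lambda>x. h - x) ` {0..h})" by (simp add: cbox_interval)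
  moreover have "(\<lambda>x. h - x) ` {0..h} = {0..h}"
    by (auto intro!: image_eqI[of _ _ "h - _"])
  ultimately show ?thesis by (simp add: integral_unique)
qed

lemma continuous_on_compact_norm_bound:
  fixes f :: "real \<Rightarrow> 'h::real_normed_vector"
  assumes "continuous_on {a..b} f"
  obtains S where "S \<ge> 0" "\<And>t. t \<in> {a..b} \<Longrightarrow> norm (f t) \<le> S"
proof -
  have "bounded (f ` {a..b})" using assms by (intro compact_imp_bounded compact_continuous_image) auto
  then obtain S where S: "\<forall>x\<in>f ` {a..b}. norm x \<le> S" unfolding bounded_iff by blast
  show ?thesis by (rule that[of "max S 0"]) (use S in \<open>auto simp: le_max_iff_disj\<close>)
qed

text \<open>n is a primitive of the norm of the force.\<close>
locale evolution =
  fixes T :: real and U V W :: "real \<Rightarrow> 'h::real_inner" and n :: "real \<Rightarrow> real"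
    and adm :: "'h \<Rightarrow> 'h \<Rightarrow> bool"
  assumes T_pos: "0 < T"
    and U_deriv: "\<And>t. t \<in> {0..T} \<Longrightarrow> (U has_vector_derivative V t) (at t within {0..T})"
    and V_cont: "continuous_on {0..T} V" and W_cont: "continuous_on {0..T} W"
    and n_cont: "continuous_on {0..T} n"
    and n_mono: "\<And>s t. 0 \<le> s \<Longrightarrow> s \<le> t \<Longrightarrow> t \<le> T \<Longrightarrow> n s \<le> n t"
    and weak: "\<And>w w' s t. adm w w' \<Longrightarrow> 0 \<le> s \<Longrightarrow> s \<le> t \<Longrightarrow> t \<le> T \<Longrightarrow>
      \<bar>inner (V t - V s) w + integral {s..t} (\<lambda>\<tau>. inner (W \<tau>) w')\<bar> \<le> norm w * (n t - n s)"
begin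

text \<open>The locale tests only with fixed pairs \<open>adm w w'\<close>, a vector and its
  weighted derivative. On a short step [s,t] the moving test is frozen at time s; the freezing
  errors are a small multiple of t - s and add up to at most \<eta> over [0,T].\<close>

lemma multiplier_identity:
  assumes wt: "\<And>t. t \<in> {0..T} \<Longrightarrow> (w has_vector_derivative wt t) (at t within {0..T})"
    and wtc: "continuous_on {0..T} wt" and w'c: "continuous_on {0..T} w'"
    and adm: "\<And>t. t \<in> {0..T} \<Longrightarrow> adm (w t) (w' t)" and B: "\<And>t. t \<in> {0..T} \<Longrightarrow> norm (w t) \<le> B"
  shows "\<bar>inner (V T) (w T) - inner (V 0) (w 0) - integral {0..T} (\<lambda>t. inner (V t) (wt t) - inner (W t) (w' t))\<bar>
    \<le> B * (n T - n 0)"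
proof -
  let ?f = "\<lambda>t. inner (V t) (wt t) - inner (W t) (w' t)"
  have fc: "continuous_on {0..T} ?f"
    by (intro continuous_intros V_cont W_cont wtc w'c)
  define R where "R t = inner (V t) (w t) - integral {0..t} ?f" for t
  obtain S where S: "S \<ge> 0" "\<And>t. t \<in> {0..T} \<Longrightarrow> norm (wt t) \<le> S"
    by (rule continuous_on_compact_norm_bound[OF wtc]) (rule that, auto)
  obtain S2 where S2: "S2 \<ge> 0" "\<And>t. t \<in> {0..T} \<Longrightarrow> norm (W t) \<le> S2"
    by (rule continuous_on_compact_norm_bound[OF W_cont]) (rule that, auto)
  have "\<bar>R T - R 0\<bar> \<le> B * (n T - n 0) + \<eta>" if \<eta>: "\<eta> > 0" for \<eta>
  proof -
    \<comment> \<open>Makes the total freezing error \<delta> (S + S2) T at most \<eta>; the extra 1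
      keeps the denominator positive.\<close>
    define \<delta> where "\<delta> = \<eta> / (T * (S + S2 + 1))"
    have \<delta>: "\<delta> > 0" using \<eta> T_pos S S2 by (auto simp: \<delta>_def intro!: divide_pos_pos mult_pos_pos)
    have "uniformly_continuous_on {0..T} V" by (intro compact_uniformly_continuous V_cont) simp
    then obtain d1 where d1: "d1 > 0" "\<And>x y. x \<in> {0..T} \<Longrightarrow> y \<in> {0..T} \<Longrightarrow> dist y x < d1 \<Longrightarrow> dist (V y) (V x) < \<delta>"
      unfolding uniformly_continuous_on_def using \<delta> by blast
    have "uniformly_continuous_on {0..T} w'" by (intro compact_uniformly_continuous w'c) simp
    then obtain d2 where d2: "d2 > 0" "\<And>x y. x \<in> {0..T} \<Longrightarrow> y \<in> {0..T} \<Longrightarrow> dist y x < d2 \<Longrightarrow> dist (w' y) (w' x) < \<delta>"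
      unfolding uniformly_continuous_on_def using \<delta> by blast
    note d = d1(1) d2(1) d1(2) d2(2)
    \<comment> \<open>The control function for telescoping: its increment over a step is the force
      term plus the freezing error.\<close>
    define m where "m t = B * n t + \<delta> * (S + S2) * t" for t
    have "\<bar>R T - R 0\<bar> \<le> m T - m 0"
    proof (rule telescope_bound)
      show "0 \<le> T" "min d1 d2 > 0" using T_pos d by auto
      fix s t assume st: "0 \<le> s" "s \<le> t" "t \<le> T" "t - s < min d1 d2"
      have sub: "{s..t} \<subseteq> {0..T}" using st by auto
      note cs = continuous_on_subset[OF _ sub]
      have Vc: "continuous_on {s..t} V" and Wc: "continuous_on {s..t} W" and wtc': "continuous_on {s..t} wt"
        and w'c': "continuous_on {s..t} w'" and fc': "continuous_on {s..t} ?f"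
        using cs V_cont W_cont wtc w'c fc by blast+
      have "((\<lambda>\<tau>. inner (V t) (wt \<tau>)) has_integral inner (V t) (w t) - inner (V t) (w s)) {s..t}"
      proof (rule fundamental_theorem_of_calculus)
        fix \<tau> assume \<tau>: "\<tau> \<in> {s..t}"
        have "(w has_vector_derivative wt \<tau>) (at \<tau> within {s..t})"
          using wt[of \<tau>] \<tau> sub by (auto intro: has_vector_derivative_within_subset)
        then show "((\<lambda>\<tau>. inner (V t) (w \<tau>)) has_vector_derivative inner (V t) (wt \<tau>)) (at \<tau> within {s..t})"
          by (rule bounded_linear.has_vector_derivative[OF bounded_linear_inner_right])
      qed (use st in auto)
      then have I1: "integral {s..t} (\<lambda>\<tau>. inner (V t) (wt \<tau>)) = inner (V t) (w t) - inner (V t) (w s)"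
        by (rule integral_unique)
      have I2: "integral {0..s} ?f + integral {s..t} ?f = integral {0..t} ?f"
        using st by (intro Henstock_Kurzweil_Integration.integral_combine integrable_continuous_real continuous_on_subset[OF fc]) auto
      have I3: "integral {s..t} ?f = integral {s..t} (\<lambda>\<tau>. inner (V \<tau>) (wt \<tau>)) - integral {s..t} (\<lambda>\<tau>. inner (W \<tau>) (w' \<tau>))"
        by (intro Henstock_Kurzweil_Integration.integral_diff integrable_continuous_real continuous_intros Vc Wc wtc' w'c')
      have I4: "integral {s..t} (\<lambda>\<tau>. inner (V t - V \<tau>) (wt \<tau>)) = integral {s..t} (\<lambda>\<tau>. inner (V t) (wt \<tau>)) - integral {s..t} (\<lambda>\<tau>. inner (V \<tau>) (wt \<tau>))"
        unfolding inner_diff_left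
        by (intro Henstock_Kurzweil_Integration.integral_diff integrable_continuous_real continuous_intros Vc Wc wtc' w'c')
      have I5: "integral {s..t} (\<lambda>\<tau>. inner (W \<tau>) (w' \<tau> - w' s)) = integral {s..t} (\<lambda>\<tau>. inner (W \<tau>) (w' \<tau>)) - integral {s..t} (\<lambda>\<tau>. inner (W \<tau>) (w' s))"
        unfolding inner_diff_right
        by (intro Henstock_Kurzweil_Integration.integral_diff integrable_continuous_real continuous_intros Vc Wc wtc' w'c')
      have eq: "R t - R s = (inner (V t - V s) (w s) + integral {s..t} (\<lambda>\<tau>. inner (W \<tau>) (w' s)))
          + integral {s..t} (\<lambda>\<tau>. inner (W \<tau>) (w' \<tau> - w' s)) + integral {s..t} (\<lambda>\<tau>. inner (V t - V \<tau>) (wt \<tau>))"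
        unfolding R_def I4 I5 I1 using I2 I3 by (simp add: inner_diff_left)
      have b1: "\<bar>inner (V t - V s) (w s) + integral {s..t} (\<lambda>\<tau>. inner (W \<tau>) (w' s))\<bar> \<le> B * (n t - n s)"
      proof -
        have "\<bar>inner (V t - V s) (w s) + integral {s..t} (\<lambda>\<tau>. inner (W \<tau>) (w' s))\<bar> \<le> norm (w s) * (n t - n s)"
          using st by (intro weak adm) auto
        also have "\<dots> \<le> B * (n t - n s)" using n_mono[of s t] B[of s] st by (intro mult_right_mono) auto
        finally show ?thesis .
      qed
      have b2: "\<bar>integral {s..t} (\<lambda>\<tau>. inner (W \<tau>) (w' \<tau> - w' s))\<bar> \<le> (S2 * \<delta>) * (t - s)"
      proof (rule abs_integral_le_const)
        show "continuous_on {s..t} (\<lambda>\<tau>. inner (W \<tau>) (w' \<tau> - w' s))" by (intro continuous_intros Wc w'c')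
        fix \<tau> assume \<tau>: "\<tau> \<in> {s..t}"
        have "norm (w' \<tau> - w' s) \<le> \<delta>" using d(4)[of s \<tau>] \<tau> st by (auto simp: dist_norm)
        then have "norm (W \<tau>) * norm (w' \<tau> - w' s) \<le> S2 * \<delta>" using S2(2)[of \<tau>] S2(1) \<tau> st by (intro mult_mono) auto
        then show "\<bar>inner (W \<tau>) (w' \<tau> - w' s)\<bar> \<le> S2 * \<delta>" using Cauchy_Schwarz_ineq2 order_trans by blast
      qed (use st in auto)
      have b3: "\<bar>integral {s..t} (\<lambda>\<tau>. inner (V t - V \<tau>) (wt \<tau>))\<bar> \<le> (\<delta> * S) * (t - s)"
      proof (rule abs_integral_le_const)
        show "continuous_on {s..t} (\<lambda>\<tau>. inner (V t - V \<tau>) (wt \<tau>))" by (intro continuous_intros Vc wtc')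
        fix \<tau> assume \<tau>: "\<tau> \<in> {s..t}"
        have "norm (V t - V \<tau>) \<le> \<delta>" using d(3)[of \<tau> t] \<tau> st by (auto simp: dist_norm)
        then have "norm (V t - V \<tau>) * norm (wt \<tau>) \<le> \<delta> * S" using S(2)[of \<tau>] S(1) \<tau> st \<delta> by (intro mult_mono) auto
        then show "\<bar>inner (V t - V \<tau>) (wt \<tau>)\<bar> \<le> \<delta> * S" using Cauchy_Schwarz_ineq2 order_trans by blast
      qed (use st in auto)
      show "\<bar>R t - R s\<bar> \<le> m t - m s"
        unfolding eq m_def using b1 b2 b3 by (simp add: algebra_simps)
    qed
    also have "m T - m 0 = B * (n T - n 0) + \<delta> * (S + S2) * T" by (simp add: m_def algebra_simps)
    also have "\<delta> * (S + S2) * T \<le> \<delta> * (T * (S + S2 + 1))"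
      using \<delta> T_pos by (simp add: algebra_simps)
    also have "\<dots> = \<eta>" using T_pos S S2 by (simp add: \<delta>_def)
    finally show ?thesis by simp
  qed
  then have "\<bar>R T - R 0\<bar> \<le> B * (n T - n 0)" by (rule field_le_epsilon)
  then show ?thesis by (simp add: R_def algebra_simps)
qed

section \<open>Energy inequality by time increments\<close>

text \<open>The weak form on [t,t+h] is tested with U(t+h) - U(t) and integrated over t in [0,s].
  The velocity term is the exact derivative of half the squared norm of the increment, and the
  elastic term reduces to end windows of the correlations <W(t), W(t+r)>. On the right, one factor h
  is the size of the test and the other comes from telescoping the integral of n(t+h) -
  n(t).\<close>

lemma energy_increment:
  assumes adm: "\<And>s t. s \<in> {0..T} \<Longrightarrow> t \<in> {0..T} \<Longrightarrow> adm (U t - U s) (W t - W s)"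
    and S: "S \<ge> 0" "\<And>t. t \<in> {0..T} \<Longrightarrow> norm (V t) \<le> S"
    and s: "0 \<le> s" and h: "0 < h" "s + h \<le> T"
  shows "(norm (U (s + h) - U s))\<^sup>2 / 2 - (norm (U h - U 0))\<^sup>2 / 2
    + integral {0..h} (\<lambda>r. integral {s..s + (h - r)} (\<lambda>t. inner (W t) (W (t + r)))
         - integral {0..h - r} (\<lambda>t. inner (W t) (W (t + r)))) \<le> h\<^sup>2 * S * (n T - n 0)"
    and "(\<lambda>r. integral {s..s + (h - r)} (\<lambda>t. inner (W t) (W (t + r)))
         - integral {0..h - r} (\<lambda>t. inner (W t) (W (t + r)))) integrable_on {0..h}"
proof -
  \<comment> \<open>Time is clamped so that the correlations are continuous on the whole line and
    their windows can be moved freely.\<close>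
  define W' where "W' t = W (max 0 (min T t))" for t
  have W'c: "continuous_on A W'" for A
    unfolding W'_def
    by (rule continuous_on_compose2[OF W_cont]) (use T_pos in \<open>auto intro!: continuous_intros\<close>)
  have W': "W' t = W t" if "0 \<le> t" "t \<le> T" for t using that by (simp add: W'_def)
  note W'comp = continuous_on_compose2[OF W'c[of UNIV]]
  have Uc: "continuous_on {0..T} U"
    unfolding continuous_on_eq_continuous_within by (intro ballI has_vector_derivative_continuous[OF U_deriv])
  have UhD: "((\<lambda>t. U (t + h)) has_vector_derivative V (t + h)) (at t within {0..s})" if t: "t \<in> {0..s}" for t
  proof -
    have "(U has_vector_derivative V (t + h)) (at (t + h) within (\<lambda>t. t + h) ` {0..s})"
      using t s h by (intro has_vector_derivative_within_subset[OF U_deriv]) auto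
    moreover have "((\<lambda>t. t + h) has_vector_derivative 1) (at t within {0..s})"
      by (auto intro!: derivative_eq_intros)
    ultimately show ?thesis
      using vector_diff_chain_within[of "\<lambda>t. t + h" 1 t "{0..s}" U "V (t+h)"] by (simp add: o_def)
  qed
  have UD: "(U has_vector_derivative V t) (at t within {0..s})" if t: "t \<in> {0..s}" for t
    using t s h by (intro has_vector_derivative_within_subset[OF U_deriv]) auto
  have P: "((\<lambda>t. inner (V (t + h) - V t) (U (t + h) - U t)) has_integral
      ((norm (U (s + h) - U s))\<^sup>2 / 2 - (norm (U h - U 0))\<^sup>2 / 2)) {0..s}"
  proof -
    have "((\<lambda>t. inner (V (t + h) - V t) (U (t + h) - U t)) has_integral
      (inner (U (s + h) - U s) (U (s + h) - U s) / 2 - inner (U (0 + h) - U 0) (U (0 + h) - U 0) / 2)) {0..s}"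
    proof (rule fundamental_theorem_of_calculus[OF s])
      fix t assume t: "t \<in> {0..s}"
      have D: "((\<lambda>t. U (t + h) - U t) has_vector_derivative V (t + h) - V t) (at t within {0..s})"
        by (intro has_vector_derivative_diff UhD UD t)
      have "((\<lambda>t. inner (U (t + h) - U t) (U (t + h) - U t)) has_vector_derivative
         inner (U (t + h) - U t) (V (t + h) - V t) + inner (V (t + h) - V t) (U (t + h) - U t)) (at t within {0..s})"
        by (rule bounded_bilinear.has_vector_derivative[OF bounded_bilinear_inner D D])
      then have "((\<lambda>t. (1/2) *\<^sub>R inner (U (t + h) - U t) (U (t + h) - U t)) has_vector_derivative
         (1/2) *\<^sub>R (inner (U (t + h) - U t) (V (t + h) - V t) + inner (V (t + h) - V t) (U (t + h) - U t))) (at t within {0..s})"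
        by (rule bounded_linear.has_vector_derivative[OF bounded_linear_scaleR_right])
      then show "((\<lambda>t. inner (U (t + h) - U t) (U (t + h) - U t) / 2) has_vector_derivative
         inner (V (t + h) - V t) (U (t + h) - U t)) (at t within {0..s})"
        by (simp add: inner_commute)
    qed
    then show ?thesis by (simp add: power2_norm_eq_inner)
  qed
  define c where "c r t = inner (W' t) (W' (t + r))" for r t
  have cc: "continuous_on A (c r)" for A r
    unfolding c_def by (intro continuous_intros W'comp) auto
  have ci: "c r integrable_on {a..b}" for r a b by (intro integrable_continuous_real cc)
  define J where "J = integral {0..s} (\<lambda>t. integral {0..h} (\<lambda>r. inner (W' (t + r)) (W' (t + h) - W' t)))"
  have "J = integral {0..h} (\<lambda>r. integral {s..s + (h - r)} (c r) - integral {0..h - r} (c r)) \<and>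
      (\<lambda>r. integral {s..s + (h - r)} (c r) - integral {0..h - r} (c r)) integrable_on {0..h}"
  proof -
    \<comment> \<open>\<open>A r\<close> is a correlation with lag h - r. Reflecting r to h - r
      gives it the same lag as \<open>C r\<close>, over a window moved by h - r.\<close>
    define A where "A r = integral {0..s} (\<lambda>t. inner (W' (t + r)) (W' (t + h)))" for r
    define C where "C r = integral {0..s} (c r)" for r
    have Ac: "continuous_on {0..h} A"
    proof -
      have "continuous_on {0..h} (\<lambda>r. integral (cbox 0 s) (\<lambda>t. inner (W' (t + r)) (W' (t + h))))"
        by (rule integral_continuous_on_param)
          (auto simp: case_prod_unfold intro!: continuous_intros W'comp)
      then show ?thesis by (simp add: A_def cbox_interval)
    qed
    have Cc: "continuous_on {0..h} C"
    proof -
      have "continuous_on {0..h} (\<lambda>r. integral (cbox 0 s) (c r))"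
        unfolding c_def
        by (rule integral_continuous_on_param)
          (auto simp: case_prod_unfold intro!: continuous_intros W'comp)
      then show ?thesis by (simp add: C_def cbox_interval)
    qed
    have "J = integral {0..h} (\<lambda>r. integral {0..s} (\<lambda>t. inner (W' (t + r)) (W' (t + h) - W' t)))"
      unfolding J_def
      using integral_swap_continuous[of 0 0 s h "\<lambda>t r. inner (W' (t + r)) (W' (t + h) - W' t)"]
      by (simp add: cbox_interval case_prod_unfold continuous_intros W'comp)
    also have "\<dots> = integral {0..h} (\<lambda>r. A r - C r)"
      unfolding A_def C_def c_def inner_diff_right
      by (intro Henstock_Kurzweil_Integration.integral_cong)
        (subst Henstock_Kurzweil_Integration.integral_diff[symmetric];
          auto intro!: integrable_continuous_real continuous_intros W'comp simp: inner_commute)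
    also have "\<dots> = integral {0..h} A - integral {0..h} C"
      by (intro Henstock_Kurzweil_Integration.integral_diff integrable_continuous_real Ac Cc)
    also have "integral {0..h} A = integral {0..h} (\<lambda>r. A (h - r))"
      by (rule integral_reflect_interval[OF Ac, symmetric])
    also have "\<dots> - integral {0..h} C = integral {0..h} (\<lambda>r. A (h - r) - C r)"
      using Ac Cc by (intro Henstock_Kurzweil_Integration.integral_diff[symmetric] integrable_continuous_real continuous_on_compose2[OF Ac])
        (auto intro!: continuous_intros)
    finally have J1: "J = integral {0..h} (\<lambda>r. A (h - r) - C r)" .
    have ACi: "(\<lambda>r. A (h - r) - C r) integrable_on {0..h}"
      by (intro integrable_continuous_real continuous_intros Cc continuous_on_compose2[OF Ac]) auto
    \<comment> \<open>Two windows of length s offset by h - r: what remains is the piece entering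
      after s minus the piece leaving after 0.\<close>
    have ACeq: "A (h - r) - C r = integral {s..s + (h - r)} (c r) - integral {0..h - r} (c r)" if r: "r \<in> {0..h}" for r
    proof -
      have "A (h - r) = integral {0..s} (\<lambda>t. c r (t + (h - r)))"
        unfolding A_def c_def by (simp add: algebra_simps)
      also have "\<dots> = integral {h - r..s + (h - r)} (c r)"
        using integral_shift_interval[of 0 "h - r" s "c r"] cc by simp
      finally have A: "A (h - r) = integral {h - r..s + (h - r)} (c r)" .
      have "integral {0..h - r} (c r) + integral {h - r..s + (h - r)} (c r) = integral {0..s + (h - r)} (c r)"
        using r s by (intro Henstock_Kurzweil_Integration.integral_combine ci) auto
      moreover have "integral {0..s} (c r) + integral {s..s + (h - r)} (c r) = integral {0..s + (h - r)} (c r)"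
        using r s by (intro Henstock_Kurzweil_Integration.integral_combine ci) auto
      ultimately show ?thesis
        unfolding A C_def by linarith
    qed
    show ?thesis
      using J1 ACi ACeq integrable_eq[OF ACi, of "\<lambda>r. integral {s..s + (h - r)} (c r) - integral {0..h - r} (c r)"]
        Henstock_Kurzweil_Integration.integral_cong[of "{0..h}" "\<lambda>r. A (h - r) - C r" "\<lambda>r. integral {s..s + (h - r)} (c r) - integral {0..h - r} (c r)"]
      by simp
  qed
  then have Jeq: "J = integral {0..h} (\<lambda>r. integral {s..s + (h - r)} (c r) - integral {0..h - r} (c r))"
    and Jint: "(\<lambda>r. integral {s..s + (h - r)} (c r) - integral {0..h - r} (c r)) integrable_on {0..h}" by auto
  have Wpart: "integral {t..t + h} (\<lambda>\<tau>. inner (W \<tau>) (W (t + h) - W t)) = integral {0..h} (\<lambda>r. inner (W' (t + r)) (W' (t + h) - W' t))"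
    if t: "t \<in> {0..s}" for t
  proof -
    have "integral {t..t + h} (\<lambda>\<tau>. inner (W \<tau>) (W (t + h) - W t)) = integral {0 + t..h + t} (\<lambda>\<tau>. inner (W' \<tau>) (W' (t + h) - W' t))"
      using t s h by (simp add: add.commute) (intro Henstock_Kurzweil_Integration.integral_cong, auto simp: W')
    also have "\<dots> = integral {0..h} (\<lambda>r. inner (W' (r + t)) (W' (t + h) - W' t))"
      by (rule integral_shift_interval) (intro continuous_intros W'c)
    finally show ?thesis by (simp add: add.commute)
  qed
  have Jc: "continuous_on {0..s} (\<lambda>t. integral {0..h} (\<lambda>r. inner (W' (t + r)) (W' (t + h) - W' t)))"
  proof -
    have "continuous_on {0..s} (\<lambda>t. integral (cbox 0 h) (\<lambda>r. inner (W' (t + r)) (W' (t + h) - W' t)))"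
      by (rule integral_continuous_on_param)
        (auto simp: case_prod_unfold intro!: continuous_intros W'comp)
    then show ?thesis by (simp add: cbox_interval)
  qed
  have nh: "continuous_on {0..s} (\<lambda>t. n (t + h))" and nc: "continuous_on {0..s} n"
    using s h by (auto intro!: continuous_on_compose2[OF n_cont] continuous_intros continuous_on_subset[OF n_cont])
  have "integral {0..s} (\<lambda>t. inner (V (t + h) - V t) (U (t + h) - U t) + integral {0..h} (\<lambda>r. inner (W' (t + r)) (W' (t + h) - W' t)))
     \<le> integral {0..s} (\<lambda>t. h * S * (n (t + h) - n t))"
  proof (rule integral_le)
    show "(\<lambda>t. inner (V (t + h) - V t) (U (t + h) - U t) + integral {0..h} (\<lambda>r. inner (W' (t + r)) (W' (t + h) - W' t))) integrable_on {0..s}"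
      by (rule integrable_add[OF has_integral_integrable[OF P] integrable_continuous_real[OF Jc]])
    show "(\<lambda>t. h * S * (n (t + h) - n t)) integrable_on {0..s}"
      by (intro integrable_continuous_real continuous_intros nh nc)
    fix t assume t: "t \<in> {0..s}"
    have "\<bar>inner (V (t + h) - V t) (U (t + h) - U t) + integral {t..t + h} (\<lambda>\<tau>. inner (W \<tau>) (W (t + h) - W t))\<bar>
       \<le> norm (U (t + h) - U t) * (n (t + h) - n t)"
      using t s h by (intro weak adm) auto
    also have "\<dots> \<le> (S * h) * (n (t + h) - n t)"
      using norm_diff_le_vector_derivative_bound[OF U_deriv S(2), of t "t + h"] n_mono[of t "t + h"] t s h
      by (intro mult_right_mono) auto
    finally show "inner (V (t + h) - V t) (U (t + h) - U t) + integral {0..h} (\<lambda>r. inner (W' (t + r)) (W' (t + h) - W' t))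
       \<le> h * S * (n (t + h) - n t)"
      unfolding Wpart[OF t] by (simp add: mult.commute)
  qed
  also have "\<dots> = h * S * integral {0..s} (\<lambda>t. n (t + h) - n t)" by simp
  also have "integral {0..s} (\<lambda>t. n (t + h) - n t) = integral {0..s} (\<lambda>t. n (t + h)) - integral {0..s} n"
    by (intro Henstock_Kurzweil_Integration.integral_diff integrable_continuous_real nh nc)
  also have "integral {0..s} (\<lambda>t. n (t + h)) = integral {h..s + h} n"
    using integral_shift_interval[of 0 h s n] s h by (simp add: continuous_on_subset[OF n_cont])
  also have "integral {h..s + h} n - integral {0..s} n = integral {s..s + h} n - integral {0..h} n"
  proof -
    have "integral {0..h} n + integral {h..s + h} n = integral {0..s + h} n"
      "integral {0..s} n + integral {s..s + h} n = integral {0..s + h} n"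
      using s h by (auto intro!: Henstock_Kurzweil_Integration.integral_combine integrable_continuous_real continuous_on_subset[OF n_cont])
    then show ?thesis by linarith
  qed
  also have "\<dots> \<le> h * (n T - n 0)"
  proof -
    have "integral {s..s + h} n \<le> integral {s..s + h} (\<lambda>_. n T)"
      using s h n_mono by (intro integral_le integrable_continuous_real continuous_on_subset[OF n_cont]) auto
    moreover have "integral {0..h} (\<lambda>_. n 0) \<le> integral {0..h} n"
      using s h n_mono by (intro integral_le integrable_continuous_real continuous_on_subset[OF n_cont]) auto
    ultimately show ?thesis using h by (simp add: algebra_simps)
  qed
  also have "integral {0..s} (\<lambda>t. inner (V (t + h) - V t) (U (t + h) - U t) + integral {0..h} (\<lambda>r. inner (W' (t + r)) (W' (t + h) - W' t)))
     = ((norm (U (s + h) - U s))\<^sup>2 / 2 - (norm (U h - U 0))\<^sup>2 / 2) + J"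
    unfolding J_def
    by (rule integral_unique[OF has_integral_add[OF P integrable_integral[OF integrable_continuous_real[OF Jc]]]])
  finally have fin: "((norm (U (s + h) - U s))\<^sup>2 / 2 - (norm (U h - U 0))\<^sup>2 / 2) + J \<le> h * S * (h * (n T - n 0))"
    using h S by (auto simp: mult_left_mono)
  have cW: "integral {s..s + (h - r)} (c r) - integral {0..h - r} (c r)
    = integral {s..s + (h - r)} (\<lambda>t. inner (W t) (W (t + r))) - integral {0..h - r} (\<lambda>t. inner (W t) (W (t + r)))"
    if r: "r \<in> {0..h}" for r
  proof -
    have "integral {a..a + (h - r)} (c r) = integral {a..a + (h - r)} (\<lambda>t. inner (W t) (W (t + r)))"
      if "0 \<le> a" "a \<le> s" for a
      unfolding c_def using r that h by (intro Henstock_Kurzweil_Integration.integral_cong) (auto simp: W')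
    from this[of s] this[of 0] s show ?thesis by simp
  qed
  have "J = integral {0..h} (\<lambda>r. integral {s..s + (h - r)} (\<lambda>t. inner (W t) (W (t + r)))
         - integral {0..h - r} (\<lambda>t. inner (W t) (W (t + r))))"
    unfolding Jeq by (rule Henstock_Kurzweil_Integration.integral_cong[OF cW])
  with fin show "(norm (U (s + h) - U s))\<^sup>2 / 2 - (norm (U h - U 0))\<^sup>2 / 2
    + integral {0..h} (\<lambda>r. integral {s..s + (h - r)} (\<lambda>t. inner (W t) (W (t + r)))
         - integral {0..h - r} (\<lambda>t. inner (W t) (W (t + r)))) \<le> h\<^sup>2 * S * (n T - n 0)"
    by (simp add: power2_eq_square algebra_simps)
  show "(\<lambda>r. integral {s..s + (h - r)} (\<lambda>t. inner (W t) (W (t + r)))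
         - integral {0..h - r} (\<lambda>t. inner (W t) (W (t + r)))) integrable_on {0..h}"
    by (rule integrable_eq[OF Jint cW])
qed

end

text \<open>Difference quotients are the form in which \<open>weak_sol\<close> prescribes the time
  derivative.\<close>

lemma has_vector_derivative_iff_quotient:
  fixes f :: "real \<Rightarrow> 'h::real_normed_vector"
  shows "(f has_vector_derivative D) (at x within S) \<longleftrightarrow> ((\<lambda>y. (f y - f x) /\<^sub>R (y - x)) \<longlongrightarrow> D) (at x within S)"
proof -
  have "(f has_vector_derivative D) (at x within S) \<longleftrightarrow>
      ((\<lambda>y. (1 / norm (y - x)) *\<^sub>R (f y - (f x + (y - x) *\<^sub>R D))) \<longlongrightarrow> 0) (at x within S)"
    unfolding has_vector_derivative_def has_derivative_within
    by (simp add: bounded_linear_scaleR_left)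
  also have "\<dots> \<longleftrightarrow> ((\<lambda>y. norm ((1 / norm (y - x)) *\<^sub>R (f y - (f x + (y - x) *\<^sub>R D)))) \<longlongrightarrow> 0) (at x within S)"
    by (simp only: tendsto_norm_zero_iff)
  also have "\<dots> \<longleftrightarrow> ((\<lambda>y. norm ((f y - f x) /\<^sub>R (y - x) - D)) \<longlongrightarrow> 0) (at x within S)"
  proof (rule tendsto_cong)
    have "norm ((1 / norm (y - x)) *\<^sub>R (f y - (f x + (y - x) *\<^sub>R D))) = norm ((f y - f x) /\<^sub>R (y - x) - D)"
      if "y \<noteq> x" for y
    proof -
      have "(f y - f x) /\<^sub>R (y - x) - D = (1 / (y - x)) *\<^sub>R (f y - (f x + (y - x) *\<^sub>R D))"
        using that by (simp add: divide_inverse scaleR_diff_right scaleR_add_right)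
      then show ?thesis by simp
    qed
    then show "\<forall>\<^sub>F y in at x within S. norm ((1 / norm (y - x)) *\<^sub>R (f y - (f x + (y - x) *\<^sub>R D))) = norm ((f y - f x) /\<^sub>R (y - x) - D)"
      by (auto simp: eventually_at_filter)
  qed
  also have "\<dots> \<longleftrightarrow> ((\<lambda>y. (f y - f x) /\<^sub>R (y - x)) \<longlongrightarrow> D) (at x within S)"
    by (simp only: tendsto_norm_zero_iff) (rule LIM_zero_iff)
  finally show ?thesis .
qed

lemma has_vector_derivative_right_quotient:
  fixes f :: "real \<Rightarrow> 'h::real_normed_vector"
  assumes "(f has_vector_derivative D) (at x within {a..b})" "a \<le> x" "x < b"
  shows "((\<lambda>h. (f (x + h) - f x) /\<^sub>R h) \<longlongrightarrow> D) (at_right 0)"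
proof -
  have "((\<lambda>y. (f y - f x) /\<^sub>R (y - x)) \<longlongrightarrow> D) (at x within {a..b})"
    using assms(1) by (simp add: has_vector_derivative_iff_quotient)
  moreover have "filterlim (\<lambda>h. x + h) (at x within {a..b}) (at_right 0)"
    unfolding filterlim_at
  proof
    show "\<forall>\<^sub>F h in at_right 0. x + h \<in> {a..b} \<and> x + h \<noteq> x"
      using eventually_at_right[of 0 "b - x"] assms(2,3)
      by (auto simp: eventually_at_right_field intro!: exI[of _ "b - x"])
    have "((\<lambda>h. x + h) \<longlongrightarrow> x + 0) (at_right 0)" by (intro tendsto_intros)
    then show "((\<lambda>h. x + h) \<longlongrightarrow> x) (at_right 0)" by simp
  qed
  ultimately have "((\<lambda>h. (f (x + h) - f x) /\<^sub>R (x + h - x)) \<longlongrightarrow> D) (at_right 0)"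
    by (rule filterlim_compose)
  then show ?thesis by simp
qed

context evolution
begin

text \<open>\<open>energy_increment\<close> is divided by h^2 and h tends to 0 from the right. The
  displacement quotients tend to the velocities. By uniform continuity of W the correlation term is
  close to K h^2 / 2, because the windows have length h - r and these lengths integrate to h^2 / 2
  over r.\<close>

lemma energy_estimate_open:
  assumes adm: "\<And>s t. s \<in> {0..T} \<Longrightarrow> t \<in> {0..T} \<Longrightarrow> adm (U t - U s) (W t - W s)"
    and S: "S \<ge> 0" "\<And>t. t \<in> {0..T} \<Longrightarrow> norm (V t) \<le> S"
    and s: "0 \<le> s" "s < T"
  shows "(norm (V s))\<^sup>2 / 2 + (norm (W s))\<^sup>2 / 2 \<le> (norm (V 0))\<^sup>2 / 2 + (norm (W 0))\<^sup>2 / 2 + S * (n T - n 0)"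
proof -
  define K where "K = (norm (W s))\<^sup>2 - (norm (W 0))\<^sup>2"
  \<comment> \<open>Each of the two windows may be off by \<eta> per unit length, hence 2
    \<eta>.\<close>
  have "(norm (V s))\<^sup>2 / 2 - (norm (V 0))\<^sup>2 / 2 + (K - 2 * \<eta>) / 2 \<le> S * (n T - n 0)" if \<eta>: "\<eta> > 0" for \<eta>
  proof -
    obtain S2 where S2: "S2 \<ge> 0" "\<And>t. t \<in> {0..T} \<Longrightarrow> norm (W t) \<le> S2"
      by (rule continuous_on_compact_norm_bound[OF W_cont]) (rule that, auto)
    define \<delta> where "\<delta> = \<eta> / (2 * S2 + 1)"
    have \<delta>: "\<delta> > 0" using \<eta> S2 by (simp add: \<delta>_def)
    have "uniformly_continuous_on {0..T} W" by (intro compact_uniformly_continuous W_cont) simp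
    then obtain d where d: "d > 0" "\<And>x y. x \<in> {0..T} \<Longrightarrow> y \<in> {0..T} \<Longrightarrow> dist y x < d \<Longrightarrow> dist (W y) (W x) < \<delta>"
      unfolding uniformly_continuous_on_def using \<delta> by blast
    have near: "\<bar>inner (W t) (W t') - (norm (W a))\<^sup>2\<bar> \<le> \<eta>"
      if "a \<in> {0..T}" "t \<in> {0..T}" "t' \<in> {0..T}" "\<bar>t - a\<bar> < d" "\<bar>t' - a\<bar> < d" for a t t'
    proof -
      have 1: "norm (W t - W a) \<le> \<delta>" "norm (W t' - W a) \<le> \<delta>"
        using d(2)[of a t] d(2)[of a t'] that by (auto simp: dist_norm dist_real_def)
      have "inner (W t) (W t') - (norm (W a))\<^sup>2 = inner (W t) (W t' - W a) + inner (W t - W a) (W a)"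
        by (simp add: power2_norm_eq_inner inner_diff_left inner_diff_right inner_commute)
      also have "\<bar>\<dots>\<bar> \<le> norm (W t) * norm (W t' - W a) + norm (W t - W a) * norm (W a)"
        using Cauchy_Schwarz_ineq2[of "W t" "W t' - W a"] Cauchy_Schwarz_ineq2[of "W t - W a" "W a"] by linarith
      also have "\<dots> \<le> S2 * \<delta> + \<delta> * S2"
        using 1 S2 that \<delta> by (intro add_mono mult_mono) auto
      also have "\<dots> \<le> \<delta> * (2 * S2 + 1)" using \<delta> by (simp add: algebra_simps)
      also have "\<dots> = \<eta>" using S2 by (simp add: \<delta>_def)
      finally show ?thesis .
    qed
    have ev: "\<forall>\<^sub>F h in at_right 0. (norm ((U (s + h) - U s) /\<^sub>R h))\<^sup>2 / 2 - (norm ((U (0 + h) - U 0) /\<^sub>R h))\<^sup>2 / 2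
        + (K - 2 * \<eta>) / 2 \<le> S * (n T - n 0)"
    proof -
      have "\<forall>\<^sub>F h in at_right 0. h \<in> {0<..<min d (T - s)}"
        using eventually_at_right_real[of 0 "min d (T - s)"] d(1) s by simp
      then show ?thesis
      proof eventually_elim
        case (elim h)
        then have h: "0 < h" "s + h \<le> T" "h < d" by auto
        let ?D = "\<lambda>r. integral {s..s + (h - r)} (\<lambda>t. inner (W t) (W (t + r))) - integral {0..h - r} (\<lambda>t. inner (W t) (W (t + r)))"
        note inc = energy_increment[OF adm S s(1) h(1,2)]
        have bd: "\<bar>integral {a..a + (h - r)} (\<lambda>t. inner (W t) (W (t + r))) - (h - r) * (norm (W a))\<^sup>2\<bar> \<le> \<eta> * (h - r)"
          if r: "r \<in> {0..h}" and a: "0 \<le> a" "a \<le> s" for r a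
        proof -
          have c: "continuous_on {a..a + (h - r)} (\<lambda>t. inner (W t) (W (t + r)))"
            using r a h by (auto intro!: continuous_intros continuous_on_compose2[OF W_cont])
          have "integral {a..a + (h - r)} (\<lambda>t. inner (W t) (W (t + r))) - (h - r) * (norm (W a))\<^sup>2
            = integral {a..a + (h - r)} (\<lambda>t. inner (W t) (W (t + r)) - (norm (W a))\<^sup>2)"
            using r by (subst Henstock_Kurzweil_Integration.integral_diff) (auto intro!: integrable_continuous_real c)
          also have "\<bar>\<dots>\<bar> \<le> \<eta> * (a + (h - r) - a)"
          proof (rule abs_integral_le_const)
            fix t assume "t \<in> {a..a + (h - r)}"
            then show "\<bar>inner (W t) (W (t + r)) - (norm (W a))\<^sup>2\<bar> \<le> \<eta>"
              using r a h s by (intro near) auto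
          qed (use r in \<open>auto intro!: continuous_intros c\<close>)
          finally show ?thesis by simp
        qed
        have Dge: "(K - 2 * \<eta>) * (h - r) \<le> ?D r" if r: "r \<in> {0..h}" for r
          using bd[OF r, of s] bd[OF r, of 0] s by (simp add: K_def abs_le_iff algebra_simps)
        have "((\<lambda>r. (K - 2 * \<eta>) * (h - r)) has_integral (K - 2 * \<eta>) * h\<^sup>2 / 2) {0..h}"
        proof -
          have "((\<lambda>r. (K - 2 * \<eta>) * (h - r)) has_integral (- ((K - 2 * \<eta>) * (h - h)\<^sup>2 / 2) - (- ((K - 2 * \<eta>) * (h - 0)\<^sup>2 / 2)))) {0..h}"
            using h by (intro fundamental_theorem_of_calculus)
              (auto intro!: derivative_eq_intros simp: has_real_derivative_iff_has_vector_derivative[symmetric] field_simps)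
          then show ?thesis by simp
        qed
        then have "(K - 2 * \<eta>) * h\<^sup>2 / 2 \<le> integral {0..h} ?D"
          using has_integral_le[OF _ integrable_integral[OF inc(2)]] Dge by blast
        with inc(1) have "(norm (U (s + h) - U s))\<^sup>2 / 2 - (norm (U h - U 0))\<^sup>2 / 2 + (K - 2 * \<eta>) * h\<^sup>2 / 2 \<le> h\<^sup>2 * (S * (n T - n 0))"
          by (simp add: mult.assoc)
        then have "((norm (U (s + h) - U s))\<^sup>2 / 2 - (norm (U h - U 0))\<^sup>2 / 2 + (K - 2 * \<eta>) * h\<^sup>2 / 2) / h\<^sup>2 \<le> S * (n T - n 0)"
          using h by (simp add: divide_le_eq mult.commute)
        moreover have "((norm (U (s + h) - U s))\<^sup>2 / 2 - (norm (U h - U 0))\<^sup>2 / 2 + (K - 2 * \<eta>) * h\<^sup>2 / 2) / h\<^sup>2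
          = (norm ((U (s + h) - U s) /\<^sub>R h))\<^sup>2 / 2 - (norm ((U (0 + h) - U 0) /\<^sub>R h))\<^sup>2 / 2 + (K - 2 * \<eta>) / 2"
        proof -
          have "(norm (X /\<^sub>R h))\<^sup>2 = (norm X)\<^sup>2 / h\<^sup>2" for X :: 'h
            using h by (simp add: power_divide divide_inverse_commute power_mult_distrib power_inverse)
          then show ?thesis using h by (simp add: add_divide_distrib diff_divide_distrib)
        qed
        ultimately show ?case by simp
      qed
    qed
    have "((\<lambda>h. (norm ((U (s + h) - U s) /\<^sub>R h))\<^sup>2 / 2 - (norm ((U (0 + h) - U 0) /\<^sub>R h))\<^sup>2 / 2 + (K - 2 * \<eta>) / 2)
       \<longlongrightarrow> (norm (V s))\<^sup>2 / 2 - (norm (V 0))\<^sup>2 / 2 + (K - 2 * \<eta>) / 2) (at_right 0)"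
      using s T_pos
      by (intro tendsto_intros has_vector_derivative_right_quotient[OF U_deriv]) auto
    from tendsto_upperbound[OF this ev] show ?thesis by simp
  qed
  note * = this
  have "(norm (V s))\<^sup>2 / 2 - (norm (V 0))\<^sup>2 / 2 + K / 2 \<le> S * (n T - n 0)"
  proof (rule field_le_epsilon)
    fix \<eta> :: real assume "\<eta> > 0"
    from *[OF this] show "(norm (V s))\<^sup>2 / 2 - (norm (V 0))\<^sup>2 / 2 + K / 2 \<le> S * (n T - n 0) + \<eta>"
      by (simp add: diff_divide_distrib)
  qed
  then show ?thesis by (simp add: K_def diff_divide_distrib)
qed

text \<open>The estimate for velocities bounded by S is applied at the time \<open>s0\<close> where
  the velocity norm is largest; there S^2 itself stands on the left and absorbs 2 S N. The final
  time is reached by continuity, and the constants of the conclusion are generous.\<close>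

lemma energy_estimate:
  assumes adm: "\<And>s t. s \<in> {0..T} \<Longrightarrow> t \<in> {0..T} \<Longrightarrow> adm (U t - U s) (W t - W s)"
    and s: "s \<in> {0..T}"
  shows "(norm (V s))\<^sup>2 + (norm (W s))\<^sup>2 \<le> 4 * ((norm (V 0))\<^sup>2 + (norm (W 0))\<^sup>2) + 16 * (n T - n 0)\<^sup>2"
proof -
  define N where "N = n T - n 0"
  define E0 where "E0 = (norm (V 0))\<^sup>2 + (norm (W 0))\<^sup>2"
  have N: "N \<ge> 0" using n_mono[of 0 T] T_pos by (simp add: N_def)
  have est: "(norm (V s))\<^sup>2 + (norm (W s))\<^sup>2 \<le> E0 + 2 * S * N"
    if S: "S \<ge> 0" "\<And>t. t \<in> {0..T} \<Longrightarrow> norm (V t) \<le> S" and s: "s \<in> {0..T}" for S s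
  proof -
    have "s \<in> closure {0..<T}" using s T_pos by simp
    moreover have "continuous_on (closure {0..<T}) (\<lambda>s. (norm (V s))\<^sup>2 + (norm (W s))\<^sup>2)"
      using T_pos by (auto intro!: continuous_intros V_cont W_cont)
    moreover have "(norm (V s))\<^sup>2 + (norm (W s))\<^sup>2 \<le> E0 + 2 * S * N" if "s \<in> {0..<T}" for s
      using energy_estimate_open[OF adm S, of s] that by (simp add: E0_def N_def)
    ultimately show ?thesis using continuous_le_on_closure by blast
  qed
  obtain s0 where s0: "s0 \<in> {0..T}" "\<And>t. t \<in> {0..T} \<Longrightarrow> norm (V t) \<le> norm (V s0)"
    using continuous_attains_sup[of "{0..T}" "\<lambda>t. norm (V t)"] T_pos continuous_on_norm[OF V_cont] by auto
  define S where "S = norm (V s0)"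
  have S: "S \<ge> 0" "\<And>t. t \<in> {0..T} \<Longrightarrow> norm (V t) \<le> S" using s0 by (auto simp: S_def)
  have "S\<^sup>2 \<le> E0 + 2 * S * N" using est[OF S s0(1)] zero_le_power2[of "norm (W s0)"] unfolding S_def by linarith
  moreover have "2 * S * N \<le> S\<^sup>2 / 2 + 2 * N\<^sup>2"
    using zero_le_power2[of "S - 2 * N"] by (simp add: power2_diff power_mult_distrib)
  ultimately have "2 * S * N \<le> E0 + 4 * N\<^sup>2" by linarith
  then have "(norm (V s))\<^sup>2 + (norm (W s))\<^sup>2 \<le> 2 * E0 + 4 * N\<^sup>2" using est[OF S s] by linarith
  moreover have "E0 \<ge> 0" by (simp add: E0_def)
  moreover have "N\<^sup>2 \<ge> 0" by simp
  ultimately show ?thesis unfolding E0_def[symmetric] N_def[symmetric] by linarith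
qed

end

section \<open>Permanence properties of absolute continuity\<close>

lemma abs_cont_onI_family:
  assumes "\<And>e. e > 0 \<Longrightarrow> \<exists>d>0. \<forall>(I::nat set) l r. ivl_family I l r a b \<longrightarrow> (\<Sum>i\<in>I. r i - l i) < d \<longrightarrow> (\<Sum>i\<in>I. \<bar>g (r i) - g (l i)\<bar>) < e"
  shows "abs_cont_on a b g"
  unfolding abs_cont_on_def
proof (intro allI impI)
  fix e :: real assume "e > 0"
  from assms[OF this] obtain d where d: "d > 0"
    "\<forall>(I::nat set) l r. ivl_family I l r a b \<longrightarrow> (\<Sum>i\<in>I. r i - l i) < d \<longrightarrow> (\<Sum>i\<in>I. \<bar>g (r i) - g (l i)\<bar>) < e"
    by (elim exE conjE) (rule that)
  show "\<exists>d>0. \<forall>(n::nat) l r.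
     (\<forall>i<n. a \<le> l i \<and> l i \<le> r i \<and> r i \<le> b) \<and>
     (\<forall>i<n. \<forall>j<n. i \<noteq> j \<longrightarrow> r i \<le> l j \<or> r j \<le> l i) \<and> (\<Sum>i<n. r i - l i) < d \<longrightarrow>
     (\<Sum>i<n. \<bar>g (r i) - g (l i)\<bar>) < e"
  proof (intro exI[of _ d] conjI d(1) allI impI)
    fix n :: nat and l r :: "nat \<Rightarrow> real"
    assume *: "(\<forall>i<n. a \<le> l i \<and> l i \<le> r i \<and> r i \<le> b) \<and>
     (\<forall>i<n. \<forall>j<n. i \<noteq> j \<longrightarrow> r i \<le> l j \<or> r j \<le> l i) \<and> (\<Sum>i<n. r i - l i) < d"
    then have "ivl_family {..<n} l r a b" by (simp add: ivl_family_def)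
    with * d(2) show "(\<Sum>i<n. \<bar>g (r i) - g (l i)\<bar>) < e" by blast
  qed
qed

text \<open>One criterion for differences, multiples, products and Lipschitz functions, all of whose
  increments are bounded in this form.\<close>

lemma abs_cont_on_dominated:
  assumes f: "abs_cont_on a b f" and g: "abs_cont_on a b g" and C: "C \<ge> 0"
    and h: "\<And>x y. x \<in> {a..b} \<Longrightarrow> y \<in> {a..b} \<Longrightarrow> \<bar>h y - h x\<bar> \<le> C * (\<bar>f y - f x\<bar> + \<bar>g y - g x\<bar>)"
  shows "abs_cont_on a b h"
proof (rule abs_cont_onI_family)
  fix e :: real assume e: "e > 0"
  define e' where "e' = e / (2 * (C + 1))"
  have e': "e' > 0" using e C by (simp add: e'_def)
  obtain d1 where d1: "d1 > 0" "\<forall>(I::nat set) l r. ivl_family I l r a b \<longrightarrow> (\<Sum>i\<in>I. r i - l i) < d1 \<longrightarrow> (\<Sum>i\<in>I. \<bar>f (r i) - f (l i)\<bar>) < e'"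
    by (rule abs_cont_on_familyD[OF f e'])
  obtain d2 where d2: "d2 > 0" "\<forall>(I::nat set) l r. ivl_family I l r a b \<longrightarrow> (\<Sum>i\<in>I. r i - l i) < d2 \<longrightarrow> (\<Sum>i\<in>I. \<bar>g (r i) - g (l i)\<bar>) < e'"
    by (rule abs_cont_on_familyD[OF g e'])
  show "\<exists>d>0. \<forall>(I::nat set) l r. ivl_family I l r a b \<longrightarrow> (\<Sum>i\<in>I. r i - l i) < d \<longrightarrow> (\<Sum>i\<in>I. \<bar>h (r i) - h (l i)\<bar>) < e"
  proof (intro exI[of _ "min d1 d2"] conjI allI impI)
    fix I :: "nat set" and l r assume I: "ivl_family I l r a b" "(\<Sum>i\<in>I. r i - l i) < min d1 d2"
    have "(\<Sum>i\<in>I. \<bar>h (r i) - h (l i)\<bar>) \<le> (\<Sum>i\<in>I. C * (\<bar>f (r i) - f (l i)\<bar> + \<bar>g (r i) - g (l i)\<bar>))"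
      using I by (intro sum_mono h) (auto simp: ivl_family_def; meson order_trans)+
    also have "\<dots> = C * ((\<Sum>i\<in>I. \<bar>f (r i) - f (l i)\<bar>) + (\<Sum>i\<in>I. \<bar>g (r i) - g (l i)\<bar>))"
      unfolding sum.distrib[symmetric] sum_distrib_left ..
    also have "\<dots> \<le> C * (e' + e')"
    proof (intro mult_left_mono C add_mono)
      show "(\<Sum>i\<in>I. \<bar>f (r i) - f (l i)\<bar>) \<le> e'" using d1(2) I by (auto intro: less_imp_le)
      show "(\<Sum>i\<in>I. \<bar>g (r i) - g (l i)\<bar>) \<le> e'" using d2(2) I by (auto intro: less_imp_le)
    qed
    also have "\<dots> < (C + 1) * (e' + e')" using e' by (simp add: algebra_simps)
    also have "\<dots> = e"
    proof -
      have "2 * (C + 1) \<noteq> 0" using add_nonneg_pos[OF C zero_less_one] by auto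
      then have "e' * (2 * (C + 1)) = e" unfolding e'_def by (metis nonzero_eq_divide_eq)
      then show ?thesis by (simp add: algebra_simps)
    qed
    finally show "(\<Sum>i\<in>I. \<bar>h (r i) - h (l i)\<bar>) < e" .
  qed (use d1 d2 in auto)
qed

text \<open>A monotone contraction maps non-overlapping intervals to non-overlapping intervals of no
  larger total length. The cases of interest are restriction to a subinterval and translations
  clamped to an interval.\<close>

lemma abs_cont_on_compose_contraction:
  assumes f: "abs_cont_on a b f" and mono: "\<And>x y. x \<le> y \<Longrightarrow> \<phi> x \<le> \<phi> y"
    and contr: "\<And>x y. x \<le> y \<Longrightarrow> \<phi> y - \<phi> x \<le> y - x" and range: "\<And>x. x \<in> {c..d} \<Longrightarrow> \<phi> x \<in> {a..b}"
  shows "abs_cont_on c d (\<lambda>x. f (\<phi> x))"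
proof (rule abs_cont_onI_family)
  fix e :: real assume e: "e > 0"
  obtain \<delta> where \<delta>: "\<delta> > 0" "\<forall>(I::nat set) l r. ivl_family I l r a b \<longrightarrow> (\<Sum>i\<in>I. r i - l i) < \<delta> \<longrightarrow> (\<Sum>i\<in>I. \<bar>f (r i) - f (l i)\<bar>) < e"
    by (rule abs_cont_on_familyD[OF f e])
  show "\<exists>d'>0. \<forall>(I::nat set) l r. ivl_family I l r c d \<longrightarrow> (\<Sum>i\<in>I. r i - l i) < d' \<longrightarrow> (\<Sum>i\<in>I. \<bar>f (\<phi> (r i)) - f (\<phi> (l i))\<bar>) < e"
  proof (intro exI[of _ \<delta>] conjI allI impI \<delta>(1))
    fix I :: "nat set" and l r assume I: "ivl_family I l r c d" "(\<Sum>i\<in>I. r i - l i) < \<delta>"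
    then have fin: "finite I" and A: "\<And>i. i \<in> I \<Longrightarrow> c \<le> l i \<and> l i \<le> r i \<and> r i \<le> d"
        and B: "\<And>i j. i \<in> I \<Longrightarrow> j \<in> I \<Longrightarrow> i \<noteq> j \<Longrightarrow> r i \<le> l j \<or> r j \<le> l i"
      unfolding ivl_family_def by auto
    have "ivl_family I (\<lambda>i. \<phi> (l i)) (\<lambda>i. \<phi> (r i)) a b"
      unfolding ivl_family_def
    proof (intro conjI ballI impI fin)
      fix i assume i: "i \<in> I"
      have "l i \<in> {c..d}" "r i \<in> {c..d}" using A[OF i] by auto
      from range[OF this(1)] range[OF this(2)] show "a \<le> \<phi> (l i)" "\<phi> (r i) \<le> b" by auto
      show "\<phi> (l i) \<le> \<phi> (r i)" using A[OF i] mono by auto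
      fix j assume "j \<in> I" "i \<noteq> j"
      from B[OF i this] mono show "\<phi> (r i) \<le> \<phi> (l j) \<or> \<phi> (r j) \<le> \<phi> (l i)" by auto
    qed
    moreover have "(\<Sum>i\<in>I. \<phi> (r i) - \<phi> (l i)) < \<delta>"
      using I(2) sum_mono[of I "\<lambda>i. \<phi> (r i) - \<phi> (l i)" "\<lambda>i. r i - l i"] contr A by fastforce
    ultimately show "(\<Sum>i\<in>I. \<bar>f (\<phi> (r i)) - f (\<phi> (l i))\<bar>) < e" using \<delta>(2)[rule_format, of I] by auto
  qed
qed

lemma abs_cont_on_ident: "abs_cont_on a b (\<lambda>x. x)"
proof (rule abs_cont_onI_family)
  fix e :: real assume e: "e > 0"
  show "\<exists>d>0. \<forall>(I::nat set) l r. ivl_family I l r a b \<longrightarrow> (\<Sum>i\<in>I. r i - l i) < d \<longrightarrow> (\<Sum>i\<in>I. \<bar>r i - l i\<bar>) < e"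
  proof (intro exI[of _ e] conjI e allI impI)
    fix I :: "nat set" and l r assume I: "ivl_family I l r a b" "(\<Sum>i\<in>I. r i - l i) < e"
    have "(\<Sum>i\<in>I. \<bar>r i - l i\<bar>) = (\<Sum>i\<in>I. r i - l i)" using I by (intro sum.cong) (auto simp: ivl_family_def)
    with I show "(\<Sum>i\<in>I. \<bar>r i - l i\<bar>) < e" by simp
  qed
qed

lemma abs_cont_on_subset:
  assumes "abs_cont_on a b f" "a \<le> c" "d \<le> b"
  shows "abs_cont_on c d f"
  using abs_cont_on_compose_contraction[OF assms(1), of "\<lambda>x. x" c d] assms(2,3) by auto

lemma abs_cont_on_Lipschitz:
  assumes "\<And>x y. x \<in> {a..b} \<Longrightarrow> y \<in> {a..b} \<Longrightarrow> \<bar>h y - h x\<bar> \<le> L * \<bar>y - x\<bar>"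
  shows "abs_cont_on a b h"
proof (rule abs_cont_on_dominated[OF abs_cont_on_ident abs_cont_on_ident])
  show "\<bar>h y - h x\<bar> \<le> \<bar>L\<bar> * (\<bar>y - x\<bar> + \<bar>y - x\<bar>)" if "x \<in> {a..b}" "y \<in> {a..b}" for x y
  proof -
    have "L * \<bar>y - x\<bar> \<le> \<bar>L\<bar> * \<bar>y - x\<bar>" by (intro mult_right_mono) auto
    also have "\<dots> \<le> \<bar>L\<bar> * (\<bar>y - x\<bar> + \<bar>y - x\<bar>)" by (intro mult_left_mono) auto
    finally show ?thesis using assms[OF that] by linarith
  qed
qed simp

lemma abs_cont_on_diff: "abs_cont_on a b f \<Longrightarrow> abs_cont_on a b g \<Longrightarrow> abs_cont_on a b (\<lambda>x. f x - g x)"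
  by (rule abs_cont_on_dominated[of a b f g 1]) auto

lemma abs_cont_on_cmult: "abs_cont_on a b f \<Longrightarrow> abs_cont_on a b (\<lambda>x. c * f x)"
proof (rule abs_cont_on_dominated[of a b f f "\<bar>c\<bar>"])
  have "\<bar>c * f y - c * f x\<bar> = \<bar>c\<bar> * \<bar>f y - f x\<bar>" for x y by (simp add: abs_mult flip: right_diff_distrib)
  then show "\<bar>c * f y - c * f x\<bar> \<le> \<bar>c\<bar> * (\<bar>f y - f x\<bar> + \<bar>f y - f x\<bar>)" for x y
    by (simp add: mult_left_mono)
qed auto

lemma abs_cont_on_mult:
  assumes f: "abs_cont_on a b f" and g: "abs_cont_on a b g"
  shows "abs_cont_on a b (\<lambda>x. f x * g x)"
proof -
  obtain S1 where S1: "S1 \<ge> 0" "\<And>t. t \<in> {a..b} \<Longrightarrow> norm (f t) \<le> S1"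
    by (rule continuous_on_compact_norm_bound[OF abs_cont_on_imp_continuous_on[OF f]]) (rule that, auto)
  obtain S2 where S2: "S2 \<ge> 0" "\<And>t. t \<in> {a..b} \<Longrightarrow> norm (g t) \<le> S2"
    by (rule continuous_on_compact_norm_bound[OF abs_cont_on_imp_continuous_on[OF g]]) (rule that, auto)
  show ?thesis
  proof (rule abs_cont_on_dominated[OF f g, of "S1 + S2"])
    fix x y assume xy: "x \<in> {a..b}" "y \<in> {a..b}"
    have "f y * g y - f x * g x = f y * (g y - g x) + (f y - f x) * g x" by (simp add: algebra_simps)
    also have "\<bar>\<dots>\<bar> \<le> \<bar>f y\<bar> * \<bar>g y - g x\<bar> + \<bar>f y - f x\<bar> * \<bar>g x\<bar>" by (metis abs_mult abs_triangle_ineq)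
    also have "\<dots> \<le> (S1 + S2) * \<bar>g y - g x\<bar> + \<bar>f y - f x\<bar> * (S1 + S2)"
      using S1 S2 xy by (intro add_mono mult_right_mono mult_left_mono) (auto intro: order_trans add_increasing add_increasing2)
    finally show "\<bar>f y * g y - f x * g x\<bar> \<le> (S1 + S2) * (\<bar>f y - f x\<bar> + \<bar>g y - g x\<bar>)" by (simp add: algebra_simps)
  qed (use S1 S2 in auto)
qed

lemma integral_lebesgue_eq_lborel:
  "g \<in> borel_measurable borel \<Longrightarrow> integral\<^sup>L lebesgue g = (integral\<^sup>L lborel g :: real)"
  by (rule integral_completion) simp

section \<open>The weighted space\<close>

definition ext01 :: "(real \<Rightarrow> real) \<Rightarrow> real \<Rightarrow> real" where
  "ext01 g x = indicator {0<..<1} x * g x"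

text \<open>The square of this function is the integrand of the weighted part of
  \<open>H1norm\<close>, so the elastic energy is a squared norm in l2. For members of H1a, points
  where \<open>deriv\<close> is unspecified form a null set.\<close>

definition wderiv :: "real \<Rightarrow> (real \<Rightarrow> real) \<Rightarrow> real \<Rightarrow> real" where
  "wderiv \<alpha> g x = indicator {0<..<1} x * (x powr (\<alpha> / 2) * deriv g x)"

lemma ennreal_ext01_sq: "ennreal ((g x)\<^sup>2) * indicator {0<..<1} x = ennreal ((ext01 g x)\<^sup>2)"
  by (auto simp: ext01_def indicator_def)

lemma in_L2_iff_sq_int: "in_L2 g \<longleftrightarrow> sq_int (ext01 g)"
proof -
  have "set_borel_measurable lebesgue {0<..<1} g \<longleftrightarrow> ext01 g \<in> borel_measurable lebesgue"
    unfolding set_borel_measurable_def ext01_def[abs_def] by simp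
  then show ?thesis
    unfolding in_L2_def sq_int_def ennreal_ext01_sq
    by (auto simp: integrable_iff_bounded)
qed

lemma L2norm_eq_norm: "in_L2 g \<Longrightarrow> L2norm g = norm (mk_l2 (ext01 g))"
proof -
  assume "in_L2 g"
  then have g: "sq_int (ext01 g)" by (simp add: in_L2_iff_sq_int)
  have "enn2real (\<integral>\<^sup>+x. ennreal ((ext01 g x)\<^sup>2) \<partial>lebesgue) = (LINT x|lebesgue. (ext01 g x)\<^sup>2)"
    using g by (intro integral_eq_nn_integral[symmetric]) (auto dest: sq_intD)
  then show ?thesis
    unfolding L2norm_def ennreal_ext01_sq using norm_mk_l2[OF g]
    by (metis norm_ge_zero real_sqrt_unique)
qed

lemma H1a_abs_cont_on:
  assumes "H1a \<alpha> g" "0 < c"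
  shows "abs_cont_on c 1 g"
proof (cases "c \<le> 1")
  case True
  with assms show ?thesis
    unfolding H1a_def loc_abs_cont_0_1_def by (auto split: if_splits intro: abs_cont_on_subset[of 0 1 g c 1])
next
  case False
  then show ?thesis by (intro abs_cont_on_Lipschitz[of _ _ _ 0]) auto
qed

text \<open>Both cases of degeneracy give absolute continuity on [1/(n+1), 1] for every n, and
  countably many null sets cover the exceptions in (0,1).\<close>

lemma H1a_AE_deriv:
  assumes "H1a \<alpha> g"
  shows "AE x in lebesgue. x \<in> {0<..<1} \<longrightarrow> (g has_real_derivative deriv g x) (at x)"
proof -
  have "AE x in lborel. \<forall>n::nat. 1 / real (Suc n) < x \<and> x < 1 \<longrightarrow> (g has_real_derivative deriv g x) (at x)"
    unfolding AE_all_countable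
  proof
    fix n :: nat
    have "1 / real (Suc n) \<le> 1" by simp
    moreover have "abs_cont_on (1 / real (Suc n)) 1 g" by (rule H1a_abs_cont_on[OF assms]) simp
    ultimately obtain h where "AE x in lborel. 1 / real (Suc n) < x \<and> x < 1 \<longrightarrow> (g has_real_derivative h x) (at x)"
      using abs_cont_on_FTC by blast
    then show "AE x in lborel. 1 / real (Suc n) < x \<and> x < 1 \<longrightarrow> (g has_real_derivative deriv g x) (at x)"
      by eventually_elim (auto simp: DERIV_imp_deriv)
  qed
  then have "AE x in lborel. x \<in> {0<..<1} \<longrightarrow> (g has_real_derivative deriv g x) (at x)"
  proof eventually_elim
    case (elim x)
    show ?case
    proof
      assume x: "x \<in> {0<..<1}"
      then obtain n :: nat where "inverse (real (Suc n)) < x" using reals_Archimedean[of x] by auto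
      with elim x show "(g has_real_derivative deriv g x) (at x)" by (auto simp: inverse_eq_divide)
    qed
  qed
  then show ?thesis by (simp add: AE_completion_iff)
qed

text \<open>Because g vanishes at 1, its continuation by zero to the right of 1 is a primitive of
  the derivative cut off at 1. This is the form suited to translates that pass the endpoint.\<close>

lemma H1a_FTC:
  assumes H: "H1a \<alpha> g" and c: "0 < c" "c < 1"
  shows "integrable lebesgue (\<lambda>t. indicator {c<..<1} t * deriv g t)"
    and "\<And>x y. c \<le> x \<Longrightarrow> x \<le> y \<Longrightarrow> (if y \<le> 1 then g y else 0) - (if x \<le> 1 then g x else 0)
      = (LINT t:{x..y}|lebesgue. indicator {c<..<1} t * deriv g t)"
proof -
  have c1: "c \<le> 1" using c by simp
  obtain h where h: "integrable lborel h" "\<forall>x\<in>{c..1}. g x = g c + (LINT t:{c..x}|lborel. h t)"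
    "AE x in lborel. c < x \<and> x < 1 \<longrightarrow> (g has_real_derivative h x) (at x)"
    by (rule abs_cont_on_FTC[OF H1a_abs_cont_on[OF H c(1)] c1])
  have [measurable]: "h \<in> borel_measurable borel" using h(1) by auto
  define Z where "Z t = indicator {c<..<1} t * h t" for t
  have [measurable]: "Z \<in> borel_measurable borel" unfolding Z_def by simp
  have eq: "AE t in lebesgue. indicator {c<..<1} t * deriv g t = Z t"
  proof -
    have "AE t in lborel. indicator {c<..<1} t * deriv g t = Z t"
      using h(3) by eventually_elim (auto simp: Z_def indicator_def DERIV_imp_deriv)
    then show ?thesis by (simp add: AE_completion_iff)
  qed
  have Zi: "integrable lborel Z"
    unfolding Z_def using integrable_mult_indicator[OF _ h(1), of "{c<..<1}"] by simp
  then have Zi': "integrable lebesgue Z" by (simp add: integrable_completion)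
  have meas: "(\<lambda>t. indicator {c<..<1} t * deriv g t) \<in> borel_measurable lebesgue"
    by (rule borel_measurable_AE[of Z]) (use eq in \<open>auto simp: measurable_completion elim: eventually_mono\<close>)
  show "integrable lebesgue (\<lambda>t. indicator {c<..<1} t * deriv g t)"
    using integrable_cong_AE[OF meas _ eq] Zi' by (auto simp: measurable_completion)
  fix x y assume xy: "c \<le> x" "x \<le> y"
  have g1: "g 1 = 0" using H by (simp add: H1a_def)
  have si: "set_integrable lborel A h" if "A \<in> sets borel" for A
    unfolding set_integrable_def using integrable_mult_indicator[OF _ h(1), of A] that by simp
  have hd: "g b - g a = (LINT t:{a<..<b}|lborel. h t)" if "c \<le> a" "a \<le> b" "b \<le> 1" for a b
  proof -
    have "(LINT t:{c..b}|lborel. h t) = (LINT t:{c..a}|lborel. h t) + (LINT t:{a<..b}|lborel. h t)"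
    proof -
      have "{c..b} = {c..a} \<union> {a<..b}" using that by auto
      then show ?thesis by (simp only:) (rule set_integral_Un, auto intro!: si)
    qed
    moreover have "(LINT t:{a<..b}|lborel. h t) = (LINT t:{a<..<b}|lborel. h t)"
      unfolding set_lebesgue_integral_def
      by (rule integral_cong_AE) (use AE_lborel_singleton[of b] in \<open>auto simp: indicator_def elim!: eventually_mono\<close>)
    moreover have "g a = g c + (LINT t:{c..a}|lborel. h t)" "g b = g c + (LINT t:{c..b}|lborel. h t)"
      by (rule bspec[OF h(2)], use that in simp)+
    ultimately show ?thesis by linarith
  qed
  have "(LINT t:{x..y}|lebesgue. indicator {c<..<1} t * deriv g t) = (LINT t:{x..y}|lebesgue. Z t)"
    unfolding set_lebesgue_integral_def
  proof (rule integral_cong_AE)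
    show "(\<lambda>t. indicator {x..y} t *\<^sub>R (indicator {c<..<1} t * deriv g t)) \<in> borel_measurable lebesgue"
      using meas by measurable
    show "(\<lambda>t. indicator {x..y} t *\<^sub>R Z t) \<in> borel_measurable lebesgue" by (simp add: measurable_completion)
    show "AE t in lebesgue. indicator {x..y} t *\<^sub>R (indicator {c<..<1} t * deriv g t) = indicator {x..y} t *\<^sub>R Z t"
      using eq by eventually_elim simp
  qed
  also have "\<dots> = (LINT t:{x..y}|lborel. Z t)"
    unfolding set_lebesgue_integral_def by (rule integral_lebesgue_eq_lborel) simp
  also have "\<dots> = (LINT t:{min x 1<..<min y 1}|lborel. h t)"
    unfolding set_lebesgue_integral_def
  proof (rule integral_cong_AE)
    show "AE t in lborel. indicator {x..y} t *\<^sub>R Z t = indicator {min x 1<..<min y 1} t *\<^sub>R h t"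
      using AE_lborel_singleton[of x] AE_lborel_singleton[of y]
      by eventually_elim (use xy in \<open>auto simp: Z_def indicator_def\<close>)
  qed auto
  also have "\<dots> = g (min y 1) - g (min x 1)"
    using xy c by (intro hd[symmetric]) auto
  also have "\<dots> = (if y \<le> 1 then g y else 0) - (if x \<le> 1 then g x else 0)"
    using g1 by (auto simp: min_def)
  finally show "(if y \<le> 1 then g y else 0) - (if x \<le> 1 then g x else 0)
      = (LINT t:{x..y}|lebesgue. indicator {c<..<1} t * deriv g t)" ..
qed

text \<open>On each (1/(n+2), 1) \<open>deriv g\<close> agrees almost everywhere with an integrable
  density and is therefore measurable; on (0,1) it is a pointwise limit of these
  restrictions.\<close>

lemma wderiv_measurable:
  assumes H: "H1a \<alpha> g"
  shows "wderiv \<alpha> g \<in> borel_measurable lebesgue"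
proof -
  define F where "F n t = indicator {1 / real (n + 2)<..<1} t * deriv g t" for n :: nat and t
  have Fm [measurable]: "F n \<in> borel_measurable lebesgue" for n
    unfolding F_def using H1a_FTC(1)[OF H, of "1 / real (n + 2)"] by (intro borel_measurable_integrable) auto
  have "(\<lambda>n. F n t) \<longlonglongrightarrow> indicator {0<..<1} t * deriv g t" for t
  proof (rule tendsto_eventually, cases "t \<in> {0<..<1}")
    case True
    then obtain N :: nat where N: "inverse (real (Suc N)) < t" using reals_Archimedean[of t] by auto
    show "\<forall>\<^sub>F n in sequentially. F n t = indicator {0<..<1} t * deriv g t"
      using eventually_ge_at_top[of N]
    proof eventually_elim
      case (elim n)
      then have "1 / real (n + 2) \<le> inverse (real (Suc N))" by (simp add: field_simps)
      then have "1 / real (n + 2) < t" using N by linarith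
      then show ?case using True by (simp add: F_def)
    qed
  next
    case False
    then show "\<forall>\<^sub>F n in sequentially. F n t = indicator {0<..<1} t * deriv g t"
      by (auto simp: F_def indicator_def not_less intro!: always_eventually)
        (smt (verit) divide_nonneg_nonneg of_nat_0_le_iff)
  qed
  then have [measurable]: "(\<lambda>t. indicator {0<..<1} t * deriv g t) \<in> borel_measurable lebesgue"
    by (rule borel_measurable_LIMSEQ_real[OF _ Fm])
  have "wderiv \<alpha> g = (\<lambda>t. t powr (\<alpha> / 2) * (indicator {0<..<1} t * deriv g t))"
    by (auto simp: wderiv_def fun_eq_iff)
  then show ?thesis by simp
qed

lemma wderiv_sq: "ennreal (x powr \<alpha> * (deriv g x)\<^sup>2) * indicator {0<..<1} x = ennreal ((wderiv \<alpha> g x)\<^sup>2)"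
proof (cases "x \<in> {0<..<1}")
  case True
  have "x powr \<alpha> = (x powr (\<alpha> / 2))\<^sup>2" by (simp add: power2_eq_square powr_add[symmetric])
  then show ?thesis using True by (simp add: wderiv_def power_mult_distrib)
qed (auto simp: wderiv_def)

lemma H1a_sq_int: "H1a \<alpha> g \<Longrightarrow> sq_int (ext01 g)" "H1a \<alpha> g \<Longrightarrow> sq_int (wderiv \<alpha> g)"
proof -
  assume H: "H1a \<alpha> g"
  then show "sq_int (ext01 g)" by (simp add: H1a_def in_L2_iff_sq_int)
  show "sq_int (wderiv \<alpha> g)"
    using H wderiv_measurable[OF H] unfolding H1a_def wderiv_sq sq_int_def
    by (auto simp: integrable_iff_bounded)
qed

lemma H1norm_sq: "H1a \<alpha> g \<Longrightarrow> (H1norm \<alpha> g)\<^sup>2 = (norm (mk_l2 (ext01 g)))\<^sup>2 + (norm (mk_l2 (wderiv \<alpha> g)))\<^sup>2"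
proof -
  assume H: "H1a \<alpha> g"
  have "enn2real (\<integral>\<^sup>+x. ennreal ((wderiv \<alpha> g x)\<^sup>2) \<partial>lebesgue) = (norm (mk_l2 (wderiv \<alpha> g)))\<^sup>2"
    using H1a_sq_int(2)[OF H] unfolding norm_mk_l2[OF H1a_sq_int(2)[OF H]]
    by (intro integral_eq_nn_integral[symmetric]) (auto dest: sq_intD)
  then show ?thesis
    unfolding H1norm_def wderiv_sq using H by (simp add: L2norm_eq_norm H1a_def)
qed

text \<open>Derivatives subtract where both exist, so linearity of the weighted derivative is a
  statement about classes in l2, while the zero extension is linear pointwise.\<close>

lemma H1a_diff:
  assumes "H1a \<alpha> f" "H1a \<alpha> g"
  shows "H1a \<alpha> (\<lambda>x. f x - g x)"
    and "mk_l2 (ext01 (\<lambda>x. f x - g x)) = mk_l2 (ext01 f) - mk_l2 (ext01 g)"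
    and "mk_l2 (wderiv \<alpha> (\<lambda>x. f x - g x)) = mk_l2 (wderiv \<alpha> f) - mk_l2 (wderiv \<alpha> g)"
proof -
  note sf = H1a_sq_int[OF assms(1)] and sg = H1a_sq_int[OF assms(2)]
  have e: "ext01 (\<lambda>x. f x - g x) = (\<lambda>x. ext01 f x - ext01 g x)"
    by (auto simp: ext01_def algebra_simps)
  show "mk_l2 (ext01 (\<lambda>x. f x - g x)) = mk_l2 (ext01 f) - mk_l2 (ext01 g)"
    unfolding e using sf sg by (simp add: mk_l2_diff)
  have w: "AE x in lebesgue. wderiv \<alpha> (\<lambda>x. f x - g x) x = wderiv \<alpha> f x - wderiv \<alpha> g x"
    using H1a_AE_deriv[OF assms(1)] H1a_AE_deriv[OF assms(2)]
  proof eventually_elim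
    case (elim x)
    then have "deriv (\<lambda>x. f x - g x) x = deriv f x - deriv g x" if "x \<in> {0<..<1}"
      using that by (intro DERIV_imp_deriv DERIV_diff) auto
    then show ?case by (cases "x \<in> {0<..<1}") (simp_all add: wderiv_def right_diff_distrib)
  qed
  have sd: "sq_int (\<lambda>x. wderiv \<alpha> f x - wderiv \<alpha> g x)" by (rule sq_int_diff[OF sf(2) sg(2)])
  have ws: "sq_int (wderiv \<alpha> (\<lambda>x. f x - g x))"
  proof (rule sq_int_bound[OF sq_int_square[OF sd]])
    show "wderiv \<alpha> (\<lambda>x. f x - g x) \<in> borel_measurable lebesgue"
      by (rule borel_measurable_AE[OF sq_intD[OF sd]]) (use w in \<open>auto elim: eventually_mono\<close>)
  qed (use w in \<open>auto elim: eventually_mono\<close>)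
  show "mk_l2 (wderiv \<alpha> (\<lambda>x. f x - g x)) = mk_l2 (wderiv \<alpha> f) - mk_l2 (wderiv \<alpha> g)"
    unfolding mk_l2_diff[OF sf(2) sg(2)] using w ws sd by (simp add: mk_l2_eq_iff)
  show "H1a \<alpha> (\<lambda>x. f x - g x)"
    using assms sq_int_diff[OF sf(1) sg(1)] sq_int_square[OF ws]
    unfolding H1a_def wderiv_sq in_L2_iff_sq_int e
    by (auto simp: loc_abs_cont_0_1_def integrable_iff_bounded intro: abs_cont_on_diff)
qed

lemma H1a_scale:
  assumes "H1a \<alpha> g"
  shows "H1a \<alpha> (\<lambda>x. c * g x)"
    and "mk_l2 (ext01 (\<lambda>x. c * g x)) = c *\<^sub>R mk_l2 (ext01 g)"
    and "mk_l2 (wderiv \<alpha> (\<lambda>x. c * g x)) = c *\<^sub>R mk_l2 (wderiv \<alpha> g)"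
    and "AE x in lebesgue. x \<in> {0<..<1} \<longrightarrow> deriv (\<lambda>x. c * g x) x = c * deriv g x"
proof -
  note sg = H1a_sq_int[OF assms]
  have e: "ext01 (\<lambda>x. c * g x) = (\<lambda>x. c * ext01 g x)" by (auto simp: ext01_def)
  show "mk_l2 (ext01 (\<lambda>x. c * g x)) = c *\<^sub>R mk_l2 (ext01 g)"
    unfolding e using sg by (simp add: mk_l2_scaleR)
  show d: "AE x in lebesgue. x \<in> {0<..<1} \<longrightarrow> deriv (\<lambda>x. c * g x) x = c * deriv g x"
    using H1a_AE_deriv[OF assms] by eventually_elim (auto intro!: DERIV_imp_deriv DERIV_cmult)
  have w: "AE x in lebesgue. wderiv \<alpha> (\<lambda>x. c * g x) x = c * wderiv \<alpha> g x"
    using d by eventually_elim (auto simp: wderiv_def indicator_def)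
  have sd: "sq_int (\<lambda>x. c * wderiv \<alpha> g x)" by (rule sq_int_scale[OF sg(2)])
  have ws: "sq_int (wderiv \<alpha> (\<lambda>x. c * g x))"
  proof (rule sq_int_bound[OF sq_int_square[OF sd]])
    show "wderiv \<alpha> (\<lambda>x. c * g x) \<in> borel_measurable lebesgue"
      by (rule borel_measurable_AE[OF sq_intD[OF sd]]) (use w in \<open>auto elim: eventually_mono\<close>)
  qed (use w in \<open>auto elim: eventually_mono\<close>)
  show "mk_l2 (wderiv \<alpha> (\<lambda>x. c * g x)) = c *\<^sub>R mk_l2 (wderiv \<alpha> g)"
    unfolding mk_l2_scaleR[OF sg(2)] using w ws sd by (simp add: mk_l2_eq_iff)
  show "H1a \<alpha> (\<lambda>x. c * g x)"
    using assms sq_int_scale[OF sg(1)] sq_int_square[OF ws]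
    unfolding H1a_def wderiv_sq in_L2_iff_sq_int e
    by (auto simp: loc_abs_cont_0_1_def integrable_iff_bounded intro: abs_cont_on_cmult)
qed

text \<open>Since g 1 = 0, the value g x is minus the integral over (x,1) of t^(-alpha/2) times the
  weighted derivative. In Cauchy-Schwarz the first factor yields (1 - x) c^(-alpha), and the second
  is the energy on (c,1) alone, which for c close to 1 is the energy of a layer.\<close>

lemma H1a_pointwise_bound:
  assumes H: "H1a \<alpha> g" and \<alpha>: "0 < \<alpha>" and c: "0 < c" "c < 1" and x: "c \<le> x" "x \<le> 1"
  shows "(g x)\<^sup>2 \<le> (1 - x) * c powr (- \<alpha>) * (norm (mult_l2 (indicator {c<..<1}) (mk_l2 (wderiv \<alpha> g))))\<^sup>2"
proof -
  note sg = H1a_sq_int[OF H]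
  define m where "m t = indicator {x<..<1} t * t powr (- \<alpha> / 2)" for t
  have mle: "(m t)\<^sup>2 \<le> (c powr (- \<alpha> / 2) * indicator {x..1} t)\<^sup>2" for t
  proof (cases "t \<in> {x<..<1}")
    case True
    then have "t powr (- \<alpha> / 2) \<le> c powr (- \<alpha> / 2)" using c x \<alpha> by (intro powr_mono2') auto
    then show ?thesis using True by (simp add: m_def power_mono)
  qed (simp add: m_def)
  have mm: "m \<in> borel_measurable lebesgue" unfolding m_def[abs_def] by measurable
  have ms: "sq_int m"
    by (rule sq_int_bound[OF sq_int_square[OF sq_int_indicator_const[of "c powr (- \<alpha> / 2)" x 1]]])
      (use mle mm in auto)
  have ind: "\<bar>indicator {c<..<1} t :: real\<bar> \<le> 1" for t by (simp add: indicator_def)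
  define Y where "Y = (\<lambda>t. indicator {c<..<1} t * wderiv \<alpha> g t)"
  have Ys: "sq_int Y" unfolding Y_def by (rule sq_int_mult_bounded[OF sg(2) _ ind]) auto
  have "g x = - (LINT t:{x..1}|lebesgue. indicator {c<..<1} t * deriv g t)"
    using H1a_FTC(2)[OF H c, of x 1] x H by (simp add: H1a_def)
  also have "(LINT t:{x..1}|lebesgue. indicator {c<..<1} t * deriv g t) = (LINT t|lebesgue. m t * Y t)"
    unfolding set_lebesgue_integral_def
  proof (rule integral_cong_AE)
    show "(\<lambda>t. indicator {x..1} t *\<^sub>R (indicator {c<..<1} t * deriv g t)) \<in> borel_measurable lebesgue"
      using borel_measurable_integrable[OF H1a_FTC(1)[OF H c]] by measurable
    show "(\<lambda>t. m t * Y t) \<in> borel_measurable lebesgue" using ms Ys by measurable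
    have "AE t in lebesgue. t \<noteq> x \<and> t \<noteq> 1"
      using AE_lborel_singleton[of x] AE_lborel_singleton[of 1] by (simp add: AE_completion_iff)
    then show "AE t in lebesgue. indicator {x..1} t *\<^sub>R (indicator {c<..<1} t * deriv g t) = m t * Y t"
    proof eventually_elim
      case (elim t)
      have "t powr (- (\<alpha> / 2)) * t powr (\<alpha> / 2) = 1" if "0 < t" using that by (simp add: powr_add[symmetric])
      then show ?case using elim c x
        by (auto simp: m_def Y_def wderiv_def indicator_def mult.assoc[symmetric])
    qed
  qed
  also have "\<dots> = inner (mk_l2 m) (mk_l2 Y)" using ms Ys by (simp add: inner_mk_l2)
  finally have "(g x)\<^sup>2 = (inner (mk_l2 m) (mk_l2 Y))\<^sup>2" by simp
  also have "\<dots> \<le> (norm (mk_l2 m))\<^sup>2 * (norm (mk_l2 Y))\<^sup>2"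
    using Cauchy_Schwarz_ineq[of "mk_l2 m" "mk_l2 Y"] by (simp add: power2_norm_eq_inner)
  also have "\<dots> \<le> ((1 - x) * c powr (- \<alpha>)) * (norm (mk_l2 Y))\<^sup>2"
  proof (rule mult_right_mono)
    have "(norm (mk_l2 m))\<^sup>2 = (LINT t|lebesgue. (m t)\<^sup>2)" by (rule norm_mk_l2[OF ms])
    also have "\<dots> \<le> (LINT t|lebesgue. (c powr (- \<alpha> / 2) * indicator {x..1} t)\<^sup>2)"
      by (intro integral_mono sq_int_square ms sq_int_indicator_const mle)
    also have "\<dots> = (LINT t|lebesgue. c powr (- \<alpha>) * indicator {x..1} t)"
    proof (rule Bochner_Integration.integral_cong)
      have "(c powr (- \<alpha> / 2))\<^sup>2 = c powr (- \<alpha>)" by (simp add: power2_eq_square powr_add[symmetric])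
      then show "(c powr (- \<alpha> / 2) * indicator {x..1} t)\<^sup>2 = c powr (- \<alpha>) * indicator {x..1} t" for t
        by (auto simp: indicator_def)
    qed simp
    also have "\<dots> = (1 - x) * c powr (- \<alpha>)" using x by simp
    finally show "(norm (mk_l2 m))\<^sup>2 \<le> (1 - x) * c powr (- \<alpha>)" .
  qed simp
  finally show ?thesis
    unfolding Y_def using mult_l2_mk[OF sg(2) _ ind] by simp
qed

text \<open>A uniform bound on [c,1], for comparing the solution at two times.\<close>

lemma H1a_pointwise_norm_bound:
  assumes H: "H1a \<alpha> g" and \<alpha>: "0 < \<alpha>" and c: "0 < c" "c < 1" and x: "c \<le> x" "x \<le> 1"
  shows "\<bar>g x\<bar> \<le> c powr (- \<alpha> / 2) * norm (mk_l2 (wderiv \<alpha> g))"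
proof -
  have ind: "\<bar>indicator {c<..<1} t :: real\<bar> \<le> 1" for t by (simp add: indicator_def)
  have "norm (mult_l2 (indicator {c<..<1}) (mk_l2 (wderiv \<alpha> g))) \<le> 1 * norm (mk_l2 (wderiv \<alpha> g))"
    by (rule norm_mult_l2_le[OF _ ind]) simp
  then have 1: "(norm (mult_l2 (indicator {c<..<1}) (mk_l2 (wderiv \<alpha> g))))\<^sup>2 \<le> (norm (mk_l2 (wderiv \<alpha> g)))\<^sup>2"
    by (intro power_mono) auto
  have "(g x)\<^sup>2 \<le> (1 - x) * c powr (- \<alpha>) * (norm (mult_l2 (indicator {c<..<1}) (mk_l2 (wderiv \<alpha> g))))\<^sup>2"
    by (rule H1a_pointwise_bound[OF assms])
  also have "\<dots> \<le> (1 * c powr (- \<alpha>)) * (norm (mk_l2 (wderiv \<alpha> g)))\<^sup>2"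
    using c x 1 by (intro mult_mono) auto
  also have "\<dots> = (c powr (- \<alpha> / 2) * norm (mk_l2 (wderiv \<alpha> g)))\<^sup>2"
    by (simp add: power_mult_distrib) (simp add: power2_eq_square powr_add[symmetric])
  finally have "\<bar>g x\<bar>\<^sup>2 \<le> (c powr (- \<alpha> / 2) * norm (mk_l2 (wderiv \<alpha> g)))\<^sup>2" by simp
  then show ?thesis by (rule power2_le_imp_le) simp
qed

section \<open>Measurability and Fubini in the plane\<close>

lemma ext01_borel:
  assumes "H1a \<alpha> g"
  shows "ext01 g \<in> borel_measurable borel"
proof -
  have "continuous_on {0<..<1} g"
    unfolding continuous_on_eq_continuous_at[OF open_greaterThanLessThan]
  proof
    fix x :: real assume x: "x \<in> {0<..<1}"
    have "continuous_on {x/2..1} g"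
      using x by (intro abs_cont_on_imp_continuous_on H1a_abs_cont_on[OF assms]) auto
    then show "isCont g x" by (rule continuous_on_interior) (use x in auto)
  qed
  then have "(\<lambda>x. indicator {0<..<1} x *\<^sub>R g x) \<in> borel_measurable borel"
    by (intro borel_measurable_continuous_on_indicator) auto
  then show ?thesis by (simp add: ext01_def[abs_def])
qed

text \<open>The points of differentiability are described by a Cauchy criterion over rational
  increments, so they form a Borel set jointly in both variables.\<close>
lemma partial_derivative_measurable:
  fixes F :: "real \<times> real \<Rightarrow> real"
  assumes F: "continuous_on UNIV F"
    and D: "\<And>t. AE x in lborel. x \<in> {a<..<b} \<longrightarrow> (\<exists>d. ((\<lambda>y. F (t, y)) has_real_derivative d) (at x))"
  obtains G where "G \<in> borel_measurable borel"
    "AE p in lborel. snd p \<in> {a<..<b} \<longrightarrow> ((\<lambda>y. F (fst p, y)) has_real_derivative G p) (at (snd p))"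
proof -
  have [measurable]: "F \<in> borel_measurable borel" using F by (rule borel_measurable_continuous_onI)
  define q where "q h p = (F (fst p, snd p + h) - F p) / h" for h p
  have qm [measurable]: "q h \<in> borel_measurable borel" for h
  proof -
    have "continuous_on UNIV (\<lambda>p. F (fst p, snd p + h))"
      by (rule continuous_on_compose2[OF F]) (auto intro!: continuous_intros)
    then have "(\<lambda>p. F (fst p, snd p + h)) \<in> borel_measurable borel" by (rule borel_measurable_continuous_onI)
    then show ?thesis unfolding q_def by measurable
  qed
  define \<Gamma> where "\<Gamma> = {p. \<forall>m::nat. \<exists>n::nat. \<forall>h k::rat. 0 < \<bar>real_of_rat h\<bar> \<and> \<bar>real_of_rat h\<bar> < 1 / Suc n \<and> 0 < \<bar>real_of_rat k\<bar> \<and> \<bar>real_of_rat k\<bar> < 1 / Suc n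
     \<longrightarrow> \<bar>q (real_of_rat h) p - q (real_of_rat k) p\<bar> \<le> 1 / Suc m}"
  have \<Gamma>m [measurable]: "\<Gamma> \<in> sets borel"
  proof -
    have "{p\<in>space borel. \<forall>m::nat. \<exists>n::nat. \<forall>h k::rat. 0 < \<bar>real_of_rat h\<bar> \<and> \<bar>real_of_rat h\<bar> < 1 / Suc n \<and> 0 < \<bar>real_of_rat k\<bar> \<and> \<bar>real_of_rat k\<bar> < 1 / Suc n
     \<longrightarrow> \<bar>q (real_of_rat h) p - q (real_of_rat k) p\<bar> \<le> 1 / Suc m} \<in> sets borel"
      by measurable
    then show ?thesis by (simp add: \<Gamma>_def)
  qed
  define G where "G p = lim (\<lambda>i. q (1 / Suc i) p)" for p
  have Gm: "G \<in> borel_measurable borel" unfolding G_def by measurable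
  have DG: "((\<lambda>y. F (fst p, y)) has_real_derivative G p) (at (snd p))" if p: "p \<in> \<Gamma>" for p
  proof -
    \<comment> \<open>Continuity of F extends the first increment from rationals to reals. The
      second stays rational, which suffices for the sequence 1/(i+1) that defines
      \<open>G\<close>.\<close>
    have R: "\<exists>n::nat. \<forall>h k::real. h \<noteq> 0 \<and> \<bar>h\<bar> < 1 / Suc n \<and> k \<in> \<rat> \<and> k \<noteq> 0 \<and> \<bar>k\<bar> < 1 / Suc n
       \<longrightarrow> \<bar>q h p - q k p\<bar> \<le> 1 / Suc m" for m :: nat
    proof -
      obtain n :: nat where n: "\<forall>h k::rat. 0 < \<bar>real_of_rat h\<bar> \<and> \<bar>real_of_rat h\<bar> < 1 / Suc n \<and> 0 < \<bar>real_of_rat k\<bar> \<and> \<bar>real_of_rat k\<bar> < 1 / Suc n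
         \<longrightarrow> \<bar>q (real_of_rat h) p - q (real_of_rat k) p\<bar> \<le> 1 / Suc m"
        using p unfolding \<Gamma>_def by blast
      show ?thesis
      proof (intro exI[of _ n] allI impI)
        fix h k :: real assume hk: "h \<noteq> 0 \<and> \<bar>h\<bar> < 1 / Suc n \<and> k \<in> \<rat> \<and> k \<noteq> 0 \<and> \<bar>k\<bar> < 1 / Suc n"
        then obtain k' where k': "k = real_of_rat k'" by (auto elim: Rats_cases)
        let ?A = "{y. y \<noteq> 0 \<and> \<bar>y\<bar> < 1 / Suc n} :: real set"
        have oA: "open ?A"
        proof -
          have "?A = {- (1 / Suc n)<..<1 / Suc n} - {0}" by auto
          then show ?thesis by (simp add: open_delete)
        qed
        have "h \<in> closure (?A \<inter> \<rat>)"
        proof -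
          have "closure (?A \<inter> \<rat>) = closure ?A"
            using closure_open_Int_superset[OF oA, of \<rat>] by (simp add: Rats_closure_real)
          then show ?thesis using hk closure_subset[of ?A] by auto
        qed
        then obtain X where X: "\<And>i. X i \<in> ?A \<inter> \<rat>" "X \<longlonglongrightarrow> h" unfolding closure_sequential by blast
        have "(\<lambda>i. q (X i) p) \<longlonglongrightarrow> q h p"
        proof -
          have "isCont F (fst p, snd p + h)" using F by (simp add: continuous_on_eq_continuous_at)
          moreover have "(\<lambda>i. (fst p, snd p + X i)) \<longlonglongrightarrow> (fst p, snd p + h)" by (intro tendsto_intros X)
          ultimately have "(\<lambda>i. F (fst p, snd p + X i)) \<longlonglongrightarrow> F (fst p, snd p + h)"
            by (rule isCont_tendsto_compose)
          then show ?thesis unfolding q_def using hk by (intro tendsto_intros X) auto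
        qed
        then have "(\<lambda>i. \<bar>q (X i) p - q k p\<bar>) \<longlonglongrightarrow> \<bar>q h p - q k p\<bar>" by (intro tendsto_intros)
        moreover have "\<bar>q (X i) p - q k p\<bar> \<le> 1 / Suc m" for i
        proof -
          obtain r where "X i = real_of_rat r" using X(1)[of i] by (auto elim: Rats_cases)
          then show ?thesis using n X(1)[of i] hk k' by auto
        qed
        ultimately show "\<bar>q h p - q k p\<bar> \<le> 1 / Suc m" by (intro LIMSEQ_le_const2) auto
      qed
    qed
    have inv: "1 / real (Suc i) \<noteq> 0" "1 / real (Suc i) \<in> \<rat>" for i by auto
    have small: "\<bar>1 / real (Suc i)\<bar> < 1 / Suc n" if "n < i" for i n
      using that by (simp add: field_simps)
    have "Cauchy (\<lambda>i. q (1 / Suc i) p)"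
    proof (rule metric_CauchyI)
      fix e :: real assume "e > 0"
      then obtain m where m: "inverse (real (Suc m)) < e" using reals_Archimedean by blast
      obtain n where n: "\<forall>h k::real. h \<noteq> 0 \<and> \<bar>h\<bar> < 1 / Suc n \<and> k \<in> \<rat> \<and> k \<noteq> 0 \<and> \<bar>k\<bar> < 1 / Suc n
         \<longrightarrow> \<bar>q h p - q k p\<bar> \<le> 1 / Suc m" using R[of m] by (elim exE) (rule that)
      have "dist (q (1 / Suc i) p) (q (1 / Suc j) p) < e" if "i \<ge> Suc n" "j \<ge> Suc n" for i j
      proof -
        have "\<bar>q (1 / Suc i) p - q (1 / Suc j) p\<bar> \<le> 1 / Suc m"
          using n inv[of i] inv[of j] small[of n i] small[of n j] that by auto
        then show ?thesis using m by (simp add: dist_real_def inverse_eq_divide)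
      qed
      then show "\<exists>M. \<forall>i\<ge>M. \<forall>j\<ge>M. dist (q (1 / Suc i) p) (q (1 / Suc j) p) < e" by blast
    qed
    then have lim: "(\<lambda>i. q (1 / Suc i) p) \<longlonglongrightarrow> G p"
      unfolding G_def by (simp add: Cauchy_convergent_iff convergent_LIMSEQ_iff)
    show ?thesis
      unfolding DERIV_def
    proof (rule LIM_I)
      fix e :: real assume "e > 0"
      then obtain m where m: "inverse (real (Suc m)) < e" using reals_Archimedean by blast
      obtain n where n: "\<forall>h k::real. h \<noteq> 0 \<and> \<bar>h\<bar> < 1 / Suc n \<and> k \<in> \<rat> \<and> k \<noteq> 0 \<and> \<bar>k\<bar> < 1 / Suc n
         \<longrightarrow> \<bar>q h p - q k p\<bar> \<le> 1 / Suc m" using R[of m] by (elim exE) (rule that)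
      show "\<exists>s>0. \<forall>h. h \<noteq> 0 \<and> norm (h - 0) < s \<longrightarrow> norm ((F (fst p, snd p + h) - F (fst p, snd p)) / h - G p) < e"
      proof (intro exI[of _ "1 / Suc n"] conjI allI impI)
        fix h :: real assume h: "h \<noteq> 0 \<and> norm (h - 0) < 1 / Suc n"
        have "(\<lambda>i. \<bar>q h p - q (1 / Suc i) p\<bar>) \<longlonglongrightarrow> \<bar>q h p - G p\<bar>" by (intro tendsto_intros lim)
        moreover have "\<bar>q h p - q (1 / Suc i) p\<bar> \<le> 1 / Suc m" if "i \<ge> Suc n" for i
          using n h inv[of i] small[of n i] that by auto
        ultimately have "\<bar>q h p - G p\<bar> \<le> 1 / Suc m" by (intro LIMSEQ_le_const2) auto
        then show "norm ((F (fst p, snd p + h) - F (fst p, snd p)) / h - G p) < e"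
          using m by (simp add: q_def inverse_eq_divide)
      qed simp
    qed
  qed
  have in\<Gamma>: "p \<in> \<Gamma>" if d: "((\<lambda>y. F (fst p, y)) has_real_derivative d) (at (snd p))" for p d
    unfolding \<Gamma>_def
  proof (intro CollectI allI)
    fix m :: nat
    have lim: "((\<lambda>h. (F (fst p, snd p + h) - F (fst p, snd p)) / h) \<longlongrightarrow> d) (at 0)" using d by (simp add: DERIV_def)
    have "1 / (2 * real (Suc m)) > 0" by simp
    from LIM_D[OF lim this] obtain s where s: "s > 0" "\<And>h. h \<noteq> 0 \<Longrightarrow> \<bar>h\<bar> < s \<Longrightarrow> \<bar>q h p - d\<bar> < 1 / (2 * real (Suc m))"
      by (auto simp: q_def)
    obtain n where n: "inverse (real (Suc n)) < s" using reals_Archimedean[OF s(1)] by blast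
    show "\<exists>n::nat. \<forall>h k::rat. 0 < \<bar>real_of_rat h\<bar> \<and> \<bar>real_of_rat h\<bar> < 1 / Suc n \<and> 0 < \<bar>real_of_rat k\<bar> \<and> \<bar>real_of_rat k\<bar> < 1 / Suc n
     \<longrightarrow> \<bar>q (real_of_rat h) p - q (real_of_rat k) p\<bar> \<le> 1 / Suc m"
    proof (intro exI[of _ n] allI impI)
      fix h k :: rat assume hk: "0 < \<bar>real_of_rat h\<bar> \<and> \<bar>real_of_rat h\<bar> < 1 / Suc n \<and> 0 < \<bar>real_of_rat k\<bar> \<and> \<bar>real_of_rat k\<bar> < 1 / Suc n"
      have "\<bar>q (real_of_rat h) p - d\<bar> < 1 / (2 * real (Suc m))" "\<bar>q (real_of_rat k) p - d\<bar> < 1 / (2 * real (Suc m))"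
      proof -
        have "1 / real (Suc n) < s" using n by (simp add: inverse_eq_divide)
        then have "\<bar>real_of_rat h\<bar> < s" "\<bar>real_of_rat k\<bar> < s" using hk by linarith+
        moreover have "real_of_rat h \<noteq> 0" "real_of_rat k \<noteq> 0" using hk by auto
        ultimately show "\<bar>q (real_of_rat h) p - d\<bar> < 1 / (2 * real (Suc m))" "\<bar>q (real_of_rat k) p - d\<bar> < 1 / (2 * real (Suc m))"
          using s(2) by blast+
      qed
      moreover have "1 / (2 * real (Suc m)) + 1 / (2 * real (Suc m)) = 1 / real (Suc m)" by (simp add: field_simps)
      moreover have "\<bar>x - y\<bar> \<le> b" if "\<bar>x - z\<bar> < a" "\<bar>y - z\<bar> < a" "a + a = b" for x y z a b :: real
        using that by linarith
      ultimately show "\<bar>q (real_of_rat h) p - q (real_of_rat k) p\<bar> \<le> 1 / Suc m" by blast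
    qed
  qed
  \<comment> \<open>Measurability of \<open>\<Gamma>\<close> allows its complement to be recognised
    as null section by section.\<close>
  have "AE p in lborel \<Otimes>\<^sub>M lborel. snd p \<in> {a<..<b} \<longrightarrow> p \<in> \<Gamma>"
  proof (rule lborel_pair.AE_pair_measure)
    have [measurable]: "\<Gamma> \<in> sets (borel \<Otimes>\<^sub>M borel)" using \<Gamma>m unfolding borel_prod .
    show "{p \<in> space (lborel \<Otimes>\<^sub>M lborel). snd p \<in> {a<..<b} \<longrightarrow> p \<in> \<Gamma>} \<in> sets (lborel \<Otimes>\<^sub>M lborel)"
      by measurable
    show "AE t in lborel. AE x in lborel. snd (t, x) \<in> {a<..<b} \<longrightarrow> (t, x) \<in> \<Gamma>"
    proof (rule AE_I2)
      fix t
      show "AE x in lborel. snd (t, x) \<in> {a<..<b} \<longrightarrow> (t, x) \<in> \<Gamma>"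
        using D[of t] by eventually_elim (use in\<Gamma>[of "(t, _)"] in auto)
    qed
  qed
  then have "AE p in lborel. snd p \<in> {a<..<b} \<longrightarrow> p \<in> \<Gamma>" unfolding lborel_prod .
  then have "AE p in lborel. snd p \<in> {a<..<b} \<longrightarrow> ((\<lambda>y. F (fst p, y)) has_real_derivative G p) (at (snd p))"
    by eventually_elim (use DG in auto)
  then show ?thesis by (rule that[OF Gm])
qed

text \<open>A Lebesgue measurable function on the plane has measurable sections only for almost
  every t. A Borel representative is integrated instead, and the bound B on the section integrals
  supplies integrability.\<close>

lemma Fubini_lebesgue:
  fixes g :: "real \<times> real \<Rightarrow> real" and B :: "real \<Rightarrow> ennreal"
  assumes g: "g \<in> borel_measurable lebesgue" and B: "(\<integral>\<^sup>+t. B t \<partial>lebesgue) < \<infinity>"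
    and le: "AE t in lebesgue. (\<integral>\<^sup>+x. ennreal \<bar>g (t, x)\<bar> \<partial>lebesgue) \<le> B t"
  shows "integrable lebesgue g"
    and "integrable lebesgue (\<lambda>t. LINT x|lebesgue. g (t, x))"
    and "integral\<^sup>L lebesgue g = (LINT t|lebesgue. LINT x|lebesgue. g (t, x))"
proof -
  obtain g' where g': "g' \<in> borel_measurable lborel" "AE p in lborel. g p = g' p"
    using completion_ex_borel_measurable_real[OF g] by auto
  have [measurable]: "g' \<in> borel_measurable borel" "g' \<in> borel_measurable (borel \<Otimes>\<^sub>M borel)"
    using g'(1) unfolding borel_prod by simp_all
  have "AE p in lborel \<Otimes>\<^sub>M lborel. g p = g' p" using g'(2) unfolding lborel_prod .
  then have "AE t in lborel. AE x in lborel. g (t, x) = g' (t, x)" by (rule lborel_pair.AE_pair)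
  then have eq: "AE t in lebesgue. AE x in lebesgue. g (t, x) = g' (t, x)" by (simp add: AE_completion_iff)
  have sect [measurable]: "(\<lambda>x. g' (t, x)) \<in> borel_measurable borel" for t by measurable
  have "(\<integral>\<^sup>+p. ennreal \<bar>g' p\<bar> \<partial>(lborel \<Otimes>\<^sub>M lborel)) = (\<integral>\<^sup>+t. \<integral>\<^sup>+x. ennreal \<bar>g' (t, x)\<bar> \<partial>lborel \<partial>lborel)"
    by (rule lborel.nn_integral_fst[symmetric]) measurable
  also have "\<dots> = (\<integral>\<^sup>+t. \<integral>\<^sup>+x. ennreal \<bar>g' (t, x)\<bar> \<partial>lborel \<partial>lebesgue)"
    by (subst nn_integral_completion) auto
  also have "\<dots> \<le> (\<integral>\<^sup>+t. B t \<partial>lebesgue)"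
  proof (rule nn_integral_mono_AE)
    show "AE t in lebesgue. (\<integral>\<^sup>+x. ennreal \<bar>g' (t, x)\<bar> \<partial>lborel) \<le> B t"
      using eq le
    proof eventually_elim
      case (elim t)
      have "(\<integral>\<^sup>+x. ennreal \<bar>g' (t, x)\<bar> \<partial>lborel) = (\<integral>\<^sup>+x. ennreal \<bar>g' (t, x)\<bar> \<partial>lebesgue)"
        by (subst nn_integral_completion) auto
      also have "\<dots> = (\<integral>\<^sup>+x. ennreal \<bar>g (t, x)\<bar> \<partial>lebesgue)"
        using elim(1) by (intro nn_integral_cong_AE) (auto elim: eventually_mono)
      finally show ?case using elim by simp
    qed
  qed
  finally have gi: "integrable (lborel \<Otimes>\<^sub>M lborel) g'"
    using B by (intro integrableI_bounded) auto
  then have gi': "integrable lborel g'" unfolding lborel_prod .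
  then have gi'': "integrable lebesgue g'" by (simp add: integrable_completion)
  have AEp: "AE p in lebesgue. g p = g' p" using g'(2) by (simp add: AE_completion_iff)
  show "integrable lebesgue g"
    using integrable_cong_AE[OF g _ AEp] gi'' by auto
  have I: "AE t in lebesgue. (LINT x|lebesgue. g (t, x)) = (LINT x|lborel. g' (t, x))"
    using eq
  proof eventually_elim
    case (elim t)
    have gm: "(\<lambda>x. g (t, x)) \<in> borel_measurable lebesgue"
      by (rule borel_measurable_AE[of "\<lambda>x. g' (t, x)"]) (use elim in \<open>auto simp: measurable_completion elim: eventually_mono\<close>)
    have "(LINT x|lebesgue. g (t, x)) = (LINT x|lebesgue. g' (t, x))"
      by (rule integral_cong_AE[OF gm _ elim]) (simp add: measurable_completion)
    also have "\<dots> = (LINT x|lborel. g' (t, x))" by (rule integral_lebesgue_eq_lborel) simp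
    finally show ?case .
  qed
  have Ii: "integrable lborel (\<lambda>t. LINT x|lborel. g' (t, x))"
    by (rule lborel_pair.integrable_fst'[OF gi])
  then have Im: "(\<lambda>t. LINT x|lborel. g' (t, x)) \<in> borel_measurable borel" by auto
  have Ii': "integrable lebesgue (\<lambda>t. LINT x|lborel. g' (t, x))" using Ii by (simp add: integrable_completion)
  have Gm: "(\<lambda>t. LINT x|lebesgue. g (t, x)) \<in> borel_measurable lebesgue"
    by (rule borel_measurable_AE[of "\<lambda>t. LINT x|lborel. g' (t, x)"])
      (use I Ii' in \<open>auto elim: eventually_mono\<close>)
  show "integrable lebesgue (\<lambda>t. LINT x|lebesgue. g (t, x))"
    using integrable_cong_AE[OF Gm _ I] Ii' by auto
  have "integral\<^sup>L lebesgue g = integral\<^sup>L lebesgue g'" by (rule integral_cong_AE[OF g _ AEp]) (use gi'' in auto)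
  also have "\<dots> = integral\<^sup>L lborel g'" by (rule integral_lebesgue_eq_lborel) simp
  also have "\<dots> = integral\<^sup>L (lborel \<Otimes>\<^sub>M lborel) g'" unfolding lborel_prod ..
  also have "\<dots> = (LINT t|lborel. LINT x|lborel. g' (t, x))"
    by (rule lborel_pair.integral_fst'[OF gi, symmetric])
  also have "\<dots> = (LINT t|lebesgue. LINT x|lborel. g' (t, x))"
    by (rule integral_lebesgue_eq_lborel[symmetric, OF Im])
  also have "\<dots> = (LINT t|lebesgue. LINT x|lebesgue. g (t, x))"
    by (rule integral_cong_AE[OF _ Gm]) (use I Ii' in \<open>auto elim: eventually_mono\<close>)
  finally show "integral\<^sup>L lebesgue g = (LINT t|lebesgue. LINT x|lebesgue. g (t, x))" .
qed

section \<open>Weak solutions of the degenerate wave equation\<close>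

text \<open>A ramp from 1 to 0 on [s,s+d]. Used as a test function in time, its derivative averages
  the velocity over the ramp, and d -> 0 isolates the time s.\<close>

definition cutoff :: "real \<Rightarrow> real \<Rightarrow> real \<Rightarrow> real" where
  "cutoff s d t = max 0 (min 1 ((s + d - t) / d))"

lemma cutoff_le: "0 \<le> cutoff s d t" "cutoff s d t \<le> 1"
  by (auto simp: cutoff_def)

lemma cutoff_eq: "d > 0 \<Longrightarrow> t \<le> s \<Longrightarrow> cutoff s d t = 1" "d > 0 \<Longrightarrow> s + d \<le> t \<Longrightarrow> cutoff s d t = 0"
  by (auto simp: cutoff_def field_simps min_def max_def)

lemma continuous_on_cutoff: "d > 0 \<Longrightarrow> continuous_on A (cutoff s d)"
  unfolding cutoff_def by (intro continuous_intros) auto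

text \<open>The ramp as a primitive of its derivative, in the shape that \<open>test_fun\<close>
  asks for.\<close>

lemma cutoff_integral:
  assumes "d > 0" "0 \<le> s" "0 \<le> t"
  shows "cutoff s d t = cutoff s d 0 + (LINT r:{0..t}|lebesgue. - (1 / d) * indicator {s<..<s + d} r)"
proof -
  define A where "A = {0..t} \<inter> {s<..<s + d}"
  have "(LINT r:{0..t}|lebesgue. - (1 / d) * indicator {s<..<s + d} r) = (LINT r|lebesgue. - (1 / d) * indicator A r)"
    unfolding set_lebesgue_integral_def A_def
    by (rule Bochner_Integration.integral_cong) (auto simp: indicator_def)
  also have "\<dots> = - (1 / d) * measure lebesgue A" by (simp add: A_def)
  also have "measure lebesgue A = max 0 (min t (s + d) - s)"
  proof -
    consider "t \<le> s" | "s < t" "t < s + d" | "s + d \<le> t" by linarith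
    then show ?thesis
    proof cases
      case 1
      then have "A = {}" using assms by (auto simp: A_def)
      then show ?thesis using 1 by simp
    next
      case 2
      then have "A = {s<..t}" using assms by (auto simp: A_def)
      then show ?thesis using 2 by simp
    next
      case 3
      then have "A = {s<..<s + d}" using assms by (auto simp: A_def)
      then show ?thesis using 3 assms by simp
    qed
  qed
  also have "cutoff s d 0 + - (1 / d) * max 0 (min t (s + d) - s) = cutoff s d t"
    using assms by (auto simp: cutoff_def min_def max_def field_simps)
  finally show ?thesis by simp
qed

locale wave =
  fixes T \<alpha> :: real and f :: "real \<Rightarrow> real \<Rightarrow> real" and u0 u1 :: "real \<Rightarrow> real" and u v :: "real \<Rightarrow> real \<Rightarrow> real"
  assumes T_pos: "0 < T" and \<alpha>_pos: "0 < \<alpha>"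
    and u0: "H1a \<alpha> u0" and u1: "in_L2 u1" and f: "in_L1L2 T f"
    and uH: "\<And>t. t \<in> {0..T} \<Longrightarrow> H1a \<alpha> (u t)"
    and u_cont: "\<And>t0. t0 \<in> {0..T} \<Longrightarrow> ((\<lambda>t. H1norm \<alpha> (\<lambda>x. u t x - u t0 x)) \<longlongrightarrow> 0) (at t0 within {0..T})"
    and u_init: "\<And>x. x \<in> {0<..1} \<Longrightarrow> u 0 x = u0 x"
    and v_meas: "set_borel_measurable lebesgue (Qset T) (\<lambda>p. v (fst p) (snd p))"
    and vL2: "\<And>t. t \<in> {0..T} \<Longrightarrow> in_L2 (v t)"
    and v_deriv: "\<And>t0. t0 \<in> {0..T} \<Longrightarrow>
       ((\<lambda>t. L2norm (\<lambda>x. (u t x - u t0 x) / (t - t0) - v t0 x)) \<longlongrightarrow> 0) (at t0 within {0..T})"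
    and v_cont: "\<And>t0. t0 \<in> {0..T} \<Longrightarrow> ((\<lambda>t. L2norm (\<lambda>x. v t x - v t0 x)) \<longlongrightarrow> 0) (at t0 within {0..T})"
    and weak: "\<And>\<phi> \<psi>. test_fun \<alpha> T \<phi> \<psi> \<Longrightarrow>
           (LINT p:Qset T|lebesgue. - v (fst p) (snd p) * \<psi> (fst p) (snd p)
               + (snd p) powr \<alpha> * deriv (u (fst p)) (snd p) * deriv (\<phi> (fst p)) (snd p))
           - (LINT x:{0<..<1}|lebesgue. u1 x * \<phi> 0 x)
           = (LINT p:Qset T|lebesgue. f (fst p) (snd p) * \<phi> (fst p) (snd p))"
begin

section \<open>The solution as curves in L2\<close>

definition "U t = mk_l2 (ext01 (u t))"
definition "V t = mk_l2 (ext01 (v t))"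
definition "W t = mk_l2 (wderiv \<alpha> (u t))"

lemma u_sq: "t \<in> {0..T} \<Longrightarrow> sq_int (ext01 (u t))" "t \<in> {0..T} \<Longrightarrow> sq_int (wderiv \<alpha> (u t))"
  and v_sq: "t \<in> {0..T} \<Longrightarrow> sq_int (ext01 (v t))"
  using H1a_sq_int[OF uH] vL2 by (auto simp: in_L2_iff_sq_int)

lemma W_cont: "continuous_on {0..T} W"
  unfolding continuous_on_def
proof
  fix t0 assume t0: "t0 \<in> {0..T}"
  have "((\<lambda>t. W t - W t0) \<longlongrightarrow> 0) (at t0 within {0..T})"
  proof (rule Lim_null_comparison[OF _ u_cont[OF t0]])
    show "\<forall>\<^sub>F t in at t0 within {0..T}. norm (W t - W t0) \<le> H1norm \<alpha> (\<lambda>x. u t x - u t0 x)"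
      unfolding eventually_at_filter
    proof (intro always_eventually allI impI)
      fix t assume t: "t \<in> {0..T}"
      have "(norm (W t - W t0))\<^sup>2 \<le> (H1norm \<alpha> (\<lambda>x. u t x - u t0 x))\<^sup>2"
        using H1a_diff(2,3)[OF uH[OF t] uH[OF t0]] unfolding H1norm_sq[OF H1a_diff(1)[OF uH[OF t] uH[OF t0]]]
        by (simp add: W_def)
      then show "norm (W t - W t0) \<le> H1norm \<alpha> (\<lambda>x. u t x - u t0 x)"
        by (rule power2_le_imp_le) (simp add: H1norm_def)
    qed
  qed
  then show "(W \<longlongrightarrow> W t0) (at t0 within {0..T})" by (simp add: LIM_zero_iff)
qed

lemma V_cont: "continuous_on {0..T} V"
  unfolding continuous_on_def
proof
  fix t0 assume t0: "t0 \<in> {0..T}"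
  have "((\<lambda>t. V t - V t0) \<longlongrightarrow> 0) (at t0 within {0..T})"
  proof (rule Lim_null_comparison[OF _ v_cont[OF t0]])
    show "\<forall>\<^sub>F t in at t0 within {0..T}. norm (V t - V t0) \<le> L2norm (\<lambda>x. v t x - v t0 x)"
      unfolding eventually_at_filter
    proof (intro always_eventually allI impI)
      fix t assume t: "t \<in> {0..T}"
      have e: "ext01 (\<lambda>x. v t x - v t0 x) = (\<lambda>x. ext01 (v t) x - ext01 (v t0) x)"
        by (auto simp: ext01_def algebra_simps)
      have "in_L2 (\<lambda>x. v t x - v t0 x)"
        unfolding in_L2_iff_sq_int e by (intro sq_int_diff v_sq t t0)
      then show "norm (V t - V t0) \<le> L2norm (\<lambda>x. v t x - v t0 x)"
        by (simp add: L2norm_eq_norm e V_def mk_l2_diff v_sq[OF t] v_sq[OF t0])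
    qed
  qed
  then show "(V \<longlongrightarrow> V t0) (at t0 within {0..T})" by (simp add: LIM_zero_iff)
qed

lemma U_deriv: 
  assumes t0: "t0 \<in> {0..T}"
  shows "(U has_vector_derivative V t0) (at t0 within {0..T})"
proof -
  have "((\<lambda>t. (U t - U t0) /\<^sub>R (t - t0) - V t0) \<longlongrightarrow> 0) (at t0 within {0..T})"
  proof (rule Lim_null_comparison[OF _ v_deriv[OF t0]])
    show "\<forall>\<^sub>F t in at t0 within {0..T}. norm ((U t - U t0) /\<^sub>R (t - t0) - V t0) \<le> L2norm (\<lambda>x. (u t x - u t0 x) / (t - t0) - v t0 x)"
      unfolding eventually_at_filter
    proof (intro always_eventually allI impI)
      fix t assume t: "t \<in> {0..T}"
      have e: "ext01 (\<lambda>x. (u t x - u t0 x) / (t - t0) - v t0 x) = (\<lambda>x. inverse (t - t0) * (ext01 (u t) x - ext01 (u t0) x) - ext01 (v t0) x)"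
        by (auto simp: ext01_def indicator_def divide_inverse)
      have s: "sq_int (\<lambda>x. inverse (t - t0) * (ext01 (u t) x - ext01 (u t0) x) - ext01 (v t0) x)"
        by (intro sq_int_diff sq_int_scale u_sq[OF t] u_sq[OF t0] v_sq[OF t0])
      then have "in_L2 (\<lambda>x. (u t x - u t0 x) / (t - t0) - v t0 x)" by (simp add: in_L2_iff_sq_int e)
      then show "norm ((U t - U t0) /\<^sub>R (t - t0) - V t0) \<le> L2norm (\<lambda>x. (u t x - u t0 x) / (t - t0) - v t0 x)"
        by (simp add: L2norm_eq_norm e U_def V_def mk_l2_diff mk_l2_scaleR sq_int_diff sq_int_scale u_sq[OF t] u_sq[OF t0] v_sq[OF t0])
    qed
  qed
  then show ?thesis unfolding has_vector_derivative_iff_quotient by (simp add: LIM_zero_iff)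
qed

text \<open>By \<open>H1a_pointwise_norm_bound\<close>, convergence of u(t) in the energy norm is
  uniform on [c,1]. Clamping both arguments gives a continuous function on the whole plane, as
  \<open>partial_derivative_measurable\<close> requires.\<close>

lemma u_jointly_continuous:
  assumes c: "0 < c" "c < 1"
  shows "continuous_on UNIV (\<lambda>p. u (max 0 (min T (fst p))) (max c (min 1 (snd p))))"
proof -
  have "continuous_on ({0..T} \<times> {c..1}) (\<lambda>p. u (fst p) (snd p))"
    unfolding continuous_on_def
  proof
    fix p0 assume p0: "p0 \<in> {0..T} \<times> {c..1}"
    let ?A = "at p0 within {0..T} \<times> {c..1}"
    obtain t0 x0 where tx: "p0 = (t0, x0)" "t0 \<in> {0..T}" "x0 \<in> {c..1}" using p0 by auto
    have ev: "\<forall>\<^sub>F p in ?A. p \<in> {0..T} \<times> {c..1}" by (auto simp: eventually_at_filter)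
    have lf: "(fst \<longlongrightarrow> t0) ?A" "(snd \<longlongrightarrow> x0) ?A"
      using tx tendsto_fst[OF tendsto_ident_at[of p0 "{0..T} \<times> {c..1}"]] tendsto_snd[OF tendsto_ident_at[of p0 "{0..T} \<times> {c..1}"]]
      by (simp_all add: tx)
    have "((\<lambda>p. W (fst p)) \<longlongrightarrow> W t0) ?A"
      by (rule continuous_on_tendsto_compose[OF W_cont lf(1) tx(2)]) (use ev in \<open>auto elim: eventually_mono\<close>)
    then have W0: "((\<lambda>p. c powr (- \<alpha> / 2) * norm (W (fst p) - W t0)) \<longlongrightarrow> c powr (- \<alpha> / 2) * norm (W t0 - W t0)) ?A"
      by (intro tendsto_intros)
    have "((\<lambda>p. u (fst p) (snd p) - u t0 (snd p)) \<longlongrightarrow> 0) ?A"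
    proof (rule Lim_null_comparison)
      show "((\<lambda>p. c powr (- \<alpha> / 2) * norm (W (fst p) - W t0)) \<longlongrightarrow> 0) ?A" using W0 by simp
      show "\<forall>\<^sub>F p in ?A. norm (u (fst p) (snd p) - u t0 (snd p)) \<le> c powr (- \<alpha> / 2) * norm (W (fst p) - W t0)"
        using ev
      proof eventually_elim
        case (elim p)
        then have t: "fst p \<in> {0..T}" and x: "c \<le> snd p" "snd p \<le> 1" by auto
        show ?case
          using H1a_pointwise_norm_bound[OF H1a_diff(1)[OF uH[OF t] uH[OF tx(2)]] \<alpha>_pos c x]
          by (simp add: W_def H1a_diff(3)[OF uH[OF t] uH[OF tx(2)]])
      qed
    qed
    moreover have "((\<lambda>p. u t0 (snd p)) \<longlongrightarrow> u t0 x0) ?A"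
      by (rule continuous_on_tendsto_compose[OF abs_cont_on_imp_continuous_on[OF H1a_abs_cont_on[OF uH[OF tx(2)] c(1)]] lf(2) tx(3)])
        (use ev in \<open>auto elim: eventually_mono\<close>)
    ultimately have "((\<lambda>p. (u (fst p) (snd p) - u t0 (snd p)) + u t0 (snd p)) \<longlongrightarrow> 0 + u t0 x0) ?A"
      by (rule tendsto_add)
    then show "((\<lambda>p. u (fst p) (snd p)) \<longlongrightarrow> u (fst p0) (snd p0)) ?A" by (simp add: tx)
  qed
  then have "continuous_on UNIV (\<lambda>p. (\<lambda>p. u (fst p) (snd p)) (max 0 (min T (fst p)), max c (min 1 (snd p))))"
    by (rule continuous_on_compose2) (use c T_pos in \<open>auto intro!: continuous_intros\<close>)
  then show ?thesis by simp
qed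

text \<open>Fubini calls for u_x measurable in both variables, while a weak solution provides each
  u(t) separately. On (c,1) this follows from joint continuity and
  \<open>partial_derivative_measurable\<close>; the numbers c = 1/(n+2) tend to 0.\<close>

lemma deriv_jointly_measurable:
  "(\<lambda>p. indicator (Qset T) p * deriv (u (fst p)) (snd p)) \<in> borel_measurable lebesgue"
proof -
  define c where "c n = 1 / real (n + 2)" for n :: nat
  have c: "0 < c n" "c n < 1" for n by (auto simp: c_def)
  let ?Q = "\<lambda>n. {0<..<T} \<times> {c n<..<1}"
  have m: "(\<lambda>p. indicator (?Q n) p * deriv (u (fst p)) (snd p)) \<in> borel_measurable lebesgue" for n
  proof -
    define F where "F p = u (max 0 (min T (fst p))) (max (c n) (min 1 (snd p)))" for p :: "real \<times> real"
    have Fc: "continuous_on UNIV F" unfolding F_def by (rule u_jointly_continuous[OF c])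
    have loc: "((\<lambda>y. F (t, y)) has_real_derivative d) (at x) \<longleftrightarrow> (u (max 0 (min T t)) has_real_derivative d) (at x)"
      if x: "x \<in> {c n<..<1}" for t x d
    proof (rule DERIV_cong_ev[OF refl _ refl])
      have "\<forall>\<^sub>F y in nhds x. y \<in> {c n<..<1}" by (rule eventually_nhds_in_open) (use x in auto)
      then show "\<forall>\<^sub>F y in nhds x. F (t, y) = u (max 0 (min T t)) y"
        by eventually_elim (auto simp: F_def)
    qed
    obtain G where G: "G \<in> borel_measurable borel"
      "AE p in lborel. snd p \<in> {c n<..<1} \<longrightarrow> ((\<lambda>y. F (fst p, y)) has_real_derivative G p) (at (snd p))"
    proof (rule partial_derivative_measurable[OF Fc])
      fix t
      have "max 0 (min T t) \<in> {0..T}" using T_pos by auto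
      from H1a_AE_deriv[OF uH[OF this]]
      have "AE x in lborel. x \<in> {0<..<1} \<longrightarrow> (u (max 0 (min T t)) has_real_derivative deriv (u (max 0 (min T t))) x) (at x)"
        by (simp add: AE_completion_iff)
      then show "AE x in lborel. x \<in> {c n<..<1} \<longrightarrow> (\<exists>d. ((\<lambda>y. F (t, y)) has_real_derivative d) (at x))"
      proof eventually_elim
        case (elim x)
        then show ?case using loc[of x t] c[of n] by auto
      qed
    qed
    have "AE p in lborel. indicator (?Q n) p * G p = indicator (?Q n) p * deriv (u (fst p)) (snd p)"
      using G(2)
    proof eventually_elim
      case (elim p)
      show ?case
      proof (cases "p \<in> ?Q n")
        case True
        then have "(u (fst p) has_real_derivative G p) (at (snd p))"
          using elim loc[of "snd p" "fst p" "G p"] by (auto simp: min_def max_def mem_Times_iff)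
        then show ?thesis by (simp add: DERIV_imp_deriv)
      qed simp
    qed
    then have AE: "AE p in lebesgue. indicator (?Q n) p * G p = indicator (?Q n) p * deriv (u (fst p)) (snd p)"
      by (simp add: AE_completion_iff)
    have "?Q n \<in> sets borel" by (intro borel_open open_Times) auto
    then have "(\<lambda>p. indicator (?Q n) p * G p) \<in> borel_measurable lebesgue"
      using G(1) by (intro measurable_completion borel_measurable_times borel_measurable_indicator) auto
    then show ?thesis by (rule borel_measurable_AE) (rule AE)
  qed
  have "(\<lambda>n. indicator (?Q n) p * deriv (u (fst p)) (snd p)) \<longlonglongrightarrow> indicator (Qset T) p * deriv (u (fst p)) (snd p)" for p
  proof (rule tendsto_eventually, cases "snd p > 0")
    case True
    then obtain N :: nat where N: "inverse (real (Suc N)) < snd p" using reals_Archimedean by blast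
    show "\<forall>\<^sub>F n in sequentially. indicator (?Q n) p * deriv (u (fst p)) (snd p) = indicator (Qset T) p * deriv (u (fst p)) (snd p)"
      using eventually_ge_at_top[of N]
    proof eventually_elim
      case (elim n)
      then have "c n \<le> inverse (real (Suc N))" by (simp add: c_def field_simps)
      then have "c n < snd p" using N by linarith
      then show ?case using True by (auto simp: Qset_def indicator_def mem_Times_iff)
    qed
  next
    case False
    have "p \<notin> ?Q n" "p \<notin> Qset T" for n using False c[of n] by (auto simp: Qset_def mem_Times_iff)
    then show "\<forall>\<^sub>F n in sequentially. indicator (?Q n) p * deriv (u (fst p)) (snd p) = indicator (Qset T) p * deriv (u (fst p)) (snd p)"
      by simp
  qed
  then show ?thesis by (rule borel_measurable_LIMSEQ_real[OF _ m])
qed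

end

section \<open>Integrals over the space-time rectangle\<close>

lemma AE_lborel_snd:
  assumes "AE x in lborel. P (x::real)"
  shows "AE p in lborel. P (snd (p :: real \<times> real))"
proof -
  obtain N where N: "N \<in> null_sets lborel" "{x. \<not> P x} \<subseteq> N" using assms by (auto simp: eventually_ae_filter)
  have [measurable]: "N \<in> sets borel" using N by auto
  have "AE p in lborel \<Otimes>\<^sub>M lborel. snd p \<notin> N"
  proof (rule lborel_pair.AE_pair_measure)
    show "{p \<in> space (lborel \<Otimes>\<^sub>M lborel). snd p \<notin> N} \<in> sets (lborel \<Otimes>\<^sub>M lborel)" by measurable
    show "AE t in lborel. AE x in lborel. snd (t, x) \<notin> N"
      using AE_not_in[OF N(1)] by simp
  qed
  then have "AE p in lborel. snd (p :: real \<times> real) \<notin> N" unfolding lborel_prod .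
  then show ?thesis by eventually_elim (use N in auto)
qed

lemma measurable_snd_lebesgue:
  assumes "h \<in> borel_measurable lebesgue"
  shows "(\<lambda>p :: real \<times> real. h (snd p) :: real) \<in> borel_measurable lebesgue"
proof -
  obtain h' where h': "h' \<in> borel_measurable lborel" "AE x in lborel. h x = h' x"
    using completion_ex_borel_measurable_real[OF assms] by auto
  have [measurable]: "h' \<in> borel_measurable borel" using h' by simp
  have "(\<lambda>p :: real \<times> real. h' (snd p)) \<in> borel_measurable (borel \<Otimes>\<^sub>M borel)" by measurable
  then have "(\<lambda>p :: real \<times> real. h' (snd p)) \<in> borel_measurable borel" unfolding borel_prod .
  then have m: "(\<lambda>p :: real \<times> real. h' (snd p)) \<in> borel_measurable lebesgue"
    by (intro measurable_completion) simp
  have "AE p in lborel. h' (snd (p :: real \<times> real)) = h (snd p)"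
    using AE_lborel_snd[OF h'(2)] by eventually_elim simp
  then have "AE p in lebesgue. h' (snd (p :: real \<times> real)) = h (snd p)" by (simp add: AE_completion_iff)
  then show ?thesis by (rule borel_measurable_AE[OF m])
qed

lemma measurable_fst_borel_lebesgue:
  assumes "h \<in> borel_measurable borel"
  shows "(\<lambda>p :: real \<times> real. h (fst p) :: real) \<in> borel_measurable lebesgue"
proof -
  have "(\<lambda>p :: real \<times> real. h (fst p)) \<in> borel_measurable borel"
    using measurable_compose[OF measurable_fst assms, of "borel :: real measure"] unfolding borel_prod .
  then show ?thesis by (intro measurable_completion) simp
qed

lemma nn_integral_Cauchy_Schwarz:
  assumes f: "sq_int f" and g: "sq_int g"
  shows "(\<integral>\<^sup>+x. ennreal \<bar>f x * g x\<bar> \<partial>lebesgue) \<le> ennreal (norm (mk_l2 f) * norm (mk_l2 g))"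
proof -
  have a: "sq_int (\<lambda>x. \<bar>h x\<bar>)" "norm (mk_l2 (\<lambda>x. \<bar>h x\<bar>)) = norm (mk_l2 h)" if "sq_int h" for h
  proof -
    show s: "sq_int (\<lambda>x. \<bar>h x\<bar>)" using that by (auto simp: sq_int_def)
    have "(norm (mk_l2 (\<lambda>x. \<bar>h x\<bar>)))\<^sup>2 = (norm (mk_l2 h))\<^sup>2" using s that by (simp add: norm_mk_l2)
    then show "norm (mk_l2 (\<lambda>x. \<bar>h x\<bar>)) = norm (mk_l2 h)" by (simp add: power2_eq_iff_nonneg)
  qed
  have "(\<integral>\<^sup>+x. ennreal \<bar>f x * g x\<bar> \<partial>lebesgue) = ennreal (LINT x|lebesgue. \<bar>f x * g x\<bar>)"
    by (rule nn_integral_eq_integral) (use sq_int_mult[OF f g] in auto)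
  also have "(LINT x|lebesgue. \<bar>f x * g x\<bar>) = inner (mk_l2 (\<lambda>x. \<bar>f x\<bar>)) (mk_l2 (\<lambda>x. \<bar>g x\<bar>))"
    using a f g by (simp add: inner_mk_l2 abs_mult)
  also have "\<dots> \<le> norm (mk_l2 f) * norm (mk_l2 g)"
    using norm_cauchy_schwarz[of "mk_l2 (\<lambda>x. \<bar>f x\<bar>)" "mk_l2 (\<lambda>x. \<bar>g x\<bar>)"] a f g by simp
  finally show ?thesis by (simp add: ennreal_leI)
qed

text \<open>Integrals over Q against product functions become time integrals of inner products. The
  majorant of the norm is merely integrable in time, so that one statement serves the velocity, the
  weighted derivative and the force.\<close>

lemma Q_integral:
  assumes F: "(\<lambda>p. indicator (Qset T) p * F (fst p) (snd p)) \<in> borel_measurable lebesgue"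
    and Fs: "AE t in lebesgue. t \<in> {0<..<T} \<longrightarrow> sq_int (ext01 (F t)) \<and> norm (mk_l2 (ext01 (F t))) \<le> nb t"
    and nb: "set_integrable lebesgue {0<..<T} nb"
    and h: "sq_int (ext01 h)"
    and \<theta>: "\<theta> \<in> borel_measurable borel" "\<And>t. \<bar>\<theta> t\<bar> \<le> C"
  shows "set_integrable lebesgue (Qset T) (\<lambda>p. \<theta> (fst p) * F (fst p) (snd p) * h (snd p))"
    and "set_integrable lebesgue {0<..<T} (\<lambda>t. \<theta> t * inner (mk_l2 (ext01 (F t))) (mk_l2 (ext01 h)))"
    and "(LINT p:Qset T|lebesgue. \<theta> (fst p) * F (fst p) (snd p) * h (snd p))
      = (LINT t:{0<..<T}|lebesgue. \<theta> t * inner (mk_l2 (ext01 (F t))) (mk_l2 (ext01 h)))"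
proof -
  define g where "g p = indicator (Qset T) p * (\<theta> (fst p) * F (fst p) (snd p) * h (snd p))" for p
  define K where "K = norm (mk_l2 (ext01 h))"
  have C: "C \<ge> 0" using \<theta>(2)[of 0] by linarith
  have "g = (\<lambda>p. \<theta> (fst p) * (indicator (Qset T) p * F (fst p) (snd p)) * ext01 h (snd p))"
    by (auto simp: g_def ext01_def Qset_def indicator_def fun_eq_iff)
  then have gm: "g \<in> borel_measurable lebesgue"
    using measurable_fst_borel_lebesgue[OF \<theta>(1)] F measurable_snd_lebesgue[OF sq_intD[OF h]] by simp
  have gtx: "g (t, x) = (indicator {0<..<T} t * \<theta> t) * (ext01 (F t) x * ext01 h x)" for t x
    by (auto simp: g_def ext01_def Qset_def indicator_def)
  define B where "B t = ennreal (C * K * \<bar>indicator {0<..<T} t * nb t\<bar>)" for t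
  have nbi: "integrable lebesgue (\<lambda>t. indicator {0<..<T} t * nb t)" using nb by (simp add: set_integrable_def)
  have B: "(\<integral>\<^sup>+t. B t \<partial>lebesgue) < \<infinity>"
  proof -
    have "integrable lebesgue (\<lambda>t. C * K * \<bar>indicator {0<..<T} t * nb t\<bar>)"
      by (intro integrable_mult_right integrable_abs nbi)
    moreover have "norm (C * K * \<bar>indicator {0<..<T} t * nb t\<bar>) = C * K * \<bar>indicator {0<..<T} t * nb t\<bar>" for t
      using C by (simp add: K_def abs_mult)
    ultimately show ?thesis unfolding B_def integrable_iff_bounded by simp
  qed
  have le: "AE t in lebesgue. (\<integral>\<^sup>+x. ennreal \<bar>g (t, x)\<bar> \<partial>lebesgue) \<le> B t"
    using Fs
  proof eventually_elim
    case (elim t)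
    show ?case
    proof (cases "t \<in> {0<..<T}")
      case True
      then have s: "sq_int (ext01 (F t))" and n: "norm (mk_l2 (ext01 (F t))) \<le> nb t" using elim by auto
      have "(\<integral>\<^sup>+x. ennreal \<bar>g (t, x)\<bar> \<partial>lebesgue) = (\<integral>\<^sup>+x. ennreal \<bar>\<theta> t\<bar> * ennreal \<bar>ext01 (F t) x * ext01 h x\<bar> \<partial>lebesgue)"
        using True by (intro nn_integral_cong) (simp add: gtx abs_mult ennreal_mult)
      also have "\<dots> = ennreal \<bar>\<theta> t\<bar> * (\<integral>\<^sup>+x. ennreal \<bar>ext01 (F t) x * ext01 h x\<bar> \<partial>lebesgue)"
        by (rule nn_integral_cmult) (use s h in measurable)
      also have "\<dots> \<le> ennreal C * ennreal (norm (mk_l2 (ext01 (F t))) * K)"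
        unfolding K_def by (intro mult_mono nn_integral_Cauchy_Schwarz s h ennreal_leI \<theta>) auto
      also have "\<dots> \<le> ennreal C * ennreal (nb t * K)"
        using n by (intro mult_left_mono ennreal_leI mult_right_mono) (auto simp: K_def)
      also have "\<dots> = ennreal (C * (nb t * K))" using C by (simp add: ennreal_mult')
      also have "\<dots> \<le> B t"
        unfolding B_def
      proof (rule ennreal_leI)
        have "C * (nb t * K) = C * K * nb t" by simp
        also have "\<dots> \<le> C * K * \<bar>nb t\<bar>" using C by (intro mult_left_mono) (auto simp: K_def)
        finally show "C * (nb t * K) \<le> C * K * \<bar>indicator {0<..<T} t * nb t\<bar>" using True by simp
      qed
      finally show ?thesis .
    qed (simp add: gtx)
  qed
  note fub = Fubini_lebesgue[OF gm B le]
  show "set_integrable lebesgue (Qset T) (\<lambda>p. \<theta> (fst p) * F (fst p) (snd p) * h (snd p))"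
    using fub(1) unfolding set_integrable_def g_def by simp
  have sec: "AE t in lebesgue. (LINT x|lebesgue. g (t, x)) = indicator {0<..<T} t *\<^sub>R (\<theta> t * inner (mk_l2 (ext01 (F t))) (mk_l2 (ext01 h)))"
    using Fs
  proof eventually_elim
    case (elim t)
    show ?case
    proof (cases "t \<in> {0<..<T}")
      case True
      then show ?thesis using elim h by (simp add: gtx inner_mk_l2)
    qed (simp add: gtx)
  qed
  have m: "(\<lambda>t. indicator {0<..<T} t *\<^sub>R (\<theta> t * inner (mk_l2 (ext01 (F t))) (mk_l2 (ext01 h)))) \<in> borel_measurable lebesgue"
    by (rule borel_measurable_AE[OF borel_measurable_integrable[OF fub(2)] sec])
  show "set_integrable lebesgue {0<..<T} (\<lambda>t. \<theta> t * inner (mk_l2 (ext01 (F t))) (mk_l2 (ext01 h)))"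
    unfolding set_integrable_def using integrable_cong_AE[OF borel_measurable_integrable[OF fub(2)] m sec] fub(2) by simp
  have "(LINT p:Qset T|lebesgue. \<theta> (fst p) * F (fst p) (snd p) * h (snd p)) = integral\<^sup>L lebesgue g"
    unfolding set_lebesgue_integral_def g_def by simp
  also have "\<dots> = (LINT t:{0<..<T}|lebesgue. \<theta> t * inner (mk_l2 (ext01 (F t))) (mk_l2 (ext01 h)))"
    unfolding fub(3) set_lebesgue_integral_def
    by (rule integral_cong_AE[OF borel_measurable_integrable[OF fub(2)] m sec])
  finally show "(LINT p:Qset T|lebesgue. \<theta> (fst p) * F (fst p) (snd p) * h (snd p))
      = (LINT t:{0<..<T}|lebesgue. \<theta> t * inner (mk_l2 (ext01 (F t))) (mk_l2 (ext01 h)))" .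
qed

lemma set_integral_Ioo_continuous:
  fixes g :: "real \<Rightarrow> real"
  assumes "continuous_on {a..b} g"
  shows "set_integrable lebesgue {a<..<b} g" "(LINT t:{a<..<b}|lebesgue. g t) = integral {a..b} g"
proof -
  have "set_integrable lebesgue {a..b} g" using absolutely_integrable_continuous_real[OF assms] .
  then show si: "set_integrable lebesgue {a<..<b} g" by (rule set_integrable_subset) auto
  show "(LINT t:{a<..<b}|lebesgue. g t) = integral {a..b} g"
    using set_lebesgue_integral_eq_integral(2)[OF si] integral_open_interval_real[of a b g] by simp
qed

context wave
begin

section \<open>The weak formulation in time\<close>

text \<open>Ramps in time multiplied by functions of space are the only test functions inserted into
  the weak formulation.\<close>

lemma test_fun_product:
  assumes w: "H1a \<alpha> w" and s: "0 \<le> s" and d: "0 < d" and sd: "s + d \<le> T"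
  shows "test_fun \<alpha> T (\<lambda>t x. cutoff s d t * w x) (\<lambda>t x. - (1 / d) * indicator {s<..<s + d} t * w x)"
proof -
  note sw = H1a_sq_int[OF w]
  have meas: "set_borel_measurable lebesgue (Qset T) (\<lambda>p. \<theta> (fst p) * w (snd p))" if \<theta>: "\<theta> \<in> borel_measurable borel" for \<theta>
  proof -
    have "(\<lambda>p. indicator (Qset T) p *\<^sub>R (\<theta> (fst p) * w (snd p))) = (\<lambda>p. indicator (Qset T) p * (\<theta> (fst p) * ext01 w (snd p)))"
      by (auto simp: ext01_def Qset_def indicator_def fun_eq_iff)
    moreover have "Qset T \<in> sets lebesgue" unfolding Qset_def by (intro sets_completionI_sets) (auto intro!: borel_open open_Times)
    ultimately show ?thesis
      unfolding set_borel_measurable_def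
      using measurable_fst_borel_lebesgue[OF \<theta>] measurable_snd_lebesgue[OF sq_intD[OF sw(1)]]
      by (simp only:) (intro borel_measurable_times borel_measurable_indicator)
  qed
  have c: "cutoff s d \<in> borel_measurable borel" by (rule borel_measurable_continuous_onI[OF continuous_on_cutoff[OF d]])
  have Hn: "(H1norm \<alpha> (\<lambda>x. cutoff s d t * w x))\<^sup>2 \<le> (H1norm \<alpha> w)\<^sup>2" for t
  proof -
    have "(cutoff s d t)\<^sup>2 \<le> 1" using cutoff_le[of s d t] by (simp add: power_le_one)
    then have "(cutoff s d t)\<^sup>2 * X \<le> X" if "X \<ge> 0" for X using that by (simp add: mult_left_le_one_le)
    then show ?thesis
      unfolding H1norm_sq[OF H1a_scale(1)[OF w]] H1norm_sq[OF w] H1a_scale(2,3)[OF w]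
      by (simp add: power_mult_distrib add_mono)
  qed
  show ?thesis
    unfolding test_fun_def
  proof (intro conjI)
    show "set_borel_measurable lebesgue (Qset T) (\<lambda>p. cutoff s d (fst p) * w (snd p))" by (rule meas[OF c])
    show "AE t in lebesgue. t \<in> {0<..<T} \<longrightarrow> H1a \<alpha> (\<lambda>x. cutoff s d t * w x)"
      using H1a_scale(1)[OF w] by simp
    have "(\<integral>\<^sup>+t\<in>{0<..<T}. ennreal ((H1norm \<alpha> (\<lambda>x. cutoff s d t * w x))\<^sup>2) \<partial>lebesgue)
      \<le> (\<integral>\<^sup>+t. ennreal ((H1norm \<alpha> w)\<^sup>2) * indicator {0<..<T} t \<partial>lebesgue)"
      by (intro nn_integral_mono mult_right_mono ennreal_leI Hn) auto
    also have "\<dots> = ennreal ((H1norm \<alpha> w)\<^sup>2) * ennreal T" using T_pos by (simp add: nn_integral_cmult_indicator)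
    also have "\<dots> < \<infinity>" by (simp add: ennreal_mult_less_top)
    finally show "(\<integral>\<^sup>+t\<in>{0<..<T}. ennreal ((H1norm \<alpha> (\<lambda>x. cutoff s d t * w x))\<^sup>2) \<partial>lebesgue) < \<infinity>" .
    show "set_borel_measurable lebesgue (Qset T) (\<lambda>p. - (1 / d) * indicator {s<..<s + d} (fst p) * w (snd p))"
      by (rule meas) simp
    have "(\<integral>\<^sup>+p\<in>Qset T. ennreal ((- (1 / d) * indicator {s<..<s + d} (fst p) * w (snd p))\<^sup>2) \<partial>lebesgue)
      \<le> (\<integral>\<^sup>+p. ennreal (1 / d\<^sup>2) * (indicator {0<..<T} (fst p) * ennreal ((ext01 w (snd p))\<^sup>2)) \<partial>lebesgue)"
    proof (rule nn_integral_mono)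
      fix p :: "real \<times> real"
      show "ennreal ((- (1 / d) * indicator {s<..<s + d} (fst p) * w (snd p))\<^sup>2) * indicator (Qset T) p
         \<le> ennreal (1 / d\<^sup>2) * (indicator {0<..<T} (fst p) * ennreal ((ext01 w (snd p))\<^sup>2))"
      proof (cases "p \<in> Qset T \<and> fst p \<in> {s<..<s + d}")
        case True
        then have "fst p \<in> {0<..<T}" "ext01 w (snd p) = w (snd p)" by (auto simp: Qset_def ext01_def mem_Times_iff)
        then show ?thesis using True by (simp add: power_mult_distrib power_divide flip: ennreal_mult)
      qed auto
    qed
    also have "\<dots> = (\<integral>\<^sup>+p. ennreal (1 / d\<^sup>2) * (indicator {0<..<T} (fst p) * ennreal ((ext01 w (snd p))\<^sup>2)) \<partial>(lborel \<Otimes>\<^sub>M lborel))"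
      unfolding lborel_prod by (rule nn_integral_completion)
    also have "\<dots> = (\<integral>\<^sup>+t. \<integral>\<^sup>+x. ennreal (1 / d\<^sup>2) * (indicator {0<..<T} t * ennreal ((ext01 w x)\<^sup>2)) \<partial>lborel \<partial>lborel)"
    proof -
      have [measurable]: "ext01 w \<in> borel_measurable borel" by (rule ext01_borel[OF w])
      show ?thesis by (subst lborel.nn_integral_fst[symmetric]) (auto simp: )
    qed
    also have "\<dots> = ennreal (1 / d\<^sup>2) * ((\<integral>\<^sup>+x. ennreal ((ext01 w x)\<^sup>2) \<partial>lborel) * ennreal T)"
    proof -
      have [measurable]: "ext01 w \<in> borel_measurable borel" by (rule ext01_borel[OF w])
      show ?thesis using T_pos by (simp add: nn_integral_cmult nn_integral_multc mult.commute)
    qed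
    also have "\<dots> < \<infinity>"
    proof -
      have "(\<integral>\<^sup>+x. ennreal ((ext01 w x)\<^sup>2) \<partial>lborel) = (\<integral>\<^sup>+x. ennreal ((ext01 w x)\<^sup>2) \<partial>lebesgue)"
        by (rule nn_integral_completion[symmetric])
      also have "\<dots> < \<infinity>" using sq_int_square[OF sw(1)] by (simp add: integrable_iff_bounded)
      finally show ?thesis by (simp add: ennreal_mult_less_top)
    qed
    finally show "(\<integral>\<^sup>+p\<in>Qset T. ennreal ((- (1 / d) * indicator {s<..<s + d} (fst p) * w (snd p))\<^sup>2) \<partial>lebesgue) < \<infinity>" .
    show "AE x in lebesgue. x \<in> {0<..<1} \<longrightarrow>
      set_integrable lebesgue {0..T} (\<lambda>r. - (1 / d) * indicator {s<..<s + d} r * w x) \<and>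
      (\<forall>t\<in>{0..T}. cutoff s d t * w x = cutoff s d 0 * w x + (LINT r:{0..t}|lebesgue. - (1 / d) * indicator {s<..<s + d} r * w x)) \<and>
      cutoff s d T * w x = 0"
    proof (rule AE_I2, intro impI conjI ballI)
      fix x t :: real
      have "set_integrable lebesgue {0..T} (\<lambda>r. indicator {s<..<s + d} r * (- (1 / d) * w x))"
      proof (rule set_integrable_subset[where A=UNIV])
        have "integrable lebesgue (\<lambda>r. indicator {s<..<s + d} r * (- (1 / d) * w x))"
          using set_integral_Ioo_continuous(1)[of s "s + d" "\<lambda>_. - (1 / d) * w x"]
          by (simp add: set_integrable_def)
        then show "set_integrable lebesgue UNIV (\<lambda>r. indicator {s<..<s + d} r * (- (1 / d) * w x))"
          by (simp add: set_integrable_def)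
      qed auto
      then show "set_integrable lebesgue {0..T} (\<lambda>r. - (1 / d) * indicator {s<..<s + d} r * w x)"
        by (simp add: mult_ac)
      show "cutoff s d T * w x = 0" using sd d by (simp add: cutoff_eq)
      assume t: "t \<in> {0..T}"
      have "(LINT r:{0..t}|lebesgue. - (1 / d) * indicator {s<..<s + d} r * w x) = (LINT r:{0..t}|lebesgue. - (1 / d) * indicator {s<..<s + d} r) * w x"
        by (rule set_integral_mult_left)
      then show "cutoff s d t * w x = cutoff s d 0 * w x + (LINT r:{0..t}|lebesgue. - (1 / d) * indicator {s<..<s + d} r * w x)"
        using cutoff_integral[OF d s, of t] t by (simp add: distrib_right)
    qed
  qed
qed

text \<open>Measurability of the map t -> L2norm (f t) is not part of \<open>in_L1L2\<close>. A
  Borel representative of f yields a measurable N that agrees with it almost everywhere on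
  (0,T).\<close>

lemma f_norm_exists:
  "\<exists>N. set_integrable lebesgue {0<..<T} N \<and> (\<forall>t. 0 \<le> N t) \<and> (LINT t:{0<..<T}|lebesgue. N t) = L1L2norm T f \<and>
    (AE t in lebesgue. t \<in> {0<..<T} \<longrightarrow> sq_int (ext01 (f t)) \<and> norm (mk_l2 (ext01 (f t))) = N t)"
proof -
  have fm: "(\<lambda>p. indicator (Qset T) p * f (fst p) (snd p)) \<in> borel_measurable lebesgue"
    and fL2: "AE t in lebesgue. t \<in> {0<..<T} \<longrightarrow> in_L2 (f t)"
    and ffin: "(\<integral>\<^sup>+t\<in>{0<..<T}. ennreal (L2norm (f t)) \<partial>lebesgue) < \<infinity>"
    using f unfolding in_L1L2_def set_borel_measurable_def by auto
  obtain f' where f': "f' \<in> borel_measurable lborel" "AE p in lborel. indicator (Qset T) p * f (fst p) (snd p) = f' p"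
    using completion_ex_borel_measurable_real[OF fm] by auto
  have [measurable]: "f' \<in> borel_measurable (borel \<Otimes>\<^sub>M borel)" using f'(1) unfolding borel_prod by simp
  have "AE p in lborel \<Otimes>\<^sub>M lborel. indicator (Qset T) p * f (fst p) (snd p) = f' p" using f'(2) unfolding lborel_prod .
  from lborel_pair.AE_pair[OF this]
  have eq: "AE t in lebesgue. AE x in lebesgue. indicator (Qset T) (t, x) * f t x = f' (t, x)" by (simp add: AE_completion_iff)
  define N where "N t = indicator {0<..<T} t * sqrt (enn2real (\<integral>\<^sup>+x. ennreal ((f' (t, x))\<^sup>2) \<partial>lborel))" for t
  have Nm: "N \<in> borel_measurable borel" unfolding N_def by measurable
  have N0: "0 \<le> N t" for t by (simp add: N_def)
  have Nf: "AE t in lebesgue. t \<in> {0<..<T} \<longrightarrow> L2norm (f t) = N t"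
    using eq
  proof eventually_elim
    case (elim t)
    show ?case
    proof
      assume t: "t \<in> {0<..<T}"
      have "(\<integral>\<^sup>+x. ennreal ((ext01 (f t) x)\<^sup>2) \<partial>lebesgue) = (\<integral>\<^sup>+x. ennreal ((f' (t, x))\<^sup>2) \<partial>lebesgue)"
      proof (rule nn_integral_cong_AE)
        show "AE x in lebesgue. ennreal ((ext01 (f t) x)\<^sup>2) = ennreal ((f' (t, x))\<^sup>2)"
          using elim
        proof eventually_elim
          case (elim x)
          have "ext01 (f t) x = f' (t, x)" using elim t by (simp add: ext01_def Qset_def indicator_def)
          then show ?case by simp
        qed
      qed
      also have "\<dots> = (\<integral>\<^sup>+x. ennreal ((f' (t, x))\<^sup>2) \<partial>lborel)" by (rule nn_integral_completion)
      finally show "L2norm (f t) = N t" using t unfolding L2norm_def ennreal_ext01_sq N_def by simp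
    qed
  qed
  have NI: "(\<integral>\<^sup>+t. ennreal (N t) \<partial>lebesgue) = (\<integral>\<^sup>+t\<in>{0<..<T}. ennreal (L2norm (f t)) \<partial>lebesgue)"
    by (rule nn_integral_cong_AE) (use Nf in \<open>auto simp: N_def indicator_def elim!: eventually_mono\<close>)
  have Ni: "integrable lebesgue N"
    unfolding integrable_iff_bounded using NI ffin N0 Nm by (auto intro: measurable_completion)
  have Nind: "indicator {0<..<T} t * N t = N t" for t by (simp add: N_def indicator_def)
  have "integral\<^sup>L lebesgue N = L1L2norm T f"
    unfolding L1L2norm_def NI[symmetric] using Ni N0 by (intro integral_eq_nn_integral) auto
  then have "(LINT t:{0<..<T}|lebesgue. N t) = L1L2norm T f"
    by (simp add: set_lebesgue_integral_def Nind)
  moreover have "set_integrable lebesgue {0<..<T} N" using Ni by (simp add: set_integrable_def Nind)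
  moreover have "AE t in lebesgue. t \<in> {0<..<T} \<longrightarrow> sq_int (ext01 (f t)) \<and> norm (mk_l2 (ext01 (f t))) = N t"
    using fL2 Nf by eventually_elim (auto simp: in_L2_iff_sq_int[symmetric] L2norm_eq_norm)
  ultimately show ?thesis using N0 by blast
qed

text \<open>Fixes one measurable version of the norm of the force.\<close>

definition "fnorm = (SOME N. set_integrable lebesgue {0<..<T} N \<and> (\<forall>t. 0 \<le> N t) \<and> (LINT t:{0<..<T}|lebesgue. N t) = L1L2norm T f \<and>
    (AE t in lebesgue. t \<in> {0<..<T} \<longrightarrow> sq_int (ext01 (f t)) \<and> norm (mk_l2 (ext01 (f t))) = N t))"

lemma fnorm: "set_integrable lebesgue {0<..<T} fnorm" "0 \<le> fnorm t" "(LINT t:{0<..<T}|lebesgue. fnorm t) = L1L2norm T f"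
    "AE t in lebesgue. t \<in> {0<..<T} \<longrightarrow> sq_int (ext01 (f t)) \<and> norm (mk_l2 (ext01 (f t))) = fnorm t"
  using someI_ex[OF f_norm_exists] unfolding fnorm_def[symmetric] by auto

text \<open>The primitive that plays the role of n in the locale \<open>evolution\<close>.\<close>

definition "fint t = integral {0..t} fnorm"

lemma fnorm_integrable: "fnorm integrable_on {0..T}"
  using set_lebesgue_integral_eq_integral(1)[OF fnorm(1)] by (simp add: integrable_on_open_interval_real)

lemma fint_cont: "continuous_on {0..T} fint"
  unfolding fint_def by (rule indefinite_integral_continuous_1[OF fnorm_integrable])

lemma fint_diff:
  assumes "0 \<le> s" "s \<le> t" "t \<le> T"
  shows "fint t - fint s = integral {s..t} fnorm" "fnorm integrable_on {s..t}"
proof -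
  have i: "fnorm integrable_on {a..b}" if "0 \<le> a" "b \<le> T" for a b
    by (rule integrable_on_subinterval[OF fnorm_integrable]) (use that in auto)
  have "integral {0..s} fnorm + integral {s..t} fnorm = integral {0..t} fnorm"
    by (rule Henstock_Kurzweil_Integration.integral_combine) (use assms i in auto)
  then show "fint t - fint s = integral {s..t} fnorm" by (simp add: fint_def)
  show "fnorm integrable_on {s..t}" using i assms by simp
qed

lemma fint_mono: "0 \<le> s \<Longrightarrow> s \<le> t \<Longrightarrow> t \<le> T \<Longrightarrow> fint s \<le> fint t"
  using fint_diff(1)[of s t] Henstock_Kurzweil_Integration.integral_nonneg[OF fint_diff(2)[of s t]] fnorm(2) by auto

lemma fint_total: "fint T - fint 0 = L1L2norm T f"
proof -
  have "integral {0..T} fnorm = integral {0<..<T} fnorm" using integral_open_interval_real[of 0 T fnorm] by simp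
  also have "\<dots> = L1L2norm T f" using set_lebesgue_integral_eq_integral(2)[OF fnorm(1)] fnorm(3) by simp
  finally show ?thesis by (simp add: fint_def)
qed

text \<open>The graph of the weighted derivative, as a relation in l2; this is all that the abstract
  evolution sees of the energy space.\<close>

definition "adm X Y \<longleftrightarrow> (\<exists>w. H1a \<alpha> w \<and> X = mk_l2 (ext01 w) \<and> Y = mk_l2 (wderiv \<alpha> w))"

text \<open>The weak formulation for a ramp times w, rewritten by \<open>Q_integral\<close> in terms
  of integrals in time. The derivative of the ramp turns the velocity term into an average over
  [s,s+d].\<close>

lemma weak_cutoff:
  assumes w: "H1a \<alpha> w" and s: "0 \<le> s" and d: "0 < d" and sd: "s + d \<le> T"
  defines "X \<equiv> mk_l2 (ext01 w)" and "Y \<equiv> mk_l2 (wderiv \<alpha> w)"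
  shows "(1 / d) * integral {s..s + d} (\<lambda>t. inner (V t) X) + integral {0..T} (\<lambda>t. cutoff s d t * inner (W t) Y)
     - inner (mk_l2 (ext01 u1)) X
    = (LINT t:{0<..<T}|lebesgue. cutoff s d t * inner (mk_l2 (ext01 (f t))) X)"
    and "set_integrable lebesgue {0<..<T} (\<lambda>t. cutoff s d t * inner (mk_l2 (ext01 (f t))) X)"
proof -
  note sw = H1a_sq_int[OF w]
  have cm: "cutoff s d \<in> borel_measurable borel" by (rule borel_measurable_continuous_onI[OF continuous_on_cutoff[OF d]])
  have cb: "\<bar>cutoff s d t\<bar> \<le> 1" for t using cutoff_le[of s d t] by simp
  define \<theta>' where "\<theta>' t = - (1 / d) * indicator {s<..<s + d} t" for t :: real
  have \<theta>'m: "(\<lambda>t. - \<theta>' t) \<in> borel_measurable borel" unfolding \<theta>'_def by simp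
  have \<theta>'b: "\<bar>- \<theta>' t\<bar> \<le> 1 / d" for t using d by (simp add: \<theta>'_def indicator_def)
  obtain SV where SV: "SV \<ge> 0" "\<And>t. t \<in> {0..T} \<Longrightarrow> norm (V t) \<le> SV"
    by (rule continuous_on_compact_norm_bound[OF V_cont]) (rule that, auto)
  obtain SW where SW: "SW \<ge> 0" "\<And>t. t \<in> {0..T} \<Longrightarrow> norm (W t) \<le> SW"
    by (rule continuous_on_compact_norm_bound[OF W_cont]) (rule that, auto)
  have const: "set_integrable lebesgue {0<..<T} (\<lambda>_. K :: real)" for K
    by (rule set_integral_Ioo_continuous(1)) (rule continuous_on_const)
  \<comment> \<open>Splitting x^alpha into two factors x^(alpha/2) makes the elastic integrand a
    product of two weighted derivatives.\<close>
  define g where "g x = x powr (\<alpha> / 2) * deriv w x" for x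
  have ge: "ext01 g = wderiv \<alpha> w" by (auto simp: ext01_def g_def wderiv_def)
  define G where "G t x = x powr (\<alpha> / 2) * deriv (u t) x" for t x
  have Ge: "ext01 (G t) = wderiv \<alpha> (u t)" for t by (auto simp: ext01_def G_def wderiv_def)
  have vm: "(\<lambda>p. indicator (Qset T) p * v (fst p) (snd p)) \<in> borel_measurable lebesgue"
    using v_meas by (simp add: set_borel_measurable_def)
  have fm: "(\<lambda>p. indicator (Qset T) p * f (fst p) (snd p)) \<in> borel_measurable lebesgue"
    using f by (simp add: in_L1L2_def set_borel_measurable_def)
  have Gm: "(\<lambda>p. indicator (Qset T) p * G (fst p) (snd p)) \<in> borel_measurable lebesgue"
  proof -
    have "(\<lambda>x::real. x powr (\<alpha> / 2)) \<in> borel_measurable lebesgue" by measurable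
    from borel_measurable_times[OF measurable_snd_lebesgue[OF this] deriv_jointly_measurable]
    show ?thesis by (simp add: G_def mult_ac)
  qed
  \<comment> \<open>Three instances: the velocity against the derivative of the ramp, then the
    weighted derivative and the force against the ramp itself.\<close>
  note A = Q_integral[OF vm _ const sw(1) \<theta>'m \<theta>'b, of SV]
  have vb: "AE t in lebesgue. t \<in> {0<..<T} \<longrightarrow> sq_int (ext01 (v t)) \<and> norm (mk_l2 (ext01 (v t))) \<le> SV"
    using SV(2) v_sq by (intro AE_I2) (auto simp: V_def)
  note A = A[OF vb]
  have Gb: "AE t in lebesgue. t \<in> {0<..<T} \<longrightarrow> sq_int (ext01 (G t)) \<and> norm (mk_l2 (ext01 (G t))) \<le> SW"
    using SW(2) u_sq(2) by (intro AE_I2) (auto simp: W_def Ge)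
  have sg: "sq_int (ext01 g)" using sw(2) by (simp add: ge)
  note B = Q_integral[OF Gm Gb const sg cm cb]
  have fb: "AE t in lebesgue. t \<in> {0<..<T} \<longrightarrow> sq_int (ext01 (f t)) \<and> norm (mk_l2 (ext01 (f t))) \<le> fnorm t"
    using fnorm(4) by eventually_elim auto
  note C = Q_integral[OF fm fb fnorm(1) sw(1) cm cb]
  show "set_integrable lebesgue {0<..<T} (\<lambda>t. cutoff s d t * inner (mk_l2 (ext01 (f t))) X)"
    unfolding X_def by (rule C(2))
  have wk: "(LINT p:Qset T|lebesgue. - v (fst p) (snd p) * (\<theta>' (fst p) * w (snd p))
               + (snd p) powr \<alpha> * deriv (u (fst p)) (snd p) * deriv (\<lambda>x. cutoff s d (fst p) * w x) (snd p))
           - (LINT x:{0<..<1}|lebesgue. u1 x * (cutoff s d 0 * w x))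
           = (LINT p:Qset T|lebesgue. f (fst p) (snd p) * (cutoff s d (fst p) * w (snd p)))"
    using weak[OF test_fun_product[OF w s d sd]] unfolding \<theta>'_def by simp
  have "(LINT p:Qset T|lebesgue. - v (fst p) (snd p) * (\<theta>' (fst p) * w (snd p))
               + (snd p) powr \<alpha> * deriv (u (fst p)) (snd p) * deriv (\<lambda>x. cutoff s d (fst p) * w x) (snd p))
     = (LINT p:Qset T|lebesgue. (- \<theta>' (fst p)) * v (fst p) (snd p) * w (snd p) + cutoff s d (fst p) * G (fst p) (snd p) * g (snd p))"
    (is "?L = (LINT p:Qset T|lebesgue. ?R p)")
  proof -
    \<comment> \<open>The scalar factor passes through \<open>deriv\<close> where w is
      differentiable, hence almost everywhere.\<close>
    have eqp: "AE p in lebesgue. indicator (Qset T) p *\<^sub>R ?R p = indicator (Qset T) p *\<^sub>R (- v (fst p) (snd p) * (\<theta>' (fst p) * w (snd p))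
               + (snd p) powr \<alpha> * deriv (u (fst p)) (snd p) * deriv (\<lambda>x. cutoff s d (fst p) * w x) (snd p))"
    proof -
      have "AE x in lborel. x \<in> {0<..<1} \<longrightarrow> (w has_real_derivative deriv w x) (at x)"
        using H1a_AE_deriv[OF w] by (simp add: AE_completion_iff)
      from AE_lborel_snd[OF this]
      have "AE p in lebesgue. snd (p :: real \<times> real) \<in> {0<..<1} \<longrightarrow> (w has_real_derivative deriv w (snd p)) (at (snd p))"
        by (simp add: AE_completion_iff)
      then show ?thesis
      proof eventually_elim
        case (elim p)
        show ?case
        proof (cases "p \<in> Qset T")
          case True
          then have x: "snd p \<in> {0<..<1}" by (auto simp: Qset_def)
          then have "(w has_real_derivative deriv w (snd p)) (at (snd p))" using elim by blast
          then have "deriv (\<lambda>x. cutoff s d (fst p) * w x) (snd p) = cutoff s d (fst p) * deriv w (snd p)"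
            by (intro DERIV_imp_deriv DERIV_cmult)
          moreover have "snd p powr \<alpha> = snd p powr (\<alpha> / 2) * snd p powr (\<alpha> / 2)" by (simp add: powr_add[symmetric])
          ultimately show ?thesis by (simp add: G_def g_def)
        qed simp
      qed
    qed
    have "integrable lebesgue (\<lambda>p. indicator (Qset T) p *\<^sub>R ?R p)"
      using set_integral_add(1)[OF A(1) B(1)] unfolding set_integrable_def .
    then have m1: "(\<lambda>p. indicator (Qset T) p *\<^sub>R ?R p) \<in> borel_measurable lebesgue" by (rule borel_measurable_integrable)
    have eqp': "AE p in lebesgue. indicator (Qset T) p *\<^sub>R (- v (fst p) (snd p) * (\<theta>' (fst p) * w (snd p))
               + (snd p) powr \<alpha> * deriv (u (fst p)) (snd p) * deriv (\<lambda>x. cutoff s d (fst p) * w x) (snd p)) = indicator (Qset T) p *\<^sub>R ?R p"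
      using eqp by eventually_elim (rule sym)
    show ?thesis
      unfolding set_lebesgue_integral_def
      by (rule integral_cong_AE[OF borel_measurable_AE[OF m1 eqp] m1 eqp'])
  qed
  also have "\<dots> = (LINT t:{0<..<T}|lebesgue. - \<theta>' t * inner (mk_l2 (ext01 (v t))) X) + (LINT t:{0<..<T}|lebesgue. cutoff s d t * inner (mk_l2 (ext01 (G t))) (mk_l2 (ext01 g)))"
    unfolding set_integral_add(2)[OF A(1) B(1)] A(3) B(3) X_def ..
  also have "(LINT t:{0<..<T}|lebesgue. - \<theta>' t * inner (mk_l2 (ext01 (v t))) X) = (1 / d) * integral {s..s + d} (\<lambda>t. inner (V t) X)"
  proof -
    have "(LINT t:{0<..<T}|lebesgue. - \<theta>' t * inner (mk_l2 (ext01 (v t))) X) = (LINT t:{s<..<s + d}|lebesgue. (1 / d) * inner (V t) X)"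
      unfolding set_lebesgue_integral_def
      by (rule Bochner_Integration.integral_cong) (use s d sd in \<open>auto simp: \<theta>'_def indicator_def V_def\<close>)
    also have "\<dots> = integral {s..s + d} (\<lambda>t. (1 / d) * inner (V t) X)"
      by (rule set_integral_Ioo_continuous(2)) (use s d sd in \<open>auto intro!: continuous_intros continuous_on_subset[OF V_cont]\<close>)
    finally show ?thesis by simp
  qed
  also have "(LINT t:{0<..<T}|lebesgue. cutoff s d t * inner (mk_l2 (ext01 (G t))) (mk_l2 (ext01 g))) = integral {0..T} (\<lambda>t. cutoff s d t * inner (W t) Y)"
    unfolding Ge ge W_def[symmetric] Y_def[symmetric]
    by (rule set_integral_Ioo_continuous(2)) (intro continuous_intros W_cont continuous_on_cutoff d)
  finally have L: "?L = (1 / d) * integral {s..s + d} (\<lambda>t. inner (V t) X) + integral {0..T} (\<lambda>t. cutoff s d t * inner (W t) Y)" .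
  have "(LINT x:{0<..<1}|lebesgue. u1 x * (cutoff s d 0 * w x)) = (LINT x|lebesgue. ext01 u1 x * ext01 w x)"
    unfolding set_lebesgue_integral_def
    by (rule Bochner_Integration.integral_cong) (use s d in \<open>auto simp: ext01_def indicator_def cutoff_eq\<close>)
  also have "\<dots> = inner (mk_l2 (ext01 u1)) X"
    unfolding X_def using u1 sw by (simp add: inner_mk_l2 in_L2_iff_sq_int)
  finally have I: "(LINT x:{0<..<1}|lebesgue. u1 x * (cutoff s d 0 * w x)) = inner (mk_l2 (ext01 u1)) X" .
  have R: "(LINT p:Qset T|lebesgue. f (fst p) (snd p) * (cutoff s d (fst p) * w (snd p)))
    = (LINT t:{0<..<T}|lebesgue. cutoff s d t * inner (mk_l2 (ext01 (f t))) X)"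
    using C(3) by (simp add: X_def mult_ac)
  show "(1 / d) * integral {s..s + d} (\<lambda>t. inner (V t) X) + integral {0..T} (\<lambda>t. cutoff s d t * inner (W t) Y)
     - inner (mk_l2 (ext01 u1)) X
    = (LINT t:{0<..<T}|lebesgue. cutoff s d t * inner (mk_l2 (ext01 (f t))) X)"
    using wk unfolding L I R .
qed

text \<open>Up to s the ramp is 1 and after s + d it is 0, so the difference is an integral over an
  interval of length d with a bounded integrand.\<close>

lemma cutoff_integral_limit:
  assumes g: "continuous_on {0..T} g" and s: "0 \<le> s" "s < T"
  shows "((\<lambda>d. integral {0..T} (\<lambda>t. cutoff s d t * g t)) \<longlongrightarrow> integral {0..s} g) (at_right 0)"
proof -
  obtain S where S: "S \<ge> 0" "\<And>t. t \<in> {0..T} \<Longrightarrow> norm (g t) \<le> S"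
    by (rule continuous_on_compact_norm_bound[OF g]) (rule that, auto)
  have "((\<lambda>d. integral {0..T} (\<lambda>t. cutoff s d t * g t) - integral {0..s} g) \<longlongrightarrow> 0) (at_right 0)"
  proof (rule Lim_null_comparison)
    have "((\<lambda>d. S * d) \<longlongrightarrow> S * 0) (at_right 0)" by (intro tendsto_intros)
    then show "((\<lambda>d. S * d) \<longlongrightarrow> 0) (at_right 0)" by simp
    have "\<forall>\<^sub>F d in at_right 0. d \<in> {0<..<T - s}" using eventually_at_right_real[of 0 "T - s"] s by simp
    then show "\<forall>\<^sub>F d in at_right 0. norm (integral {0..T} (\<lambda>t. cutoff s d t * g t) - integral {0..s} g) \<le> S * d"
    proof eventually_elim
      case (elim d)
      then have d: "0 < d" "s + d < T" by auto
      have ci: "continuous_on {0..T} (\<lambda>t. cutoff s d t * g t)" by (intro continuous_intros continuous_on_cutoff d g)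
      have ii: "(\<lambda>t. cutoff s d t * g t) integrable_on {a..b}" if "0 \<le> a" "b \<le> T" for a b
        using that by (intro integrable_continuous_real continuous_on_subset[OF ci]) auto
      have "integral {0..s} (\<lambda>t. cutoff s d t * g t) + integral {s..T} (\<lambda>t. cutoff s d t * g t) = integral {0..T} (\<lambda>t. cutoff s d t * g t)"
        by (rule Henstock_Kurzweil_Integration.integral_combine) (use s ii in auto)
      moreover have "integral {s..s + d} (\<lambda>t. cutoff s d t * g t) + integral {s + d..T} (\<lambda>t. cutoff s d t * g t) = integral {s..T} (\<lambda>t. cutoff s d t * g t)"
        by (rule Henstock_Kurzweil_Integration.integral_combine) (use s d ii in auto)
      moreover have "integral {0..s} (\<lambda>t. cutoff s d t * g t) = integral {0..s} g"
        by (rule Henstock_Kurzweil_Integration.integral_cong) (use d in \<open>auto simp: cutoff_eq\<close>)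
      moreover have "integral {s + d..T} (\<lambda>t. cutoff s d t * g t) = integral {s + d..T} (\<lambda>t. 0)"
        by (rule Henstock_Kurzweil_Integration.integral_cong) (use d in \<open>auto simp: cutoff_eq\<close>)
      ultimately have "integral {0..T} (\<lambda>t. cutoff s d t * g t) - integral {0..s} g = integral {s..s + d} (\<lambda>t. cutoff s d t * g t)" by simp
      moreover have "\<bar>integral {s..s + d} (\<lambda>t. cutoff s d t * g t)\<bar> \<le> S * (s + d - s)"
      proof (rule abs_integral_le_const)
        show "continuous_on {s..s + d} (\<lambda>t. cutoff s d t * g t)" using s d by (intro continuous_on_subset[OF ci]) auto
        fix t assume t: "t \<in> {s..s + d}"
        have "\<bar>cutoff s d t\<bar> * \<bar>g t\<bar> \<le> 1 * S"
          using cutoff_le[of s d t] S t s d by (intro mult_mono) auto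
        then show "\<bar>cutoff s d t * g t\<bar> \<le> S" by (simp add: abs_mult)
      qed (use d in auto)
      ultimately show ?case by simp
    qed
  qed
  then show ?thesis by (simp add: LIM_zero_iff)
qed

lemma average_limit:
  fixes g :: "real \<Rightarrow> real"
  assumes g: "continuous_on {0..T} g" and s: "0 \<le> s" "s < T"
  shows "((\<lambda>d. (1 / d) * integral {s..s + d} g) \<longlongrightarrow> g s) (at_right 0)"
proof -
  have gc: "continuous_on {s..T} g" using s by (intro continuous_on_subset[OF g]) auto
  have "((\<lambda>x. integral {s..x} g) has_vector_derivative g s) (at s within {s..T})"
    by (rule integral_has_vector_derivative[OF gc]) (use s in auto)
  from has_vector_derivative_right_quotient[OF this] s
  have "((\<lambda>d. (integral {s..s + d} g - integral {s..s} g) /\<^sub>R d) \<longlongrightarrow> g s) (at_right 0)" by simp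
  then show ?thesis by (simp add: divide_inverse)
qed

lemma weak_limit:
  assumes w: "H1a \<alpha> w" and s: "0 \<le> s" "s < T"
  defines "X \<equiv> mk_l2 (ext01 w)" and "Y \<equiv> mk_l2 (wderiv \<alpha> w)"
  shows "((\<lambda>d. (1 / d) * integral {s..s + d} (\<lambda>t. inner (V t) X) + integral {0..T} (\<lambda>t. cutoff s d t * inner (W t) Y))
    \<longlongrightarrow> inner (V s) X + integral {0..s} (\<lambda>t. inner (W t) Y)) (at_right 0)"
  by (intro tendsto_add average_limit[of "\<lambda>t. inner (V t) X"] cutoff_integral_limit s continuous_intros V_cont W_cont)

text \<open>Cauchy-Schwarz at almost every time. The support of \<theta> localises the force to
  [a,b], which is where the increment of \<open>fint\<close> comes from.\<close>

lemma f_cutoff_bound: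
  assumes w: "H1a \<alpha> w" and ab: "0 \<le> a" "a \<le> b" "b \<le> T"
    and si: "set_integrable lebesgue {0<..<T} (\<lambda>t. \<theta> t * inner (mk_l2 (ext01 (f t))) (mk_l2 (ext01 w)))"
    and \<theta>: "\<And>t. \<bar>\<theta> t\<bar> \<le> 1" "\<And>t. t \<notin> {a..b} \<Longrightarrow> \<theta> t = 0"
  shows "\<bar>LINT t:{0<..<T}|lebesgue. \<theta> t * inner (mk_l2 (ext01 (f t))) (mk_l2 (ext01 w))\<bar> \<le> norm (mk_l2 (ext01 w)) * (fint b - fint a)"
proof -
  let ?K = "norm (mk_l2 (ext01 w))"
  have fi: "set_integrable lebesgue ({0<..<T} \<inter> {a..b}) fnorm" by (rule set_integrable_subset[OF fnorm(1)]) auto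
  have "\<bar>LINT t:{0<..<T}|lebesgue. \<theta> t * inner (mk_l2 (ext01 (f t))) (mk_l2 (ext01 w))\<bar>
    \<le> (LINT t:({0<..<T} \<inter> {a..b})|lebesgue. ?K * fnorm t)"
  proof -
    have "\<bar>LINT t:{0<..<T}|lebesgue. \<theta> t * inner (mk_l2 (ext01 (f t))) (mk_l2 (ext01 w))\<bar>
      \<le> (LINT t|lebesgue. \<bar>indicator {0<..<T} t *\<^sub>R (\<theta> t * inner (mk_l2 (ext01 (f t))) (mk_l2 (ext01 w)))\<bar>)"
      unfolding set_lebesgue_integral_def by (rule integral_abs_bound)
    also have "\<dots> \<le> (LINT t:({0<..<T} \<inter> {a..b})|lebesgue. ?K * fnorm t)"
      unfolding set_lebesgue_integral_def
    proof (rule integral_mono_AE)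
      show "integrable lebesgue (\<lambda>t. \<bar>indicator {0<..<T} t *\<^sub>R (\<theta> t * inner (mk_l2 (ext01 (f t))) (mk_l2 (ext01 w)))\<bar>)"
        using si unfolding set_integrable_def by (rule integrable_abs)
      show "integrable lebesgue (\<lambda>t. indicator ({0<..<T} \<inter> {a..b}) t *\<^sub>R (?K * fnorm t))"
        using set_integrable_mult_right[of ?K, OF fi] unfolding set_integrable_def by simp
      show "AE t in lebesgue. \<bar>indicator {0<..<T} t *\<^sub>R (\<theta> t * inner (mk_l2 (ext01 (f t))) (mk_l2 (ext01 w)))\<bar>
        \<le> indicator ({0<..<T} \<inter> {a..b}) t *\<^sub>R (?K * fnorm t)"
        using fnorm(4)
      proof eventually_elim
        case (elim t)
        show ?case
        proof (cases "t \<in> {0<..<T} \<and> t \<in> {a..b}")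
          case True
          then have n: "norm (mk_l2 (ext01 (f t))) = fnorm t" using elim by auto
          have "\<bar>inner (mk_l2 (ext01 (f t))) (mk_l2 (ext01 w))\<bar> \<le> fnorm t * ?K"
            using Cauchy_Schwarz_ineq2[of "mk_l2 (ext01 (f t))" "mk_l2 (ext01 w)"] by (simp add: n)
          then have "\<bar>\<theta> t\<bar> * \<bar>inner (mk_l2 (ext01 (f t))) (mk_l2 (ext01 w))\<bar> \<le> 1 * (fnorm t * ?K)"
            by (intro mult_mono \<theta>(1)) auto
          then show ?thesis using True by (simp add: abs_mult mult.commute)
        qed (use \<theta>(2)[of t] in \<open>auto simp: indicator_def\<close>)
      qed
    qed
    finally show ?thesis .
  qed
  also have "\<dots> = ?K * (LINT t:({0<..<T} \<inter> {a..b})|lebesgue. fnorm t)" by simp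
  also have "(LINT t:({0<..<T} \<inter> {a..b})|lebesgue. fnorm t) = fint b - fint a"
  proof -
    have "integral ({0<..<T} \<inter> {a..b}) fnorm = integral {a..b} fnorm"
    proof (rule integral_spike_set)
      have "{x \<in> {0<..<T} \<inter> {a..b} - {a..b}. fnorm x \<noteq> 0} = {}" by auto
      then show "negligible {x \<in> {0<..<T} \<inter> {a..b} - {a..b}. fnorm x \<noteq> 0}" by (simp only: negligible_empty)
      have "{x \<in> {a..b} - {0<..<T} \<inter> {a..b}. fnorm x \<noteq> 0} \<subseteq> {0, T}" using ab by auto
      then show "negligible {x \<in> {a..b} - {0<..<T} \<inter> {a..b}. fnorm x \<noteq> 0}"
        by (rule negligible_subset[rotated]) (simp add: negligible_finite)
    qed
    then show ?thesis using set_lebesgue_integral_eq_integral(2)[OF fi] fint_diff(1)[OF ab] by simp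
  qed
  finally show ?thesis .
qed

text \<open>The initial velocity enters the weak formulation only through the term with u1. With a
  ramp of length d starting at 0, the force contributes at most a multiple of the increment of
  \<open>fint\<close> over [0,d], which vanishes as d -> 0.\<close>

lemma V_initial:
  assumes w: "H1a \<alpha> w"
  shows "inner (V 0) (mk_l2 (ext01 w)) = inner (mk_l2 (ext01 u1)) (mk_l2 (ext01 w))"
proof -
  let ?X = "mk_l2 (ext01 w)" and ?Y = "mk_l2 (wderiv \<alpha> w)"
  let ?L = "\<lambda>d. (1 / d) * integral {0..0 + d} (\<lambda>t. inner (V t) ?X) + integral {0..T} (\<lambda>t. cutoff 0 d t * inner (W t) ?Y)"
  have A: "((\<lambda>d. \<bar>?L d - inner (mk_l2 (ext01 u1)) ?X\<bar>) \<longlongrightarrow> \<bar>inner (V 0) ?X + integral {0..0} (\<lambda>t. inner (W t) ?Y) - inner (mk_l2 (ext01 u1)) ?X\<bar>) (at_right 0)"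
    by (intro tendsto_intros weak_limit[OF w _ T_pos]) simp
  have B: "((\<lambda>d. norm ?X * (fint d - fint 0)) \<longlongrightarrow> norm ?X * (fint 0 - fint 0)) (at_right 0)"
  proof (intro tendsto_intros)
    have "(fint \<longlongrightarrow> fint 0) (at 0 within {0..T})" using fint_cont T_pos by (auto simp: continuous_on_def)
    then show "(fint \<longlongrightarrow> fint 0) (at_right 0)" using T_pos by (simp add: at_within_Icc_at_right)
  qed
  have C: "\<forall>\<^sub>F d in at_right 0. \<bar>?L d - inner (mk_l2 (ext01 u1)) ?X\<bar> \<le> norm ?X * (fint d - fint 0)"
  proof -
    have "\<forall>\<^sub>F d in at_right 0. d \<in> {0<..<T}" using eventually_at_right_real[OF T_pos] .
    then show ?thesis
    proof eventually_elim
      case (elim d)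
      then have d: "0 < d" "0 + d \<le> T" by auto
      note wc = weak_cutoff[OF w order_refl d]
      \<comment> \<open>The ramp equals 1 at negative times; it is set to zero there, outside (0,T),
        so that its support lies in [0,d].\<close>
      have "\<bar>LINT t:{0<..<T}|lebesgue. (if t < 0 then 0 else cutoff 0 d t) * inner (mk_l2 (ext01 (f t))) ?X\<bar> \<le> norm ?X * (fint d - fint 0)"
      proof (rule f_cutoff_bound[OF w])
        show "set_integrable lebesgue {0<..<T} (\<lambda>t. (if t < 0 then 0 else cutoff 0 d t) * inner (mk_l2 (ext01 (f t))) ?X)"
          using wc(2) by (rule set_integrable_cong[THEN iffD1, rotated -1]) auto
        show "\<bar>if t < 0 then 0 else cutoff 0 d t\<bar> \<le> 1" for t using cutoff_le[of 0 d t] by simp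
        show "(if t < 0 then 0 else cutoff 0 d t) = 0" if "t \<notin> {0..d}" for t using that d by (auto simp: cutoff_eq)
      qed (use d in auto)
      also have "(LINT t:{0<..<T}|lebesgue. (if t < 0 then 0 else cutoff 0 d t) * inner (mk_l2 (ext01 (f t))) ?X)
        = (LINT t:{0<..<T}|lebesgue. cutoff 0 d t * inner (mk_l2 (ext01 (f t))) ?X)"
        by (rule set_lebesgue_integral_cong) auto
      finally show ?case using wc(1) by simp
    qed
  qed
  have "\<bar>inner (V 0) ?X + integral {0..0} (\<lambda>t. inner (W t) ?Y) - inner (mk_l2 (ext01 u1)) ?X\<bar> \<le> norm ?X * (fint 0 - fint 0)"
    by (rule tendsto_le[OF trivial_limit_at_right_real B A C])
  then show ?thesis by simp
qed

text \<open>Subtracting the identities for ramps at t and at s removes the initial data and leaves a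
  force term supported in [s,t+d]. Continuity of \<open>fint\<close> gives the bound as d -> 0 for t
  < T, where the ramp still fits into [0,T]; the case t = T follows by continuity.\<close>

lemma weak_increment:
  assumes XY: "adm X Y" and st: "0 \<le> s" "s \<le> t" "t \<le> T"
  shows "\<bar>inner (V t - V s) X + integral {s..t} (\<lambda>\<tau>. inner (W \<tau>) Y)\<bar> \<le> norm X * (fint t - fint s)"
proof -
  obtain w where w: "H1a \<alpha> w" and X: "X = mk_l2 (ext01 w)" and Y: "Y = mk_l2 (wderiv \<alpha> w)"
    using XY unfolding adm_def by auto
  have gc: "continuous_on {0..T} (\<lambda>\<tau>. inner (W \<tau>) Y)" by (intro continuous_intros W_cont)
  have gi: "(\<lambda>\<tau>. inner (W \<tau>) Y) integrable_on {a..b}" if "0 \<le> a" "b \<le> T" for a b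
    using that by (intro integrable_continuous_real continuous_on_subset[OF gc]) auto
  have main: "\<bar>inner (V t - V s) X + integral {s..t} (\<lambda>\<tau>. inner (W \<tau>) Y)\<bar> \<le> norm X * (fint t - fint s)"
    if st: "0 \<le> s" "s \<le> t" "t < T" for s t
  proof -
    let ?L = "\<lambda>s d. (1 / d) * integral {s..s + d} (\<lambda>t. inner (V t) X) + integral {0..T} (\<lambda>t. cutoff s d t * inner (W t) Y)"
    let ?I = "\<lambda>s. inner (V s) X + integral {0..s} (\<lambda>t. inner (W t) Y)"
    have A: "((\<lambda>d. \<bar>?L t d - ?L s d\<bar>) \<longlongrightarrow> \<bar>?I t - ?I s\<bar>) (at_right 0)"
      unfolding X Y using st by (intro tendsto_rabs tendsto_diff weak_limit[OF w]) auto
    have B: "((\<lambda>d. norm X * (fint (t + d) - fint s)) \<longlongrightarrow> norm X * (fint t - fint s)) (at_right 0)"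
    proof (intro tendsto_intros)
      have "(fint \<longlongrightarrow> fint t) (at_right t)"
      proof -
        have "continuous_on {t..T} fint" using st by (intro continuous_on_subset[OF fint_cont]) auto
        then have "(fint \<longlongrightarrow> fint t) (at t within {t..T})" using st by (auto simp: continuous_on_def)
        then show ?thesis using st by (simp add: at_within_Icc_at_right)
      qed
      then show "((\<lambda>d. fint (t + d)) \<longlongrightarrow> fint t) (at_right 0)"
        by (simp add: filterlim_at_right_to_0[of fint _ t] add.commute)
    qed
    have C: "\<forall>\<^sub>F d in at_right 0. \<bar>?L t d - ?L s d\<bar> \<le> norm X * (fint (t + d) - fint s)"
    proof -
      have "\<forall>\<^sub>F d in at_right 0. d \<in> {0<..<T - t}" using eventually_at_right_real[of 0 "T - t"] st by simp
      then show ?thesis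
      proof eventually_elim
        case (elim d)
        then have d: "0 < d" "t + d \<le> T" "s + d \<le> T" using st by auto
        have t0: "0 \<le> t" using st by simp
        note wt = weak_cutoff[OF w t0 d(1,2)] and ws = weak_cutoff[OF w st(1) d(1,3)]
        have dist: "(\<lambda>r. (cutoff t d r - cutoff s d r) * inner (mk_l2 (ext01 (f r))) X)
          = (\<lambda>r. cutoff t d r * inner (mk_l2 (ext01 (f r))) X - cutoff s d r * inner (mk_l2 (ext01 (f r))) X)"
          by (simp add: left_diff_distrib)
        have "?L t d - ?L s d = (LINT r:{0<..<T}|lebesgue. (cutoff t d r - cutoff s d r) * inner (mk_l2 (ext01 (f r))) X)"
          unfolding dist unfolding X Y set_integral_diff(2)[OF wt(2) ws(2)] wt(1)[symmetric] ws(1)[symmetric] by simp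
        also have "\<bar>\<dots>\<bar> \<le> norm X * (fint (t + d) - fint s)"
          unfolding X
        proof (rule f_cutoff_bound[OF w])
          show "set_integrable lebesgue {0<..<T} (\<lambda>r. (cutoff t d r - cutoff s d r) * inner (mk_l2 (ext01 (f r))) (mk_l2 (ext01 w)))"
            using set_integral_diff(1)[OF wt(2) ws(2)] dist unfolding X by simp
          show "\<bar>cutoff t d r - cutoff s d r\<bar> \<le> 1" for r using cutoff_le[of t d r] cutoff_le[of s d r] by linarith
          show "cutoff t d r - cutoff s d r = 0" if "r \<notin> {s..t + d}" for r
            using that d st by (cases "r < s") (auto simp: cutoff_eq)
        qed (use st d in auto)
        finally show ?case .
      qed
    qed
    have "\<bar>?I t - ?I s\<bar> \<le> norm X * (fint t - fint s)"
      by (rule tendsto_le[OF trivial_limit_at_right_real B A C])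
    moreover have "integral {0..s} (\<lambda>\<tau>. inner (W \<tau>) Y) + integral {s..t} (\<lambda>\<tau>. inner (W \<tau>) Y) = integral {0..t} (\<lambda>\<tau>. inner (W \<tau>) Y)"
      by (rule Henstock_Kurzweil_Integration.integral_combine) (use st gi in auto)
    ultimately show ?thesis by (simp add: inner_diff_left)
  qed
  show ?thesis
  proof (cases "s < T")
    case True
    have cl: "closure {s..<T} = {s..T}" using True by simp
    have "continuous_on {s..T} (\<lambda>t. integral {s..t} (\<lambda>\<tau>. inner (W \<tau>) Y))"
      using gi st by (intro indefinite_integral_continuous_1) auto
    then have "continuous_on (closure {s..<T}) (\<lambda>t. \<bar>inner (V t - V s) X + integral {s..t} (\<lambda>\<tau>. inner (W \<tau>) Y)\<bar> - norm X * (fint t - fint s))"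
      unfolding cl using st
      by (intro continuous_intros continuous_on_subset[OF V_cont] continuous_on_subset[OF fint_cont]) auto
    then have "\<bar>inner (V t - V s) X + integral {s..t} (\<lambda>\<tau>. inner (W \<tau>) Y)\<bar> - norm X * (fint t - fint s) \<le> 0"
      by (rule continuous_le_on_closure) (use cl st main[of s] in auto)
    then show ?thesis by simp
  next
    case False
    then have "s = t" "t = T" using st by auto
    then show ?thesis by simp
  qed
qed

sublocale evolution T U V W fint adm
  by unfold_locales (use T_pos U_deriv V_cont W_cont fint_cont fint_mono weak_increment in auto)

section \<open>Initial data and the energy bound\<close>

lemma adm_diff: "s \<in> {0..T} \<Longrightarrow> t \<in> {0..T} \<Longrightarrow> adm (U t - U s) (W t - W s)"
  unfolding adm_def U_def W_def using H1a_diff[OF uH uH] by metis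

text \<open>\<open>V_initial\<close> compares V 0 with u1 only against the energy space. Density of
  that space is avoided: V 0 is itself the limit of difference quotients lying in it, and testing
  with these gives |V 0|^2 = <u1, V 0>.\<close>

lemma norm_V_initial: "norm (V 0) \<le> L2norm u1"
proof -
  have u1': "L2norm u1 = norm (mk_l2 (ext01 u1))" by (rule L2norm_eq_norm[OF u1])
  have T0: "0 \<in> {0..T}" using T_pos by simp
  have lim: "((\<lambda>h. (U (0 + h) - U 0) /\<^sub>R h) \<longlongrightarrow> V 0) (at_right 0)"
    by (rule has_vector_derivative_right_quotient[OF U_deriv[OF T0]]) (use T_pos in auto)
  have l1: "((\<lambda>h. inner (V 0) ((U (0 + h) - U 0) /\<^sub>R h)) \<longlongrightarrow> inner (V 0) (V 0)) (at_right 0)"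
    by (intro tendsto_intros lim)
  have l2: "((\<lambda>h. inner (mk_l2 (ext01 u1)) ((U (0 + h) - U 0) /\<^sub>R h)) \<longlongrightarrow> inner (mk_l2 (ext01 u1)) (V 0)) (at_right 0)"
    by (intro tendsto_intros lim)
  have ev: "\<forall>\<^sub>F h in at_right 0. inner (V 0) ((U (0 + h) - U 0) /\<^sub>R h) = inner (mk_l2 (ext01 u1)) ((U (0 + h) - U 0) /\<^sub>R h)"
  proof -
    have "\<forall>\<^sub>F h in at_right 0. h \<in> {0<..<T}" using eventually_at_right_real[OF T_pos] .
    then show ?thesis
    proof eventually_elim
      case (elim h)
      then have h: "h \<in> {0..T}" by auto
      have "inner (V 0) (U h - U 0) = inner (mk_l2 (ext01 u1)) (U h - U 0)"
        using V_initial[OF H1a_diff(1)[OF uH[OF h] uH[OF T0]]] H1a_diff(2)[OF uH[OF h] uH[OF T0]] by (simp add: U_def)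
      then show ?case by simp
    qed
  qed
  have "inner (V 0) (V 0) = inner (mk_l2 (ext01 u1)) (V 0)"
    by (rule tendsto_unique[OF trivial_limit_at_right_real tendsto_cong[OF ev, THEN iffD1, OF l1] l2])
  then have "norm (V 0) * norm (V 0) \<le> L2norm u1 * norm (V 0)"
    using norm_cauchy_schwarz[of "mk_l2 (ext01 u1)" "V 0"] by (simp add: u1' power2_norm_eq_inner[symmetric] power2_eq_square)
  then show ?thesis by (cases "norm (V 0) = 0") (auto simp: u1')
qed

text \<open>u 0 and u0 are prescribed to agree on (0,1], which determines the derivatives in (0,1)
  because differentiation is local.\<close>

lemma norm_W_initial: "(norm (W 0))\<^sup>2 \<le> (H1norm \<alpha> u0)\<^sup>2"
proof -
  have "wderiv \<alpha> (u 0) = wderiv \<alpha> u0"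
  proof
    fix x
    have "deriv (u 0) x = deriv u0 x" if x: "x \<in> {0<..<1}"
    proof (rule deriv_cong_ev[OF _ refl])
      have "\<forall>\<^sub>F y in nhds x. y \<in> {0<..<1}" by (rule eventually_nhds_in_open) (use x in auto)
      then show "\<forall>\<^sub>F y in nhds x. u 0 y = u0 y" by eventually_elim (auto intro: u_init)
    qed
    then show "wderiv \<alpha> (u 0) x = wderiv \<alpha> u0 x" by (simp add: wderiv_def indicator_def)
  qed
  then show ?thesis by (simp add: W_def H1norm_sq[OF u0])
qed

lemma energy_bound:
  assumes t: "t \<in> {0..T}"
  shows "(norm (V t))\<^sup>2 + (norm (W t))\<^sup>2 \<le> 16 * ((L1L2norm T f)\<^sup>2 + (H1norm \<alpha> u0)\<^sup>2 + (L2norm u1)\<^sup>2)"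
proof -
  have "(norm (V t))\<^sup>2 + (norm (W t))\<^sup>2 \<le> 4 * ((norm (V 0))\<^sup>2 + (norm (W 0))\<^sup>2) + 16 * (fint T - fint 0)\<^sup>2"
    by (rule energy_estimate[OF adm_diff t])
  moreover have "(norm (V 0))\<^sup>2 \<le> (L2norm u1)\<^sup>2" using norm_V_initial by (intro power_mono) auto
  moreover have "0 \<le> (norm (V 0))\<^sup>2" "0 \<le> (norm (W 0))\<^sup>2" by auto
  moreover have "0 \<le> (L1L2norm T f)\<^sup>2" "0 \<le> (H1norm \<alpha> u0)\<^sup>2" "0 \<le> (L2norm u1)\<^sup>2" by auto
  moreover note norm_W_initial
  ultimately show ?thesis unfolding fint_total distrib_left by linarith
qed

end

section \<open>Central differences\<close>

text \<open>The group law and the isometry property move continuity at any point to continuity at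
  0.\<close>

lemma continuous_on_shift_l2: "continuous_on A (\<lambda>s. shift_l2 s X)"
  unfolding continuous_on_def
proof
  fix s0 assume "s0 \<in> A"
  have sh: "norm (shift_l2 s X - shift_l2 s0 X) = norm (shift_l2 (s - s0) X - X)" for s
  proof -
    have "shift_l2 s X = shift_l2 s0 (shift_l2 (s - s0) X)"
      by transfer (auto simp: l2_rel_def intro!: sq_int_shift)
    then have "shift_l2 s X - shift_l2 s0 X = shift_l2 s0 (shift_l2 (s - s0) X - X)"
      by (simp add: linear_diff[OF bounded_linear.linear[OF bounded_linear_shift_l2]])
    then show ?thesis by simp
  qed
  have z: "shift_l2 0 X = X" by transfer simp
  have "isCont (\<lambda>s. shift_l2 s X) 0" using shift_l2_tendsto[of X] by (simp add: isCont_def z)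
  moreover have "((\<lambda>s. s - s0) \<longlongrightarrow> s0 - s0) (at s0 within A)" by (intro tendsto_intros)
  ultimately have "((\<lambda>s. shift_l2 (s - s0) X) \<longlongrightarrow> shift_l2 0 X) (at s0 within A)"
    by (intro isCont_tendsto_compose[of 0 "\<lambda>s. shift_l2 s X"]) auto
  then have "((\<lambda>s. norm (shift_l2 (s - s0) X - X)) \<longlongrightarrow> norm (X - X)) (at s0 within A)"
    unfolding z by (intro tendsto_intros)
  then have "((\<lambda>s. norm (shift_l2 s X - shift_l2 s0 X)) \<longlongrightarrow> 0) (at s0 within A)" by (simp add: sh)
  then show "((\<lambda>s. shift_l2 s X) \<longlongrightarrow> shift_l2 s0 X) (at s0 within A)"
    by (simp only: tendsto_norm_zero_iff LIM_zero_iff)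
qed

text \<open>Discrete integration by parts: the term with y(x - k) is translated by k, after which
  only a difference of the coefficient b remains.\<close>

lemma central_difference_identity:
  assumes y: "sq_int y" and bm: "b \<in> borel_measurable lebesgue" and bb: "\<And>x. \<bar>b x\<bar> \<le> M"
  shows "(LINT x|lebesgue. b x * y x * (y (x + k) - y (x - k))) = - (LINT x|lebesgue. y x * y (x + k) * (b (x + k) - b x))"
proof -
  have yk: "sq_int (\<lambda>x. y (x + k))" "sq_int (\<lambda>x. y (x - k))"
    using sq_int_shift[OF y, of k] sq_int_shift[OF y, of "-k"] by simp_all
  have bys: "sq_int (\<lambda>x. b x * y x)" by (rule sq_int_mult_bounded[OF y bm bb])
  have byks: "sq_int (\<lambda>x. b (x + k) * y (x + k))" using sq_int_shift[OF bys, of k] .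
  have "(LINT x|lebesgue. b x * y x * (y (x + k) - y (x - k))) = (LINT x|lebesgue. (b x * y x) * y (x + k)) - (LINT x|lebesgue. (b x * y x) * y (x - k))"
    unfolding right_diff_distrib by (rule Bochner_Integration.integral_diff[OF sq_int_mult[OF bys yk(1)] sq_int_mult[OF bys yk(2)]])
  also have "(LINT x|lebesgue. (b x * y x) * y (x - k)) = (LINT x|lebesgue. (b (x + k) * y (x + k)) * y x)"
    using lebesgue_integral_shift[of "\<lambda>x. (b x * y x) * y (x - k)" k] by simp
  also have "(LINT x|lebesgue. (b x * y x) * y (x + k)) - \<dots> = (LINT x|lebesgue. (b x * y x) * y (x + k) - (b (x + k) * y (x + k)) * y x)"
    by (rule Bochner_Integration.integral_diff[OF sq_int_mult[OF bys yk(1)] sq_int_mult[OF byks y], symmetric])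
  also have "\<dots> = (LINT x|lebesgue. - (y x * y (x + k) * (b (x + k) - b x)))"
    by (rule Bochner_Integration.integral_cong) (auto simp: algebra_simps)
  finally show ?thesis by simp
qed

text \<open>The divisor k is absorbed by the Lipschitz bound of b, and the translate of y has the
  norm of y, so the estimate is uniform in k.\<close>

lemma central_difference_bound:
  assumes y: "sq_int y" and bm: "b \<in> borel_measurable lebesgue" and bb: "\<And>x. \<bar>b x\<bar> \<le> M"
    and L: "\<And>x z. \<bar>b x - b z\<bar> \<le> L * \<bar>x - z\<bar>" and k: "k > 0"
  shows "\<bar>(LINT x|lebesgue. b x * y x * (y (x + k) - y (x - k))) / (2 * k)\<bar> \<le> L / 2 * (norm (mk_l2 y))\<^sup>2"
proof -
  define d where "d x = (b (x + k) - b x) / k" for x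
  have dm: "d \<in> borel_measurable lebesgue"
    unfolding d_def[abs_def] using borel_measurable_affine[of b 1 k] bm by (simp add: add.commute)
  have dL: "\<bar>d x\<bar> \<le> L" for x using L[of "x + k" x] k by (simp add: d_def abs_divide divide_le_eq)
  have yk: "sq_int (\<lambda>x. y (x + k))" by (rule sq_int_shift[OF y])
  have "(LINT x|lebesgue. b x * y x * (y (x + k) - y (x - k))) / (2 * k) = - (1/2) * (LINT x|lebesgue. (d x * y x) * y (x + k))"
  proof -
    have "(LINT x|lebesgue. (d x * y x) * y (x + k)) = (LINT x|lebesgue. y x * y (x + k) * (b (x + k) - b x)) / k"
      by (subst integral_divide_zero[symmetric], rule Bochner_Integration.integral_cong) (auto simp: d_def mult_ac)
    then show ?thesis using central_difference_identity[OF y bm bb, of k] k by (simp add: field_simps)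
  qed
  also have "(LINT x|lebesgue. (d x * y x) * y (x + k)) = inner (mult_l2 d (mk_l2 y)) (shift_l2 k (mk_l2 y))"
    using y by (simp add: mult_l2_mk[OF y dm dL] shift_l2_mk inner_mk_l2 sq_int_mult_bounded[OF y dm dL] yk)
  also have "\<bar>- (1/2) * \<dots>\<bar> \<le> (1/2) * (L * norm (mk_l2 y) * norm (mk_l2 y))"
  proof -
    have "\<bar>inner (mult_l2 d (mk_l2 y)) (shift_l2 k (mk_l2 y))\<bar> \<le> norm (mult_l2 d (mk_l2 y)) * norm (mk_l2 y)"
      using Cauchy_Schwarz_ineq2[of "mult_l2 d (mk_l2 y)" "shift_l2 k (mk_l2 y)"] by simp
    also have "\<dots> \<le> L * norm (mk_l2 y) * norm (mk_l2 y)" by (intro mult_right_mono norm_mult_l2_le dm dL) auto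
    finally show ?thesis by (simp add: abs_mult)
  qed
  finally show ?thesis by (simp add: power2_eq_square)
qed

text \<open>The quotients of b converge boundedly to \<open>b'\<close> where y is nonzero, and the
  translates of y converge in norm, so the inner products converge. Asking for differentiability
  only where y is nonzero permits coefficients that are irregular outside the interval carrying the
  solution.\<close>

lemma central_difference_limit:
  assumes y: "sq_int y" and bm: "b \<in> borel_measurable lebesgue" and bb: "\<And>x. \<bar>b x\<bar> \<le> M"
    and L: "\<And>x z. \<bar>b x - b z\<bar> \<le> L * \<bar>x - z\<bar>"
    and b': "b' \<in> borel_measurable lebesgue"
    and D: "AE x in lebesgue. y x \<noteq> 0 \<longrightarrow> (b has_real_derivative b' x) (at x)"
    and k: "\<And>n. k n > 0" "k \<longlonglongrightarrow> 0"
  shows "(\<lambda>n. (LINT x|lebesgue. b x * y x * (y (x + k n) - y (x - k n))) / (2 * k n)) \<longlonglongrightarrow> - (1/2) * (LINT x|lebesgue. b' x * (y x)\<^sup>2)"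
proof -
  define d where "d n x = (b (x + k n) - b x) / k n" for n x
  have dm: "d n \<in> borel_measurable lebesgue" for n
    unfolding d_def[abs_def] using borel_measurable_affine[of b 1 "k n"] bm by (simp add: add.commute)
  have dL: "\<bar>d n x\<bar> \<le> L" for n x using L[of "x + k n" x] k(1)[of n] by (simp add: d_def abs_divide divide_le_eq)
  have yk: "sq_int (\<lambda>x. y (x + k n))" for n by (rule sq_int_shift[OF y])
  let ?Y = "mk_l2 y"
  have eq: "(LINT x|lebesgue. b x * y x * (y (x + k n) - y (x - k n))) / (2 * k n) = - (1/2) * inner (mult_l2 (d n) ?Y) (shift_l2 (k n) ?Y)" for n
  proof -
    have "(LINT x|lebesgue. (d n x * y x) * y (x + k n)) = (LINT x|lebesgue. y x * y (x + k n) * (b (x + k n) - b x)) / k n"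
      by (subst integral_divide_zero[symmetric], rule Bochner_Integration.integral_cong) (auto simp: d_def mult_ac)
    then have "(LINT x|lebesgue. b x * y x * (y (x + k n) - y (x - k n))) / (2 * k n) = - (1/2) * (LINT x|lebesgue. (d n x * y x) * y (x + k n))"
      using central_difference_identity[OF y bm bb, of "k n"] k(1)[of n] by (simp add: field_simps)
    then show ?thesis
      using y by (simp add: mult_l2_mk[OF y dm dL] shift_l2_mk inner_mk_l2 sq_int_mult_bounded[OF y dm dL] yk)
  qed
  have "(\<lambda>n. mk_l2 (\<lambda>x. d n x * y x)) \<longlonglongrightarrow> mk_l2 (\<lambda>x. b' x * y x)"
  proof (rule l2_dominated_convergence[where G="\<lambda>x. L * \<bar>y x\<bar>"])
    have "sq_int (\<lambda>x. \<bar>y x\<bar>)" using y by (auto simp: sq_int_def)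
    then show "sq_int (\<lambda>x. L * \<bar>y x\<bar>)" by (rule sq_int_scale)
    show "(\<lambda>x. d n x * y x) \<in> borel_measurable lebesgue" for n using dm[of n] y by measurable
    show "(\<lambda>x. b' x * y x) \<in> borel_measurable lebesgue" using b' y by measurable
    show "AE x in lebesgue. \<bar>d n x * y x\<bar> \<le> L * \<bar>y x\<bar>" for n
      using dL by (intro AE_I2) (simp add: abs_mult mult_right_mono)
    show "AE x in lebesgue. (\<lambda>n. d n x * y x) \<longlonglongrightarrow> b' x * y x"
      using D
    proof eventually_elim
      case (elim x)
      show ?case
      proof (cases "y x = 0")
        case False
        then have "((\<lambda>h. (b (x + h) - b x) / h) \<longlongrightarrow> b' x) (at 0)" using elim by (simp add: DERIV_def)
        moreover have "filterlim k (at 0) sequentially"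
          unfolding filterlim_at using k by (auto intro!: always_eventually simp: less_imp_neq[symmetric])
        ultimately have "(\<lambda>n. d n x) \<longlonglongrightarrow> b' x" unfolding d_def by (rule filterlim_compose)
        then show ?thesis by (intro tendsto_intros)
      qed simp
    qed
  qed
  moreover have "mult_l2 (d n) ?Y = mk_l2 (\<lambda>x. d n x * y x)" for n by (rule mult_l2_mk[OF y dm dL])
  ultimately have "(\<lambda>n. mult_l2 (d n) ?Y) \<longlonglongrightarrow> mk_l2 (\<lambda>x. b' x * y x)" by simp
  moreover have "(\<lambda>n. shift_l2 (k n) ?Y) \<longlonglongrightarrow> ?Y"
  proof -
    have "filterlim k (at 0) sequentially"
      unfolding filterlim_at using k by (auto intro!: always_eventually simp: less_imp_neq[symmetric])
    then show ?thesis by (rule filterlim_compose[OF shift_l2_tendsto])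
  qed
  ultimately have "(\<lambda>n. - (1/2) * inner (mult_l2 (d n) ?Y) (shift_l2 (k n) ?Y)) \<longlonglongrightarrow> - (1/2) * inner (mk_l2 (\<lambda>x. b' x * y x)) ?Y"
    by (intro tendsto_intros)
  moreover have "inner (mk_l2 (\<lambda>x. b' x * y x)) ?Y = (LINT x|lebesgue. b' x * (y x)\<^sup>2)"
  proof -
    \<comment> \<open>The bound on the difference quotients passes to \<open>b'\<close>, which makes
      its product with y square integrable.\<close>
    have b'L: "AE x in lebesgue. y x \<noteq> 0 \<longrightarrow> \<bar>b' x\<bar> \<le> L"
      using D
    proof eventually_elim
      case (elim x)
      show ?case
      proof
        assume "y x \<noteq> 0"
        then have "((\<lambda>h. (b (x + h) - b x) / h) \<longlongrightarrow> b' x) (at 0)" using elim by (simp add: DERIV_def)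
        then have "((\<lambda>h. \<bar>(b (x + h) - b x) / h\<bar>) \<longlongrightarrow> \<bar>b' x\<bar>) (at 0)" by (rule tendsto_rabs)
        then show "\<bar>b' x\<bar> \<le> L"
        proof (rule tendsto_upperbound)
          show "\<forall>\<^sub>F h in at 0. \<bar>(b (x + h) - b x) / h\<bar> \<le> L"
            unfolding eventually_at_filter
          proof (intro always_eventually allI impI)
            fix h :: real assume "h \<noteq> 0"
            then show "\<bar>(b (x + h) - b x) / h\<bar> \<le> L" using L[of "x + h" x] by (simp add: abs_divide divide_le_eq)
          qed
        qed simp
      qed
    qed
    have "sq_int (\<lambda>x. b' x * y x)"
    proof (rule sq_int_bound)
      show "integrable lebesgue (\<lambda>x. L\<^sup>2 * (y x)\<^sup>2)" using sq_int_square[OF y] by simp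
      show "(\<lambda>x. b' x * y x) \<in> borel_measurable lebesgue" using b' y by measurable
      show "AE x in lebesgue. (b' x * y x)\<^sup>2 \<le> L\<^sup>2 * (y x)\<^sup>2"
        using b'L
      proof eventually_elim
        case (elim x)
        show ?case
        proof (cases "y x = 0")
          case False
          then have "\<bar>b' x\<bar>\<^sup>2 \<le> L\<^sup>2" using elim by (intro power_mono) auto
          then show ?thesis by (simp add: power_mult_distrib mult_right_mono)
        qed simp
      qed
    qed
    then show ?thesis using y by (simp add: inner_mk_l2 power2_eq_square mult.assoc)
  qed
  ultimately show ?thesis by (simp add: eq)
qed

lemma average_tendsto_zero:
  fixes \<phi> :: "real \<Rightarrow> real"
  assumes \<phi>: "continuous_on UNIV \<phi>" and k: "\<And>n. k n > 0" "k \<longlonglongrightarrow> 0"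
  shows "(\<lambda>n. integral {- k n..k n} \<phi> / (2 * k n)) \<longlonglongrightarrow> \<phi> 0"
proof (rule LIMSEQ_I)
  fix e :: real assume e: "e > 0"
  have "isCont \<phi> 0" using \<phi> by (simp add: continuous_on_eq_continuous_at)
  then obtain \<delta> where \<delta>: "\<delta> > 0" "\<And>s. \<bar>s\<bar> < \<delta> \<Longrightarrow> \<bar>\<phi> s - \<phi> 0\<bar> < e / 2"
    using e unfolding continuous_at_eps_delta by (metis (no_types, lifting) diff_0_right dist_real_def half_gt_zero)
  obtain N where N: "\<And>n. n \<ge> N \<Longrightarrow> \<bar>k n\<bar> < \<delta>" using LIMSEQ_D[OF k(2) \<delta>(1)] by auto
  show "\<exists>no. \<forall>n\<ge>no. norm (integral {- k n..k n} \<phi> / (2 * k n) - \<phi> 0) < e"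
  proof (intro exI[of _ N] allI impI)
    fix n assume n: "n \<ge> N"
    have kn: "k n > 0" "k n < \<delta>" using k(1)[of n] N[OF n] by auto
    have c: "continuous_on {- k n..k n} \<phi>" by (rule continuous_on_subset[OF \<phi>]) simp
    have "integral {- k n..k n} \<phi> - 2 * k n * \<phi> 0 = integral {- k n..k n} (\<lambda>s. \<phi> s - \<phi> 0)"
      using kn by (subst Henstock_Kurzweil_Integration.integral_diff) (auto intro!: integrable_continuous_real c)
    also have "\<bar>\<dots>\<bar> \<le> (e / 2) * (k n - - k n)"
    proof (rule abs_integral_le_const)
      show "continuous_on {- k n..k n} (\<lambda>s. \<phi> s - \<phi> 0)" by (intro continuous_intros c)
      fix s assume "s \<in> {- k n..k n}"
      then have "\<bar>s\<bar> < \<delta>" using kn by auto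
      from \<delta>(2)[OF this] show "\<bar>\<phi> s - \<phi> 0\<bar> \<le> e / 2" by simp
    qed (use kn in simp)
    finally have "\<bar>integral {- k n..k n} \<phi> - 2 * k n * \<phi> 0\<bar> \<le> e * k n" by simp
    then have "\<bar>(integral {- k n..k n} \<phi> - 2 * k n * \<phi> 0) / (2 * k n)\<bar> \<le> e / 2"
      using kn by (simp add: abs_divide divide_le_eq)
    moreover have "(integral {- k n..k n} \<phi> - 2 * k n * \<phi> 0) / (2 * k n) = integral {- k n..k n} \<phi> / (2 * k n) - \<phi> 0"
      using kn by (simp add: diff_divide_distrib)
    ultimately show "norm (integral {- k n..k n} \<phi> / (2 * k n) - \<phi> 0) < e" using e by simp
  qed
qed

text \<open>E(x+k) - E(x-k) is the integral of z(x+s) over s in [-k,k], and Fubini turns the pairing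
  with g into an integral of inner products with translates of z. The formula for E is available
  from c on; c + k \<le> a keeps x - k there on the support of g.\<close>

lemma difference_duality:
  assumes g: "sq_int g" and gsupp: "\<And>x. x < a \<Longrightarrow> g x = 0"
    and z: "sq_int z" and E: "\<And>x y. c \<le> x \<Longrightarrow> x \<le> y \<Longrightarrow> E y - E x = (LINT t:{x..y}|lebesgue. z t)"
    and k: "k > 0" "c + k \<le> a"
  shows "(LINT x|lebesgue. g x * (E (x + k) - E (x - k))) = integral {- k..k} (\<lambda>s. inner (mk_l2 g) (shift_l2 s (mk_l2 z)))"
proof -
  obtain g' where g': "g' \<in> borel_measurable lborel" "AE x in lborel. g x = g' x"
    using completion_ex_borel_measurable_real[OF sq_intD[OF g]] by auto
  obtain z' where z': "z' \<in> borel_measurable lborel" "AE x in lborel. z x = z' x"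
    using completion_ex_borel_measurable_real[OF sq_intD[OF z]] by auto
  have [measurable]: "g' \<in> borel_measurable borel" "z' \<in> borel_measurable borel" using g' z' by simp_all
  have gAE: "AE x in lebesgue. g x = g' x" and zAE: "AE x in lebesgue. z x = z' x"
    using g'(2) z'(2) by (simp_all add: AE_completion_iff)
  have gs: "sq_int g'"
    by (rule sq_int_bound[OF sq_int_square[OF g]]) (use gAE in \<open>auto intro: measurable_completion elim: eventually_mono\<close>)
  have zs: "sq_int z'"
    by (rule sq_int_bound[OF sq_int_square[OF z]]) (use zAE in \<open>auto intro: measurable_completion elim: eventually_mono\<close>)
  have gmk: "mk_l2 g = mk_l2 g'" using mk_l2_eq_iff[OF g gs] gAE by simp
  have zmk: "mk_l2 z = mk_l2 z'" using mk_l2_eq_iff[OF z zs] zAE by simp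
  \<comment> \<open>Borel representatives make the integrand measurable in both variables, including
    the composition with x + s.\<close>
  define H where "H = (\<lambda>(s::real, x). indicator {- k..k} s * (g' x * z' (x + s)))"
  have Hm [measurable]: "H \<in> borel_measurable (borel \<Otimes>\<^sub>M borel)" unfolding H_def by measurable
  then have HB: "H \<in> borel_measurable borel" unfolding borel_prod .
  have HL: "H \<in> borel_measurable lebesgue" using HB by (intro measurable_completion) simp
  define K where "K = norm (mk_l2 g') * norm (mk_l2 z')"
  have fin: "(\<integral>\<^sup>+s. ennreal K * indicator {- k..k} s \<partial>lebesgue) < \<infinity>"
    using k by (simp add: nn_integral_cmult_indicator ennreal_mult_less_top)
  have le: "AE s in lebesgue. (\<integral>\<^sup>+x. ennreal \<bar>H (s, x)\<bar> \<partial>lebesgue) \<le> ennreal K * indicator {- k..k} s"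
  proof (rule AE_I2)
    fix s
    show "(\<integral>\<^sup>+x. ennreal \<bar>H (s, x)\<bar> \<partial>lebesgue) \<le> ennreal K * indicator {- k..k} s"
    proof (cases "s \<in> {- k..k}")
      case True
      have "(\<integral>\<^sup>+x. ennreal \<bar>g' x * z' (x + s)\<bar> \<partial>lebesgue) \<le> ennreal (norm (mk_l2 g') * norm (mk_l2 (\<lambda>x. z' (x + s))))"
        by (rule nn_integral_Cauchy_Schwarz[OF gs sq_int_shift[OF zs]])
      also have "norm (mk_l2 (\<lambda>x. z' (x + s))) = norm (mk_l2 z')" by (simp add: shift_l2_mk[OF zs, symmetric])
      finally show ?thesis using True by (simp add: H_def K_def)
    qed (simp add: H_def)
  qed
  note fub = Fubini_lebesgue[OF HL fin le]
  have Hi: "integrable (lborel \<Otimes>\<^sub>M lborel) H"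
  proof -
    have "integrable lborel H" using fub(1) HB by (simp add: integrable_completion)
    then show ?thesis unfolding lborel_prod .
  qed
  define J where "J x = (LINT s|lborel. H (s, x))" for x
  have Jm: "J \<in> borel_measurable borel" unfolding J_def H_def prod.case by measurable
  have "(LINT s|lebesgue. LINT x|lebesgue. H (s, x)) = integral {- k..k} (\<lambda>s. inner (mk_l2 g) (shift_l2 s (mk_l2 z)))"
  proof -
    have "(LINT x|lebesgue. H (s, x)) = indicator {- k..k} s *\<^sub>R inner (mk_l2 g) (shift_l2 s (mk_l2 z))" for s
    proof -
      have "(LINT x|lebesgue. H (s, x)) = indicator {- k..k} s * (LINT x|lebesgue. g' x * z' (x + s))"
        by (simp add: H_def)
      also have "(LINT x|lebesgue. g' x * z' (x + s)) = inner (mk_l2 g) (shift_l2 s (mk_l2 z))"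
        unfolding gmk zmk using gs zs by (simp add: shift_l2_mk inner_mk_l2 sq_int_shift)
      finally show ?thesis by simp
    qed
    then have "(LINT s|lebesgue. LINT x|lebesgue. H (s, x)) = (LINT s:{- k..k}|lebesgue. inner (mk_l2 g) (shift_l2 s (mk_l2 z)))"
      by (simp add: set_lebesgue_integral_def)
    also have "\<dots> = integral {- k..k} (\<lambda>s. inner (mk_l2 g) (shift_l2 s (mk_l2 z)))"
      by (intro set_lebesgue_integral_eq_integral(2) absolutely_integrable_continuous_real continuous_intros continuous_on_shift_l2)
    finally show ?thesis .
  qed
  moreover have "integral\<^sup>L lebesgue H = (LINT x|lebesgue. g x * (E (x + k) - E (x - k)))"
  proof -
    have "integral\<^sup>L lebesgue H = integral\<^sup>L lborel H" by (rule integral_completion) (use HB in simp)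
    also have "\<dots> = integral\<^sup>L (lborel \<Otimes>\<^sub>M lborel) H" unfolding lborel_prod ..
    also have "\<dots> = (LINT x|lborel. LINT s|lborel. H (s, x))"
      using lborel_pair.integral_snd[of "\<lambda>s x. H (s, x)"] Hi by simp
    also have "\<dots> = integral\<^sup>L lborel J" unfolding J_def ..
    also have "\<dots> = integral\<^sup>L lebesgue J" by (rule integral_lebesgue_eq_lborel[OF Jm, symmetric])
    also have "\<dots> = (LINT x|lebesgue. g x * (E (x + k) - E (x - k)))"
    proof -
      have JmL: "J \<in> borel_measurable lebesgue" using Jm by (intro measurable_completion) simp
      have Jeq: "AE x in lebesgue. J x = g x * (E (x + k) - E (x - k))"
        using gAE
      proof eventually_elim
        case (elim x)
        have "J x = g' x * (LINT s|lborel. indicator {- k..k} s * z' (x + s))"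
          unfolding J_def H_def prod.case by (subst integral_mult_right_zero[symmetric], rule Bochner_Integration.integral_cong) auto
        also have "(LINT s|lborel. indicator {- k..k} s * z' (x + s)) = (LINT t|lborel. indicator {x - k..x + k} t * z' t)"
        proof -
          have "indicator {x - k..x + k} (x + s) = (indicator {- k..k} s :: real)" for s by (auto simp: indicator_def)
          then show ?thesis
            using lborel_integral_real_affine[of 1 "\<lambda>t. indicator {x - k..x + k} t * z' t" x] by simp
        qed
        also have "\<dots> = (LINT t|lebesgue. indicator {x - k..x + k} t * z' t)"
          by (rule integral_lebesgue_eq_lborel[symmetric]) simp
        also have "\<dots> = (LINT t:{x - k..x + k}|lebesgue. z t)"
          unfolding set_lebesgue_integral_def
        proof (rule integral_cong_AE)
          show "(\<lambda>t. indicator {x - k..x + k} t * z' t) \<in> borel_measurable lebesgue" by (intro measurable_completion) simp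
          show "(\<lambda>t. indicator {x - k..x + k} t *\<^sub>R z t) \<in> borel_measurable lebesgue" using z by measurable
        qed (use zAE in \<open>auto elim: eventually_mono\<close>)
        finally have J: "J x = g' x * (LINT t:{x - k..x + k}|lebesgue. z t)" .
        show ?case
        proof (cases "x < a")
          case True
          then show ?thesis using J elim gsupp[of x] by simp
        next
          case False
          then show ?thesis using J elim E[of "x - k" "x + k"] k by simp
        qed
      qed
      show ?thesis by (rule integral_cong_AE[OF JmL borel_measurable_AE[OF JmL Jeq] Jeq])
    qed
    finally show ?thesis .
  qed
  ultimately show ?thesis using fub(3) by simp
qed

lemma Lipschitz_min_max:
  fixes f g :: "real \<Rightarrow> real"
  assumes "\<And>x z. \<bar>f x - f z\<bar> \<le> L * \<bar>x - z\<bar>" "\<And>x z. \<bar>g x - g z\<bar> \<le> M * \<bar>x - z\<bar>"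
  shows "\<bar>min (f x) (g x) - min (f z) (g z)\<bar> \<le> max L M * \<bar>x - z\<bar>"
proof -
  have "L * \<bar>x - z\<bar> \<le> max L M * \<bar>x - z\<bar>" "M * \<bar>x - z\<bar> \<le> max L M * \<bar>x - z\<bar>"
    by (intro mult_right_mono; simp)+
  then show ?thesis using assms(1)[of x z] assms(2)[of x z] by linarith
qed

text \<open>In general x^alpha is not globally Lipschitz, for alpha < 1 because of the origin and
  for alpha > 1 because of its growth; hence the clamp. On [c,2] the derivative is monotone, so its
  endpoint values bound it whichever side of 1 alpha lies on.\<close>

lemma powr_clamp_Lipschitz:
  fixes c \<alpha> :: real
  assumes "0 < c" "c \<le> 2" "0 < \<alpha>"
  obtains L where "L \<ge> 0" "\<And>x z. \<bar>(min 2 (max c x)) powr \<alpha> - (min 2 (max c z)) powr \<alpha>\<bar> \<le> L * \<bar>x - z\<bar>"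
proof -
  define S where "S = \<alpha> * (max (c powr (\<alpha> - 1)) (2 powr (\<alpha> - 1)))"
  have S: "S \<ge> 0" using assms by (simp add: S_def le_max_iff_disj)
  have D: "\<bar>x powr \<alpha> - z powr \<alpha>\<bar> \<le> S * \<bar>x - z\<bar>" if xz: "x \<in> {c..2}" "z \<in> {c..2}" for x z
  proof -
    have "norm (x powr \<alpha> - z powr \<alpha>) \<le> S * norm (x - z)"
    proof (rule field_differentiable_bound[of "{c..2}" "\<lambda>x. x powr \<alpha>" "\<lambda>x. \<alpha> * x powr (\<alpha> - 1)"])
      fix y assume y: "y \<in> {c..2}"
      then have y0: "y > 0" using assms by auto
      show "((\<lambda>x. x powr \<alpha>) has_real_derivative \<alpha> * y powr (\<alpha> - 1)) (at y within {c..2})"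
        by (rule has_field_derivative_at_within[OF has_real_derivative_powr[OF y0]])
      have "y powr (\<alpha> - 1) \<le> max (c powr (\<alpha> - 1)) (2 powr (\<alpha> - 1))"
      proof (cases "\<alpha> \<ge> 1")
        case True
        then have "y powr (\<alpha> - 1) \<le> 2 powr (\<alpha> - 1)" using y y0 by (intro powr_mono2) auto
        then show ?thesis by simp
      next
        case False
        then have "y powr (\<alpha> - 1) \<le> c powr (\<alpha> - 1)" using y assms by (intro powr_mono2') auto
        then show ?thesis by simp
      qed
      then show "norm (\<alpha> * y powr (\<alpha> - 1)) \<le> S" using assms by (simp add: S_def abs_mult)
    qed (use xz in auto)
    then show ?thesis by simp
  qed
  show ?thesis
  proof (rule that[OF S])
    fix x z
    have "\<bar>(min 2 (max c x)) powr \<alpha> - (min 2 (max c z)) powr \<alpha>\<bar> \<le> S * \<bar>min 2 (max c x) - min 2 (max c z)\<bar>"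
      using assms by (intro D) auto
    also have "\<dots> \<le> S * \<bar>x - z\<bar>" by (intro mult_left_mono S) linarith
    finally show "\<bar>(min 2 (max c x)) powr \<alpha> - (min 2 (max c z)) powr \<alpha>\<bar> \<le> S * \<bar>x - z\<bar>" .
  qed
qed

lemma Lipschitz_mult:
  fixes f g :: "real \<Rightarrow> real"
  assumes f: "\<And>x z. \<bar>f x - f z\<bar> \<le> L * \<bar>x - z\<bar>" "\<And>x. \<bar>f x\<bar> \<le> A"
    and g: "\<And>x z. \<bar>g x - g z\<bar> \<le> M * \<bar>x - z\<bar>" "\<And>x. \<bar>g x\<bar> \<le> B"
  shows "\<bar>f x * g x - f z * g z\<bar> \<le> (A * M + L * B) * \<bar>x - z\<bar>"
proof -
  have "f x * g x - f z * g z = f x * (g x - g z) + (f x - f z) * g z" by (simp add: algebra_simps)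
  also have "\<bar>\<dots>\<bar> \<le> \<bar>f x\<bar> * \<bar>g x - g z\<bar> + \<bar>f x - f z\<bar> * \<bar>g z\<bar>" by (metis abs_mult abs_triangle_ineq)
  also have "\<dots> \<le> A * (M * \<bar>x - z\<bar>) + (L * \<bar>x - z\<bar>) * B"
    using f(2)[of x] g(2)[of z] f(1)[of x z] g(1)[of x z] by (intro add_mono mult_mono) (auto intro: order_trans[OF abs_ge_zero])
  finally show ?thesis by (simp add: algebra_simps)
qed

section \<open>The boundary layer\<close>

text \<open>The profile starts at a, and translations by less than a - c keep its support in the
  region x > c, where the weight is bounded below. The condition on 2 a reserves [a, 2 a] for the
  rise of the profile before the layer begins.\<close>

locale wave_layer = wave +
  fixes a c \<epsilon> :: real
  assumes c: "0 < c" and ca: "c < a" and a\<epsilon>: "2 * a \<le> 1 - \<epsilon>" and \<epsilon>: "0 < \<epsilon>"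
begin

text \<open>The multiplier profile vanishes at the endpoint 1, has slope -1 on the layer and height at most \<epsilon>.\<close>
definition p :: "real \<Rightarrow> real" where
  "p x = min (\<epsilon> * max 0 (min 1 ((x - a) / a))) (max (- 1) (1 - x))"

definition p' :: "real \<Rightarrow> real" where
  "p' x = (if a < x \<and> x < 2 * a then \<epsilon> / a else if 1 - \<epsilon> < x then - 1 else 0)"

text \<open>Agrees with x^alpha on [c,2] and is constant beyond, so that p \<rho> is bounded and
  Lipschitz on the whole line.\<close>

definition \<rho> :: "real \<Rightarrow> real" where "\<rho> x = (min 2 (max c x)) powr \<alpha>"

definition \<rho>' :: "real \<Rightarrow> real" where "\<rho>' x = indicator {c<..<1} x * (\<alpha> * x powr (\<alpha> - 1))"

lemma a_pos: "0 < a" and \<epsilon>1: "\<epsilon> < 1" and a1: "2 * a < 1"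
  using c ca a\<epsilon> \<epsilon> by auto

lemma clamp_range: "0 \<le> \<epsilon> * max 0 (min 1 y)" "\<epsilon> * max 0 (min 1 y) \<le> \<epsilon>"
proof -
  show "0 \<le> \<epsilon> * max 0 (min 1 y)" using \<epsilon> by simp
  have "\<epsilon> * max 0 (min 1 y) \<le> \<epsilon> * 1" using \<epsilon> by (intro mult_left_mono) auto
  then show "\<epsilon> * max 0 (min 1 y) \<le> \<epsilon>" by simp
qed

text \<open>Past the endpoint 1 the profile turns negative and is clamped at -1: the central
  difference estimates ask for a bound on the whole line, since they evaluate the coefficient at x +
  k.\<close>

lemma p_bounded: "\<bar>p x\<bar> \<le> 1"
proof -
  have "0 \<le> A \<Longrightarrow> A \<le> \<epsilon> \<Longrightarrow> \<bar>min A (max (- 1) (1 - x))\<bar> \<le> 1" for A using \<epsilon>1 by linarith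
  then show ?thesis unfolding p_def using clamp_range .
qed

lemma p_range: "x \<le> 1 \<Longrightarrow> 0 \<le> p x \<and> p x \<le> \<epsilon>"
proof -
  assume x: "x \<le> 1"
  have "0 \<le> A \<Longrightarrow> A \<le> \<epsilon> \<Longrightarrow> 0 \<le> min A (max (- 1) (1 - x)) \<and> min A (max (- 1) (1 - x)) \<le> \<epsilon>" for A using x by linarith
  then show ?thesis unfolding p_def using clamp_range .
qed

lemma p_zero: "x \<le> a \<Longrightarrow> p x = 0" and p_one: "p 1 = 0"
proof -
  show "p x = 0" if "x \<le> a"
  proof -
    have "(x - a) / a \<le> 0" using that a_pos by (simp add: divide_le_0_iff)
    then show ?thesis using that a1 by (simp add: p_def)
  qed
  have "0 \<le> \<epsilon> * max 0 (min 1 ((1 - a) / a))" using \<epsilon> by simp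
  then show "p 1 = 0" by (simp add: p_def)
qed

definition "Lp = max (\<epsilon> / a) 1"

lemma p_Lipschitz: "\<bar>p x - p z\<bar> \<le> Lp * \<bar>x - z\<bar>"
  unfolding p_def Lp_def
proof (rule Lipschitz_min_max)
  fix x z :: real
  have "\<bar>max 0 (min 1 ((x - a) / a)) - max 0 (min 1 ((z - a) / a))\<bar> \<le> \<bar>(x - a) / a - (z - a) / a\<bar>" by linarith
  also have "\<dots> = \<bar>x - z\<bar> / a" using a_pos by (simp add: diff_divide_distrib[symmetric] abs_divide)
  finally have "\<epsilon> * \<bar>max 0 (min 1 ((x - a) / a)) - max 0 (min 1 ((z - a) / a))\<bar> \<le> \<epsilon> * (\<bar>x - z\<bar> / a)"
    using \<epsilon> by (intro mult_left_mono) auto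
  moreover have "\<bar>\<epsilon> * A - \<epsilon> * B\<bar> = \<epsilon> * \<bar>A - B\<bar>" for A B
    using \<epsilon> by (metis abs_mult abs_of_pos right_diff_distrib)
  ultimately show "\<bar>\<epsilon> * max 0 (min 1 ((x - a) / a)) - \<epsilon> * max 0 (min 1 ((z - a) / a))\<bar> \<le> \<epsilon> / a * \<bar>x - z\<bar>"
    by simp
  show "\<bar>max (- 1) (1 - x) - max (- 1) (1 - z)\<bar> \<le> 1 * \<bar>x - z\<bar>" by (simp add: max_def) linarith
qed

lemma p_deriv:
  assumes x: "x < 1" "x \<noteq> a" "x \<noteq> 2 * a" "x \<noteq> 1 - \<epsilon>"
  shows "(p has_real_derivative p' x) (at x)"
proof -
  consider "x < a" | "a < x" "x < 2 * a" | "2 * a < x" "x < 1 - \<epsilon>" | "1 - \<epsilon> < x" using x by linarith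
  then show ?thesis
  proof cases
    case 1
    have "((\<lambda>x. 0) has_real_derivative p' x) (at x)" using 1 a_pos a\<epsilon> by (auto simp: p'_def)
    then show ?thesis
      by (rule has_field_derivative_transform_within_open[of _ _ _ "{..<a}"]) (use 1 in \<open>auto simp: p_zero\<close>)
  next
    case 2
    have "((\<lambda>x. \<epsilon> * ((x - a) / a)) has_real_derivative p' x) (at x)"
      using 2 a_pos by (auto simp: p'_def intro!: derivative_eq_intros)
    then show ?thesis
    proof (rule has_field_derivative_transform_within_open[of _ _ _ "{a<..<2 * a}"])
      fix y assume y: "y \<in> {a<..<2 * a}"
      then have "0 < (y - a) / a" "(y - a) / a < 1" using a_pos by (auto simp: divide_less_eq)
      moreover from this have "\<epsilon> * ((y - a) / a) \<le> \<epsilon> * 1" using \<epsilon> by (intro mult_left_mono) auto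
      moreover have "\<epsilon> \<le> 1 - y" using y a\<epsilon> by auto
      ultimately show "\<epsilon> * ((y - a) / a) = p y" unfolding p_def by (simp add: min_def max_def)
    qed (use 2 in auto)
  next
    case 3
    have "((\<lambda>x. \<epsilon>) has_real_derivative p' x) (at x)" using 3 by (auto simp: p'_def)
    then show ?thesis
    proof (rule has_field_derivative_transform_within_open[of _ _ _ "{2 * a<..<1 - \<epsilon>}"])
      fix y assume y: "y \<in> {2 * a<..<1 - \<epsilon>}"
      then have "1 \<le> (y - a) / a" using a_pos by (simp add: le_divide_eq)
      then show "\<epsilon> = p y" using y unfolding p_def by (simp add: min_def max_def)
    qed (use 3 in auto)
  next
    case 4
    have "((\<lambda>x. 1 - x) has_real_derivative p' x) (at x)" using 4 a\<epsilon> by (auto simp: p'_def intro!: derivative_eq_intros)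
    then show ?thesis
    proof (rule has_field_derivative_transform_within_open[of _ _ _ "{1 - \<epsilon><..<1}"])
      fix y assume y: "y \<in> {1 - \<epsilon><..<1}"
      then have "1 \<le> (y - a) / a" using a_pos a\<epsilon> by (simp add: le_divide_eq)
      then show "1 - y = p y" using y unfolding p_def by (simp add: min_def max_def)
    qed (use 4 x in auto)
  qed
qed

lemma p_measurable [measurable]: "p \<in> borel_measurable borel" and p'_measurable [measurable]: "p' \<in> borel_measurable borel"
  and \<rho>_measurable [measurable]: "\<rho> \<in> borel_measurable borel" and \<rho>'_measurable [measurable]: "\<rho>' \<in> borel_measurable borel"
proof -
  show "p \<in> borel_measurable borel" unfolding p_def[abs_def] by measurable
  have "Measurable.pred borel (\<lambda>x. a < x \<and> x < 2 * a)" "Measurable.pred borel (\<lambda>x. 1 - \<epsilon> < x)" by measurable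
  then show "p' \<in> borel_measurable borel" unfolding p'_def[abs_def] by measurable
  show "\<rho> \<in> borel_measurable borel" unfolding \<rho>_def[abs_def] by measurable
  show "\<rho>' \<in> borel_measurable borel" unfolding \<rho>'_def[abs_def] by measurable
qed

lemma \<rho>_bounded: "\<bar>\<rho> x\<bar> \<le> 2 powr \<alpha>"
proof -
  have "(min 2 (max c x)) powr \<alpha> \<le> 2 powr \<alpha>" using \<alpha>_pos c by (intro powr_mono2) auto
  then show ?thesis by (simp add: \<rho>_def)
qed

lemma \<rho>_deriv:
  assumes "c < x" "x < 1"
  shows "(\<rho> has_real_derivative \<rho>' x) (at x)"
proof -
  have "((\<lambda>x. x powr \<alpha>) has_real_derivative \<rho>' x) (at x)"
    using has_real_derivative_powr[of x \<alpha>] assms c by (simp add: \<rho>'_def)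
  then show ?thesis
    by (rule has_field_derivative_transform_within_open[of _ _ _ "{c<..<1}"]) (use assms in \<open>auto simp: \<rho>_def\<close>)
qed

lemma p\<rho>_Lipschitz: obtains L where "\<And>x z. \<bar>p x * \<rho> x - p z * \<rho> z\<bar> \<le> L * \<bar>x - z\<bar>"
proof -
  have "c \<le> 2" using ca a1 a_pos by linarith
  then obtain M where M: "\<And>x z. \<bar>\<rho> x - \<rho> z\<bar> \<le> M * \<bar>x - z\<bar>"
    unfolding \<rho>_def using powr_clamp_Lipschitz[OF c _ \<alpha>_pos] by metis
  show ?thesis
    by (rule that[OF Lipschitz_mult[OF p_Lipschitz p_bounded M \<rho>_bounded]])
qed

text \<open>The finitely many points at which p, \<rho> or \<open>u_ext\<close> may have a kink in
  the range of interest.\<close>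

lemma AE_generic: "AE x in lebesgue. x \<noteq> a \<and> x \<noteq> 2 * a \<and> x \<noteq> 1 - \<epsilon> \<and> x \<noteq> c \<and> x \<noteq> 1"
proof -
  have "AE x in lborel. x \<noteq> a \<and> x \<noteq> 2 * a \<and> x \<noteq> 1 - \<epsilon> \<and> x \<noteq> c \<and> x \<noteq> 1"
    using AE_lborel_singleton[of a] AE_lborel_singleton[of "2*a"] AE_lborel_singleton[of "1 - \<epsilon>"] AE_lborel_singleton[of c] AE_lborel_singleton[of 1]
    by eventually_elim simp
  then show ?thesis by (simp add: AE_completion_iff)
qed

section \<open>The test function and its operator form\<close>

text \<open>Constant continuation of u(t) beyond [c,1], which on the right means zero because u(t,1)
  = 0.\<close>

definition "u_ext t y = u t (max c (min 1 y))"
definition "z t y = indicator {c<..<1} y * deriv (u t) y"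
definition "w_test k t x = p x / (2 * k) * (u_ext t (x + k) - u_ext t (x - k))"
text \<open>Undoes the weight on (c,1), where its inverse is bounded, and so turns W into the plain
  derivative \<open>z\<close>.\<close>

definition "\<mu> x = indicator {c<..<1} x * x powr (- \<alpha> / 2)"
definition "Z t = mult_l2 \<mu> (W t)"
definition "m1 k x = indicator {0<..<1} x * p x / (2 * k)"
definition "m2 k x = indicator {a<..<1} x * (x powr (\<alpha> / 2) * p' x) / (2 * k)"
definition "m3 k x = indicator {0<..<1} x * (x powr (\<alpha> / 2) * p x) / (2 * k)"
text \<open>\<open>X\<close>, \<open>Xt\<close> and \<open>Y\<close> express the test function
  \<open>w_test\<close>, its time derivative and its weighted space derivative through bounded
  operators on U, V and \<open>Z\<close>; regularity in time is thus inherited. The two summands of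
  \<open>Y\<close> are those of the product rule.\<close>

definition "X k t = mult_l2 (m1 k) (shift_l2 k (U t) - shift_l2 (- k) (U t))"
definition "Xt k t = mult_l2 (m1 k) (shift_l2 k (V t) - shift_l2 (- k) (V t))"
definition "Y k t = mult_l2 (m2 k) (shift_l2 k (U t) - shift_l2 (- k) (U t)) + mult_l2 (m3 k) (shift_l2 k (Z t) - shift_l2 (- k) (Z t))"

lemma borel_imp_lebesgue: "h \<in> borel_measurable borel \<Longrightarrow> (h :: real \<Rightarrow> real) \<in> borel_measurable lebesgue"
  by (intro measurable_completion) simp

lemma c1: "c < 1" using ca a1 a_pos by linarith

lemma \<mu>: "\<mu> \<in> borel_measurable lebesgue" "\<bar>\<mu> x\<bar> \<le> c powr (- \<alpha> / 2)"
proof -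
  show "\<mu> \<in> borel_measurable lebesgue" by (rule borel_imp_lebesgue) (simp add: \<mu>_def[abs_def])
  have "x powr (- \<alpha> / 2) \<le> c powr (- \<alpha> / 2)" if "c < x" using that c \<alpha>_pos by (intro powr_mono2') auto
  then show "\<bar>\<mu> x\<bar> \<le> c powr (- \<alpha> / 2)" by (auto simp: \<mu>_def indicator_def)
qed

lemma m1: "m1 k \<in> borel_measurable lebesgue" "\<bar>m1 k x\<bar> \<le> 1 / \<bar>2 * k\<bar>"
proof -
  show "m1 k \<in> borel_measurable lebesgue" by (rule borel_imp_lebesgue) (simp add: m1_def[abs_def])
  have "\<bar>indicator {0<..<1} x * p x\<bar> \<le> 1" using p_bounded[of x] by (simp add: indicator_def)
  then show "\<bar>m1 k x\<bar> \<le> 1 / \<bar>2 * k\<bar>" unfolding m1_def abs_divide by (intro divide_right_mono) auto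
qed

lemma p'_bounded: "\<bar>p' x\<bar> \<le> Lp"
  using \<epsilon> a_pos by (auto simp: p'_def Lp_def)

lemma powr_half_le: "0 < x \<Longrightarrow> x < 1 \<Longrightarrow> \<bar>x powr (\<alpha> / 2)\<bar> \<le> 1"
  using \<alpha>_pos powr_mono2[of "\<alpha>/2" x 1] by simp

lemma m2: "m2 k \<in> borel_measurable lebesgue" "\<bar>m2 k x\<bar> \<le> Lp / \<bar>2 * k\<bar>"
proof -
  show "m2 k \<in> borel_measurable lebesgue" by (rule borel_imp_lebesgue) (simp add: m2_def[abs_def])
  have "\<bar>x powr (\<alpha> / 2)\<bar> * \<bar>p' x\<bar> \<le> 1 * Lp" if "x \<in> {a<..<1}"
    using that a_pos by (intro mult_mono powr_half_le p'_bounded) auto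
  then have "\<bar>indicator {a<..<1} x * (x powr (\<alpha> / 2) * p' x)\<bar> \<le> Lp"
    by (auto simp: indicator_def abs_mult Lp_def)
  then show "\<bar>m2 k x\<bar> \<le> Lp / \<bar>2 * k\<bar>" unfolding m2_def abs_divide by (intro divide_right_mono) auto
qed

lemma m3: "m3 k \<in> borel_measurable lebesgue" "\<bar>m3 k x\<bar> \<le> 1 / \<bar>2 * k\<bar>"
proof -
  show "m3 k \<in> borel_measurable lebesgue" by (rule borel_imp_lebesgue) (simp add: m3_def[abs_def])
  have "\<bar>x powr (\<alpha> / 2)\<bar> * \<bar>p x\<bar> \<le> 1 * 1" if "x \<in> {0<..<1}"
    using that by (intro mult_mono powr_half_le p_bounded) auto
  then have "\<bar>indicator {0<..<1} x * (x powr (\<alpha> / 2) * p x)\<bar> \<le> 1"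
    by (auto simp: indicator_def abs_mult)
  then show "\<bar>m3 k x\<bar> \<le> 1 / \<bar>2 * k\<bar>" unfolding m3_def abs_divide by (intro divide_right_mono) auto
qed

lemma z_eq: "z t y = \<mu> y * wderiv \<alpha> (u t) y"
proof (cases "y \<in> {c<..<1}")
  case True
  then have "y powr (- (\<alpha> / 2)) * y powr (\<alpha> / 2) = 1" using c by (simp add: powr_add[symmetric])
  then show ?thesis using True c by (simp add: z_def \<mu>_def wderiv_def mult.assoc[symmetric])
qed (simp add: z_def \<mu>_def)

lemma z_sq: "t \<in> {0..T} \<Longrightarrow> sq_int (z t)" and Z_mk: "t \<in> {0..T} \<Longrightarrow> Z t = mk_l2 (z t)"
proof -
  have z: "z t = (\<lambda>y. \<mu> y * wderiv \<alpha> (u t) y)" for t by (rule ext) (rule z_eq)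
  show "t \<in> {0..T} \<Longrightarrow> sq_int (z t)" unfolding z by (rule sq_int_mult_bounded[OF u_sq(2) \<mu>])
  show "t \<in> {0..T} \<Longrightarrow> Z t = mk_l2 (z t)" unfolding z Z_def W_def by (rule mult_l2_mk[OF u_sq(2) \<mu>])
qed

lemma norm_Z_le: "norm (Z t) \<le> c powr (- \<alpha> / 2) * norm (W t)"
  unfolding Z_def by (rule norm_mult_l2_le[OF \<mu>])

lemma u_ext_FTC:
  assumes t: "t \<in> {0..T}" and xy: "c \<le> x" "x \<le> y"
  shows "u_ext t y - u_ext t x = (LINT r:{x..y}|lebesgue. z t r)"
proof -
  have u1: "u t 1 = 0" using uH[OF t] by (simp add: H1a_def)
  have "u_ext t x = (if x \<le> 1 then u t x else 0)" if "c \<le> x" for x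
    using that u1 c1 by (auto simp: u_ext_def min_def max_def)
  then show ?thesis using H1a_FTC(2)[OF uH[OF t] c c1 xy] xy by (simp add: z_def)
qed

lemma u_ext_eq_ext01: "t \<in> {0..T} \<Longrightarrow> c \<le> x \<Longrightarrow> u_ext t x = ext01 (u t) x"
  using uH[of t] c c1 by (auto simp: u_ext_def ext01_def H1a_def indicator_def min_def max_def)

text \<open>The clamped continuation and the zero extension agree from c on. Since p vanishes up to
  a and k < a - c, no other points matter.\<close>

lemma ext01_w_test:
  assumes t: "t \<in> {0..T}" and k: "0 < k" "k < a - c"
  shows "ext01 (w_test k t) x = m1 k x * (ext01 (u t) (x + k) - ext01 (u t) (x - k))"
proof (cases "x \<in> {a<..<1}")
  case True
  then show ?thesis using k a_pos by (simp add: ext01_def[of "w_test k t"] w_test_def m1_def u_ext_eq_ext01[OF t])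
next
  case False
  then show ?thesis
    using p_zero[of x] by (auto simp: ext01_def[of "w_test k t"] w_test_def m1_def indicator_def)
qed

lemma AE_u_ext_deriv:
  assumes t: "t \<in> {0..T}"
  shows "AE y in lebesgue. (u_ext t has_real_derivative z t y) (at y)"
  using H1a_AE_deriv[OF uH[OF t]] AE_generic
proof eventually_elim
  case (elim y)
  consider "y < c" | "c < y" "y < 1" | "1 < y" using elim by linarith
  then show ?case
  proof cases
    case 1
    have "((\<lambda>y. u t c) has_real_derivative z t y) (at y)" using 1 by (simp add: z_def)
    then show ?thesis
      by (rule has_field_derivative_transform_within_open[of _ _ _ "{..<c}"]) (use 1 c1 in \<open>auto simp: u_ext_def\<close>)
  next
    case 2
    then have "(u t has_real_derivative z t y) (at y)" using elim c by (simp add: z_def)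
    then show ?thesis
      by (rule has_field_derivative_transform_within_open[of _ _ _ "{c<..<1}"]) (use 2 in \<open>auto simp: u_ext_def\<close>)
  next
    case 3
    have "((\<lambda>y. u t 1) has_real_derivative z t y) (at y)" using 3 by (simp add: z_def)
    then show ?thesis
      by (rule has_field_derivative_transform_within_open[of _ _ _ "{1<..}"]) (use 3 c1 in \<open>auto simp: u_ext_def\<close>)
  qed
qed

text \<open>The product rule, off the points of \<open>AE_generic\<close> and the translates by k
  and -k of the null set where \<open>u_ext t\<close> is not differentiable.\<close>

lemma wderiv_w_test:
  assumes t: "t \<in> {0..T}" and k: "0 < k" "k < a - c"
  shows "AE x in lebesgue. wderiv \<alpha> (w_test k t) x
    = m2 k x * (ext01 (u t) (x + k) - ext01 (u t) (x - k)) + m3 k x * (z t (x + k) - z t (x - k))"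
proof -
  have "AE x in lebesgue. (u_ext t has_real_derivative z t (x + - k)) (at (x + - k))"
    by (rule AE_lebesgue_shift[OF AE_u_ext_deriv[OF t]])
  with AE_lebesgue_shift[OF AE_u_ext_deriv[OF t], of k] AE_generic show ?thesis
  proof eventually_elim
    case (elim x)
    show ?case
    proof (cases "x \<in> {0<..<1}")
      case True
      have p: "(p has_real_derivative p' x) (at x)" using True elim by (intro p_deriv) auto
      have up: "((\<lambda>x. u_ext t (x + k)) has_real_derivative z t (x + k)) (at x)"
        using elim by (simp add: DERIV_shift)
      have um: "((\<lambda>x. u_ext t (x - k)) has_real_derivative z t (x - k)) (at x)"
        using elim DERIV_shift[of "u_ext t" "z t (x - k)" x "- k"] by simp
      have "(w_test k t has_real_derivative (p' x / (2 * k) * (u_ext t (x + k) - u_ext t (x - k)) + (z t (x + k) - z t (x - k)) * (p x / (2 * k)))) (at x)"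
        unfolding w_test_def[abs_def]
        by (intro DERIV_mult DERIV_diff up um DERIV_cdivide p)
      then have d: "deriv (w_test k t) x = p' x / (2 * k) * (u_ext t (x + k) - u_ext t (x - k)) + (z t (x + k) - z t (x - k)) * (p x / (2 * k))"
        by (rule DERIV_imp_deriv)
      show ?thesis
      proof (cases "a < x")
        case True
        then show ?thesis using \<open>x \<in> {0<..<1}\<close> k
          by (simp add: wderiv_def d m2_def m3_def u_ext_eq_ext01[OF t] field_simps)
      next
        case False
        then have "x < a" using elim by auto
        then have "p x = 0" "p' x = 0" using a_pos a\<epsilon> by (auto simp: p_zero p'_def)
        then show ?thesis using \<open>x < a\<close> by (simp add: wderiv_def d m2_def m3_def)
      qed
    next
      case False
      then show ?thesis using a_pos by (auto simp: wderiv_def m2_def m3_def indicator_def)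
    qed
  qed
qed

text \<open>The factor p vanishes near the degeneracy and at 1, so the test function is absolutely
  continuous on all of [0,1] and zero at both ends. This meets the requirements of weak and of
  strong degeneracy at once.\<close>

lemma adm_X_Y:
  assumes t: "t \<in> {0..T}" and k: "0 < k" "k < a - c"
  shows "adm (X k t) (Y k t)" and "X k t = mk_l2 (ext01 (w_test k t))" and "sq_int (ext01 (w_test k t))"
proof -
  note us = u_sq(1)[OF t] and zs = z_sq[OF t]
  have ud: "sq_int (\<lambda>x. ext01 (u t) (x + k) - ext01 (u t) (x - k))"
    using sq_int_diff[OF sq_int_shift[OF us, of k] sq_int_shift[OF us, of "- k"]] by simp
  have zd: "sq_int (\<lambda>x. z t (x + k) - z t (x - k))"
    using sq_int_diff[OF sq_int_shift[OF zs, of k] sq_int_shift[OF zs, of "- k"]] by simp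
  have Ud: "shift_l2 k (U t) - shift_l2 (- k) (U t) = mk_l2 (\<lambda>x. ext01 (u t) (x + k) - ext01 (u t) (x - k))"
    unfolding U_def using us sq_int_shift[OF us] sq_int_shift[OF us, of "- k", simplified] by (simp add: shift_l2_mk mk_l2_diff)
  have Zd: "shift_l2 k (Z t) - shift_l2 (- k) (Z t) = mk_l2 (\<lambda>x. z t (x + k) - z t (x - k))"
    unfolding Z_mk[OF t] using zs sq_int_shift[OF zs] sq_int_shift[OF zs, of "- k", simplified] by (simp add: shift_l2_mk mk_l2_diff)
  have we: "ext01 (w_test k t) = (\<lambda>x. m1 k x * (ext01 (u t) (x + k) - ext01 (u t) (x - k)))"
    by (rule ext) (rule ext01_w_test[OF t k])
  show ws: "sq_int (ext01 (w_test k t))" unfolding we by (rule sq_int_mult_bounded[OF ud m1])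
  show X: "X k t = mk_l2 (ext01 (w_test k t))" unfolding X_def Ud we by (rule mult_l2_mk[OF ud m1])
  have s2: "sq_int (\<lambda>x. m2 k x * (ext01 (u t) (x + k) - ext01 (u t) (x - k)))" by (rule sq_int_mult_bounded[OF ud m2])
  have s3: "sq_int (\<lambda>x. m3 k x * (z t (x + k) - z t (x - k)))" by (rule sq_int_mult_bounded[OF zd m3])
  have Y: "Y k t = mk_l2 (\<lambda>x. m2 k x * (ext01 (u t) (x + k) - ext01 (u t) (x - k)) + m3 k x * (z t (x + k) - z t (x - k)))"
    unfolding Y_def Ud Zd mult_l2_mk[OF ud m2] mult_l2_mk[OF zd m3] by (rule mk_l2_add[OF s2 s3])
  note s23 = sq_int_add[OF s2 s3]
  have ae: "AE x in lebesgue. m2 k x * (ext01 (u t) (x + k) - ext01 (u t) (x - k)) + m3 k x * (z t (x + k) - z t (x - k)) = wderiv \<alpha> (w_test k t) x"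
    using wderiv_w_test[OF t k] by eventually_elim simp
  have wds: "sq_int (wderiv \<alpha> (w_test k t))"
    by (rule sq_int_bound[OF sq_int_square[OF s23] borel_measurable_AE[OF sq_intD[OF s23] ae]])
      (use ae in \<open>auto elim!: eventually_mono\<close>)
  have Y': "Y k t = mk_l2 (wderiv \<alpha> (w_test k t))"
    unfolding Y using mk_l2_eq_iff[OF s23 wds] ae by simp
  have AC: "abs_cont_on 0 1 (w_test k t)"
    unfolding w_test_def[abs_def]
  proof (intro abs_cont_on_mult abs_cont_on_diff)
    show "abs_cont_on 0 1 (\<lambda>x. p x / (2 * k))"
    proof (rule abs_cont_on_Lipschitz)
      fix x y
      have "\<bar>p y / (2 * k) - p x / (2 * k)\<bar> = \<bar>p y - p x\<bar> / (2 * k)" using k by (simp add: diff_divide_distrib[symmetric] abs_divide)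
      also have "\<dots> \<le> (Lp * \<bar>y - x\<bar>) / (2 * k)" using p_Lipschitz[of y x] k by (intro divide_right_mono) auto
      finally show "\<bar>p y / (2 * k) - p x / (2 * k)\<bar> \<le> (Lp / (2 * k)) * \<bar>y - x\<bar>" by simp
    qed
    have "abs_cont_on 0 1 (\<lambda>x. u t (max c (min 1 (x + h))))" for h
      by (rule abs_cont_on_compose_contraction[OF H1a_abs_cont_on[OF uH[OF t] c]]) (use c1 in auto)
    from this[of k] this[of "- k"]
    show "abs_cont_on 0 1 (\<lambda>x. u_ext t (x + k))" "abs_cont_on 0 1 (\<lambda>x. u_ext t (x - k))" by (simp_all add: u_ext_def)
  qed
  have "H1a \<alpha> (w_test k t)"
    unfolding H1a_def wderiv_sq in_L2_iff_sq_int
  proof (intro conjI)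
    show "sq_int (ext01 (w_test k t))" by (rule ws)
    have "loc_abs_cont_0_1 (w_test k t)"
      unfolding loc_abs_cont_0_1_def using AC by (auto intro: abs_cont_on_subset)
    then show "if \<alpha> < 1 then abs_cont_on 0 1 (w_test k t) \<and> w_test k t 0 = 0 else loc_abs_cont_0_1 (w_test k t)"
      using AC p_zero[of 0] a_pos by (simp add: w_test_def)
    show "w_test k t 1 = 0" by (simp add: w_test_def p_one)
    show "(\<integral>\<^sup>+x. ennreal ((wderiv \<alpha> (w_test k t) x)\<^sup>2) \<partial>lebesgue) < \<infinity>"
      using sq_int_square[OF wds] by (simp add: integrable_iff_bounded)
  qed
  then show "adm (X k t) (Y k t)" unfolding adm_def using X Y' by blast
qed

lemma ext01_w_test_u_ext: "ext01 (w_test k t) x = m1 k x * (u_ext t (x + k) - u_ext t (x - k))"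
  by (simp add: ext01_def w_test_def m1_def)

text \<open>|X|^2 is a pairing of h = m1 X with a difference of \<open>u_ext\<close>; duality bounds
  it by 2 k |h| |Z|, while |h| is at most eps / (2 k) times |X|. The factors 2 k cancel, so the
  bound is uniform in k, and eps is the height of p.\<close>

lemma norm_X_le:
  assumes t: "t \<in> {0..T}" and k: "0 < k" "k < a - c"
  shows "norm (X k t) \<le> \<epsilon> * norm (Z t)"
proof -
  let ?g = "ext01 (w_test k t)"
  define h where "h x = m1 k x * ?g x" for x
  note Xg = adm_X_Y(2)[OF t k] and gs = adm_X_Y(3)[OF t k]
  have hs: "sq_int h" unfolding h_def by (rule sq_int_mult_bounded[OF gs m1])
  have m1\<epsilon>: "\<bar>m1 k x\<bar> \<le> \<epsilon> / (2 * k)" for x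
  proof -
    have "\<bar>indicator {0<..<1} x * p x\<bar> \<le> \<epsilon>" using p_range[of x] \<epsilon> by (auto simp: indicator_def)
    then show ?thesis unfolding m1_def abs_divide using k by (simp add: divide_right_mono)
  qed
  have hX: "mk_l2 h = mult_l2 (m1 k) (X k t)" unfolding h_def Xg by (rule mult_l2_mk[OF gs m1, symmetric])
  have hn: "norm (mk_l2 h) \<le> \<epsilon> / (2 * k) * norm (X k t)"
    unfolding hX by (rule norm_mult_l2_le[OF m1(1) m1\<epsilon>])
  have "(norm (X k t))\<^sup>2 = (LINT x|lebesgue. h x * (u_ext t (x + k) - u_ext t (x - k)))"
    unfolding Xg norm_mk_l2[OF gs]
    by (rule Bochner_Integration.integral_cong) (simp_all add: h_def ext01_w_test_u_ext power2_eq_square)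
  also have "\<dots> = integral {- k..k} (\<lambda>s. inner (mk_l2 h) (shift_l2 s (mk_l2 (z t))))"
    by (rule difference_duality[OF hs _ z_sq[OF t] u_ext_FTC[OF t]])
      (use k in \<open>auto simp: h_def m1_def p_zero\<close>)
  also have "\<dots> \<le> (norm (mk_l2 h) * norm (Z t)) * (k - - k)"
  proof (rule order_trans[OF abs_ge_self abs_integral_le_const])
    show "continuous_on {- k..k} (\<lambda>s. inner (mk_l2 h) (shift_l2 s (mk_l2 (z t))))"
      by (intro continuous_on_inner continuous_on_const continuous_on_shift_l2)
    show "\<bar>inner (mk_l2 h) (shift_l2 s (mk_l2 (z t)))\<bar> \<le> norm (mk_l2 h) * norm (Z t)" for s
      using Cauchy_Schwarz_ineq2[of "mk_l2 h" "shift_l2 s (mk_l2 (z t))"] by (simp add: Z_mk[OF t])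
  qed (use k in simp)
  also have "\<dots> \<le> (\<epsilon> / (2 * k) * norm (X k t) * norm (Z t)) * (k - - k)"
    using k by (intro mult_right_mono hn) auto
  also have "\<dots> = norm (X k t) * (\<epsilon> * norm (Z t))" using k by (simp add: field_simps)
  finally have "norm (X k t) * norm (X k t) \<le> norm (X k t) * (\<epsilon> * norm (Z t))" by (simp add: power2_eq_square)
  then show ?thesis using \<epsilon> by (cases "norm (X k t) = 0") (auto dest: mult_left_le_imp_le)
qed

lemma X_deriv: "t \<in> {0..T} \<Longrightarrow> (X k has_vector_derivative Xt k t) (at t within {0..T})"
  unfolding X_def[abs_def] Xt_def
  by (intro bounded_linear.has_vector_derivative[OF bounded_linear_mult_l2[OF m1]] has_vector_derivative_diff
      bounded_linear.has_vector_derivative[OF bounded_linear_shift_l2] U_deriv)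

lemma U_cont: "continuous_on {0..T} U"
  by (rule continuous_on_vector_derivative[OF U_deriv])

lemma Xt_cont: "continuous_on {0..T} (Xt k)"
  unfolding Xt_def[abs_def]
  by (intro bounded_linear.continuous_on[OF bounded_linear_mult_l2[OF m1]] continuous_on_diff
      bounded_linear.continuous_on[OF bounded_linear_shift_l2] V_cont)

lemma Z_cont: "continuous_on {0..T} Z"
  unfolding Z_def[abs_def]
  by (rule bounded_linear.continuous_on[OF bounded_linear_mult_l2[OF \<mu>] W_cont])

lemma Y_cont: "continuous_on {0..T} (Y k)"
  unfolding Y_def[abs_def]
  by (intro continuous_on_add bounded_linear.continuous_on[OF bounded_linear_mult_l2[OF m2]]
      bounded_linear.continuous_on[OF bounded_linear_mult_l2[OF m3]] continuous_on_diff
      bounded_linear.continuous_on[OF bounded_linear_shift_l2] U_cont Z_cont)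

definition "D = (L1L2norm T f)\<^sup>2 + (H1norm \<alpha> u0)\<^sup>2 + (L2norm u1)\<^sup>2"

lemma D_nonneg: "0 \<le> D" by (simp add: D_def)

text \<open>The factor 4 is the square root of the constant 16 in
  \<open>energy_bound\<close>.\<close>

lemma VW_le: "t \<in> {0..T} \<Longrightarrow> norm (V t) \<le> 4 * sqrt D" "t \<in> {0..T} \<Longrightarrow> norm (W t) \<le> 4 * sqrt D"
proof -
  have s: "sqrt (16 * D) = 4 * sqrt D" by (simp add: real_sqrt_mult)
  assume t: "t \<in> {0..T}"
  have e: "(norm (V t))\<^sup>2 + (norm (W t))\<^sup>2 \<le> 16 * D" using energy_bound[OF t] by (simp add: D_def)
  have "(norm (V t))\<^sup>2 \<le> 16 * D" "(norm (W t))\<^sup>2 \<le> 16 * D"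
    using e zero_le_power2[of "norm (V t)"] zero_le_power2[of "norm (W t)"] by linarith+
  then show "norm (V t) \<le> 4 * sqrt D" "norm (W t) \<le> 4 * sqrt D"
    unfolding s[symmetric] by (auto intro: real_le_rsqrt)
qed

lemma L1L2_le: "L1L2norm T f \<le> 4 * sqrt D"
proof -
  have "L1L2norm T f \<le> sqrt D" by (rule real_le_rsqrt) (simp add: D_def)
  then show ?thesis using D_nonneg real_sqrt_ge_zero[of D] by linarith
qed

section \<open>The multiplier integrand and its limit\<close>

definition "\<Lambda> k t = inner (V t) (Xt k t) - inner (W t) (Y k t)"

lemma \<Lambda>_cont: "continuous_on {0..T} (\<Lambda> k)"
  unfolding \<Lambda>_def[abs_def] by (intro continuous_intros V_cont W_cont Xt_cont Y_cont)

text \<open>\<open>multiplier_identity\<close> leaves three terms: at time T, at time 0 and from the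
  force. Each is at most 4 sqrt D times eps c^(-alpha/2) 4 sqrt D, which gives three times
  16.\<close>

lemma \<Lambda>_integral:
  assumes k: "0 < k" "k < a - c"
  shows "integral {0..T} (\<Lambda> k) \<le> 48 * \<epsilon> * c powr (- \<alpha> / 2) * D"
proof -
  let ?S = "4 * sqrt D" and ?B = "\<epsilon> * (c powr (- \<alpha> / 2) * (4 * sqrt D))"
  have B0: "0 \<le> ?B" using \<epsilon> D_nonneg by simp
  have B: "norm (X k t) \<le> ?B" if t: "t \<in> {0..T}" for t
  proof -
    have "norm (X k t) \<le> \<epsilon> * norm (Z t)" by (rule norm_X_le[OF t k])
    also have "\<dots> \<le> \<epsilon> * (c powr (- \<alpha> / 2) * norm (W t))" using \<epsilon> by (intro mult_left_mono norm_Z_le) auto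
    also have "\<dots> \<le> ?B" using \<epsilon> VW_le(2)[OF t] by (intro mult_left_mono) auto
    finally show ?thesis .
  qed
  have VX: "\<bar>inner (V t) (X k t)\<bar> \<le> ?S * ?B" if t: "t \<in> {0..T}" for t
    by (rule order_trans[OF Cauchy_Schwarz_ineq2 mult_mono[OF VW_le(1)[OF t] B[OF t]]]) (use D_nonneg in auto)
  have "\<bar>inner (V T) (X k T) - inner (V 0) (X k 0) - integral {0..T} (\<Lambda> k)\<bar> \<le> ?B * (fint T - fint 0)"
    unfolding \<Lambda>_def[abs_def]
    by (rule multiplier_identity[OF X_deriv Xt_cont Y_cont adm_X_Y(1)[OF _ k] B])
  also have "\<dots> \<le> ?B * ?S" unfolding fint_total by (rule mult_left_mono[OF L1L2_le B0])
  finally have "integral {0..T} (\<Lambda> k) \<le> 3 * (?S * ?B)"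
    using VX[of T, unfolded atLeastAtMost_iff] VX[of 0, unfolded atLeastAtMost_iff] T_pos
    unfolding mult.commute[of ?B ?S] by linarith
  also have "3 * (?S * ?B) = 48 * \<epsilon> * c powr (- \<alpha> / 2) * (sqrt D * sqrt D)" by (simp add: mult_ac)
  also have "sqrt D * sqrt D = D" using D_nonneg by simp
  finally show ?thesis .
qed

text \<open>The factor paired with the difference of u in the part of the elastic term where the
  derivative falls on p.\<close>

definition "g t x = indicator {a<..<1} x * (x powr (\<alpha> / 2) * p' x) * wderiv \<alpha> (u t) x"

lemma g_sq: "t \<in> {0..T} \<Longrightarrow> sq_int (g t)" and g_norm: "t \<in> {0..T} \<Longrightarrow> norm (mk_l2 (g t)) \<le> Lp * norm (W t)"
proof -
  assume t: "t \<in> {0..T}"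
  have m: "(\<lambda>x. indicator {a<..<1} x * (x powr (\<alpha> / 2) * p' x)) \<in> borel_measurable lebesgue"
    by (rule borel_imp_lebesgue) measurable
  have b: "\<bar>indicator {a<..<1} x * (x powr (\<alpha> / 2) * p' x)\<bar> \<le> Lp" for x
  proof (cases "x \<in> {a<..<1}")
    case True
    then have "\<bar>x powr (\<alpha> / 2)\<bar> * \<bar>p' x\<bar> \<le> 1 * Lp"
      using a_pos by (intro mult_mono powr_half_le p'_bounded) auto
    then show ?thesis using True by (simp add: abs_mult)
  qed (simp add: Lp_def)
  show "sq_int (g t)" unfolding g_def[abs_def] by (rule sq_int_mult_bounded[OF u_sq(2)[OF t] m b])
  have "mk_l2 (g t) = mult_l2 (\<lambda>x. indicator {a<..<1} x * (x powr (\<alpha> / 2) * p' x)) (W t)"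
    unfolding g_def[abs_def] W_def by (rule mult_l2_mk[OF u_sq(2)[OF t] m b, symmetric])
  then show "norm (mk_l2 (g t)) \<le> Lp * norm (W t)" using norm_mult_l2_le[OF m b] by simp
qed

lemma \<rho>_z: assumes "x \<in> {c<..<1}" shows "\<rho> x * z t x = x powr (\<alpha> / 2) * wderiv \<alpha> (u t) x"
proof -
  have "x powr \<alpha> * x powr (- \<alpha> / 2) = x powr (\<alpha> / 2)" using assms c by (simp add: powr_add[symmetric])
  moreover have "\<rho> x = x powr \<alpha>" using assms by (simp add: \<rho>_def)
  ultimately show ?thesis using assms by (simp add: z_eq \<mu>_def mult.assoc[symmetric])
qed

text \<open>The velocity term and the p part of the elastic term pair a function with its own
  central difference, the form open to discrete integration by parts. The p' part pairs a derivative
  with a difference of u and is converted into an average over translates by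
  \<open>difference_duality\<close>.\<close>

lemma \<Lambda>_eq:
  assumes t: "t \<in> {0..T}" and k: "0 < k" "k < a - c"
  defines "v0 \<equiv> ext01 (v t)"
  shows "\<Lambda> k t = (LINT x|lebesgue. p x * v0 x * (v0 (x + k) - v0 (x - k))) / (2 * k)
    - integral {- k..k} (\<lambda>s. inner (mk_l2 (g t)) (shift_l2 s (Z t))) / (2 * k)
    - (LINT x|lebesgue. (p x * \<rho> x) * z t x * (z t (x + k) - z t (x - k))) / (2 * k)"
proof -
  have vs: "sq_int v0" unfolding v0_def by (rule v_sq[OF t])
  note us = u_sq(1)[OF t] and ws = u_sq(2)[OF t] and zs = z_sq[OF t]
  have vd: "sq_int (\<lambda>x. v0 (x + k) - v0 (x - k))"
    using sq_int_diff[OF sq_int_shift[OF vs, of k] sq_int_shift[OF vs, of "- k"]] by simp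
  have ud: "sq_int (\<lambda>x. ext01 (u t) (x + k) - ext01 (u t) (x - k))"
    using sq_int_diff[OF sq_int_shift[OF us, of k] sq_int_shift[OF us, of "- k"]] by simp
  have zd: "sq_int (\<lambda>x. z t (x + k) - z t (x - k))"
    using sq_int_diff[OF sq_int_shift[OF zs, of k] sq_int_shift[OF zs, of "- k"]] by simp
  have d: "shift_l2 k (mk_l2 h) - shift_l2 (- k) (mk_l2 h) = mk_l2 (\<lambda>x. h (x + k) - h (x - k))" if "sq_int h" for h
    using that sq_int_shift[OF that, of k] sq_int_shift[OF that, of "- k", simplified] by (simp add: shift_l2_mk mk_l2_diff)
  have 1: "inner (V t) (Xt k t) = (LINT x|lebesgue. p x * v0 x * (v0 (x + k) - v0 (x - k))) / (2 * k)"
  proof -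
    have "inner (V t) (Xt k t) = (LINT x|lebesgue. v0 x * (m1 k x * (v0 (x + k) - v0 (x - k))))"
      unfolding V_def Xt_def v0_def[symmetric] d[OF vs] mult_l2_mk[OF vd m1]
      by (rule inner_mk_l2[OF vs sq_int_mult_bounded[OF vd m1]])
    also have "\<dots> = (LINT x|lebesgue. p x * v0 x * (v0 (x + k) - v0 (x - k)) / (2 * k))"
      by (rule Bochner_Integration.integral_cong) (auto simp: m1_def v0_def ext01_def[of "v t" x for x] indicator_def)
    finally show ?thesis by simp
  qed
  have 2: "inner (W t) (mult_l2 (m2 k) (shift_l2 k (U t) - shift_l2 (- k) (U t)))
      = integral {- k..k} (\<lambda>s. inner (mk_l2 (g t)) (shift_l2 s (Z t))) / (2 * k)"
  proof -
    have "inner (W t) (mult_l2 (m2 k) (shift_l2 k (U t) - shift_l2 (- k) (U t)))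
        = (LINT x|lebesgue. wderiv \<alpha> (u t) x * (m2 k x * (ext01 (u t) (x + k) - ext01 (u t) (x - k))))"
      unfolding W_def U_def d[OF us] mult_l2_mk[OF ud m2] by (rule inner_mk_l2[OF ws sq_int_mult_bounded[OF ud m2]])
    also have "\<dots> = (LINT x|lebesgue. g t x * (u_ext t (x + k) - u_ext t (x - k)) / (2 * k))"
    proof (rule Bochner_Integration.integral_cong)
      fix x show "wderiv \<alpha> (u t) x * (m2 k x * (ext01 (u t) (x + k) - ext01 (u t) (x - k)))
          = g t x * (u_ext t (x + k) - u_ext t (x - k)) / (2 * k)"
        using k by (cases "x \<in> {a<..<1}") (auto simp: m2_def g_def u_ext_eq_ext01[OF t])
    qed simp
    also have "\<dots> = (LINT x|lebesgue. g t x * (u_ext t (x + k) - u_ext t (x - k))) / (2 * k)" by simp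
    also have "(LINT x|lebesgue. g t x * (u_ext t (x + k) - u_ext t (x - k)))
        = integral {- k..k} (\<lambda>s. inner (mk_l2 (g t)) (shift_l2 s (mk_l2 (z t))))"
      by (rule difference_duality[OF g_sq[OF t] _ zs u_ext_FTC[OF t]]) (use k in \<open>auto simp: g_def\<close>)
    finally show ?thesis by (simp add: Z_mk[OF t])
  qed
  have 3: "inner (W t) (mult_l2 (m3 k) (shift_l2 k (Z t) - shift_l2 (- k) (Z t)))
      = (LINT x|lebesgue. (p x * \<rho> x) * z t x * (z t (x + k) - z t (x - k))) / (2 * k)"
  proof -
    have "inner (W t) (mult_l2 (m3 k) (shift_l2 k (Z t) - shift_l2 (- k) (Z t)))
        = (LINT x|lebesgue. wderiv \<alpha> (u t) x * (m3 k x * (z t (x + k) - z t (x - k))))"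
      unfolding W_def Z_mk[OF t] d[OF zs] mult_l2_mk[OF zd m3] by (rule inner_mk_l2[OF ws sq_int_mult_bounded[OF zd m3]])
    also have "\<dots> = (LINT x|lebesgue. (p x * \<rho> x) * z t x * (z t (x + k) - z t (x - k)) / (2 * k))"
    proof (rule Bochner_Integration.integral_cong)
      fix x
      consider "x \<le> a" | "a < x" "x < 1" | "1 \<le> x" by linarith
      then show "wderiv \<alpha> (u t) x * (m3 k x * (z t (x + k) - z t (x - k)))
          = (p x * \<rho> x) * z t x * (z t (x + k) - z t (x - k)) / (2 * k)"
      proof cases
        case 1 then show ?thesis by (simp add: m3_def p_zero)
      next
        case 2
        then have "x \<in> {c<..<1}" "x \<in> {0<..<1}" using ca c by auto
        then have "p x * \<rho> x * z t x = p x * (x powr (\<alpha> / 2) * wderiv \<alpha> (u t) x)" using \<rho>_z[of x t] by (simp add: mult.assoc)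
        then show ?thesis using \<open>x \<in> {0<..<1}\<close> by (auto simp: m3_def mult_ac)
      next
        case 3 then show ?thesis by (simp add: m3_def z_def)
      qed
    qed simp
    finally show ?thesis by simp
  qed
  show ?thesis unfolding \<Lambda>_def Y_def inner_add_right 1 2 3 by simp
qed

lemma p\<rho>_measurable: "(\<lambda>x. p x * \<rho> x) \<in> borel_measurable lebesgue"
  by (rule borel_imp_lebesgue) measurable

lemma p\<rho>_bounded: "\<bar>p x * \<rho> x\<bar> \<le> 1 * 2 powr \<alpha>"
  unfolding abs_mult by (intro mult_mono p_bounded \<rho>_bounded) auto

text \<open>Cauchy-Schwarz under the integral; the length 2 k of the interval cancels the
  divisor.\<close>

lemma g_average_bound:
  assumes t: "t \<in> {0..T}" and k: "0 < k"
  shows "\<bar>integral {- k..k} (\<lambda>s. inner (mk_l2 (g t)) (shift_l2 s (Z t))) / (2 * k)\<bar> \<le> Lp * norm (W t) * norm (Z t)"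
proof -
  have "\<bar>integral {- k..k} (\<lambda>s. inner (mk_l2 (g t)) (shift_l2 s (Z t)))\<bar> \<le> (Lp * norm (W t) * norm (Z t)) * (k - - k)"
  proof (rule abs_integral_le_const)
    show "continuous_on {- k..k} (\<lambda>s. inner (mk_l2 (g t)) (shift_l2 s (Z t)))"
      by (intro continuous_on_inner continuous_on_const continuous_on_shift_l2)
    fix s
    have "\<bar>inner (mk_l2 (g t)) (shift_l2 s (Z t))\<bar> \<le> norm (mk_l2 (g t)) * norm (Z t)"
      using Cauchy_Schwarz_ineq2[of "mk_l2 (g t)" "shift_l2 s (Z t)"] by simp
    also have "\<dots> \<le> Lp * norm (W t) * norm (Z t)" by (intro mult_right_mono g_norm[OF t]) simp
    finally show "\<bar>inner (mk_l2 (g t)) (shift_l2 s (Z t))\<bar> \<le> Lp * norm (W t) * norm (Z t)" .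
  qed (use k in simp)
  then show ?thesis using k by (simp add: abs_divide divide_le_eq mult_ac)
qed

text \<open>Uniformity in t and k provides the constant majorant for dominated convergence in
  time.\<close>

lemma \<Lambda>_bounded: obtains K where "\<And>t k. t \<in> {0..T} \<Longrightarrow> 0 < k \<Longrightarrow> k < a - c \<Longrightarrow> \<bar>\<Lambda> k t\<bar> \<le> K"
proof -
  obtain L where L: "\<And>x z. \<bar>p x * \<rho> x - p z * \<rho> z\<bar> \<le> L * \<bar>x - z\<bar>" by (rule p\<rho>_Lipschitz) (rule that, auto)
  define S where "S = 4 * sqrt D"
  define R where "R = c powr (- \<alpha> / 2) * S"
  have S0: "0 \<le> S" using D_nonneg by (simp add: S_def)
  have Lp0: "0 \<le> Lp" by (simp add: Lp_def)
  have "\<bar>\<Lambda> k t\<bar> \<le> Lp / 2 * S\<^sup>2 + Lp * S * R + \<bar>L\<bar> / 2 * R\<^sup>2"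
    if t: "t \<in> {0..T}" and k: "0 < k" "k < a - c" for t k
  proof -
    have VS: "norm (V t) \<le> S" and WS: "norm (W t) \<le> S" using VW_le[OF t] by (auto simp: S_def)
    have ZR: "norm (Z t) \<le> R"
      unfolding R_def by (rule order_trans[OF norm_Z_le mult_left_mono[OF WS]]) simp
    let ?v = "ext01 (v t)"
    have "\<bar>(LINT x|lebesgue. p x * ?v x * (?v (x + k) - ?v (x - k))) / (2 * k)\<bar> \<le> Lp / 2 * (norm (V t))\<^sup>2"
      unfolding V_def
      by (rule central_difference_bound[OF v_sq[OF t] borel_imp_lebesgue[OF p_measurable] p_bounded p_Lipschitz k(1)])
    also have "\<dots> \<le> Lp / 2 * S\<^sup>2" using Lp0 VS by (intro mult_left_mono power_mono) auto
    finally have 1: "\<bar>(LINT x|lebesgue. p x * ?v x * (?v (x + k) - ?v (x - k))) / (2 * k)\<bar> \<le> Lp / 2 * S\<^sup>2" .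
    have 2: "\<bar>integral {- k..k} (\<lambda>s. inner (mk_l2 (g t)) (shift_l2 s (Z t))) / (2 * k)\<bar> \<le> Lp * S * R"
      by (rule order_trans[OF g_average_bound[OF t k(1)]]) (use Lp0 WS ZR S0 in \<open>auto intro!: mult_mono\<close>)
    have "\<bar>(LINT x|lebesgue. (p x * \<rho> x) * z t x * (z t (x + k) - z t (x - k))) / (2 * k)\<bar> \<le> L / 2 * (norm (Z t))\<^sup>2"
      unfolding Z_mk[OF t] by (rule central_difference_bound[OF z_sq[OF t] p\<rho>_measurable p\<rho>_bounded L k(1)])
    also have "\<dots> \<le> \<bar>L\<bar> / 2 * R\<^sup>2" using ZR by (intro mult_mono power_mono) auto
    finally have 3: "\<bar>(LINT x|lebesgue. (p x * \<rho> x) * z t x * (z t (x + k) - z t (x - k))) / (2 * k)\<bar> \<le> \<bar>L\<bar> / 2 * R\<^sup>2" .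
    show ?thesis unfolding \<Lambda>_eq[OF t k] using 1 2 3 by linarith
  qed
  then show ?thesis by (rule that)
qed

text \<open>The integrand that the multiplier p u_x would produce formally after integration by
  parts in space.\<close>

definition "\<Lambda>0 t = - (1/2) * (LINT x|lebesgue. p' x * (ext01 (v t) x)\<^sup>2) - (LINT x|lebesgue. g t x * z t x)
  + (1/2) * (LINT x|lebesgue. (p' x * \<rho> x + \<rho>' x * p x) * (z t x)\<^sup>2)"

text \<open>The three terms of \<open>\<Lambda>_eq\<close> converge separately; the average over
  translates tends to its value at translation 0.\<close>

lemma \<Lambda>_limit:
  assumes t: "t \<in> {0..T}" and k: "\<And>n. 0 < k n" "\<And>n. k n < a - c" "k \<longlonglongrightarrow> 0"
  shows "(\<lambda>n. \<Lambda> (k n) t) \<longlonglongrightarrow> \<Lambda>0 t"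
proof -
  obtain L where L: "\<And>x z. \<bar>p x * \<rho> x - p z * \<rho> z\<bar> \<le> L * \<bar>x - z\<bar>" by (rule p\<rho>_Lipschitz) (rule that, auto)
  let ?v = "ext01 (v t)"
  have D1: "AE x in lebesgue. ?v x \<noteq> 0 \<longrightarrow> (p has_real_derivative p' x) (at x)"
    using AE_generic by eventually_elim (auto simp: ext01_def indicator_def intro!: p_deriv)
  have 1: "(\<lambda>n. (LINT x|lebesgue. p x * ?v x * (?v (x + k n) - ?v (x - k n))) / (2 * k n))
      \<longlonglongrightarrow> - (1/2) * (LINT x|lebesgue. p' x * (?v x)\<^sup>2)"
    by (rule central_difference_limit[OF v_sq[OF t] borel_imp_lebesgue[OF p_measurable] p_bounded p_Lipschitz
          borel_imp_lebesgue[OF p'_measurable] D1 k(1,3)])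
  have "(\<lambda>n. integral {- k n..k n} (\<lambda>s. inner (mk_l2 (g t)) (shift_l2 s (Z t))) / (2 * k n))
      \<longlonglongrightarrow> inner (mk_l2 (g t)) (shift_l2 0 (Z t))"
    by (rule average_tendsto_zero[OF _ k(1,3)]) (intro continuous_on_inner continuous_on_const continuous_on_shift_l2)
  moreover have "inner (mk_l2 (g t)) (shift_l2 0 (Z t)) = (LINT x|lebesgue. g t x * z t x)"
    using inner_mk_l2[OF g_sq[OF t] z_sq[OF t]] z_sq[OF t] by (simp add: Z_mk[OF t] shift_l2_mk)
  ultimately have 2: "(\<lambda>n. integral {- k n..k n} (\<lambda>s. inner (mk_l2 (g t)) (shift_l2 s (Z t))) / (2 * k n))
      \<longlonglongrightarrow> (LINT x|lebesgue. g t x * z t x)" by simp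
  have D3: "AE x in lebesgue. z t x \<noteq> 0 \<longrightarrow> ((\<lambda>x. p x * \<rho> x) has_real_derivative p' x * \<rho> x + \<rho>' x * p x) (at x)"
    using AE_generic
  proof eventually_elim
    case (elim x)
    show ?case
    proof
      assume "z t x \<noteq> 0"
      then have "c < x" "x < 1" by (auto simp: z_def indicator_def)
      then show "((\<lambda>x. p x * \<rho> x) has_real_derivative p' x * \<rho> x + \<rho>' x * p x) (at x)"
        using elim by (intro DERIV_mult p_deriv \<rho>_deriv) auto
    qed
  qed
  have m3: "(\<lambda>x. p' x * \<rho> x + \<rho>' x * p x) \<in> borel_measurable lebesgue"
    by (rule borel_imp_lebesgue) measurable
  have 3: "(\<lambda>n. (LINT x|lebesgue. (p x * \<rho> x) * z t x * (z t (x + k n) - z t (x - k n))) / (2 * k n))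
      \<longlonglongrightarrow> - (1/2) * (LINT x|lebesgue. (p' x * \<rho> x + \<rho>' x * p x) * (z t x)\<^sup>2)"
    by (rule central_difference_limit[OF z_sq[OF t] p\<rho>_measurable p\<rho>_bounded L m3 D3 k(1,3)])
  have "(\<lambda>n. \<Lambda> (k n) t) \<longlonglongrightarrow> - (1/2) * (LINT x|lebesgue. p' x * (?v x)\<^sup>2) - (LINT x|lebesgue. g t x * z t x)
      - (- (1/2) * (LINT x|lebesgue. (p' x * \<rho> x + \<rho>' x * p x) * (z t x)\<^sup>2))"
    unfolding \<Lambda>_eq[OF t k(1,2)] by (intro tendsto_diff 1 2 3)
  then show ?thesis by (simp add: \<Lambda>0_def)
qed

section \<open>The layer energy and the final estimate\<close>

definition "q t = (norm (mult_l2 (indicator {1 - \<epsilon><..<1}) (W t)))\<^sup>2"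

lemma \<rho>'_bounded: "\<bar>\<rho>' x\<bar> \<le> \<alpha> * (c powr (\<alpha> - 1) + 1)"
proof (cases "x \<in> {c<..<1}")
  case True
  have "x powr (\<alpha> - 1) \<le> c powr (\<alpha> - 1) + 1"
  proof (cases "\<alpha> \<ge> 1")
    case True
    then have "x powr (\<alpha> - 1) \<le> 1 powr (\<alpha> - 1)" using \<open>x \<in> {c<..<1}\<close> c by (intro powr_mono2) auto
    then show ?thesis by (simp add: add_increasing)
  next
    case False
    then have "x powr (\<alpha> - 1) \<le> c powr (\<alpha> - 1)" using \<open>x \<in> {c<..<1}\<close> c by (intro powr_mono2') auto
    then show ?thesis by simp
  qed
  then show ?thesis using True \<alpha>_pos by (simp add: \<rho>'_def abs_mult)
qed (use \<alpha>_pos in \<open>simp add: \<rho>'_def\<close>)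

text \<open>The elastic terms combine: \<open>\<Lambda>0\<close> is -1/2 of the integral of p'
  (u_t^2 + x^alpha u_x^2) plus 1/2 of the integral of \<rho>' p z^2. The latter is nonnegative
  because alpha > 0 and p \<ge> 0 up to 1. In the former, p' = -1 on the layer yields q / 2, and p'
  \<le> eps / a everywhere gives the error.\<close>

lemma \<Lambda>0_lower:
  assumes t: "t \<in> {0..T}"
  shows "q t / 2 - \<epsilon> / (2 * a) * ((norm (V t))\<^sup>2 + (norm (W t))\<^sup>2) \<le> \<Lambda>0 t"
proof -
  let ?v = "ext01 (v t)" and ?w = "wderiv \<alpha> (u t)"
  note vs = v_sq[OF t] and ws = u_sq(2)[OF t] and zs = z_sq[OF t]
  let ?I = "indicator {1 - \<epsilon><..<1} :: real \<Rightarrow> real"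
  have Im: "?I \<in> borel_measurable lebesgue" by (rule borel_imp_lebesgue) simp
  have Ib: "\<bar>?I x\<bar> \<le> 1" for x by (simp add: indicator_def)
  have iv: "integrable lebesgue (\<lambda>x. p' x * (?v x)\<^sup>2)"
    using sq_int_mult[OF sq_int_mult_bounded[OF vs borel_imp_lebesgue[OF p'_measurable] p'_bounded] vs]
    by (simp add: power2_eq_square mult.assoc)
  have iw: "integrable lebesgue (\<lambda>x. p' x * (?w x)\<^sup>2)"
    using sq_int_mult[OF sq_int_mult_bounded[OF ws borel_imp_lebesgue[OF p'_measurable] p'_bounded] ws]
    by (simp add: power2_eq_square mult.assoc)
  have pr: "\<bar>\<rho>' x * p x\<bar> \<le> (\<alpha> * (c powr (\<alpha> - 1) + 1)) * 1" for x
    unfolding abs_mult using \<alpha>_pos by (intro mult_mono p_bounded \<rho>'_bounded) auto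
  have prm: "(\<lambda>x. \<rho>' x * p x) \<in> borel_measurable lebesgue" by (rule borel_imp_lebesgue) measurable
  have iz: "integrable lebesgue (\<lambda>x. \<rho>' x * p x * (z t x)\<^sup>2)"
    using sq_int_mult[OF sq_int_mult_bounded[OF zs prm pr] zs] by (simp add: power2_eq_square mult.assoc)
  have iI: "integrable lebesgue (\<lambda>x. (?I x * ?w x)\<^sup>2)"
    by (rule sq_int_square[OF sq_int_mult_bounded[OF ws Im Ib]])
  have q: "q t = (LINT x|lebesgue. (?I x * ?w x)\<^sup>2)"
    unfolding q_def W_def mult_l2_mk[OF ws Im Ib] by (rule norm_mk_l2[OF sq_int_mult_bounded[OF ws Im Ib]])
  have out: "p' x = 0" "p x = 0" if "x \<le> a" for x using that a_pos a\<epsilon> by (auto simp: p'_def p_zero)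
  have on: "x powr (\<alpha> / 2) * ?w x * z t x = (?w x)\<^sup>2" if "x \<in> {c<..<1}" for x
  proof -
    have "x powr (\<alpha> / 2) * x powr (- \<alpha> / 2) = 1" using that c by (simp add: powr_add[symmetric])
    then show ?thesis using that by (simp add: z_eq \<mu>_def power2_eq_square)
  qed
  have gz: "g t x * z t x = p' x * (?w x)\<^sup>2" for x
  proof -
    consider "x \<le> a" | "x \<in> {a<..<1}" "x \<in> {c<..<1}" | "1 \<le> x" using ca by fastforce
    then show ?thesis
    proof cases
      case 2
      then have "g t x * z t x = p' x * (x powr (\<alpha> / 2) * ?w x * z t x)" by (simp add: g_def)
      then show ?thesis unfolding on[OF 2(2)] .
    qed (simp_all add: out g_def z_def wderiv_def)
  qed
  have \<rho>z: "(p' x * \<rho> x + \<rho>' x * p x) * (z t x)\<^sup>2 = p' x * (?w x)\<^sup>2 + \<rho>' x * p x * (z t x)\<^sup>2" for x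
  proof -
    consider "x \<le> a" | "x \<in> {c<..<1}" | "1 \<le> x" using ca by fastforce
    then show ?thesis
    proof cases
      case 2
      have "\<rho> x * (z t x)\<^sup>2 = (\<rho> x * z t x) * z t x" by (simp add: power2_eq_square)
      also have "\<dots> = (?w x)\<^sup>2" unfolding \<rho>_z[OF 2] by (rule on[OF 2])
      finally show ?thesis by (simp only: distrib_right mult.assoc)
    qed (simp_all add: out z_def wderiv_def)
  qed
  have \<epsilon>a: "- 1 \<le> \<epsilon> / a" "0 \<le> \<epsilon> / a" using \<epsilon> a_pos by (auto intro: order_trans[of _ 0])
  have "(LINT x|lebesgue. p' x * (?v x)\<^sup>2) \<le> (LINT x|lebesgue. \<epsilon> / a * (?v x)\<^sup>2)"
    using \<epsilon>a by (intro Bochner_Integration.integral_mono[OF iv] integrable_mult_right sq_int_square[OF vs] mult_right_mono) (auto simp: p'_def)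
  also have "\<dots> = \<epsilon> / a * (norm (V t))\<^sup>2" unfolding V_def norm_mk_l2[OF vs] by simp
  finally have 1: "(LINT x|lebesgue. p' x * (?v x)\<^sup>2) \<le> \<epsilon> / a * (norm (V t))\<^sup>2" .
  have "(LINT x|lebesgue. p' x * (?w x)\<^sup>2) \<le> (LINT x|lebesgue. \<epsilon> / a * (?w x)\<^sup>2 - (?I x * ?w x)\<^sup>2)"
  proof (rule Bochner_Integration.integral_mono[OF iw])
    show "integrable lebesgue (\<lambda>x. \<epsilon> / a * (?w x)\<^sup>2 - (?I x * ?w x)\<^sup>2)"
      by (intro Bochner_Integration.integrable_diff iI integrable_mult_right sq_int_square[OF ws])
    fix x :: real
    \<comment> \<open>On the layer p' = -1 is at most eps / a - 1, and outside it p' is at most eps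
      / a.\<close>
    have "p' x \<le> \<epsilon> / a - (?I x)\<^sup>2" using \<epsilon>a a\<epsilon> by (auto simp: p'_def indicator_def)
    then have "p' x * (?w x)\<^sup>2 \<le> (\<epsilon> / a - (?I x)\<^sup>2) * (?w x)\<^sup>2" by (rule mult_right_mono) simp
    then show "p' x * (?w x)\<^sup>2 \<le> \<epsilon> / a * (?w x)\<^sup>2 - (?I x * ?w x)\<^sup>2"
      by (simp add: left_diff_distrib power_mult_distrib)
  qed
  also have "\<dots> = \<epsilon> / a * (norm (W t))\<^sup>2 - q t"
    unfolding q W_def norm_mk_l2[OF ws]
    by (subst Bochner_Integration.integral_diff[OF integrable_mult_right[OF sq_int_square[OF ws]] iI]) simp
  finally have 2: "(LINT x|lebesgue. p' x * (?w x)\<^sup>2) \<le> \<epsilon> / a * (norm (W t))\<^sup>2 - q t" .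
  have 3: "0 \<le> (LINT x|lebesgue. \<rho>' x * p x * (z t x)\<^sup>2)"
  proof (rule Bochner_Integration.integral_nonneg)
    fix x
    show "0 \<le> \<rho>' x * p x * (z t x)\<^sup>2"
      using p_range[of x] \<alpha>_pos by (cases "x \<le> 1") (auto simp: \<rho>'_def z_def intro!: mult_nonneg_nonneg)
  qed
  have "\<Lambda>0 t = - (1/2) * (LINT x|lebesgue. p' x * (?v x)\<^sup>2) - (1/2) * (LINT x|lebesgue. p' x * (?w x)\<^sup>2)
      + (1/2) * (LINT x|lebesgue. \<rho>' x * p x * (z t x)\<^sup>2)"
    unfolding \<Lambda>0_def gz \<rho>z Bochner_Integration.integral_add[OF iw iz] by simp
  moreover have "\<epsilon> / (2 * a) * ((norm (V t))\<^sup>2 + (norm (W t))\<^sup>2) = (1/2) * (\<epsilon> / a * (norm (V t))\<^sup>2) + (1/2) * (\<epsilon> / a * (norm (W t))\<^sup>2)"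
    by (simp add: field_simps add_divide_distrib)
  ultimately show ?thesis using 1 2 3 by linarith
qed

lemma q_cont: "continuous_on {0..T} q"
proof -
  have "(indicator {1 - \<epsilon><..<1} :: real \<Rightarrow> real) \<in> borel_measurable lebesgue" by (rule borel_imp_lebesgue) simp
  then have "bounded_linear (mult_l2 (indicator {1 - \<epsilon><..<1}))"
    by (rule bounded_linear_mult_l2[of _ 1]) (simp add: indicator_def)
  then show ?thesis unfolding q_def[abs_def]
    by (intro continuous_on_power continuous_on_norm bounded_linear.continuous_on[OF _ W_cont])
qed

text \<open>Dominated convergence in time carries the upper bound of
  \<open>\<Lambda>_integral\<close> to \<open>\<Lambda>0\<close>, where
  \<open>\<Lambda>0_lower\<close> applies. Energy at most 16 D makes the error 8 eps D / a at each
  time; removing the factor 1/2 from q doubles 48 to 96 and 8 T to 16 T.\<close>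

lemma q_integral: "integral {0..T} q \<le> \<epsilon> * D * (96 * c powr (- \<alpha> / 2) + 16 * T / a)"
proof -
  \<comment> \<open>Adding 2 keeps every increment strictly below a - c, already for n = 0.\<close>
  define k where "k n = (a - c) / (real n + 2)" for n
  have k: "0 < k n" "k n < a - c" for n using ca by (auto simp: k_def divide_less_eq intro!: mult_less_cancel_left_pos[THEN iffD1])
  have k0: "k \<longlonglongrightarrow> 0" unfolding k_def by real_asymp
  obtain K where K: "\<And>t k. t \<in> {0..T} \<Longrightarrow> 0 < k \<Longrightarrow> k < a - c \<Longrightarrow> \<bar>\<Lambda> k t\<bar> \<le> K" by (rule \<Lambda>_bounded) (rule that, auto)
  have \<Lambda>i: "\<Lambda> (k n) integrable_on {0..T}" for n by (rule integrable_continuous_real[OF \<Lambda>_cont])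
  note dc = dominated_convergence[of "\<lambda>n. \<Lambda> (k n)" "{0..T}" "\<lambda>t. K" \<Lambda>0]
  have dc1: "\<Lambda>0 integrable_on {0..T}" and dc2: "(\<lambda>n. integral {0..T} (\<Lambda> (k n))) \<longlonglongrightarrow> integral {0..T} \<Lambda>0"
    using dc \<Lambda>i K[OF _ k] \<Lambda>_limit[OF _ k k0] by auto
  have up: "integral {0..T} \<Lambda>0 \<le> 48 * \<epsilon> * c powr (- \<alpha> / 2) * D"
    by (rule LIMSEQ_le_const2[OF dc2]) (use \<Lambda>_integral[OF k] in auto)
  have qi: "q integrable_on {0..T}" by (rule integrable_continuous_real[OF q_cont])
  have "integral {0..T} (\<lambda>t. q t / 2 - 8 * \<epsilon> * D / a) \<le> integral {0..T} \<Lambda>0"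
  proof (rule integral_le[OF _ dc1])
    show "(\<lambda>t. q t / 2 - 8 * \<epsilon> * D / a) integrable_on {0..T}"
      by (intro integrable_diff integrable_on_divide qi integrable_const_ivl)
    fix t assume t: "t \<in> {0..T}"
    have "\<epsilon> / (2 * a) * ((norm (V t))\<^sup>2 + (norm (W t))\<^sup>2) \<le> \<epsilon> / (2 * a) * (16 * D)"
      using energy_bound[OF t] \<epsilon> a_pos by (intro mult_left_mono) (auto simp: D_def)
    also have "\<dots> = 8 * \<epsilon> * D / a" by simp
    finally show "q t / 2 - 8 * \<epsilon> * D / a \<le> \<Lambda>0 t" using \<Lambda>0_lower[OF t] by linarith
  qed
  moreover have "integral {0..T} (\<lambda>t. q t / 2 - 8 * \<epsilon> * D / a) = integral {0..T} q / 2 - T * (8 * \<epsilon> * D / a)"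
    using T_pos by (subst integral_diff) (auto intro!: integrable_on_divide qi)
  ultimately have i: "integral {0..T} q / 2 \<le> T * (8 * \<epsilon> * D / a) + 48 * \<epsilon> * c powr (- \<alpha> / 2) * D" using up by linarith
  have "x \<le> 2 * y" if "x / 2 \<le> y" for x y :: real using that by simp
  from this[OF i] have "integral {0..T} q \<le> 2 * (T * (8 * \<epsilon> * D / a) + 48 * \<epsilon> * c powr (- \<alpha> / 2) * D)" .
  also have "\<dots> = \<epsilon> * D * (96 * c powr (- \<alpha> / 2) + 16 * T / a)" by (simp add: algebra_simps)
  finally show ?thesis .
qed

text \<open>\<open>H1a_pointwise_bound\<close> is used from the point 1 - eps on, where the inverse
  weight is at most (1 - eps0)^(-alpha) uniformly in eps; moreover 1 - x < eps.\<close>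

lemma layer_pointwise_bound:
  assumes t: "t \<in> {0..T}" and x: "x \<in> {1 - \<epsilon><..<1}" and \<epsilon>0: "\<epsilon> \<le> \<epsilon>0" "\<epsilon>0 < 1"
  shows "(u t x)\<^sup>2 \<le> \<epsilon> * (1 - \<epsilon>0) powr (- \<alpha>) * q t"
proof -
  have "(u t x)\<^sup>2 \<le> (1 - x) * (1 - \<epsilon>) powr (- \<alpha>) * q t"
    unfolding q_def W_def using H1a_pointwise_bound[OF uH[OF t] \<alpha>_pos, of "1 - \<epsilon>" x] x \<epsilon> \<epsilon>1 by simp
  also have "\<dots> \<le> \<epsilon> * (1 - \<epsilon>0) powr (- \<alpha>) * q t"
    using x \<epsilon>0 \<epsilon> \<alpha>_pos by (intro mult_mono powr_mono2') (auto simp: q_def)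
  finally show ?thesis .
qed

text \<open>The three factors eps come from 1 - x in the pointwise bound, from the width of the
  layer and from \<open>q_integral\<close>.\<close>

lemma layer_estimate:
  assumes \<epsilon>0: "\<epsilon> \<le> \<epsilon>0" "\<epsilon>0 < 1"
  shows "(\<integral>\<^sup>+p\<in>{0<..<T} \<times> {1 - \<epsilon><..<1}. ennreal ((u (fst p) (snd p))\<^sup>2) \<partial>lebesgue)
    \<le> ennreal (\<epsilon> ^ 3 * ((1 - \<epsilon>0) powr (- \<alpha>) * (96 * c powr (- \<alpha> / 2) + 16 * T / a) * D))"
proof -
  let ?S = "{0<..<T} \<times> {1 - \<epsilon><..<1}"
  \<comment> \<open>The clamped function is Borel on the plane and agrees with u on the rectangle,
    which permits iterated integration.\<close>
  define F where "F p = u (max 0 (min T (fst p))) (max (1 - \<epsilon>) (min 1 (snd p)))" for p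
  define K where "K = \<epsilon> * (1 - \<epsilon>0) powr (- \<alpha>)"
  have K0: "0 \<le> K" using \<epsilon> by (simp add: K_def)
  have q0: "0 \<le> q t" for t by (simp add: q_def)
  have [measurable]: "F \<in> borel_measurable borel"
    unfolding F_def[abs_def] by (intro borel_measurable_continuous_onI u_jointly_continuous) (use \<epsilon> \<epsilon>1 in auto)
  have [measurable]: "?S \<in> sets borel" by (intro borel_open open_Times) auto
  have "(\<integral>\<^sup>+p\<in>?S. ennreal ((u (fst p) (snd p))\<^sup>2) \<partial>lebesgue) = (\<integral>\<^sup>+p. ennreal ((F p)\<^sup>2) * indicator ?S p \<partial>lborel)"
    unfolding nn_integral_completion by (rule nn_integral_cong) (auto simp: F_def indicator_def)
  also have "\<dots> = (\<integral>\<^sup>+t. \<integral>\<^sup>+x. ennreal ((F (t, x))\<^sup>2) * indicator ?S (t, x) \<partial>lborel \<partial>lborel)"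
  proof -
    have "(\<lambda>p. ennreal ((F p)\<^sup>2) * indicator ?S p) \<in> borel_measurable (lborel \<Otimes>\<^sub>M lborel)"
      unfolding lborel_prod by measurable
    then show ?thesis by (subst lborel.nn_integral_fst) (simp_all add: lborel_prod)
  qed
  also have "\<dots> \<le> (\<integral>\<^sup>+t. indicator {0..T} t * ennreal (\<epsilon> * (K * q t)) \<partial>lborel)"
  proof (rule nn_integral_mono)
    fix t :: real
    show "(\<integral>\<^sup>+x. ennreal ((F (t, x))\<^sup>2) * indicator ?S (t, x) \<partial>lborel) \<le> indicator {0..T} t * ennreal (\<epsilon> * (K * q t))"
    proof (cases "t \<in> {0<..<T}")
      case True
      have "(\<integral>\<^sup>+x. ennreal ((F (t, x))\<^sup>2) * indicator ?S (t, x) \<partial>lborel)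
          \<le> (\<integral>\<^sup>+x. ennreal (K * q t) * indicator {1 - \<epsilon><..<1} x \<partial>lborel)"
        by (rule nn_integral_mono)
          (use True layer_pointwise_bound[OF _ _ \<epsilon>0, of t] in \<open>auto simp: F_def K_def indicator_def intro!: ennreal_leI\<close>)
      also have "\<dots> = ennreal (\<epsilon> * (K * q t))"
        using \<epsilon> K0 q0[of t] by (subst nn_integral_cmult_indicator) (simp_all add: ennreal_mult[symmetric] mult.commute)
      finally show ?thesis using True by simp
    qed auto
  qed
  also have "\<dots> = (\<integral>\<^sup>+t. ennreal (indicator {0..T} t * (\<epsilon> * (K * q t))) \<partial>lborel)"
    by (rule nn_integral_cong) (auto simp: indicator_def)
  also have "\<dots> = ennreal (\<epsilon> * (K * integral {0..T} q))"
  proof (rule nn_integral_has_integral_lebesgue)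
    show "((\<lambda>t. \<epsilon> * (K * q t)) has_integral \<epsilon> * (K * integral {0..T} q)) {0..T}"
      by (intro has_integral_mult_right integrable_integral integrable_continuous_real q_cont)
  qed (use \<epsilon> K0 q0 in auto)
  also have "\<dots> \<le> ennreal (\<epsilon> * (K * (\<epsilon> * D * (96 * c powr (- \<alpha> / 2) + 16 * T / a))))"
    using \<epsilon> K0 by (intro ennreal_leI mult_left_mono q_integral) auto
  also have "\<epsilon> * (K * (\<epsilon> * D * (96 * c powr (- \<alpha> / 2) + 16 * T / a)))
      = \<epsilon> ^ 3 * ((1 - \<epsilon>0) powr (- \<alpha>) * (96 * c powr (- \<alpha> / 2) + 16 * T / a) * D)"
    by (simp add: K_def power3_eq_cube mult_ac)
  finally show ?thesis .
qed

end

theorem mainTheorem1: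
  fixes T \<alpha> \<epsilon>0 :: real
  assumes "T > 0" and "0 < \<alpha>" and "\<alpha> < 2" and "0 < \<epsilon>0" and "\<epsilon>0 < 1"
  shows "\<exists>C>0. \<forall>u0 u1 f u.
           H1a \<alpha> u0 \<longrightarrow> in_L2 u1 \<longrightarrow> in_L1L2 T f \<longrightarrow> weak_sol \<alpha> T f u0 u1 u \<longrightarrow>
           (\<forall>\<epsilon>\<in>{0<..\<epsilon>0}.
              ennreal (1 / \<epsilon> ^ 3) *
                (\<integral>\<^sup>+p\<in>{0<..<T} \<times> {1 - \<epsilon><..<1}. ennreal ((u (fst p) (snd p))\<^sup>2) \<partial>lebesgue)
              \<le> ennreal (C * ((L1L2norm T f)\<^sup>2 + (H1norm \<alpha> u0)\<^sup>2 + (L2norm u1)\<^sup>2)))"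
proof -
  \<comment> \<open>With 2 a = 1 - eps0 the condition 2 a \<le> 1 - eps holds for every eps up to
    eps0, and c = a / 2 leaves a gap for the translations. Thus C involves only eps0, alpha and
    T.\<close>
  define a where "a = (1 - \<epsilon>0) / 2"
  define c where "c = a / 2"
  define C where "C = (1 - \<epsilon>0) powr (- \<alpha>) * (96 * c powr (- \<alpha> / 2) + 16 * T / a)"
  have a: "0 < a" and c: "0 < c" "c < a" using assms by (auto simp: a_def c_def)
  have "0 < 96 * c powr (- \<alpha> / 2) + 16 * T / a" using a c assms by (intro add_pos_pos) auto
  then have C: "0 < C" unfolding C_def using assms by (intro mult_pos_pos) auto
  show ?thesis
  proof (intro exI[of _ C] conjI C allI impI ballI)
    fix u0 u1 f u \<epsilon>
    assume u0: "H1a \<alpha> u0" and u1: "in_L2 u1" and f: "in_L1L2 T f" and ws: "weak_sol \<alpha> T f u0 u1 u"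
      and \<epsilon>_range: "\<epsilon> \<in> {0<..\<epsilon>0}"
    let ?D = "(L1L2norm T f)\<^sup>2 + (H1norm \<alpha> u0)\<^sup>2 + (L2norm u1)\<^sup>2"
    let ?I = "\<integral>\<^sup>+p\<in>{0<..<T} \<times> {1 - \<epsilon><..<1}. ennreal ((u (fst p) (snd p))\<^sup>2) \<partial>lebesgue"
    \<comment> \<open>Choosing one velocity representative turns the weak solution into an instance
      of the locale.\<close>
    have "\<exists>v. wave T \<alpha> f u0 u1 u v"
      using ws unfolding weak_sol_def wave_def by (elim conjE ex_forward) (use assms u0 u1 f in simp)
    then obtain v where wave: "wave T \<alpha> f u0 u1 u v" ..
    interpret wave_layer T \<alpha> f u0 u1 u v a c \<epsilon>
      by (rule wave_layer.intro[OF wave]) (unfold_locales, use c \<epsilon>_range in \<open>auto simp: a_def\<close>)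
    have "?I \<le> ennreal (\<epsilon> ^ 3 * (C * D))"
      unfolding C_def by (rule layer_estimate) (use \<epsilon>_range assms in auto)
    then have "ennreal (1 / \<epsilon> ^ 3) * ?I \<le> ennreal (1 / \<epsilon> ^ 3) * ennreal (\<epsilon> ^ 3 * (C * D))"
      by (rule mult_left_mono) simp
    also have "\<dots> = ennreal (C * D)" using \<epsilon> C D_nonneg by (simp flip: ennreal_mult)
    finally show "ennreal (1 / \<epsilon> ^ 3) * ?I \<le> ennreal (C * ?D)" by (simp add: D_def)
  qed
qed

end
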